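(* Let $\varphi$ be a continuous function on $[0,\pi]$. Then for every $t>0$ and $x\in[0,\pi]$, with probability one, $|u_\diamond(t,x;\varepsilon)-u_\circ(t,x;\varepsilon)|=O(\varepsilon^2)$ as $\varepsilon\to0$, and $$\lim_{\varepsilon\to0}\varepsilon^{-2}\big(u_\circ(t,x;\varepsilon)-u_\diamond(t,x;\varepsilon)\big)=\int_0^\pi p^{(3)}(t,x,z)\varphi(z)\,dz,$$ where $$p^{(3)}(t,x,z)=\int_0^\pi\int_0^t\int_0^s p(t-s,x,y)\,p(s-r,y,y)\,p(r,y,z)\,dr\,ds\,dy.$$ In particular the limit is non-random.
   Context: $W$ is a standard Brownian motion on $[0,\pi]$ with realizations Hölder continuous of every order less than $1/2$; $p(t,x,y)=\frac{2}{\pi}\sum_{k\ge1}e^{-k^2t}\sin(kx)\sin(ky)$ is the Dirichlet heat kernel on $[0,\pi]$; $u(t,x)=\int_0^\pi p(t,x,y)\varphi(y)dy$. Wick solution: with $\mathfrak m_k(x)=\sqrt{2/\pi}\sin(kx)$, $\xi_k=\int_0^\pi\mathfrak m_kdW$, multi-indices $\alpha\in\mathcal J$ (finitely supported sequences of nonnegative integers, $|\alpha|=\sum\alpha_k$, $\epsilon(k)$ the $k$-th unit multi-index), $\xi_\alpha=\prod_k\mathrm H_{\alpha_k}(\xi_k)/\sqrt{\alpha_k!}$ with Hermite polynomials $\mathrm H_n(x)=(-1)^ne^{x^2/2}\frac{d^n}{dx^n}e^{-x^2/2}$, $u_{\mathbf0}(t,x;\varepsilon)=u(t,x)$, $u_\alpha(t,x;\varepsilon)=\varepsilon\sum_k\sqrt{\alpha_k}\int_0^t\int_0^\pi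 p(t-s,x,y)u_{\alpha-\epsilon(k)}(s,y;\varepsilon)\mathfrak m_k(y)dyds$, define $u_\diamond(t,x;\varepsilon)=\sum_\alpha u_\alpha(t,x;\varepsilon)\xi_\alpha$ (the chaos solution of $\partial_tu=\partial_x^2u+\varepsilon u\diamond\dot W$, zero Dirichlet data, $u(0)=\varphi$). Stratonovich solution: with $p*g(t,s,x)=\int_0^\pi p(t-s,x,y)g(s,y)dy$ (derivatives in the distributional sense), $u_\circ(\cdot,\cdot;\varepsilon)$ is, for each realization of $W$, the solution of $$v(t,x)=\varepsilon\int_0^tp*(vW)_x(t,s,x)\,ds-\varepsilon\int_0^tp*(v_xW)(t,s,x)\,ds+\int_0^\pi p(t,x,y)\varphi(y)dy,$$ the mild solution of $\partial_tu=\partial_x^2u+\varepsilon u\circ\dot W$ with zero Dirichlet data and $u(0)=\varphi$. *)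

theory Defs
  imports "HOL-Probability.Probability" "HOL-Library.Landau_Symbols"
begin

definition heat_kernel :: "real \<Rightarrow> real \<Rightarrow> real \<Rightarrow> real" where
  "heat_kernel t x y =
     2 / pi * (\<Sum>k. exp (- (real (Suc k))\<^sup>2 * t) * sin (real (Suc k) * x) * sin (real (Suc k) * y))"

definition heat_sol :: "(real \<Rightarrow> real) \<Rightarrow> real \<Rightarrow> real \<Rightarrow> real" where
  "heat_sol \<phi> t x = integral {0..pi} (\<lambda>y. heat_kernel t x y * \<phi> y)"

definition p3 :: "real \<Rightarrow> real \<Rightarrow> real \<Rightarrow> real" where
  "p3 t x z = integral {0..pi} (\<lambda>y. integral {0..t} (\<lambda>s. integral {0..s} (\<lambda>r.
      heat_kernel (t - s) x y * heat_kernel (s - r) y y * heat_kernel r y z)))"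

text \<open>A standard Brownian motion on [0,pi] on the probability space M: starts at 0,
  increments over [s,t] are N(0,t-s), increments over disjoint consecutive intervals
  are independent; in addition every realization is Hoelder continuous of every
  order less than 1/2 (standing assumption of the paper).\<close>
definition std_brownian_motion :: "'w measure \<Rightarrow> ('w \<Rightarrow> real \<Rightarrow> real) \<Rightarrow> bool" where
  "std_brownian_motion M W \<longleftrightarrow>
     prob_space M \<and>
     (\<forall>y\<in>{0..pi}. (\<lambda>\<omega>. W \<omega> y) \<in> borel_measurable M) \<and>
     (\<forall>\<omega>\<in>space M. W \<omega> 0 = 0) \<and>
     (\<forall>s t. 0 \<le> s \<and> s < t \<and> t \<le> pi \<longrightarrow>
        distributed M lborel (\<lambda>\<omega>. W \<omega> t - W \<omega> s) (\<lambda>z. ennreal (normal_density 0 (sqrt (t - s)) z))) \<and>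
     (\<forall>(n::nat) (ts :: nat \<Rightarrow> real). 0 \<le> ts 0 \<and> ts n \<le> pi \<and> (\<forall>i<n. ts i < ts (Suc i)) \<longrightarrow>
        prob_space.indep_vars M (\<lambda>_. borel) (\<lambda>i \<omega>. W \<omega> (ts (Suc i)) - W \<omega> (ts i)) {..<n}) \<and>
     (\<forall>\<omega>\<in>space M. \<forall>\<gamma>. 0 < \<gamma> \<and> \<gamma> < 1/2 \<longrightarrow>
        (\<exists>C. \<forall>x\<in>{0..pi}. \<forall>y\<in>{0..pi}. \<bar>W \<omega> x - W \<omega> y\<bar> \<le> C * \<bar>x - y\<bar> powr \<gamma>))"

definition mk :: "nat \<Rightarrow> real \<Rightarrow> real" where
  "mk k y = sqrt (2 / pi) * sin (real k * y)"

text \<open>xi_k = int_0^pi m_k dW.  Since m_k is C^1 with m_k(0) = m_k(pi) = 0, the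
  (pathwise Riemann--Stieltjes / Wiener) integral equals -int_0^pi m_k'(y) W(y) dy.\<close>
definition xi :: "('w \<Rightarrow> real \<Rightarrow> real) \<Rightarrow> nat \<Rightarrow> 'w \<Rightarrow> real" where
  "xi W k \<omega> = - integral {0..pi} (\<lambda>y. deriv (mk k) y * W \<omega> y)"

definition hermite :: "nat \<Rightarrow> real \<Rightarrow> real" where
  "hermite n x = (-1) ^ n * exp (x\<^sup>2 / 2) * (deriv ^^ n) (\<lambda>z. exp (- z\<^sup>2 / 2)) x"

text \<open>Multi-indices: finitely supported sequences alpha_1, alpha_2, ... of naturals,
  represented as functions nat => nat with alpha 0 = 0 (index 0 unused).\<close>
definition multi_index :: "(nat \<Rightarrow> nat) \<Rightarrow> bool" where
  "multi_index \<alpha> \<longleftrightarrow> finite {k. \<alpha> k \<noteq> 0} \<and> \<alpha> 0 = 0"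

definition mi_len :: "(nat \<Rightarrow> nat) \<Rightarrow> nat" where
  "mi_len \<alpha> = (\<Sum>k\<in>{k. \<alpha> k \<noteq> 0}. \<alpha> k)"

definition unit_mi :: "nat \<Rightarrow> nat \<Rightarrow> nat" where
  "unit_mi k = (\<lambda>j. if j = k then 1 else 0)"

definition mi_minus :: "(nat \<Rightarrow> nat) \<Rightarrow> (nat \<Rightarrow> nat) \<Rightarrow> nat \<Rightarrow> nat" where
  "mi_minus \<alpha> \<beta> = (\<lambda>j. \<alpha> j - \<beta> j)"

definition xi_mi :: "('w \<Rightarrow> real \<Rightarrow> real) \<Rightarrow> (nat \<Rightarrow> nat) \<Rightarrow> 'w \<Rightarrow> real" where
  "xi_mi W \<alpha> \<omega> = (\<Prod>k\<in>{k. \<alpha> k \<noteq> 0}. hermite (\<alpha> k) (xi W k \<omega>) / sqrt (fact (\<alpha> k)))"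

text \<open>chaos_coef n phi eps alpha t x is u_alpha(t,x;eps) for |alpha| = n (recursion on |alpha|).
  The sum over k >= 1 is restricted to the support of alpha, since the other
  terms carry the factor sqrt(alpha_k) = 0.\<close>
fun chaos_coef :: "nat \<Rightarrow> (real \<Rightarrow> real) \<Rightarrow> real \<Rightarrow> (nat \<Rightarrow> nat) \<Rightarrow> real \<Rightarrow> real \<Rightarrow> real" where
  "chaos_coef 0 \<phi> \<epsilon> \<alpha> t x = heat_sol \<phi> t x"
| "chaos_coef (Suc n) \<phi> \<epsilon> \<alpha> t x =
     \<epsilon> * (\<Sum>k\<in>{k. \<alpha> k \<noteq> 0}. sqrt (real (\<alpha> k)) *
        integral {0..t} (\<lambda>s. integral {0..pi} (\<lambda>y.
           heat_kernel (t - s) x y * chaos_coef n \<phi> \<epsilon> (mi_minus \<alpha> (unit_mi k)) s y * mk k y)))"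

definition u_alpha :: "(real \<Rightarrow> real) \<Rightarrow> real \<Rightarrow> (nat \<Rightarrow> nat) \<Rightarrow> real \<Rightarrow> real \<Rightarrow> real" where
  "u_alpha \<phi> \<epsilon> \<alpha> t x = chaos_coef (mi_len \<alpha>) \<phi> \<epsilon> \<alpha> t x"

definition chaos_component :: "'w measure \<Rightarrow> ('w \<Rightarrow> real \<Rightarrow> real) \<Rightarrow> (real \<Rightarrow> real)
    \<Rightarrow> real \<Rightarrow> real \<Rightarrow> nat \<Rightarrow> ('w \<Rightarrow> real) \<Rightarrow> bool" where
  "chaos_component M W \<phi> t x n U \<longleftrightarrow>
     U \<in> borel_measurable M \<and> integrable M (\<lambda>\<omega>. (U \<omega>)\<^sup>2) \<and>
     ((\<lambda>F. integral\<^sup>L M (\<lambda>\<omega>. (U \<omega> - (\<Sum>\<alpha>\<in>F. u_alpha \<phi> 1 \<alpha> t x * xi_mi W \<alpha> \<omega>))\<^sup>2))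
        \<longlongrightarrow> 0) (finite_subsets_at_top {\<alpha>. multi_index \<alpha> \<and> mi_len \<alpha> = n})"

text \<open>u_diamond(t,x;eps) = sum_alpha u_alpha(t,x;eps) xi_alpha = sum_n eps^n U_n,
  using u_alpha(t,x;eps) = eps^|alpha| u_alpha(t,x;1).\<close>
definition wick_sol :: "(nat \<Rightarrow> 'w \<Rightarrow> real) \<Rightarrow> real \<Rightarrow> 'w \<Rightarrow> real" where
  "wick_sol U \<epsilon> \<omega> = (\<Sum>n. \<epsilon> ^ n * U n \<omega>)"

text \<open>v solves, for the path w of W,
   v(t,x) = eps int_0^t p*(v w)_x ds - eps int_0^t p*(v_x w) ds + int p(t,x,y) phi(y) dy.
  Derivatives are taken in the distributional sense: the spatial derivative of
  g(s,.) paired with the kernel p(t-s,x,.) (which vanishes at y = 0, pi) is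
  -int_0^pi d/dy p(t-s,x,y) g(s,y) dy; v_x is required to exist as a function vx
  (the derivative of v(s,.) on [0,pi]).  Solution class: v continuous on
  (0,oo) x [0,pi], locally bounded in t, with |v_x(s,.)| <= C s^(-1/2), and all the
  integrals in the equation existing.\<close>
definition strat_mild_solution :: "real \<Rightarrow> (real \<Rightarrow> real) \<Rightarrow> (real \<Rightarrow> real)
    \<Rightarrow> (real \<Rightarrow> real \<Rightarrow> real) \<Rightarrow> bool" where
  "strat_mild_solution \<epsilon> w \<phi> v \<longleftrightarrow>
     (\<exists>vx :: real \<Rightarrow> real \<Rightarrow> real.
       continuous_on ({0<..} \<times> {0..pi}) (\<lambda>(s, y). v s y) \<and>
       (\<forall>s>0. \<forall>y\<in>{0..pi}. (v s has_real_derivative vx s y) (at y within {0..pi})) \<and>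
       (\<forall>T>0. \<exists>C. \<forall>s\<in>{0<..T}. \<forall>y\<in>{0..pi}. \<bar>v s y\<bar> \<le> C \<and> \<bar>vx s y\<bar> \<le> C / sqrt s) \<and>
       (\<forall>t>0. \<forall>x\<in>{0..pi}.
          (\<forall>s\<in>{0<..<t}.
             (\<lambda>y. deriv (heat_kernel (t - s) x) y * (v s y * w y)) integrable_on {0..pi} \<and>
             (\<lambda>y. heat_kernel (t - s) x y * (vx s y * w y)) integrable_on {0..pi}) \<and>
          (\<lambda>s. integral {0..pi} (\<lambda>y. deriv (heat_kernel (t - s) x) y * (v s y * w y)))
             integrable_on {0..t} \<and>
          (\<lambda>s. integral {0..pi} (\<lambda>y. heat_kernel (t - s) x y * (vx s y * w y)))
             integrable_on {0..t} \<and>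
          v t x =
            \<epsilon> * integral {0..t} (\<lambda>s. - integral {0..pi}
                   (\<lambda>y. deriv (heat_kernel (t - s) x) y * (v s y * w y)))
          - \<epsilon> * integral {0..t} (\<lambda>s. integral {0..pi}
                   (\<lambda>y. heat_kernel (t - s) x y * (vx s y * w y)))
          + integral {0..pi} (\<lambda>y. heat_kernel t x y * \<phi> y)))"

end

theory Submission
  imports Defs
begin

text \<open>
  Write \<open>K\<close> for the operator with \<open>u\<^sub>\<circ> = u + \<epsilon> K u\<^sub>\<circ>\<close> and \<open>T\<^sub>h f\<close> for the Duhamel integral of \<open>f h\<close>. For a path that
  is Hoelder continuous of order \<open>1/4\<close>, heat kernel estimates bound \<open>K\<close> on a weighted space of differentiable
  functions, so that \<open>u\<^sub>\<circ> = u + \<epsilon> K u + \<epsilon>\<^sup>2 K K u + O(\<epsilon>\<^sup>3)\<close>; moreover \<open>K u\<close> and \<open>K K u\<close> are the limits of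
  \<open>T\<^sub>h u\<close> and \<open>T\<^sub>h T\<^sub>h u\<close> when \<open>h = \<Sum>\<^sub>k c\<^sub>k \<xi>\<^sub>k m\<^sub>k\<close> is the derivative of a Fejer mean of the path.

  On the Wick side Bessel's inequality gives \<open>\<Sum>\<^bsub>|\<alpha>| = n\<^esub> u\<^sub>\<alpha>\<^sup>2 \<le> E\<^bsup>n+1\<^esup>\<close>, so almost surely the chaos
  components \<open>U\<^sub>n\<close> grow at most geometrically and are limits, along subsequences, of the chaos sums with Fejer
  weights. The weighted sums of orders 1 and 2 are \<open>T\<^sub>h u\<close> and
  \<open>T\<^sub>h T\<^sub>h u - \<Sum>\<^sub>k c\<^sub>k\<^sup>2 T\<^bsub>m\<^sub>k\<^esub> T\<^bsub>m\<^sub>k\<^esub> u\<close>, since \<open>H\<^sub>2(\<xi>) = \<xi>\<^sup>2 - 1\<close>. Hence \<open>U\<^sub>1 = K u\<close> and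
  \<open>K K u - U\<^sub>2\<close> is the limit of the traces; because \<open>\<Sum>\<^sub>k c\<^sub>k\<^sup>2 m\<^sub>k(y) m\<^sub>k(z)\<close> is a positive approximate identity,
  this limit replaces \<open>p(s - r, y, z)\<close> by its diagonal value \<open>p(s - r, y, y)\<close>.
\<close>

section \<open>Integrals over open intervals\<close>

text \<open>On the Stratonovich side the obstacle is the mixed kernel derivative
  \<open>hkxy\<close>, of size \<open>\<tau> powr (-3/2)\<close> and thus not integrable in time.
  Since \<open>hkx\<close> vanishes at y = 0 and y = pi, the constant \<open>w x\<close> may be
  subtracted from the path, and the resulting factor |x - y|^(1/4) makes both the space and the time
  singularity integrable. The mild solution is only a given object; smallness of \<epsilon> turns
  its unquantified bounds into explicit ones. Paths are taken Hoelder of order 3/8, so that uniform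
  convergence of their means can be interpolated to convergence of order 1/4. Fejer weights serve
  both sides at once. They have finite support, lie in [0,1] and tend to 1, so the weighted chaos
  sums have the same mean-square limit as the unordered net defining \<open>U n\<close>. Their
  kernels, also those of the squared weights, are positive, so averaged paths keep uniform Hoelder
  bounds and the traces converge. All exceptional sets are chosen before \<epsilon>, since the chaos
  components do not depend on it.\<close>

lemma integrable_on_Ioo_dominated:
  fixes f g :: "real \<Rightarrow> real"
  assumes "continuous_on {a<..<b} f" "g integrable_on {a..b}"
    "\<And>s. s \<in> {a<..<b} \<Longrightarrow> \<bar>f s\<bar> \<le> g s"
  shows "f absolutely_integrable_on {a<..<b}" "f integrable_on {a..b}"
proof -
  show "f absolutely_integrable_on {a<..<b}"
  proof (rule measurable_bounded_by_integrable_imp_absolutely_integrable)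
    show "f \<in> borel_measurable (lebesgue_on {a<..<b})"
      by (intro continuous_imp_measurable_on_sets_lebesgue assms) auto
    show "g integrable_on {a<..<b}" using assms(2) by (simp add: integrable_on_Icc_iff_Ioo)
  qed (use assms in auto)
  then have "f integrable_on {a<..<b}" by (rule set_lebesgue_integral_eq_integral)
  then show "f integrable_on {a..b}" by (simp add: integrable_on_Icc_iff_Ioo)
qed

text \<open>Duhamel integrands are controlled only for 0 < s < t: at s = t the kernel is evaluated
  at time 0, where its series need not converge, and at s = 0 the bounds degenerate. Hypotheses are
  therefore asked on the open interval; the two end points form a null set.\<close>

lemma integral_abs_bound_Ioo:
  fixes f g :: "real \<Rightarrow> real"
  assumes "f integrable_on {a..b}" "g integrable_on {a..b}"
    "\<And>s. s \<in> {a<..<b} \<Longrightarrow> \<bar>f s\<bar> \<le> g s"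
  shows "\<bar>integral {a..b} f\<bar> \<le> integral {a..b} g"
  using integral_norm_bound_integral[of f "{a<..<b}" g] assms
  by (simp add: integral_open_interval_real integrable_on_Icc_iff_Ioo)

lemma dominated_convergence_Ioo:
  fixes f :: "nat \<Rightarrow> real \<Rightarrow> real"
  assumes "\<And>k. f k integrable_on {a..b}" "g integrable_on {a..b}"
    "\<And>k s. s \<in> {a<..<b} \<Longrightarrow> \<bar>f k s\<bar> \<le> g s"
    "\<And>s. s \<in> {a<..<b} \<Longrightarrow> (\<lambda>k. f k s) \<longlonglongrightarrow> h s"
  shows "h integrable_on {a..b}" "(\<lambda>k. integral {a..b} (f k)) \<longlonglongrightarrow> integral {a..b} h"
proof -
  have "\<And>k. f k integrable_on {a<..<b}" "g integrable_on {a<..<b}"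
    using assms(1,2) by (simp_all add: integrable_on_Icc_iff_Ioo)
  note d = dominated_convergence[where f = f and S = "{a<..<b}" and h = g and g = h, OF this]
  have "h integrable_on {a<..<b}" "(\<lambda>k. integral {a<..<b} (f k)) \<longlonglongrightarrow> integral {a<..<b} h"
    by (rule d; use assms in auto)+
  then show "h integrable_on {a..b}" "(\<lambda>k. integral {a..b} (f k)) \<longlonglongrightarrow> integral {a..b} h"
    by (simp_all add: integral_open_interval_real integrable_on_Icc_iff_Ioo)
qed

text \<open>The bound \<open>g\<close> on the derivative may be unbounded as long as it is
  integrable, as the singular time integrals require. The mean value inequality on the convex set
  \<open>X\<close> makes \<open>g\<close> also a bound for the difference quotients, so dominated
  convergence applies along every sequence tending to \<open>x\<close>.\<close>

lemma has_real_derivative_integral_Ioo: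
  fixes F F' :: "real \<Rightarrow> real \<Rightarrow> real"
  assumes X: "convex X" "x \<in> X"
    and int: "\<And>x. x \<in> X \<Longrightarrow> F x integrable_on {a..b}"
    and der: "\<And>x s. x \<in> X \<Longrightarrow> s \<in> {a<..<b} \<Longrightarrow> ((\<lambda>x. F x s) has_real_derivative F' x s) (at x within X)"
    and g: "g integrable_on {a..b}"
    and bnd: "\<And>x s. x \<in> X \<Longrightarrow> s \<in> {a<..<b} \<Longrightarrow> \<bar>F' x s\<bar> \<le> g s"
  shows "((\<lambda>x. integral {a..b} (F x)) has_real_derivative integral {a..b} (F' x)) (at x within X)"
proof -
  have lip: "\<bar>F y s - F x s\<bar> \<le> g s * \<bar>y - x\<bar>" if "y \<in> X" "s \<in> {a<..<b}" for y s
    using field_differentiable_bound[OF X(1) der[OF _ that(2)], of "g s" x y] bnd that X(2)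
    by (auto simp: abs_minus_commute)
  show ?thesis
    unfolding has_field_derivative_iff
  proof (subst tendsto_at_iff_sequentially, intro allI impI)
    fix Y assume Y: "\<forall>i. Y i \<in> X - {x}" "Y \<longlonglongrightarrow> x"
    let ?q = "\<lambda>k s. (F (Y k) s - F x s) / (Y k - x)"
    have "(\<lambda>k. integral {a..b} (?q k)) \<longlonglongrightarrow> integral {a..b} (F' x)"
    proof (rule dominated_convergence_Ioo(2))
      show "?q k integrable_on {a..b}" for k
        using int X(2) Y(1) by (intro integrable_on_divide integrable_diff) auto
      show "g integrable_on {a..b}" by (rule g)
      show "\<bar>?q k s\<bar> \<le> g s" if "s \<in> {a<..<b}" for k s
        using lip[of "Y k" s] Y(1) that by (auto simp: abs_divide divide_le_eq)
      show "(\<lambda>k. ?q k s) \<longlonglongrightarrow> F' x s" if "s \<in> {a<..<b}" for s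
        using der[OF X(2) that] Y unfolding has_field_derivative_iff
        by (subst (asm) tendsto_at_iff_sequentially) (auto simp: o_def)
    qed
    moreover have "integral {a..b} (?q k) = (integral {a..b} (F (Y k)) - integral {a..b} (F x)) / (Y k - x)" for k
      using int X(2) Y(1) by (subst integral_divide, subst integral_diff) auto
    ultimately show "((\<lambda>y. (integral {a..b} (F y) - integral {a..b} (F x)) / (y - x)) \<circ> Y) \<longlonglongrightarrow> integral {a..b} (F' x)"
      by (simp only: o_def)
  qed
qed

section \<open>Integrals of power singularities in time and space\<close>

text \<open>Scaling s to t times a variable in [0,1] gives the Beta integral. The exponent 1 - a - b
  of \<open>t\<close> decides later whether a time integral stays bounded as t tends to 0.\<close>

lemma integral_powr_Beta:
  fixes a b t :: real
  assumes "a < 1" "b < 1" "t > 0"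
  shows "((\<lambda>s. (t - s) powr (-a) * s powr (-b)) has_integral t powr (1 - a - b) * Beta (1-b) (1-a)) {0..t}"
proof -
  have "((\<lambda>s. s powr (1 - b - 1) * (1 - s) powr (1 - a - 1)) has_integral Beta (1-b) (1-a)) {0..1}"
    using has_integral_Beta_real[of "1-b" "1-a"] assms by simp
  from has_integral_stretch_real[OF this, of "1/t"] assms(3)
  have "((\<lambda>s. (s / t) powr (-b) * (1 - s / t) powr (-a)) has_integral t * Beta (1-b) (1-a)) {0..t}"
    using image_mult_atLeastAtMost[of t 0 1] by (simp add: mult.commute)
  from has_integral_mult_right[OF this, of "t powr (-a-b)"]
  have *: "((\<lambda>s. t powr (-a-b) * ((s / t) powr (-b) * (1 - s / t) powr (-a))) has_integral
      t powr (1-a-b) * Beta (1-b) (1-a)) {0..t}"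
    using assms(3) by (simp add: powr_diff powr_minus powr_add field_simps)
  show ?thesis
  proof (rule has_integral_spike_eq[THEN iffD1, OF _ _ *])
    fix s assume s: "s \<in> {0..t} - {}"
    have "1 - s / t = (t - s) / t" using assms(3) by (simp add: field_simps)
    then show "(t - s) powr (-a) * s powr (-b) = t powr (-a-b) * ((s / t) powr (-b) * (1 - s / t) powr (-a))"
      using s assms(3) by (simp add: powr_divide powr_minus powr_diff field_simps)
  qed auto
qed

lemma has_integral_powr_Ioo_shift:
  fixes a x c :: real
  assumes "a < 1" "0 \<le> x" "x \<le> c"
  shows "((\<lambda>y. \<bar>x - y\<bar> powr (-a)) has_integral (x powr (1-a) + (c-x) powr (1-a)) / (1-a)) {0..c}"
proof -
  have "((\<lambda>y. y powr (-a)) has_integral (x powr (-a+1) / (-a+1))) (cbox 0 x)"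
    using has_integral_powr_from_0[of "-a" x] assms by auto
  from has_integral_affinity[OF this, of "-1" x]
  have 1: "((\<lambda>y. (x - y) powr (-a)) has_integral x powr (1-a) / (1-a)) {0..x}"
    by (simp add: image_affinity_atLeastAtMost algebra_simps)
  have "((\<lambda>y. y powr (-a)) has_integral ((c-x) powr (-a+1) / (-a+1))) (cbox 0 (c-x))"
    using has_integral_powr_from_0[of "-a" "c-x"] assms by auto
  from has_integral_affinity[OF this, of "1" "-x"]
  have 2: "((\<lambda>y. (y - x) powr (-a)) has_integral (c-x) powr (1-a) / (1-a)) {x..c}"
    by (simp add: image_affinity_atLeastAtMost algebra_simps)
  have 3: "((\<lambda>y. \<bar>x - y\<bar> powr (-a)) has_integral x powr (1-a) / (1-a)) {0..x}"
    by (rule has_integral_eq[OF _ 1]) auto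
  have 4: "((\<lambda>y. \<bar>x - y\<bar> powr (-a)) has_integral (c-x) powr (1-a) / (1-a)) {x..c}"
    by (rule has_integral_eq[OF _ 2]) auto
  show ?thesis using has_integral_combine[OF assms(2,3) 3 4] by (simp add: add_divide_distrib)
qed

text \<open>What matters is a bound uniform in \<open>x\<close>. The two pieces have length at most
  pi < 4, and powers of such lengths with exponent in (0,1] stay below 4, whence 8 = 4 + 4.\<close>

lemma integral_powr_abs_diff:
  fixes a x :: real
  assumes "0 \<le> a" "a < 1" "x \<in> {0..pi}"
  shows "(\<lambda>y. \<bar>x - y\<bar> powr (-a)) integrable_on {0..pi}"
    "integral {0..pi} (\<lambda>y. \<bar>x - y\<bar> powr (-a)) \<le> 8 / (1 - a)"
proof -
  note h = has_integral_powr_Ioo_shift[OF assms(2), of x pi]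
  show "(\<lambda>y. \<bar>x - y\<bar> powr (-a)) integrable_on {0..pi}" using h assms by (auto intro: has_integral_integrable)
  have *: "z powr (1-a) \<le> 4" if "0 \<le> z" "z \<le> pi" for z
  proof (cases "z \<le> 1")
    case True then have "z powr (1-a) \<le> 1" using that assms by (intro powr_le1) auto
    then show ?thesis by simp
  next
    case False then have "z powr (1-a) \<le> z powr 1" using assms by (intro powr_mono) auto
    then show ?thesis using that pi_less_4 False by auto
  qed
  have "integral {0..pi} (\<lambda>y. \<bar>x - y\<bar> powr (-a)) = (x powr (1-a) + (pi-x) powr (1-a)) / (1-a)"
    using h assms by (auto intro: integral_unique)
  also have "\<dots> \<le> 8 / (1-a)" using *[of x] *[of "pi - x"] assms by (intro divide_right_mono) auto
  finally show "integral {0..pi} (\<lambda>y. \<bar>x - y\<bar> powr (-a)) \<le> 8 / (1 - a)" .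
qed

text \<open>The spatial derivative of a mild solution is only given as some function, without a
  formula. Its size is read off from a Lipschitz estimate for the solution, so the time integral
  never has to be differentiated for rough paths.\<close>

lemma deriv_le_lipschitz:
  fixes f :: "real \<Rightarrow> real"
  assumes "(f has_real_derivative D) (at y within {a..b})" "a < b" "y \<in> {a..b}"
    "\<And>z. z \<in> {a..b} \<Longrightarrow> \<bar>f z - f y\<bar> \<le> L * \<bar>z - y\<bar>"
  shows "\<bar>D\<bar> \<le> L"
proof -
  have "((\<lambda>z. \<bar>(f z - f y) / (z - y)\<bar>) \<longlongrightarrow> \<bar>D\<bar>) (at y within {a..b})"
    using assms(1) unfolding has_field_derivative_iff by (rule tendsto_rabs)
  moreover have "at y within {a..b} \<noteq> bot"
    using assms(2,3) by (simp add: trivial_limit_within islimpt_Icc)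
  moreover have "eventually (\<lambda>z. \<bar>(f z - f y) / (z - y)\<bar> \<le> L) (at y within {a..b})"
    unfolding eventually_at_topological
    by (intro exI[of _ UNIV]) (auto simp: abs_divide divide_le_eq assms(4))
  ultimately show ?thesis using tendsto_upperbound by blast
qed

text \<open>\<open>f'\<close> is a pointwise derivative, with no continuity assumed. It is
  integrable by the fundamental theorem for the gauge integral; being bounded it is absolutely
  integrable, and this class admits multiplication by the continuous \<open>g\<close>.\<close>

lemma deriv_times_cont_integrable:
  fixes f f' g :: "real \<Rightarrow> real"
  assumes der: "\<And>y. y \<in> {a..b} \<Longrightarrow> (f has_real_derivative f' y) (at y within {a..b})"
    and bnd: "\<And>y. y \<in> {a..b} \<Longrightarrow> \<bar>f' y\<bar> \<le> B" and g: "continuous_on {a..b} g" and ab: "a \<le> b"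
  shows "(\<lambda>y. g y * f' y) integrable_on {a..b}"
proof -
  have "(f' has_integral f b - f a) {a..b}"
    by (rule fundamental_theorem_of_calculus[OF ab])
       (auto simp: has_real_derivative_iff_has_vector_derivative[symmetric] der)
  then have "f' absolutely_integrable_on {a..b}"
    using bnd by (intro absolutely_integrable_integrable_bound[where g="\<lambda>_. B"]) auto
  then have "(\<lambda>y. g y * f' y) absolutely_integrable_on {a..b}"
    by (intro absolutely_integrable_bounded_measurable_product_real
        continuous_imp_measurable_on_sets_lebesgue g compact_imp_bounded compact_continuous_image) auto
  then show ?thesis by (rule set_lebesgue_integral_eq_integral)
qed

text \<open>The majorant \<open>h\<close> depends on \<open>s\<close> alone because the
  singularities are in time. The gauge integrals are rewritten as Lebesgue integrals for the product
  measure, where Borel measurability and domination give the interchange, and are then read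
  back.\<close>

lemma fubini_Ioo:
  fixes f :: "real \<Rightarrow> real \<Rightarrow> real"
  assumes meas: "(\<lambda>(s,y). f s y) \<in> borel_measurable borel"
    and h: "h integrable_on {a..b}" "h \<in> borel_measurable borel"
    and bnd: "\<And>s y. s \<in> {a<..<b} \<Longrightarrow> y \<in> {c<..<d} \<Longrightarrow> \<bar>f s y\<bar> \<le> h s"
    and hpos: "\<And>s. 0 \<le> h s"
  shows "integral {a..b} (\<lambda>s. integral {c..d} (f s)) = integral {c..d} (\<lambda>y. integral {a..b} (\<lambda>s. f s y))"
proof -
  let ?g = "\<lambda>(s,y). indicator {a<..<b} s * indicator {c<..<d} y * f s y"
  have [measurable]: "(\<lambda>(s,y). f s y) \<in> borel_measurable (borel \<Otimes>\<^sub>M borel)" 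
    using meas by (simp add: borel_prod)
  have [measurable]: "h \<in> borel_measurable borel" by (rule h)
  have hi: "set_integrable lborel {a<..<b} h"
  proof -
    have "h absolutely_integrable_on {a<..<b}"
      using h hpos by (intro nonnegative_absolutely_integrable_1) (auto simp: integrable_on_Icc_iff_Ioo)
    then show ?thesis unfolding set_integrable_def
      by (subst (asm) integrable_completion) auto
  qed
  have int: "integrable (lborel \<Otimes>\<^sub>M lborel) ?g"
  proof (rule Bochner_Integration.integrable_bound)
    have "integrable (lborel \<Otimes>\<^sub>M lborel) (\<lambda>(s,y). (indicator {a<..<b} s * h s) * (indicator {c<..<d} y :: real))"
    proof (rule lborel_pair.Fubini_integrable)
      show "integrable lborel (\<lambda>x. LINT y|lborel. norm (case (x, y) of (s, y) \<Rightarrow> indicator {a<..<b} s * h s * (indicator {c<..<d} y :: real)))"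
        using hi unfolding set_integrable_def using hpos by (simp add: abs_mult)
      show "AE x in lborel. integrable lborel (\<lambda>y. case (x, y) of (s, y) \<Rightarrow> indicator {a<..<b} s * h s * (indicator {c<..<d} y :: real))"
        by (auto intro!: AE_I2 integrable_mult_right integrable_real_indicator emeasure_bounded_finite)
    qed measurable
    then show "integrable (lborel \<Otimes>\<^sub>M lborel) (\<lambda>(s,y). (indicator {a<..<b} s * h s) * (indicator {c<..<d} y :: real))" .
    show "?g \<in> borel_measurable (lborel \<Otimes>\<^sub>M lborel)" by measurable
    show "AE x in lborel \<Otimes>\<^sub>M lborel. norm (?g x) \<le> norm (case x of (s,y) \<Rightarrow> (indicator {a<..<b} s * h s) * (indicator {c<..<d} y :: real))"
      using bnd hpos by (intro AE_I2) (auto simp: indicator_def abs_mult)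
  qed
  have hk: "integral {p..q} k = (LINT s|lborel. indicator {p<..<q} s * k s)" 
    if "integrable lborel (\<lambda>s. indicator {p<..<q} s * k s)" for k :: "real \<Rightarrow> real" and p q
    using set_borel_integral_eq_integral(2)[of "{p<..<q}" k] that
    by (simp add: set_integrable_def set_lebesgue_integral_def integral_open_interval_real)
  have y_int: "integrable lborel (\<lambda>y. indicator {c<..<d} y * f s y)" if "s \<in> {a<..<b}" for s
  proof (rule Bochner_Integration.integrable_bound)
    show "integrable lborel (\<lambda>y. indicator {c<..<d} y * h s)"
      by (intro integrable_mult_left integrable_real_indicator emeasure_bounded_finite) auto
    show "(\<lambda>y. indicator {c<..<d} y * f s y) \<in> borel_measurable lborel" by measurable
    show "AE x in lborel. norm (indicator {c<..<d} x * f s x) \<le> norm (indicator {c<..<d} x * h s)"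
      using bnd[OF that] hpos by (intro AE_I2) (auto simp: indicator_def)
  qed
  have s_int: "integrable lborel (\<lambda>s. indicator {a<..<b} s * f s y)" if "y \<in> {c<..<d}" for y
  proof (rule Bochner_Integration.integrable_bound)
    show "integrable lborel (\<lambda>s. indicator {a<..<b} s * h s)" using hi by (simp add: set_integrable_def)
    show "(\<lambda>s. indicator {a<..<b} s * f s y) \<in> borel_measurable lborel" by measurable
    show "AE x in lborel. norm (indicator {a<..<b} x * f x y) \<le> norm (indicator {a<..<b} x * h x)"
      using bnd[OF _ that] hpos by (intro AE_I2) (auto simp: indicator_def)
  qed
  have 1: "indicator {a<..<b} s * integral {c..d} (f s) = (LINT y|lborel. ?g (s,y))" for s
    by (cases "s \<in> {a<..<b}") (simp_all add: hk[OF y_int])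
  have 2: "indicator {c<..<d} y * integral {a..b} (\<lambda>s. f s y) = (LINT s|lborel. ?g (s,y))" for y
    using hk[OF s_int] by (cases "y \<in> {c<..<d}") simp_all
  have "integral {a..b} (\<lambda>s. integral {c..d} (f s)) = (LINT s|lborel. LINT y|lborel. ?g (s,y))"
    using lborel_pair.integrable_fst[of "\<lambda>s y. ?g (s,y)"] int
    by (subst hk) (simp_all add: 1)
  also have "\<dots> = (LINT y|lborel. LINT s|lborel. ?g (s,y))"
    using lborel_pair.Fubini_integral[of "\<lambda>s y. ?g (s,y)"] int by simp
  also have "\<dots> = integral {c..d} (\<lambda>y. integral {a..b} (\<lambda>s. f s y))"
    using lborel_pair.integrable_snd[of "\<lambda>s y. ?g (s,y)"] int
    by (subst hk) (simp_all add: 2)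
  finally show ?thesis .
qed

section \<open>The Dirichlet heat kernel\<close>

text \<open>The summand is at most 1 / (1 + (k+1)^2 s), which by the mean value theorem is at most
  the increment of arctan(sqrt s * x) / sqrt s over [k, k+1]. The sum telescopes, and 2 replaces
  pi/2.\<close>

lemma sum_gauss_le:
  fixes s :: real assumes "s > 0"
  shows "summable (\<lambda>k. exp (- (real (Suc k))\<^sup>2 * s))"
    "(\<Sum>k. exp (- (real (Suc k))\<^sup>2 * s)) \<le> 2 / sqrt s"
proof -
  define a where "a = sqrt s"
  have a: "a > 0" "a\<^sup>2 = s" using assms by (auto simp: a_def)
  have step: "exp (- (real (Suc k))\<^sup>2 * s) \<le> (arctan (a * real (Suc k)) - arctan (a * real k)) / a" for k
  proof -
    have "\<exists>z. z > a * real k \<and> z < a * real (Suc k) \<and>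
        arctan (a * real (Suc k)) - arctan (a * real k) = (a * real (Suc k) - a * real k) * inverse (1 + z\<^sup>2)"
      using a by (intro MVT2) (auto intro!: derivative_eq_intros)
    then obtain z where z: "z > a * real k" "z < a * real (Suc k)"
      "arctan (a * real (Suc k)) - arctan (a * real k) = a * inverse (1 + z\<^sup>2)"
      by (auto simp: algebra_simps)
    have "0 \<le> z" using z(1) a by (meson less_imp_le mult_nonneg_nonneg of_nat_0_le_iff order_trans)
    then have "z\<^sup>2 \<le> (a * real (Suc k))\<^sup>2" using z(2) by (intro power_mono) auto
    then have "1 + z\<^sup>2 \<le> 1 + (real (Suc k))\<^sup>2 * s" using a by (simp add: power_mult_distrib mult.commute)
    also have "\<dots> \<le> exp ((real (Suc k))\<^sup>2 * s)" by (rule exp_ge_add_one_self)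
    finally have "inverse (exp ((real (Suc k))\<^sup>2 * s)) \<le> inverse (1 + z\<^sup>2)"
      by (intro le_imp_inverse_le) (auto intro: add_pos_nonneg)
    then show ?thesis using z(3) a by (simp add: exp_minus)
  qed
  have part: "(\<Sum>k<n. exp (- (real (Suc k))\<^sup>2 * s)) \<le> 2 / sqrt s" for n
  proof -
    have "(\<Sum>k<n. exp (- (real (Suc k))\<^sup>2 * s)) \<le> (\<Sum>k<n. (arctan (a * real (Suc k)) - arctan (a * real k)) / a)"
      by (intro sum_mono step)
    also have "\<dots> = (arctan (a * real n)) / a"
      by (subst sum_divide_distrib[symmetric], subst sum_lessThan_telescope) simp
    also have "\<dots> \<le> 2 / a" using arctan_ubound[of "a * real n"] pi_less_4 a by (intro divide_right_mono) auto
    finally show ?thesis by (simp add: a_def)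
  qed
  show sm: "summable (\<lambda>k. exp (- (real (Suc k))\<^sup>2 * s))"
    by (rule summableI_nonneg_bounded[OF _ part]) auto
  show "(\<Sum>k. exp (- (real (Suc k))\<^sup>2 * s)) \<le> 2 / sqrt s"
    by (rule suminf_le_const[OF sm part])
qed

text \<open>Half of the Gaussian exponent pays for the polynomial factor:
  \<open>exp (x\<^sup>2/2) \<ge> 1 + x^4/8\<close> together with |x|^j \<le> 1 + x^4 gives the
  constant 9. Degree 4 is the highest one met, in the second derivative of
  \<open>gw 2\<close>.\<close>

lemma power_exp_bound:
  fixes x :: real assumes "j \<le> 4"
  shows "\<bar>x\<bar> ^ j * exp (- (x\<^sup>2)) \<le> 9 * exp (- (x\<^sup>2 / 2))"
proof -
  have "1 + x\<^sup>2/2 + (x\<^sup>2/2)\<^sup>2/2 \<le> exp (x\<^sup>2/2)" using exp_lower_Taylor_quadratic[of "x\<^sup>2/2"] by simp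
  then have "1 + x ^ 4 / 8 \<le> exp (x\<^sup>2/2)" 
  proof -
    have "(x\<^sup>2/2)\<^sup>2/2 = x ^ 4 / 8" by (simp add: power_divide)
    moreover have "0 \<le> x\<^sup>2/2" by simp
    ultimately show ?thesis using \<open>1 + x\<^sup>2/2 + (x\<^sup>2/2)\<^sup>2/2 \<le> exp (x\<^sup>2/2)\<close> by linarith
  qed
  moreover have "\<bar>x\<bar> ^ j \<le> 1 + x ^ 4"
  proof (cases "\<bar>x\<bar> \<le> 1")
    case True then have "\<bar>x\<bar> ^ j \<le> 1" by (simp add: power_le_one)
    then show ?thesis by (smt (verit) zero_le_even_power'[of x 2] even_numeral zero_le_even_power)
  next
    case False then have "\<bar>x\<bar> ^ j \<le> \<bar>x\<bar> ^ 4" using assms by (intro power_increasing) auto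
    then show ?thesis by simp
  qed
  moreover have "0 \<le> x ^ 4" by simp
  ultimately have "\<bar>x\<bar> ^ j \<le> 9 * exp (x\<^sup>2/2)" by linarith
  then have "\<bar>x\<bar> ^ j * exp (- (x\<^sup>2)) \<le> 9 * exp (x\<^sup>2/2) * exp (- (x\<^sup>2))" by (intro mult_right_mono) auto
  also have "\<dots> = 9 * exp (- (x\<^sup>2 / 2))" by (simp add: exp_add[symmetric])
  finally show ?thesis .
qed

text \<open>The heat multiplier times a power of the frequency, as a function of a real frequency,
  so that second differences in k can be estimated through derivatives in \<xi>.\<close>

definition gw :: "nat \<Rightarrow> real \<Rightarrow> real \<Rightarrow> real" where
  "gw j t \<xi> = \<xi> ^ j * exp (- \<xi>\<^sup>2 * t)"

lemma gw_bound:
  assumes "t > 0" "j \<le> 4"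
  shows "\<bar>\<xi>\<bar> ^ j * exp (- \<xi>\<^sup>2 * t) \<le> 9 * exp (- \<xi>\<^sup>2 * (t/2)) / sqrt t ^ j"
  using power_exp_bound[OF assms(2), of "\<xi> * sqrt t"] assms(1)
  by (simp add: power_mult_distrib abs_mult field_simps)

lemma gw_abs_bound:
  assumes "t > 0" "j \<le> 4"
  shows "\<bar>gw j t \<xi>\<bar> \<le> 9 / sqrt t ^ j * exp (- \<xi>\<^sup>2 * (t/2))"
  using gw_bound[OF assms, of \<xi>] by (simp add: gw_def abs_mult power_abs)

lemma gw_summable:
  assumes "t > 0" "j \<le> 4"
  shows "summable (\<lambda>k. \<bar>gw j t (real (Suc k))\<bar>)"
proof (rule summable_comparison_test')
  show "summable (\<lambda>k. 9 / sqrt t ^ j * exp (- (real (Suc k))\<^sup>2 * (t/2)))"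
    using assms by (intro summable_mult sum_gauss_le) auto
qed (use gw_abs_bound[OF assms] in auto)

lemma second_difference_bound:
  fixes f f' f'' :: "real \<Rightarrow> real"
  assumes "\<And>x. (f has_real_derivative f' x) (at x)" "\<And>x. (f' has_real_derivative f'' x) (at x)"
    and bnd: "\<And>x. a - 1 \<le> x \<Longrightarrow> x \<le> a + 1 \<Longrightarrow> \<bar>f'' x\<bar> \<le> B"
  shows "\<bar>2 * f a - f (a + 1) - f (a - 1)\<bar> \<le> 2 * B"
proof -
  have "\<exists>h. h > 0 \<and> h < 1 \<and> (f (a + 1) + f (a - 1)) - (f (a + 0) + f (a - 0)) = (1 - 0) * (f' (a + h) - f' (a - h))"
    by (rule MVT2) (auto intro!: derivative_eq_intros DERIV_chain2[OF assms(1)])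
  then obtain h where h: "h > 0" "h < 1" "f (a + 1) + f (a - 1) - 2 * f a = f' (a + h) - f' (a - h)" by auto
  obtain z where z: "z > a - h" "z < a + h" "f' (a + h) - f' (a - h) = ((a + h) - (a - h)) * f'' z"
    using MVT2[of "a - h" "a + h" f' f''] assms(2) h by auto
  have "\<bar>f'' z\<bar> \<le> B" using z h by (intro bnd) auto
  then have "\<bar>2 * h * f'' z\<bar> \<le> 2 * B" using h by (simp add: abs_mult) (smt (verit) mult_left_le_one_le)
  then show ?thesis using h(3) z(3) by (simp add: algebra_simps) 
qed

section \<open>Off-diagonal decay by summation by parts\<close>

text \<open>The addition formula for \<open>tr\<close> makes multiplication by 2 - 2 cos z act on
  the coefficients as minus the second difference in k. This is controlled by \<open>f''\<close>,
  which for the heat multipliers gains a factor of order t over \<open>f\<close>, so decay in z is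
  obtained without Poisson summation. The subtracted terms \<open>f 0 * tr z - f 1 * tr 0\<close>
  are boundary terms, present because the series starts at k = 1.\<close>

lemma trig_series_bound:
  fixes f f' f'' tr :: "real \<Rightarrow> real"
  assumes t: "t > 0"
    and f: "\<And>x. (f has_real_derivative f' x) (at x)" "\<And>x. (f' has_real_derivative f'' x) (at x)"
    and A: "\<And>x. \<bar>f x\<bar> \<le> A * exp (- x\<^sup>2 * (t/2))"
    and B: "\<And>x. \<bar>f'' x\<bar> \<le> B * exp (- x\<^sup>2 * (t/2))"
    and tr: "\<And>a b. tr (a + b) + tr (a - b) = 2 * tr a * cos b" "\<And>a. \<bar>tr a\<bar> \<le> 1"
  shows "\<bar>\<Sum>k. f (real (Suc k)) * tr (real (Suc k) * z)\<bar> \<le> A * (3 / sqrt t)"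
    and "\<bar>(2 - 2 * cos z) * (\<Sum>k. f (real (Suc k)) * tr (real (Suc k) * z)) - (f 0 * tr z - f 1 * tr 0)\<bar>
      \<le> 2 * B * (1 + 3 / sqrt t)"
proof -
  have s2: "2 / sqrt (t/2) \<le> 3 / sqrt t"
  proof -
    have "2 * sqrt 2 \<le> (3::real)" by (rule power2_le_imp_le) (auto simp: power_mult_distrib)
    then show ?thesis using t by (simp add: real_sqrt_divide divide_right_mono)
  qed
  have t2: "t/2 > 0" using t by simp
  note gs = sum_gauss_le[OF t2]
  have A0: "A \<ge> 0" using A[of 0] by simp
  have B0: "B \<ge> 0" using B[of 0] by simp
  let ?F = "\<lambda>k. f (real (Suc k)) * tr (real (Suc k) * z)"
  have Fb: "norm (?F k) \<le> A * exp (- (real (Suc k))\<^sup>2 * (t/2))" for k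
  proof -
    have "norm (?F k) \<le> \<bar>f (real (Suc k))\<bar> * 1" unfolding real_norm_def abs_mult by (intro mult_left_mono tr) auto
    then show ?thesis using A[of "real (Suc k)"] by simp
  qed
  have sA: "summable (\<lambda>k. A * exp (- (real (Suc k))\<^sup>2 * (t/2)))" by (intro summable_mult gs)
  have sF: "summable ?F" by (rule summable_comparison_test'[OF sA Fb])
  have "\<bar>\<Sum>k. ?F k\<bar> \<le> (\<Sum>k. A * exp (- (real (Suc k))\<^sup>2 * (t/2)))"
    using norm_suminf_le[OF Fb sA] by simp
  also have "\<dots> \<le> A * (3 / sqrt t)"
    unfolding suminf_mult[OF gs(1)] using gs(2) s2 A0 by (intro mult_left_mono) auto
  finally show "\<bar>\<Sum>k. ?F k\<bar> \<le> A * (3 / sqrt t)" .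
  let ?G = "\<lambda>k. f (real k) * tr (real (Suc k) * z)"
  let ?H = "\<lambda>k. f (real (Suc (Suc k))) * tr (real (Suc k) * z)"
  have sfe: "summable (\<lambda>k. A * exp (- (real k)\<^sup>2 * (t/2)))"
    using sA by (subst (asm) summable_Suc_iff)
  have sG: "summable ?G"
  proof (rule summable_comparison_test'[OF sfe])
    show "norm (?G k) \<le> A * exp (- (real k)\<^sup>2 * (t/2))" for k
    proof -
      have "norm (?G k) \<le> \<bar>f (real k)\<bar> * 1" unfolding real_norm_def abs_mult by (intro mult_left_mono tr) auto
      then show ?thesis using A[of "real k"] by simp
    qed
  qed
  have sH: "summable ?H"
  proof -
    have "summable (\<lambda>k. A * exp (- (real (Suc (Suc k)))\<^sup>2 * (t/2)))" using sA by (subst summable_Suc_iff)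
    then show ?thesis
    proof (rule summable_comparison_test')
      show "norm (?H k) \<le> A * exp (- (real (Suc (Suc k)))\<^sup>2 * (t/2))" for k
      proof -
        have "norm (?H k) \<le> \<bar>f (real (Suc (Suc k)))\<bar> * 1" unfolding real_norm_def abs_mult by (intro mult_left_mono tr) auto
        then show ?thesis using A[of "real (Suc (Suc k))"] by simp
      qed
    qed
  qed
  have up: "(\<Sum>k. f (real (Suc k)) * tr (real (Suc (Suc k)) * z)) = suminf ?G - f 0 * tr z"
    "summable (\<lambda>k. f (real (Suc k)) * tr (real (Suc (Suc k)) * z))"
    using suminf_split_head[OF sG] sG summable_Suc_iff[of ?G] by auto
  have tel: "summable (\<lambda>k. f (real (Suc k)) * tr (real k * z))"
    using sH summable_Suc_iff[of "\<lambda>k. f (real (Suc k)) * tr (real k * z)"] by simp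
  have dn: "(\<Sum>k. f (real (Suc k)) * tr (real k * z)) = suminf ?H + f 1 * tr 0"
    using suminf_split_head[OF tel] by simp
  \<comment> \<open>Product formula 2 cos z tr(m z) = tr((m+1) z) + tr((m-1) z), followed by a shift
    of each of the two series by one index; the heads split off by the shifts are the boundary
    terms.\<close>
  have two: "2 * cos z * suminf ?F = (suminf ?G - f 0 * tr z) + (suminf ?H + f 1 * tr 0)"
  proof -
    have "2 * cos z * suminf ?F = (\<Sum>k. 2 * cos z * ?F k)" by (rule suminf_mult[OF sF, symmetric])
    also have "\<dots> = (\<Sum>k. f (real (Suc k)) * tr (real (Suc (Suc k)) * z) + f (real (Suc k)) * tr (real k * z))"
    proof (rule suminf_cong)
      fix k
      have "tr (real (Suc (Suc k)) * z) + tr (real k * z) = 2 * tr (real (Suc k) * z) * cos z"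
        using tr(1)[of "real (Suc k) * z" z] by (simp add: algebra_simps)
      then show "2 * cos z * ?F k = f (real (Suc k)) * tr (real (Suc (Suc k)) * z) + f (real (Suc k)) * tr (real k * z)"
        by (simp only: distrib_left[symmetric]) simp
    qed
    also have "\<dots> = (suminf ?G - f 0 * tr z) + (suminf ?H + f 1 * tr 0)"
      using suminf_add[OF up(2) tel] up(1) dn by simp
    finally show ?thesis .
  qed
  let ?D = "\<lambda>k. (2 * f (real (Suc k)) - f (real (Suc (Suc k))) - f (real k)) * tr (real (Suc k) * z)"
  have "(2 - 2 * cos z) * suminf ?F - (f 0 * tr z - f 1 * tr 0) = 2 * suminf ?F - suminf ?H - suminf ?G"
    using two by (simp add: algebra_simps)
  also have "\<dots> = (\<Sum>k. 2 * ?F k - ?H k - ?G k)"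
    using suminf_diff[OF summable_diff[OF summable_mult[OF sF, of 2] sH] sG]
      suminf_diff[OF summable_mult[OF sF, of 2] sH] suminf_mult[OF sF, of 2] by linarith
  also have "\<dots> = suminf ?D" by (rule suminf_cong) (simp add: algebra_simps)
  finally have eq: "(2 - 2 * cos z) * suminf ?F - (f 0 * tr z - f 1 * tr 0) = suminf ?D" .
  \<comment> \<open>The second difference at k + 1 involves frequencies in [k, k+2], so the Gaussian
    is taken at the left end k. The comparison sum then starts at k = 0, which is where the 1 in 1 +
    3 / sqrt t comes from.\<close>
  have Db: "norm (?D k) \<le> 2 * B * exp (- (real k)\<^sup>2 * (t/2))" for k
  proof -
    have "\<bar>2 * f (real (Suc k)) - f (real (Suc k) + 1) - f (real (Suc k) - 1)\<bar> \<le> 2 * (B * exp (- (real k)\<^sup>2 * (t/2)))"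
    proof (rule second_difference_bound[OF f])
      fix x assume "real (Suc k) - 1 \<le> x"
      then have "(real k)\<^sup>2 \<le> x\<^sup>2" by (intro power_mono) auto
      then have "exp (- x\<^sup>2 * (t/2)) \<le> exp (- (real k)\<^sup>2 * (t/2))" using t by (simp add: mult_right_mono)
      then show "\<bar>f'' x\<bar> \<le> B * exp (- (real k)\<^sup>2 * (t/2))" using B[of x] B0 by (meson mult_left_mono order_trans)
    qed
    then have "\<bar>2 * f (real (Suc k)) - f (real (Suc (Suc k))) - f (real k)\<bar> \<le> 2 * B * exp (- (real k)\<^sup>2 * (t/2))" 
      by (simp add: add.commute)
    moreover have "norm (?D k) \<le> \<bar>2 * f (real (Suc k)) - f (real (Suc (Suc k))) - f (real k)\<bar> * 1"
      unfolding real_norm_def abs_mult by (intro mult_left_mono tr) auto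
    ultimately show ?thesis by simp
  qed
  have sB: "summable (\<lambda>k. exp (- (real k)\<^sup>2 * (t/2)))" using gs(1) by (subst (asm) summable_Suc_iff)
  have "\<bar>suminf ?D\<bar> \<le> (\<Sum>k. 2 * B * exp (- (real k)\<^sup>2 * (t/2)))"
    using norm_suminf_le[OF Db] summable_mult[OF sB] by simp
  also have "\<dots> = 2 * B * (1 + (\<Sum>k. exp (- (real (Suc k))\<^sup>2 * (t/2))))"
    using suminf_mult[OF sB, of "2 * B"] suminf_split_head[OF sB] by simp
  also have "\<dots> \<le> 2 * B * (1 + 3 / sqrt t)" using gs(2) s2 B0 by (intro mult_left_mono) auto
  finally show "\<bar>(2 - 2 * cos z) * (\<Sum>k. ?F k) - (f 0 * tr z - f 1 * tr 0)\<bar> \<le> 2 * B * (1 + 3 / sqrt t)"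
    unfolding eq .
qed

text \<open>With u = |z|/2 \<le> pi/2 this amounts to u/2 \<le> sin u: up to pi/3 the derivative of
  sin is at least 1/2, and beyond it sin(pi/3) > 0.8 > pi/4. It makes 2 - 2 cos z a substitute for
  the squared distance.\<close>

lemma one_minus_cos_ge:
  fixes z :: real assumes "\<bar>z\<bar> \<le> pi" shows "z\<^sup>2 / 4 \<le> 2 - 2 * cos z"
proof -
  define u where "u = \<bar>z\<bar> / 2"
  have u: "0 \<le> u" "u \<le> pi/2" using assms by (auto simp: u_def)
  have "u / 2 \<le> sin u"
  proof (cases "u \<le> pi/3")
    case True
    show ?thesis
    proof (cases "u = 0")
      case False
      then obtain v where v: "0 < v" "v < u" "sin u - sin 0 = (u - 0) * cos v"
        using MVT2[of 0 u sin cos] u by auto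
      have "cos (pi/3) \<le> cos v" using v True by (intro cos_monotone_0_pi_le) auto
      then show ?thesis using v u by (simp add: cos_60)
    qed simp
  next
    case False
    then have "sin (pi/3) \<le> sin u" using u by (intro sin_monotone_2pi_le) auto
    moreover have "(0.8::real) \<le> sin (pi/3)"
    proof -
      have "1.6 \<le> sqrt (3::real)" by (rule real_le_rsqrt) (simp add: power2_eq_square)
      then show ?thesis by (simp add: sin_60)
    qed
    ultimately show ?thesis using u pi_approx by simp
  qed
  then have "(u/2)\<^sup>2 \<le> (sin u)\<^sup>2" using u by (intro power_mono) auto
  moreover have "cos z = 1 - 2 * (sin u)\<^sup>2" using cos_double_sin[of u] by (simp add: u_def)
  ultimately show ?thesis by (simp add: u_def power_divide)
qed

text \<open>The difference of the two sides is 2 sin x sin y \<ge> 0. On the circle the image point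
  is thus never closer than the original, and the reflected term of the kernel obeys every decay
  estimate stated in terms of x - y.\<close>

lemma cos_diff_ge_cos_add:
  assumes "x \<in> {0..pi}" "y \<in> {0..pi}"
  shows "cos (x + y) \<le> cos (x - y)"
  using assms by (simp add: cos_add cos_diff) (meson mult_nonneg_nonneg sin_ge_zero)

text \<open>With \<open>tr\<close> one of \<open>sin\<close>, \<open>cos\<close>, these theta series are up to sign the derivatives of order \<open>j\<close> of
  \<open>\<Sum>\<^sub>k exp (- k\<^sup>2 t) cos (k z)\<close>, from which the kernel is obtained by reflection at \<open>0\<close> and \<open>\<pi>\<close>.\<close>
definition trs :: "(real \<Rightarrow> real) \<Rightarrow> nat \<Rightarrow> real \<Rightarrow> real \<Rightarrow> real" where
  "trs tr j t z = (\<Sum>k. gw j t (real (Suc k)) * tr (real (Suc k) * z))"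

section \<open>Theta series: uniform convergence, continuity, derivatives\<close>

lemma gw_antimono:
  assumes "\<delta> \<le> t" "0 \<le> \<xi>" shows "0 \<le> gw j t \<xi>" "gw j t \<xi> \<le> gw j \<delta> \<xi>"
  using assms by (auto simp: gw_def mult_left_mono)

lemma trs_uniform:
  assumes tr: "\<And>a. \<bar>tr a\<bar> \<le> 1" and "\<delta> > 0" "j \<le> 4"
  shows "uniform_limit ({\<delta>..} \<times> UNIV) (\<lambda>n (t,z). \<Sum>k<n. gw j t (real (Suc k)) * tr (real (Suc k) * z))
     (\<lambda>(t,z). trs tr j t z) sequentially"
proof -
  have "uniform_limit ({\<delta>..} \<times> UNIV) (\<lambda>n p. \<Sum>k<n. gw j (fst p) (real (Suc k)) * tr (real (Suc k) * snd p))
     (\<lambda>p. \<Sum>k. gw j (fst p) (real (Suc k)) * tr (real (Suc k) * snd p)) sequentially"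
  proof (rule Weierstrass_m_test)
    show "summable (\<lambda>k. \<bar>gw j \<delta> (real (Suc k))\<bar>)" by (rule gw_summable[OF assms(2,3)])
    fix k p assume "p \<in> {\<delta>..} \<times> (UNIV :: real set)"
    then have "\<bar>gw j (fst p) (real (Suc k))\<bar> \<le> \<bar>gw j \<delta> (real (Suc k))\<bar>"
      using gw_antimono[of \<delta> "fst p" "real (Suc k)" j] by auto
    then show "norm (gw j (fst p) (real (Suc k)) * tr (real (Suc k) * snd p)) \<le> \<bar>gw j \<delta> (real (Suc k))\<bar>"
      using mult_mono[of "\<bar>gw j (fst p) (real (Suc k))\<bar>" "\<bar>gw j \<delta> (real (Suc k))\<bar>" "\<bar>tr (real (Suc k) * snd p)\<bar>" 1] tr
      by (simp add: abs_mult)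
  qed
  then show ?thesis by (simp add: case_prod_unfold trs_def)
qed

lemma trs_continuous:
  assumes tr: "\<And>a. \<bar>tr a\<bar> \<le> 1" "continuous_on UNIV tr" and "j \<le> 4"
  shows "continuous_on ({0<..} \<times> UNIV) (\<lambda>(t,z). trs tr j t z)"
proof -
  have trc[continuous_intros]: "continuous_on S g \<Longrightarrow> continuous_on S (\<lambda>x. tr (g x))" for S and g :: "real \<times> real \<Rightarrow> real"
    using continuous_on_compose2[OF tr(2)] by auto
  have "continuous (at p) (\<lambda>(t,z). trs tr j t z)" if "p \<in> {0<..} \<times> UNIV" for p
  proof -
    obtain t z where p: "p = (t,z)" "t > 0" using \<open>p \<in> {0<..} \<times> UNIV\<close> by auto
    have "continuous_on ({t/2..} \<times> UNIV) (\<lambda>(t,z). trs tr j t z)"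
      using p assms by (intro uniform_limit_theorem[OF _ trs_uniform] always_eventually allI)
        (auto intro!: continuous_intros simp: case_prod_unfold gw_def)
    then have "continuous_on ({t/2<..} \<times> UNIV) (\<lambda>(t,z). trs tr j t z)"
      by (rule continuous_on_subset) auto
    moreover have "open ({t/2<..} \<times> (UNIV :: real set))" by (intro open_Times) auto
    ultimately show ?thesis using p by (auto simp: continuous_on_eq_continuous_at)
  qed
  then show ?thesis by (auto intro: continuous_at_imp_continuous_on)
qed

lemma trs_deriv:
  assumes "\<And>a. \<bar>tr a\<bar> \<le> 1" "\<And>a. \<bar>tr' a\<bar> \<le> 1" "\<And>a. (tr has_real_derivative c * tr' a) (at a)"
    "t > 0" "j < 4"
  shows "((\<lambda>z. trs tr j t z) has_real_derivative c * trs tr' (Suc j) t z) (at z)"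
proof -
  let ?f = "\<lambda>k z. gw j t (real (Suc k)) * tr (real (Suc k) * z)"
  let ?f' = "\<lambda>k z. c * (gw (Suc j) t (real (Suc k)) * tr' (real (Suc k) * z))"
  have b: "norm (?f' k z) \<le> \<bar>c\<bar> * \<bar>gw (Suc j) t (real (Suc k))\<bar>" for k z
    using mult_mono[of "\<bar>gw (Suc j) t (real (Suc k))\<bar>" "\<bar>gw (Suc j) t (real (Suc k))\<bar>" "\<bar>tr' (real (Suc k) * z)\<bar>" 1] assms(2)
    by (auto simp: abs_mult intro!: mult_left_mono)
  have s: "summable (\<lambda>k. gw (Suc j) t (real (Suc k)) * tr' (real (Suc k) * z))" for z
  proof (rule summable_comparison_test'[OF gw_summable[of t "Suc j"]])
    show "norm (gw (Suc j) t (real (Suc k)) * tr' (real (Suc k) * z)) \<le> \<bar>gw (Suc j) t (real (Suc k))\<bar>" for k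
      using mult_mono[of "\<bar>gw (Suc j) t (real (Suc k))\<bar>" "\<bar>gw (Suc j) t (real (Suc k))\<bar>" "\<bar>tr' (real (Suc k) * z)\<bar>" 1] assms(2)
      by (auto simp: abs_mult)
  qed (use assms in auto)
  have "((\<lambda>z. \<Sum>k. ?f k z) has_field_derivative (\<Sum>k. ?f' k z)) (at z)"
  proof (rule has_field_derivative_series'(2)[where S = UNIV and x0 = z])
    show "(?f k has_field_derivative ?f' k x) (at x within UNIV)" for k x
      using assms(3) by (auto intro!: derivative_eq_intros DERIV_chain2[OF assms(3)] simp: gw_def)
    show "uniformly_convergent_on UNIV (\<lambda>n x. \<Sum>i<n. ?f' i x)"
    proof (rule Weierstrass_m_test'[OF b])
      show "summable (\<lambda>k. \<bar>c\<bar> * \<bar>gw (Suc j) t (real (Suc k))\<bar>)"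
        using assms by (intro summable_mult gw_summable) auto
    qed
    show "summable (\<lambda>k. ?f k z)"
    proof (rule summable_comparison_test'[OF gw_summable[of t j]])
      show "norm (?f k z) \<le> \<bar>gw j t (real (Suc k))\<bar>" for k
        using mult_mono[of "\<bar>gw j t (real (Suc k))\<bar>" "\<bar>gw j t (real (Suc k))\<bar>" "\<bar>tr (real (Suc k) * z)\<bar>" 1] assms(1)
        by (auto simp: abs_mult)
    qed (use assms in auto)
  qed auto
  then show ?thesis by (simp only: trs_def suminf_mult[OF s])
qed

text \<open>The partial derivatives of the kernel in x, in y and in both, obtained termwise from its
  reflected form. Of the two first-order ones it is \<open>hkx\<close>, not \<open>hky\<close>, that
  vanishes at y = 0 and y = pi.\<close>

definition hkx :: "real \<Rightarrow> real \<Rightarrow> real \<Rightarrow> real" where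
  "hkx t x y = (trs sin 1 t (x + y) - trs sin 1 t (x - y)) / pi"
definition hky :: "real \<Rightarrow> real \<Rightarrow> real \<Rightarrow> real" where
  "hky t x y = (trs sin 1 t (x + y) + trs sin 1 t (x - y)) / pi"
definition hkxy :: "real \<Rightarrow> real \<Rightarrow> real \<Rightarrow> real" where
  "hkxy t x y = (trs cos 2 t (x + y) + trs cos 2 t (x - y)) / pi"

lemma trs_summable:
  assumes "\<And>a. \<bar>tr a\<bar> \<le> 1" "t > 0" "j \<le> 4"
  shows "summable (\<lambda>k. gw j t (real (Suc k)) * tr (real (Suc k) * z))"
proof (rule summable_comparison_test'[OF gw_summable[OF assms(2,3)]])
  show "norm (gw j t (real (Suc k)) * tr (real (Suc k) * z)) \<le> \<bar>gw j t (real (Suc k))\<bar>" for k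
    using mult_mono[of "\<bar>gw j t (real (Suc k))\<bar>" "\<bar>gw j t (real (Suc k))\<bar>" "\<bar>tr (real (Suc k) * z)\<bar>" 1] assms(1)
    by (auto simp: abs_mult)
qed

text \<open>The method of images: a product of sines is a difference of cosines. For positive time
  the two resulting series converge separately.\<close>

lemma heat_kernel_eq:
  assumes "t > 0" shows "heat_kernel t x y = (trs cos 0 t (x - y) - trs cos 0 t (x + y)) / pi"
proof -
  have "trs cos 0 t (x - y) - trs cos 0 t (x + y) = (\<Sum>k. gw 0 t (real (Suc k)) * cos (real (Suc k) * (x - y))
      - gw 0 t (real (Suc k)) * cos (real (Suc k) * (x + y)))"
    unfolding trs_def using assms by (intro suminf_diff trs_summable) auto
  also have "\<dots> = (\<Sum>k. 2 * (exp (- (real (Suc k))\<^sup>2 * t) * sin (real (Suc k) * x) * sin (real (Suc k) * y)))"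
  proof (rule suminf_cong)
    fix k
    have "e * cos (m * (x - y)) - e * cos (m * (x + y)) = 2 * (e * sin (m * x) * sin (m * y))" for e m :: real
      by (simp add: right_diff_distrib distrib_left cos_add cos_diff)
    then show "gw 0 t (real (Suc k)) * cos (real (Suc k) * (x - y)) - gw 0 t (real (Suc k)) * cos (real (Suc k) * (x + y)) =
      2 * (exp (- (real (Suc k))\<^sup>2 * t) * sin (real (Suc k) * x) * sin (real (Suc k) * y))"
      by (simp add: gw_def)
  qed
  also have "\<dots> = 2 * (\<Sum>k. exp (- (real (Suc k))\<^sup>2 * t) * sin (real (Suc k) * x) * sin (real (Suc k) * y))"
  proof (rule suminf_mult)
    show "summable (\<lambda>k. exp (- (real (Suc k))\<^sup>2 * t) * sin (real (Suc k) * x) * sin (real (Suc k) * y))"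
    proof (rule summable_comparison_test'[OF sum_gauss_le(1)[OF assms]])
      show "norm (exp (- (real (Suc k))\<^sup>2 * t) * sin (real (Suc k) * x) * sin (real (Suc k) * y)) \<le> exp (- (real (Suc k))\<^sup>2 * t)" for k
        using mult_mono[of "\<bar>sin (real (Suc k) * x)\<bar>" 1 "\<bar>sin (real (Suc k) * y)\<bar>" 1]
        by (simp add: abs_mult mult.assoc mult_le_cancel_left1)
    qed
  qed
  finally show ?thesis by (simp add: heat_kernel_def)
qed

lemma trs_sin_deriv [derivative_intros]:
  assumes "t > 0" "(g has_real_derivative g') (at x within S)"
  shows "((\<lambda>x. trs sin 1 t (g x)) has_real_derivative trs cos 2 t (g x) * g') (at x within S)"
proof -
  have "(trs sin 1 t has_real_derivative trs cos 2 t (g x)) (at (g x))"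
    using trs_deriv[of sin cos 1 t 1 "g x"] assms(1) by (auto simp: numeral_2_eq_2)
  from DERIV_chain2[OF this assms(2)] show ?thesis .
qed

lemma trs_cos_deriv [derivative_intros]:
  assumes "t > 0" "(g has_real_derivative g') (at x within S)"
  shows "((\<lambda>x. trs cos 0 t (g x)) has_real_derivative - trs sin 1 t (g x) * g') (at x within S)"
proof -
  have "(trs cos 0 t has_real_derivative - trs sin 1 t (g x)) (at (g x))"
    using trs_deriv[of cos sin "-1" t 0 "g x"] assms(1) by auto
  from DERIV_chain2[OF this assms(2)] show ?thesis .
qed

lemma heat_kernel_deriv_x:
  assumes "t > 0" shows "((\<lambda>x. heat_kernel t x y) has_real_derivative hkx t x y) (at x within S)"
proof -
  have "((\<lambda>x. (trs cos 0 t (x - y) - trs cos 0 t (x + y)) / pi) has_real_derivative hkx t x y) (at x within S)"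
    unfolding hkx_def using assms by (auto intro!: derivative_eq_intros simp del: One_nat_def)
  then show ?thesis using heat_kernel_eq[OF assms] by simp
qed

lemma heat_kernel_deriv_y:
  assumes "t > 0" shows "(heat_kernel t x has_real_derivative hky t x y) (at y within S)"
proof -
  have "((\<lambda>y. (trs cos 0 t (x - y) - trs cos 0 t (x + y)) / pi) has_real_derivative hky t x y) (at y within S)"
    unfolding hky_def using assms by (auto intro!: derivative_eq_intros simp del: One_nat_def)
  moreover have "heat_kernel t x = (\<lambda>y. (trs cos 0 t (x - y) - trs cos 0 t (x + y)) / pi)"
    using heat_kernel_eq[OF assms] by auto
  ultimately show ?thesis by simp
qed

lemma hkx_deriv_y: "t > 0 \<Longrightarrow> (hkx t x has_real_derivative hkxy t x y) (at y within S)"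
  unfolding hkx_def[abs_def] hkxy_def by (auto intro!: derivative_eq_intros simp del: One_nat_def)

lemma hky_deriv_x: "t > 0 \<Longrightarrow> ((\<lambda>x. hky t x y) has_real_derivative hkxy t x y) (at x within S)"
  unfolding hky_def[abs_def] hkxy_def by (auto intro!: derivative_eq_intros simp del: One_nat_def)

lemma deriv_heat_kernel: "t > 0 \<Longrightarrow> deriv (heat_kernel t x) y = hky t x y"
  using heat_kernel_deriv_y[of t x y UNIV] by (simp add: DERIV_imp_deriv)

lemma sin_nat_pi: "sin (real n * pi) = 0" by (simp add: mult.commute)

lemma heat_kernel_boundary [simp]: "heat_kernel t x 0 = 0" "heat_kernel t x pi = 0" "heat_kernel t 0 x = 0" "heat_kernel t pi x = 0"
  using sin_nat_pi[of "Suc _"] by (simp_all add: heat_kernel_def del: of_nat_Suc)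

lemma hkx_boundary [simp]: "hkx t x 0 = 0" "hkx t x pi = 0"
proof -
  show "hkx t x 0 = 0" by (simp add: hkx_def)
  have "sin (real n * (x + pi)) = sin (real n * (x - pi))" for n
    by (simp add: distrib_left right_diff_distrib sin_add sin_diff mult.commute)
  then show "hkx t x pi = 0" by (simp add: hkx_def trs_def del: of_nat_Suc)
qed

lemma hk_continuous:
  fixes a b c :: "'a::topological_space \<Rightarrow> real"
  assumes "continuous_on S a" "continuous_on S b" "continuous_on S c" "\<And>x. x \<in> S \<Longrightarrow> a x > 0"
  shows heat_kernel_continuous: "continuous_on S (\<lambda>x. heat_kernel (a x) (b x) (c x))"
    and hkx_continuous: "continuous_on S (\<lambda>x. hkx (a x) (b x) (c x))"
    and hky_continuous: "continuous_on S (\<lambda>x. hky (a x) (b x) (c x))"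
    and hkxy_continuous: "continuous_on S (\<lambda>x. hkxy (a x) (b x) (c x))"
proof -
  have *: "continuous_on S (\<lambda>x. trs tr j (a x) (d x))" if "continuous_on S d" "\<And>a. \<bar>tr a\<bar> \<le> 1" "continuous_on UNIV tr" "j \<le> 4" for tr j d
  proof -
    have "continuous_on S (\<lambda>x. case (a x, d x) of (t,z) \<Rightarrow> trs tr j t z)"
      by (rule continuous_on_compose2[OF trs_continuous[OF that(2-4)]]) (use assms that in \<open>auto intro!: continuous_intros\<close>)
    then show ?thesis by simp
  qed
  have "continuous_on S (\<lambda>x. (trs cos 0 (a x) (b x - c x) - trs cos 0 (a x) (b x + c x)) / pi)"
    by (intro continuous_intros * assms) auto
  then show "continuous_on S (\<lambda>x. heat_kernel (a x) (b x) (c x))"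
    by (rule continuous_on_eq) (use assms heat_kernel_eq in auto)
  show "continuous_on S (\<lambda>x. hkx (a x) (b x) (c x))" "continuous_on S (\<lambda>x. hky (a x) (b x) (c x))"
     "continuous_on S (\<lambda>x. hkxy (a x) (b x) (c x))"
    unfolding hkx_def hky_def hkxy_def by (intro continuous_intros * assms; simp)+
qed

section \<open>Pointwise kernel bounds on a bounded time interval\<close>

text \<open>\<open>trig_series_bound\<close> applied to \<open>gw j t\<close> with j = 0, 1, 2. For
  j = 0 the constant 1/2 is the zero mode, absent from a series starting at k = 1; it cancels in the
  kernel. The horizon T enters the constant because the 1 in 1 + 3 / sqrt t is absorbed as sqrt T /
  sqrt t.\<close>

lemma trs_bounds:
  fixes T :: real assumes "T > 0"
  shows "\<exists>C>0. \<forall>t\<in>{0<..T}. \<forall>z.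
     \<bar>trs cos 0 t z + 1/2\<bar> \<le> C / sqrt t \<and> \<bar>trs sin 1 t z\<bar> \<le> C / t \<and> \<bar>trs cos 2 t z\<bar> \<le> C / (t * sqrt t) \<and>
     (2 - 2 * cos z) * \<bar>trs cos 0 t z + 1/2\<bar> \<le> C * sqrt t \<and> (2 - 2 * cos z) * \<bar>trs sin 1 t z\<bar> \<le> C \<and>
     (2 - 2 * cos z) * \<bar>trs cos 2 t z\<bar> \<le> C / sqrt t"
proof -
  define C where "C = 1000 * (sqrt T + 3)"
  have C: "C > 0" using assms by (simp add: C_def add_pos_pos)
  show ?thesis
  proof (intro exI[of _ C] conjI ballI allI C)
    fix t z :: real assume tT: "t \<in> {0<..T}"
    define r where "r = sqrt t"
    have t: "t > 0" and r: "r > 0" "r * r = t" "r\<^sup>2 = t" using tT by (auto simp: r_def)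
    have rT: "r \<le> sqrt T" using tT by (simp add: r_def)
    have R3: "600 * (r + 3) \<le> C"
    proof -
      have "600 * (r + 3) \<le> 1000 * (r + 3)" using r(1) by (intro mult_right_mono) auto
      also have "\<dots> \<le> 1000 * (sqrt T + 3)" using rT by (intro mult_left_mono) auto
      finally show ?thesis by (simp add: C_def)
    qed
    have R: "300 * (1 + 3/r) \<le> C / r"
    proof -
      have "300 * (1 + 3/r) = 300 * (r + 3) / r" using r by (simp add: field_simps)
      also have "\<dots> \<le> C / r" using R3 r by (intro divide_right_mono) auto
      finally show ?thesis .
    qed
    have R1: "27 / r + 1/2 \<le> C / r"
    proof -
      have "27 / r + 1/2 = (27 + r/2) / r" using r by (simp add: field_simps)
      also have "\<dots> \<le> C / r" using R3 r by (intro divide_right_mono) auto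
      finally show ?thesis .
    qed
    have R0: "300 * t * (1 + 3/r) + t \<le> C * r"
    proof -
      have "300 * t * (1 + 3/r) + t = (300 * (r + 3) + r) * r" unfolding r(2)[symmetric] using r(1) by (simp add: field_simps)
      also have "\<dots> \<le> C * r" using R3 r by (intro mult_right_mono) auto
      finally show ?thesis .
    qed
    have R2: "270 / (r * r) \<le> C / (r * r)" using R3 r by (intro divide_right_mono) auto
    note ab = gw_abs_bound[OF t]
    have cosid: "cos (a + b) + cos (a - b) = 2 * cos a * cos b" for a b :: real by (simp add: cos_add cos_diff)
    have sinid: "sin (a + b) + sin (a - b) = 2 * sin a * cos b" for a b :: real by (simp add: sin_add sin_diff)
    have pw: "\<bar>x\<bar> ^ j * exp (- x\<^sup>2 * t) \<le> 9 * exp (- x\<^sup>2 * (t/2)) / r ^ j" if "j \<le> 4" for x j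
      using gw_bound[OF t that, of x] by (simp add: r_def)
    show "\<bar>trs cos 0 t z + 1/2\<bar> \<le> C / sqrt t" "(2 - 2 * cos z) * \<bar>trs cos 0 t z + 1/2\<bar> \<le> C * sqrt t"
    proof -
      let ?f' = "\<lambda>x. (- 2 * x * t) * exp (- x\<^sup>2 * t)"
      let ?f'' = "\<lambda>x. (4 * x\<^sup>2 * t\<^sup>2 - 2 * t) * exp (- x\<^sup>2 * t)"
      have d1: "(gw 0 t has_real_derivative ?f' x) (at x)" for x
        unfolding gw_def[abs_def] by (auto intro!: derivative_eq_intros)
      have d2: "(?f' has_real_derivative ?f'' x) (at x)" for x
        by (auto intro!: derivative_eq_intros simp: power2_eq_square algebra_simps)
      have bb: "\<bar>?f'' x\<bar> \<le> (60 * t) * exp (- x\<^sup>2 * (t/2))" for x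
      proof -
        have "\<bar>?f'' x\<bar> \<le> (4 * x\<^sup>2 * t\<^sup>2 + 2 * t) * exp (- x\<^sup>2 * t)"
          unfolding abs_mult using t by (intro mult_mono) (auto intro: order_trans[OF abs_triangle_ineq4])
        also have "\<dots> = 4 * t\<^sup>2 * (\<bar>x\<bar>^2 * exp (- x\<^sup>2 * t)) + 2 * t * (\<bar>x\<bar>^0 * exp (- x\<^sup>2 * t))"
          by (simp add: algebra_simps)
        also have "\<dots> \<le> 4 * t\<^sup>2 * (9 * exp (- x\<^sup>2 * (t/2)) / r^2) + 2 * t * (9 * exp (- x\<^sup>2 * (t/2)) / r^0)"
          using t by (intro add_mono mult_left_mono pw) auto
        also have "\<dots> = (54 * t) * exp (- x\<^sup>2 * (t/2))" using r t by (simp add: power2_eq_square)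
        also have "\<dots> \<le> (60 * t) * exp (- x\<^sup>2 * (t/2))" using t by (intro mult_right_mono) auto
        finally show ?thesis .
      qed
      note B = trig_series_bound[OF t d1 d2 ab[of 0, simplified power_0 div_by_1] bb cosid abs_cos_le_one, of z, folded trs_def]
      have "\<bar>trs cos 0 t z + 1/2\<bar> \<le> 27 / r + 1/2" using B(1) by (simp add: r_def)
      then show "\<bar>trs cos 0 t z + 1/2\<bar> \<le> C / sqrt t" using R1 by (simp add: r_def)
      have g1: "gw 0 t 0 = 1" "gw 0 t 1 = exp (-t)" "exp (-t) \<le> 1" "1 - t \<le> exp (-t)" 
        using t exp_ge_add_one_self[of "-t"] by (auto simp: gw_def)
      \<comment> \<open>Adding 1/2 contributes 1 - cos z, which cancels the boundary term cos z and
        leaves 1 - exp(-t), at most t. This is what makes the product small with t.\<close>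
      have "(2 - 2 * cos z) * (trs cos 0 t z + 1/2) = ((2 - 2 * cos z) * trs cos 0 t z - (cos z - exp (-t))) + (1 - exp (-t))"
        by (simp add: algebra_simps)
      moreover have "\<bar>(2 - 2 * cos z) * trs cos 0 t z - (cos z - exp (-t))\<bar> \<le> 120 * t * (1 + 3 / r)"
        using B(2) g1 by (simp add: r_def)
      ultimately have "\<bar>(2 - 2 * cos z) * (trs cos 0 t z + 1/2)\<bar> \<le> 120 * t * (1 + 3 / r) + t"
        using g1(3,4) abs_triangle_ineq[of "(2 - 2 * cos z) * trs cos 0 t z - (cos z - exp (-t))" "1 - exp (-t)"]
        by (simp only:)
      also have "\<dots> \<le> 300 * t * (1 + 3/r) + t" using t r by (intro add_right_mono mult_right_mono) auto
      also have "\<dots> \<le> C * sqrt t" using R0 by (simp add: r_def)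
      finally show "(2 - 2 * cos z) * \<bar>trs cos 0 t z + 1/2\<bar> \<le> C * sqrt t"
        using cos_le_one[of z] by (simp add: abs_mult)
    qed
    show "\<bar>trs sin 1 t z\<bar> \<le> C / t" "(2 - 2 * cos z) * \<bar>trs sin 1 t z\<bar> \<le> C"
    proof -
      let ?f' = "\<lambda>x. (1 - 2 * x\<^sup>2 * t) * exp (- x\<^sup>2 * t)"
      let ?f'' = "\<lambda>x. (4 * x^3 * t\<^sup>2 - 6 * x * t) * exp (- x\<^sup>2 * t)"
      have d1: "(gw 1 t has_real_derivative ?f' x) (at x)" for x
        unfolding gw_def[abs_def] by (auto intro!: derivative_eq_intros simp: power2_eq_square algebra_simps)
      have d2: "(?f' has_real_derivative ?f'' x) (at x)" for x
        by (auto intro!: derivative_eq_intros simp: power2_eq_square power3_eq_cube algebra_simps)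
      have bb: "\<bar>?f'' x\<bar> \<le> (100 * r) * exp (- x\<^sup>2 * (t/2))" for x
      proof -
        have "\<bar>?f'' x\<bar> \<le> (4 * \<bar>x\<bar>^3 * t\<^sup>2 + 6 * \<bar>x\<bar> * t) * exp (- x\<^sup>2 * t)"
          unfolding abs_mult using t by (intro mult_mono order_trans[OF abs_triangle_ineq4]) (auto simp: abs_mult power_abs)
        also have "\<dots> = 4 * t\<^sup>2 * (\<bar>x\<bar>^3 * exp (- x\<^sup>2 * t)) + 6 * t * (\<bar>x\<bar>^1 * exp (- x\<^sup>2 * t))"
          by (simp add: algebra_simps)
        also have "\<dots> \<le> 4 * t\<^sup>2 * (9 * exp (- x\<^sup>2 * (t/2)) / r^3) + 6 * t * (9 * exp (- x\<^sup>2 * (t/2)) / r^1)"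
          using t by (intro add_mono mult_left_mono pw) auto
        also have "\<dots> = (90 * r) * exp (- x\<^sup>2 * (t/2))" using r(1) unfolding r(2)[symmetric] by (simp add: power2_eq_square power3_eq_cube)
        also have "\<dots> \<le> (100 * r) * exp (- x\<^sup>2 * (t/2))" using r by (intro mult_right_mono) auto
        finally show ?thesis .
      qed
      note B = trig_series_bound[OF t d1 d2 ab[of 1] bb sinid abs_sin_le_one, of z, folded trs_def]
      have "\<bar>trs sin 1 t z\<bar> \<le> 27 / (r * r)" using B(1) by (simp add: r_def)
      also have "\<dots> \<le> 270 / (r * r)" using r by (intro divide_right_mono) auto
      also note R2
      finally show "\<bar>trs sin 1 t z\<bar> \<le> C / t" by (simp only: r(2))
      have "\<bar>(2 - 2 * cos z) * trs sin 1 t z\<bar> \<le> 200 * r * (1 + 3 / r)"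
        using B(2) by (simp add: r_def gw_def)
      also have "\<dots> = 200 * (r + 3)" using r by (simp add: field_simps)
      also have "\<dots> \<le> C" using R3 r by simp
      finally show "(2 - 2 * cos z) * \<bar>trs sin 1 t z\<bar> \<le> C" using cos_le_one[of z] by (simp add: abs_mult)
    qed
    show "\<bar>trs cos 2 t z\<bar> \<le> C / (t * sqrt t)" "(2 - 2 * cos z) * \<bar>trs cos 2 t z\<bar> \<le> C / sqrt t"
    proof -
      let ?f' = "\<lambda>x. (2 * x - 2 * x^3 * t) * exp (- x\<^sup>2 * t)"
      let ?f'' = "\<lambda>x. (2 - 10 * x\<^sup>2 * t + 4 * x^4 * t\<^sup>2) * exp (- x\<^sup>2 * t)"
      have d1: "(gw 2 t has_real_derivative ?f' x) (at x)" for x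
        unfolding gw_def[abs_def] by (auto intro!: derivative_eq_intros simp: power2_eq_square power3_eq_cube algebra_simps)
      have d2: "(?f' has_real_derivative ?f'' x) (at x)" for x
        by (auto intro!: derivative_eq_intros simp: power2_eq_square power3_eq_cube power4_eq_xxxx algebra_simps)
      have bb: "\<bar>?f'' x\<bar> \<le> 149 * exp (- x\<^sup>2 * (t/2))" for x
      proof -
        have "\<bar>?f'' x\<bar> \<le> (2 + 10 * \<bar>x\<bar>^2 * t + 4 * \<bar>x\<bar>^4 * t\<^sup>2) * exp (- x\<^sup>2 * t)"
          unfolding abs_mult abs_exp_cancel using t 
          by (intro mult_right_mono) (auto intro!: abs_leI simp: algebra_simps)
        also have "\<dots> = 2 * (\<bar>x\<bar>^0 * exp (- x\<^sup>2 * t)) + 10 * t * (\<bar>x\<bar>^2 * exp (- x\<^sup>2 * t)) + 4 * t\<^sup>2 * (\<bar>x\<bar>^4 * exp (- x\<^sup>2 * t))"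
          by (simp add: algebra_simps)
        also have "\<dots> \<le> 2 * (9 * exp (- x\<^sup>2 * (t/2)) / r^0) + 10 * t * (9 * exp (- x\<^sup>2 * (t/2)) / r^2) + 4 * t\<^sup>2 * (9 * exp (- x\<^sup>2 * (t/2)) / r^4)"
          using t by (intro add_mono mult_left_mono pw) auto
        also have "\<dots> = 144 * exp (- x\<^sup>2 * (t/2))" using r(1) unfolding r(2)[symmetric] by (simp add: power2_eq_square power4_eq_xxxx)
        also have "\<dots> \<le> 149 * exp (- x\<^sup>2 * (t/2))" by (intro mult_right_mono) auto
        finally show ?thesis .
      qed
      note B = trig_series_bound[OF t d1 d2 ab[of 2] bb cosid abs_cos_le_one, of z, folded trs_def]
      have "\<bar>trs cos 2 t z\<bar> \<le> 27 / (r * r) / r" using B(1) r t by (simp add: r_def mult.commute)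
      also have "\<dots> \<le> 270 / (r * r) / r" using r by (intro divide_right_mono) auto
      also have "\<dots> \<le> C / (r * r) / r" by (rule divide_right_mono[OF R2]) (use r in auto)
      finally show "\<bar>trs cos 2 t z\<bar> \<le> C / (t * sqrt t)" using r by (simp add: r_def)
      have "\<bar>(2 - 2 * cos z) * trs cos 2 t z\<bar> \<le> 298 * (1 + 3 / r) + 1"
      proof -
        have "\<bar>(2 - 2 * cos z) * trs cos 2 t z + exp (- t)\<bar> \<le> 298 * (1 + 3 / r)"
          using B(2) by (simp add: r_def gw_def)
        moreover have "\<bar>exp (- t)\<bar> \<le> 1" using t by simp
        ultimately show ?thesis
          using abs_triangle_ineq4[of "(2 - 2 * cos z) * trs cos 2 t z + exp (- t)" "exp (- t)"]
          by (simp only: add_diff_cancel_right')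
      qed
      also have "\<dots> \<le> 300 * (1 + 3/r)"
      proof -
        have "298 * (1 + q) + 1 \<le> 300 * (1 + q)" if "0 \<le> q" for q :: real using that by simp
        from this[of "3 / r"] show ?thesis using r(1) by (simp only: divide_nonneg_pos zero_le_numeral)
      qed
      finally show "(2 - 2 * cos z) * \<bar>trs cos 2 t z\<bar> \<le> C / sqrt t" using cos_le_one[of z] R by (simp add: abs_mult r_def)
    qed
  qed
qed

lemma powr_interpolate:
  fixes p A B \<theta> :: real
  assumes "0 \<le> p" "p \<le> A" "p \<le> B" "0 \<le> \<theta>" "\<theta> \<le> 1"
  shows "p \<le> A powr (1 - \<theta>) * B powr \<theta>"
proof (cases "p = 0")
  case False
  have "p powr (1-\<theta>) * p powr \<theta> = p"
    using powr_add[of p "1-\<theta>" \<theta>] False assms(1) by simp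
  moreover have "p powr (1-\<theta>) * p powr \<theta> \<le> A powr (1 - \<theta>) * B powr \<theta>"
    using assms by (intro mult_mono powr_mono2) auto
  ultimately show ?thesis by simp
qed auto

text \<open>Interpolation between the bound at the diagonal and the bound with decay d^(-2). The
  parameter \<theta> trades time singularity for space singularity, so both can be kept
  integrable.\<close>

lemma interpolate_bound:
  fixes d t :: real
  assumes "0 < C" "t > 0" "d > 0" "0 \<le> p" "p \<le> C * t powr a" "d\<^sup>2 * p \<le> C * t powr b" "0 \<le> \<theta>" "\<theta> \<le> 1"
  shows "p \<le> C * t powr (a * (1 - \<theta>) + b * \<theta>) * d powr (- 2 * \<theta>)"
proof -
  have d2: "d powr (-2) = 1 / d\<^sup>2" using assms(3) powr_realpow[of d 2] by (simp add: powr_minus_divide)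
  have "p \<le> C * t powr b / d\<^sup>2"
    using assms(3,6) by (simp add: pos_le_divide_eq mult.commute)
  then have "p \<le> C * t powr b * d powr (-2)" by (simp add: d2)
  from powr_interpolate[OF assms(4,5) this assms(7,8)]
  have "p \<le> (C * t powr a) powr (1-\<theta>) * (C * t powr b * d powr (-2)) powr \<theta>" .
  also have "(C * t powr a) powr (1-\<theta>) = C powr (1-\<theta>) * t powr (a * (1-\<theta>))"
    using assms(1) by (subst powr_mult) (auto simp: powr_powr)
  also have "(C * t powr b * d powr (-2)) powr \<theta> = C powr \<theta> * t powr (b * \<theta>) * d powr (- 2 * \<theta>)"
    using assms(1) by (subst powr_mult, simp, simp, subst powr_mult) (auto simp: powr_powr)
  also have "C powr (1-\<theta>) * t powr (a * (1-\<theta>)) * (C powr \<theta> * t powr (b * \<theta>) * d powr (- 2 * \<theta>)) =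
    (C powr (1-\<theta>) * C powr \<theta>) * (t powr (a * (1-\<theta>)) * t powr (b * \<theta>)) * d powr (- 2 * \<theta>)"
    by (simp only: ac_simps)
  also have "C powr (1-\<theta>) * C powr \<theta> = C"
    using powr_add[of C "1-\<theta>" \<theta>] assms(1) by simp
  also have "t powr (a * (1-\<theta>)) * t powr (b * \<theta>) = t powr (a * (1 - \<theta>) + b * \<theta>)"
    by (rule powr_add[symmetric])
  finally show ?thesis .
qed

text \<open>The bounds interpolate with \<theta> = 1/4, 1/8 or 9/16. For the mixed derivative a path
  of Hoelder order 1/4 contributes |x - y|^(1/4); integrability in space then means \<theta> < 5/8
  and in time \<theta> > 1/2, and 9/16 is the midpoint. The bound with \<theta> = 1/8 is made to be
  squared: its square has exponents -1/2 in space and -3/4 in time.\<close>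

lemma heat_kernel_bounds:
  fixes T :: real assumes "T > 0"
  shows "\<exists>C>0. \<forall>t\<in>{0<..T}. \<forall>x\<in>{0..pi}. \<forall>y\<in>{0..pi}.
     \<bar>heat_kernel t x y\<bar> \<le> C * t powr (-1/2) \<and>
     (x \<noteq> y \<longrightarrow> \<bar>heat_kernel t x y\<bar> \<le> C * t powr (-1/4) * \<bar>x - y\<bar> powr (-1/2) \<and>
       \<bar>heat_kernel t x y\<bar> \<le> C * t powr (-3/8) * \<bar>x - y\<bar> powr (-1/4) \<and>
       \<bar>hkx t x y\<bar> \<le> C * t powr (-3/4) * \<bar>x - y\<bar> powr (-1/2) \<and>
       \<bar>hky t x y\<bar> \<le> C * t powr (-3/4) * \<bar>x - y\<bar> powr (-1/2) \<and>
       \<bar>hkxy t x y\<bar> * \<bar>x - y\<bar> powr (1/4) \<le> C * t powr (-15/16) * \<bar>x - y\<bar> powr (-7/8))"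
proof -
  obtain C where C: "C > 0" and tb: "\<forall>t\<in>{0<..T}. \<forall>z.
     \<bar>trs cos 0 t z + 1/2\<bar> \<le> C / sqrt t \<and> \<bar>trs sin 1 t z\<bar> \<le> C / t \<and> \<bar>trs cos 2 t z\<bar> \<le> C / (t * sqrt t) \<and>
     (2 - 2 * cos z) * \<bar>trs cos 0 t z + 1/2\<bar> \<le> C * sqrt t \<and> (2 - 2 * cos z) * \<bar>trs sin 1 t z\<bar> \<le> C \<and>
     (2 - 2 * cos z) * \<bar>trs cos 2 t z\<bar> \<le> C / sqrt t"
    using trs_bounds[OF assms] by auto
  \<comment> \<open>Two image terms, each losing the factor 4 of \<open>one_minus_cos_ge\<close>;
    the division by pi is dropped.\<close>
  define D where "D = 8 * C"
  have D: "D > 0" using C by (simp add: D_def)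
  show ?thesis
  proof (intro exI[of _ D] conjI ballI D impI)
    fix t x y :: real assume tT: "t \<in> {0<..T}" and x: "x \<in> {0..pi}" and y: "y \<in> {0..pi}"
    have t: "t > 0" using tT by auto
    have h: "sqrt t = t powr (1/2)" using t by (simp add: powr_half_sqrt)
    have sq: "1 / sqrt t = t powr (-1/2)" "1 / t = t powr (-1)" "1 / (t * sqrt t) = t powr (-3/2)" "sqrt t = t powr (1/2)" "1 = t powr 0"
    proof -
      show "1 / sqrt t = t powr (-1/2)" unfolding h by (simp add: powr_minus_divide[symmetric])
      show "1 / t = t powr (-1)" using t by (simp add: powr_minus_divide)
      have "t * sqrt t = t powr (1 + 1/2)" unfolding powr_add using t h by simp
      then show "1 / (t * sqrt t) = t powr (-3/2)" by (simp add: powr_minus_divide[symmetric])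
    qed (use h t in auto)
    note tb' = tb[rule_format, OF tT]
    have absb: "\<bar>(a + b) / pi\<bar> \<le> \<bar>a\<bar> + \<bar>b\<bar>" for a b :: real
    proof -
      have "\<bar>(a + b) / pi\<bar> \<le> \<bar>a + b\<bar> / 1" using pi_gt3 unfolding abs_divide by (intro divide_left_mono) auto
      also have "\<dots> \<le> \<bar>a\<bar> + \<bar>b\<bar>" by simp
      finally show ?thesis .
    qed
    have comb: "\<bar>(a + b) / pi\<bar> \<le> D * c" if "\<bar>a\<bar> \<le> C * c" "\<bar>b\<bar> \<le> C * c" for a b c
    proof -
      have "\<bar>(a + b) / pi\<bar> \<le> C * c + C * c" using absb[of a b] add_mono[OF that] by (rule order_trans)
      also have "\<dots> \<le> D * c" using order_trans[OF abs_ge_zero that(1)] by (simp add: D_def)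
      finally show ?thesis .
    qed
    have comb2: "(x - y)\<^sup>2 * \<bar>(a + b) / pi\<bar> \<le> D * c"
      if "(2 - 2 * cos (x + y)) * \<bar>a\<bar> \<le> C * c" "(2 - 2 * cos (x - y)) * \<bar>b\<bar> \<le> C * c" for a b c
    proof -
      have 1: "(x-y)\<^sup>2 / 4 \<le> 2 - 2 * cos (x - y)" using x y by (intro one_minus_cos_ge) auto
      have 2: "2 - 2 * cos (x - y) \<le> 2 - 2 * cos (x + y)" using cos_diff_ge_cos_add[OF x y] by simp
      have a: "(x-y)\<^sup>2 / 4 * \<bar>a\<bar> \<le> C * c" using 1 2 that(1) by (meson abs_ge_zero mult_right_mono order_trans)
      have b: "(x-y)\<^sup>2 / 4 * \<bar>b\<bar> \<le> C * c" using 1 that(2) by (meson abs_ge_zero mult_right_mono order_trans)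
      have "(x-y)\<^sup>2 * \<bar>(a + b) / pi\<bar> \<le> (x-y)\<^sup>2 * (\<bar>a\<bar> + \<bar>b\<bar>)" using absb by (intro mult_left_mono) auto
      also have "\<dots> = 4 * ((x-y)\<^sup>2 / 4 * \<bar>a\<bar> + (x-y)\<^sup>2 / 4 * \<bar>b\<bar>)" by (simp add: algebra_simps)
      also have "\<dots> \<le> 4 * (C * c + C * c)" using a b by (intro mult_left_mono add_mono) auto
      also have "\<dots> = D * c" by (simp add: D_def)
      finally show ?thesis .
    qed
    have e: "C / sqrt t = C * t powr (-1/2)" "C / t = C * t powr (-1)" "C / (t * sqrt t) = C * t powr (-3/2)"
      "C * sqrt t = C * t powr (1/2)" "C = C * t powr 0"
      using t by (simp_all only: sq[symmetric] times_divide_eq_right mult_1_right)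
    have c0: "\<bar>trs cos 0 t z + 1/2\<bar> \<le> C * t powr (-1/2)" "\<bar>- (trs cos 0 t z + 1/2)\<bar> \<le> C * t powr (-1/2)"
      "(2 - 2 * cos z) * \<bar>trs cos 0 t z + 1/2\<bar> \<le> C * t powr (1/2)"
      "(2 - 2 * cos z) * \<bar>- (trs cos 0 t z + 1/2)\<bar> \<le> C * t powr (1/2)" for z
      using tb'[of z] unfolding abs_minus_cancel e(1,4) by blast+
    have c1: "\<bar>trs sin 1 t z\<bar> \<le> C * t powr (-1)" "\<bar>- trs sin 1 t z\<bar> \<le> C * t powr (-1)"
      "(2 - 2 * cos z) * \<bar>trs sin 1 t z\<bar> \<le> C * t powr 0"
      "(2 - 2 * cos z) * \<bar>- trs sin 1 t z\<bar> \<le> C * t powr 0" for z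
      using tb'[of z] unfolding abs_minus_cancel e(2) e(5)[symmetric] by blast+
    have c2: "\<bar>trs cos 2 t z\<bar> \<le> C * t powr (-3/2)"
      "(2 - 2 * cos z) * \<bar>trs cos 2 t z\<bar> \<le> C * t powr (-1/2)" for z
      using tb'[of z] unfolding e(3) e(1) by blast+
    have hk: "heat_kernel t x y = (- (trs cos 0 t (x + y) + 1/2) + (trs cos 0 t (x - y) + 1/2)) / pi"
      using heat_kernel_eq[OF t] by simp
    have kb: "\<bar>heat_kernel t x y\<bar> \<le> D * t powr (-1/2)" "(x - y)\<^sup>2 * \<bar>heat_kernel t x y\<bar> \<le> D * t powr (1/2)"
      unfolding hk by (rule comb[OF c0(2) c0(1)], rule comb2[OF c0(4) c0(3)])
    have yb: "\<bar>hky t x y\<bar> \<le> D * t powr (-1)" "(x - y)\<^sup>2 * \<bar>hky t x y\<bar> \<le> D * t powr 0"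
      unfolding hky_def by (rule comb[OF c1(1) c1(1)], rule comb2[OF c1(3) c1(3)])
    have xb: "\<bar>hkx t x y\<bar> \<le> D * t powr (-1)" "(x - y)\<^sup>2 * \<bar>hkx t x y\<bar> \<le> D * t powr 0"
      unfolding hkx_def diff_conv_add_uminus[of "trs sin 1 t (x+y)"]
      by (rule comb[OF c1(1) c1(2)], rule comb2[OF c1(3) c1(4)])
    have xyb: "\<bar>hkxy t x y\<bar> \<le> D * t powr (-3/2)" "(x - y)\<^sup>2 * \<bar>hkxy t x y\<bar> \<le> D * t powr (-1/2)"
      unfolding hkxy_def by (rule comb[OF c2(1) c2(1)], rule comb2[OF c2(2) c2(2)])
    show "\<bar>heat_kernel t x y\<bar> \<le> D * t powr (-1/2)" by (rule kb)
    assume ne: "x \<noteq> y"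
    then have d: "\<bar>x - y\<bar> > 0" by simp
    note ib = interpolate_bound[OF D t d abs_ge_zero, unfolded power2_abs]
    show "\<bar>heat_kernel t x y\<bar> \<le> D * t powr (-1/4) * \<bar>x - y\<bar> powr (-1/2)"
      using ib[OF kb, of "1/4"] by simp
    show "\<bar>heat_kernel t x y\<bar> \<le> D * t powr (-3/8) * \<bar>x - y\<bar> powr (-1/4)"
      using ib[OF kb, of "1/8"] by simp
    show "\<bar>hkx t x y\<bar> \<le> D * t powr (-3/4) * \<bar>x - y\<bar> powr (-1/2)"
      using ib[OF xb, of "1/4"] by simp
    show "\<bar>hky t x y\<bar> \<le> D * t powr (-3/4) * \<bar>x - y\<bar> powr (-1/2)"
      using ib[OF yb, of "1/4"] by simp
    have "\<bar>hkxy t x y\<bar> \<le> D * t powr (-15/16) * \<bar>x - y\<bar> powr (-9/8)"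
      using ib[OF xyb, of "9/16"] by simp
    then have "\<bar>hkxy t x y\<bar> * \<bar>x - y\<bar> powr (1/4) \<le> D * t powr (-15/16) * \<bar>x - y\<bar> powr (-9/8) * \<bar>x - y\<bar> powr (1/4)"
      by (intro mult_right_mono) auto
    also have "\<dots> = D * t powr (-15/16) * \<bar>x - y\<bar> powr (-7/8)"
      by (simp add: mult.assoc powr_add[symmetric])
    finally show "\<bar>hkxy t x y\<bar> * \<bar>x - y\<bar> powr (1/4) \<le> D * t powr (-15/16) * \<bar>x - y\<bar> powr (-7/8)" .
  qed
qed

section \<open>The Stratonovich term as a pathwise operator\<close>

text \<open>One constant for the supremum and for the Hoelder seminorm of order 1/4. The predicate
  is applied to paths and their means with a fixed bound, and to their differences with a bound
  tending to 0.\<close>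

definition noise_bound :: "real \<Rightarrow> (real \<Rightarrow> real) \<Rightarrow> bool" where
  "noise_bound M w \<longleftrightarrow> continuous_on {0..pi} w \<and> (\<forall>x\<in>{0..pi}. \<bar>w x\<bar> \<le> M) \<and>
     (\<forall>x\<in>{0..pi}. \<forall>y\<in>{0..pi}. \<bar>w x - w y\<bar> \<le> M * \<bar>x - y\<bar> powr (1/4))"

text \<open>The exponents -1/4 and -3/4 are those that the kernel bounds give for a bounded initial
  datum, and the operator reproduces them. The derivative is a separate argument because the
  solution concept supplies it as a function, one-sided at the end points.\<close>

definition in_X :: "real \<Rightarrow> real \<Rightarrow> (real \<Rightarrow> real \<Rightarrow> real) \<Rightarrow> (real \<Rightarrow> real \<Rightarrow> real) \<Rightarrow> bool" where
  "in_X T B f fx \<longleftrightarrow> (\<forall>s\<in>{0<..T}. \<forall>y\<in>{0..pi}. (f s has_real_derivative fx s y) (at y within {0..pi}) \<and>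
     \<bar>f s y\<bar> \<le> B * s powr (-1/4) \<and> \<bar>fx s y\<bar> \<le> B * s powr (-3/4))"

text \<open>\<open>Kop w f f\<^sub>x\<close> is the right-hand side of the mild equation without the factor \<open>\<epsilon>\<close> and the initial datum;
  for a differentiable path \<open>w\<close> an integration by parts turns it into the Duhamel integral of \<open>f w'\<close>.\<close>
definition Jop :: "(real \<Rightarrow> real) \<Rightarrow> (real \<Rightarrow> real \<Rightarrow> real) \<Rightarrow> (real \<Rightarrow> real \<Rightarrow> real) \<Rightarrow> real \<Rightarrow> real \<Rightarrow> real \<Rightarrow> real" where
  "Jop w f fx \<tau> s x = - integral {0..pi} (\<lambda>y. hky \<tau> x y * (f s y * w y))
     - integral {0..pi} (\<lambda>y. heat_kernel \<tau> x y * (fx s y * w y))"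

definition Kop :: "(real \<Rightarrow> real) \<Rightarrow> (real \<Rightarrow> real \<Rightarrow> real) \<Rightarrow> (real \<Rightarrow> real \<Rightarrow> real) \<Rightarrow> real \<Rightarrow> real \<Rightarrow> real" where
  "Kop w f fx t x = integral {0..t} (\<lambda>s. Jop w f fx (t - s) s x)"

lemma in_XD:
  assumes "in_X T B f fx" "s \<in> {0<..T}" "y \<in> {0..pi}"
  shows "(f s has_real_derivative fx s y) (at y within {0..pi})" "\<bar>f s y\<bar> \<le> B * s powr (-1/4)"
    "\<bar>fx s y\<bar> \<le> B * s powr (-3/4)"
  using assms unfolding in_X_def by blast+

lemma in_X_cont: "in_X T B f fx \<Longrightarrow> s \<in> {0<..T} \<Longrightarrow> continuous_on {0..pi} (f s)"
  using DERIV_continuous_on in_XD(1) by blast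

lemma in_X_nonneg: "in_X T B f fx \<Longrightarrow> 0 < T \<Longrightarrow> 0 \<le> B"
  using in_XD(2)[of T B f fx T 0] by (smt (verit) atLeastAtMost_iff greaterThanAtMost_iff pi_ge_zero powr_gt_zero zero_le_mult_iff)

lemma noise_boundD:
  assumes "noise_bound M w"
  shows "continuous_on {0..pi} w" "x \<in> {0..pi} \<Longrightarrow> \<bar>w x\<bar> \<le> M"
    "x \<in> {0..pi} \<Longrightarrow> y \<in> {0..pi} \<Longrightarrow> \<bar>w x - w y\<bar> \<le> M * \<bar>x - y\<bar> powr (1/4)" "0 \<le> M"
  using assms unfolding noise_bound_def by (auto intro: order_trans[OF abs_ge_zero, of "w 0"])

lemma Jop_integrable:
  assumes "in_X T B f fx" "s \<in> {0<..T}" "continuous_on {0..pi} w" "\<tau> > 0"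
  shows "(\<lambda>y. hky \<tau> x y * (f s y * w y)) integrable_on {0..pi}"
    "(\<lambda>y. heat_kernel \<tau> x y * (fx s y * w y)) integrable_on {0..pi}"
proof -
  show "(\<lambda>y. hky \<tau> x y * (f s y * w y)) integrable_on {0..pi}"
    by (intro integrable_continuous_real continuous_intros hky_continuous assms in_X_cont[OF assms(1,2)]) 
  have "(\<lambda>y. (heat_kernel \<tau> x y * w y) * fx s y) integrable_on {0..pi}"
    by (rule deriv_times_cont_integrable[OF in_XD(1)[OF assms(1,2)] in_XD(3)[OF assms(1,2)]])
       (auto intro!: continuous_intros heat_kernel_continuous assms)
  then show "(\<lambda>y. heat_kernel \<tau> x y * (fx s y * w y)) integrable_on {0..pi}"
    by (simp add: mult_ac)
qed

lemma Jop_diff: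
  assumes "in_X T B f fx" "in_X T B' g gx" "s \<in> {0<..T}" "continuous_on {0..pi} w" "\<tau> > 0"
  shows "Jop w (\<lambda>s y. f s y - g s y) (\<lambda>s y. fx s y - gx s y) \<tau> s x = Jop w f fx \<tau> s x - Jop w g gx \<tau> s x"
  unfolding Jop_def left_diff_distrib right_diff_distrib
  using Jop_integrable[OF assms(1,3-5)] Jop_integrable[OF assms(2-5)]
  by (simp add: integral_diff)

lemma Jop_noise_diff:
  assumes "in_X T B f fx" "s \<in> {0<..T}" "continuous_on {0..pi} w" "continuous_on {0..pi} w'" "\<tau> > 0"
  shows "Jop (\<lambda>y. w y - w' y) f fx \<tau> s x = Jop w f fx \<tau> s x - Jop w' f fx \<tau> s x"
  unfolding Jop_def right_diff_distrib
  using Jop_integrable[OF assms(1,2,3,5)] Jop_integrable[OF assms(1,2,4,5)]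
  by (simp add: integral_diff)

lemma Jop_scale:
  "Jop w (\<lambda>s y. f s y / c) (\<lambda>s y. fx s y / c) \<tau> s x = Jop w f fx \<tau> s x / c"
  unfolding Jop_def by (simp add: diff_divide_distrib)

text \<open>Fundamental theorem for the product of kernel, \<open>f s\<close> and \<open>w\<close>:
  the boundary terms vanish through the kernel, whatever the values of \<open>f s\<close> and
  \<open>w\<close> at the ends.\<close>

lemma Jop_smooth:
  assumes "in_X T B f fx" "s \<in> {0<..T}" "\<tau> > 0"
    "\<And>y. y \<in> {0..pi} \<Longrightarrow> (w has_real_derivative w' y) (at y within {0..pi})" "continuous_on {0..pi} w'"
  shows "Jop w f fx \<tau> s x = integral {0..pi} (\<lambda>y. heat_kernel \<tau> x y * f s y * w' y)"
proof -
  have cw: "continuous_on {0..pi} w" by (rule DERIV_continuous_on[OF assms(4)])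
  note ji = Jop_integrable[OF assms(1,2) cw assms(3), of x]
  let ?a = "\<lambda>y. hky \<tau> x y * (f s y * w y)" and ?b = "\<lambda>y. heat_kernel \<tau> x y * (fx s y * w y)"
  let ?c = "\<lambda>y. heat_kernel \<tau> x y * f s y * w' y"
  have ci: "?c integrable_on {0..pi}"
    by (intro integrable_continuous_real continuous_intros heat_kernel_continuous assms in_X_cont[OF assms(1,2)])
  have "((\<lambda>y. ?a y + ?b y + ?c y) has_integral
      (heat_kernel \<tau> x pi * f s pi * w pi - heat_kernel \<tau> x 0 * f s 0 * w 0)) {0..pi}"
  proof (rule fundamental_theorem_of_calculus)
    fix y assume y: "y \<in> {0..pi}"
    show "((\<lambda>y. heat_kernel \<tau> x y * f s y * w y) has_vector_derivative ?a y + ?b y + ?c y) (at y within {0..pi})"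
      unfolding has_real_derivative_iff_has_vector_derivative[symmetric]
      by (rule DERIV_cong[OF DERIV_mult[OF DERIV_mult[OF heat_kernel_deriv_y[OF assms(3)] in_XD(1)[OF assms(1,2) y]] assms(4)[OF y]]])
         (simp add: algebra_simps)
  qed simp
  then have "integral {0..pi} (\<lambda>y. ?a y + ?b y + ?c y) = 0" by (simp add: integral_unique)
  then have "integral {0..pi} ?a + integral {0..pi} ?b + integral {0..pi} ?c = 0"
    using ji ci by (simp add: integral_add integrable_add)
  then show ?thesis unfolding Jop_def by linarith
qed

text \<open>At y = x the term \<open>\<bar>x - y\<bar> powr (-a)\<close> evaluates to 0, so no
  useful bound by it can be asked there; the integrand is reset to 0 at that single point.\<close>

lemma integral_abs_bound_singular:
  fixes f :: "real \<Rightarrow> real"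
  assumes "f integrable_on {0..pi}" "x \<in> {0..pi}" "0 \<le> a" "a < 1" "0 \<le> K"
    "\<And>y. y \<in> {0..pi} \<Longrightarrow> x \<noteq> y \<Longrightarrow> \<bar>f y\<bar> \<le> K * \<bar>x - y\<bar> powr (-a)"
  shows "\<bar>integral {0..pi} f\<bar> \<le> K * (8 / (1 - a))"
proof -
  let ?f = "\<lambda>y. if y = x then 0 else f y"
  have eq: "integral {0..pi} f = integral {0..pi} ?f"
    by (rule integral_spike[of "{x}"]) auto
  have "?f integrable_on {0..pi}"
    by (rule integrable_spike[OF assms(1), of "{x}"]) auto
  moreover have "(\<lambda>y. K * \<bar>x - y\<bar> powr (-a)) integrable_on {0..pi}"
    using integral_powr_abs_diff(1)[OF assms(3,4,2)] by (rule integrable_on_mult_right)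
  ultimately have "\<bar>integral {0..pi} ?f\<bar> \<le> integral {0..pi} (\<lambda>y. K * \<bar>x - y\<bar> powr (-a))"
    using integral_norm_bound_integral[of ?f "{0..pi}" "\<lambda>y. K * \<bar>x - y\<bar> powr (-a)"] assms(5,6) by auto
  also have "\<dots> = K * integral {0..pi} (\<lambda>y. \<bar>x - y\<bar> powr (-a))" by simp
  also have "\<dots> \<le> K * (8 / (1 - a))" using integral_powr_abs_diff(2)[OF assms(3,4,2)] assms(5) by (intro mult_left_mono)
  finally show ?thesis using eq by simp
qed

text \<open>Fixing the horizon T and one constant C makes all later constants explicit in T and C. T
  will be the time at which the two solutions are compared.\<close>

locale heat_bounds =
  fixes T C :: real
  assumes T_pos: "T > 0" and C_pos: "C > 0"
    and hk_le: "\<And>t x y. t \<in> {0<..T} \<Longrightarrow> x \<in> {0..pi} \<Longrightarrow> y \<in> {0..pi} \<Longrightarrow> \<bar>heat_kernel t x y\<bar> \<le> C * t powr (-1/2)"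
    and hk_le_sing: "\<And>t x y. t \<in> {0<..T} \<Longrightarrow> x \<in> {0..pi} \<Longrightarrow> y \<in> {0..pi} \<Longrightarrow> x \<noteq> y \<Longrightarrow>
       \<bar>heat_kernel t x y\<bar> \<le> C * t powr (-1/4) * \<bar>x - y\<bar> powr (-1/2)"
    and hk_le_sing': "\<And>t x y. t \<in> {0<..T} \<Longrightarrow> x \<in> {0..pi} \<Longrightarrow> y \<in> {0..pi} \<Longrightarrow> x \<noteq> y \<Longrightarrow>
       \<bar>heat_kernel t x y\<bar> \<le> C * t powr (-3/8) * \<bar>x - y\<bar> powr (-1/4)"
    and hkx_le: "\<And>t x y. t \<in> {0<..T} \<Longrightarrow> x \<in> {0..pi} \<Longrightarrow> y \<in> {0..pi} \<Longrightarrow> x \<noteq> y \<Longrightarrow>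
       \<bar>hkx t x y\<bar> \<le> C * t powr (-3/4) * \<bar>x - y\<bar> powr (-1/2)"
    and hky_le: "\<And>t x y. t \<in> {0<..T} \<Longrightarrow> x \<in> {0..pi} \<Longrightarrow> y \<in> {0..pi} \<Longrightarrow> x \<noteq> y \<Longrightarrow>
       \<bar>hky t x y\<bar> \<le> C * t powr (-3/4) * \<bar>x - y\<bar> powr (-1/2)"
    and hkxy_le: "\<And>t x y. t \<in> {0<..T} \<Longrightarrow> x \<in> {0..pi} \<Longrightarrow> y \<in> {0..pi} \<Longrightarrow> x \<noteq> y \<Longrightarrow>
       \<bar>hkxy t x y\<bar> * \<bar>x - y\<bar> powr (1/4) \<le> C * t powr (-15/16) * \<bar>x - y\<bar> powr (-7/8)"

lemma heat_bounds_exist: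
  assumes "T > 0" shows "\<exists>C. heat_bounds T C"
  using heat_kernel_bounds[OF assms] assms unfolding heat_bounds_def by (elim exE) (rule_tac x=C in exI, simp)

context heat_bounds begin

text \<open>The derivative falls on the kernel in the first term and on \<open>f\<close> in the
  second, so their stronger singularities sit at opposite ends of the time interval. In both terms
  the exponents add up to -1, and the time integral is independent of t.\<close>

lemma Jop_bound:
  assumes X: "in_X T B f fx" and N: "noise_bound M w" and s: "s \<in> {0<..T}" and \<tau>: "\<tau> \<in> {0<..T}" and x: "x \<in> {0..pi}"
  shows "\<bar>Jop w f fx \<tau> s x\<bar> \<le> 16 * C * B * M * (\<tau> powr (-3/4) * s powr (-1/4) + \<tau> powr (-1/4) * s powr (-3/4))"
proof -
  have B: "0 \<le> B" by (rule in_X_nonneg[OF X T_pos])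
  note n = noise_boundD[OF N]
  have t0: "\<tau> > 0" using \<tau> by simp
  note ji = Jop_integrable[OF X s n(1) t0, of x]
  have a: "\<bar>integral {0..pi} (\<lambda>y. hky \<tau> x y * (f s y * w y))\<bar> \<le> (C * \<tau> powr (-3/4) * (B * s powr (-1/4) * M)) * (8 / (1 - 1/2))"
  proof (rule integral_abs_bound_singular[OF ji(1) x])
    fix y assume y: "y \<in> {0..pi}" "x \<noteq> y"
    have "\<bar>hky \<tau> x y * (f s y * w y)\<bar> = \<bar>hky \<tau> x y\<bar> * (\<bar>f s y\<bar> * \<bar>w y\<bar>)" by (simp add: abs_mult)
    also have "\<dots> \<le> (C * \<tau> powr (-3/4) * \<bar>x - y\<bar> powr (-1/2)) * (B * s powr (-1/4) * M)"
      using hky_le[OF \<tau> x y] in_XD(2)[OF X s y(1)] n(2)[OF y(1)] B C_pos n(4) by (intro mult_mono) auto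
    finally show "\<bar>hky \<tau> x y * (f s y * w y)\<bar> \<le> C * \<tau> powr (-3/4) * (B * s powr (-1/4) * M) * \<bar>x - y\<bar> powr - (1/2)"
      by (simp add: mult_ac)
  qed (use B C_pos n(4) in auto)
  have b: "\<bar>integral {0..pi} (\<lambda>y. heat_kernel \<tau> x y * (fx s y * w y))\<bar> \<le> (C * \<tau> powr (-1/4) * (B * s powr (-3/4) * M)) * (8 / (1 - 1/2))"
  proof (rule integral_abs_bound_singular[OF ji(2) x])
    fix y assume y: "y \<in> {0..pi}" "x \<noteq> y"
    have "\<bar>heat_kernel \<tau> x y * (fx s y * w y)\<bar> = \<bar>heat_kernel \<tau> x y\<bar> * (\<bar>fx s y\<bar> * \<bar>w y\<bar>)" by (simp add: abs_mult)
    also have "\<dots> \<le> (C * \<tau> powr (-1/4) * \<bar>x - y\<bar> powr (-1/2)) * (B * s powr (-3/4) * M)"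
      using hk_le_sing[OF \<tau> x y] in_XD(3)[OF X s y(1)] n(2)[OF y(1)] B C_pos n(4) by (intro mult_mono) auto
    finally show "\<bar>heat_kernel \<tau> x y * (fx s y * w y)\<bar> \<le> C * \<tau> powr (-1/4) * (B * s powr (-3/4) * M) * \<bar>x - y\<bar> powr - (1/2)"
      by (simp add: mult_ac)
  qed (use B C_pos n(4) in auto)
  have "\<bar>Jop w f fx \<tau> s x\<bar> \<le> \<bar>integral {0..pi} (\<lambda>y. hky \<tau> x y * (f s y * w y))\<bar> + \<bar>integral {0..pi} (\<lambda>y. heat_kernel \<tau> x y * (fx s y * w y))\<bar>"
    unfolding Jop_def by linarith
  also have "\<dots> \<le> (C * \<tau> powr (-3/4) * (B * s powr (-1/4) * M)) * (8 / (1 - 1/2)) + (C * \<tau> powr (-1/4) * (B * s powr (-3/4) * M)) * (8 / (1 - 1/2))"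
    by (rule add_mono[OF a b])
  finally show ?thesis by (simp add: algebra_simps)
qed

text \<open>After differentiating in x under the integrals, \<open>w y\<close> may be replaced by
  \<open>w y - w x\<close>: the terms multiplying \<open>w x\<close> add up to the y-integral of the
  derivative of \<open>hkx \<tau> x y * f s y\<close>, which is zero because \<open>hkx\<close>
  vanishes at both ends. For fixed \<open>\<tau> > 0\<close> compactness gives the bounds
  \<open>L1\<close>, \<open>L2\<close> that justify the differentiation.\<close>

lemma Jop_has_derivative:
  assumes X: "in_X T B f fx" and N: "noise_bound M w" and s: "s \<in> {0<..T}" and \<tau>: "\<tau> > 0" and x: "x \<in> {0..pi}"
  shows "((\<lambda>x. Jop w f fx \<tau> s x) has_real_derivative
     - integral {0..pi} (\<lambda>y. hkxy \<tau> x y * (f s y * (w y - w x))) - integral {0..pi} (\<lambda>y. hkx \<tau> x y * (fx s y * (w y - w x))))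
     (at x within {0..pi})"
proof -
  note n = noise_boundD[OF N]
  note ji = Jop_integrable[OF X s n(1) \<tau>]
  have c: "compact ((\<lambda>p. hkxy \<tau> (fst p) (snd p)) ` ({0..pi} \<times> {0..pi}))" "compact ((\<lambda>p. hkx \<tau> (fst p) (snd p)) ` ({0..pi} \<times> {0..pi}))"
    using \<tau> by (auto intro!: compact_continuous_image compact_Times continuous_intros hkxy_continuous hkx_continuous)
  obtain L1 where "\<forall>z\<in>(\<lambda>p. hkxy \<tau> (fst p) (snd p)) ` ({0..pi} \<times> {0..pi}). norm z \<le> L1"
    using compact_imp_bounded[OF c(1)] unfolding bounded_iff by blast
  moreover obtain L2 where "\<forall>z\<in>(\<lambda>p. hkx \<tau> (fst p) (snd p)) ` ({0..pi} \<times> {0..pi}). norm z \<le> L2"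
    using compact_imp_bounded[OF c(2)] unfolding bounded_iff by blast
  ultimately have L: "\<And>x y. x \<in> {0..pi} \<Longrightarrow> y \<in> {0..pi} \<Longrightarrow> \<bar>hkxy \<tau> x y\<bar> \<le> L1"
      "\<And>x y. x \<in> {0..pi} \<Longrightarrow> y \<in> {0..pi} \<Longrightarrow> \<bar>hkx \<tau> x y\<bar> \<le> L2" by force+
  have d1: "((\<lambda>x. integral {0..pi} (\<lambda>y. hky \<tau> x y * (f s y * w y))) has_real_derivative
      integral {0..pi} (\<lambda>y. hkxy \<tau> x y * (f s y * w y))) (at x within {0..pi})"
  proof (rule has_real_derivative_integral_Ioo)
    show "((\<lambda>x. hky \<tau> x y * (f s y * w y)) has_real_derivative hkxy \<tau> x y * (f s y * w y)) (at x within {0..pi})" for x y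
      by (rule DERIV_cmult_right[OF hky_deriv_x[OF \<tau>]])
    show "\<bar>hkxy \<tau> x' y * (f s y * w y)\<bar> \<le> L1 * (B * s powr (-1/4) * M)" if "x' \<in> {0..pi}" "y \<in> {0<..<pi}" for x' y
      unfolding abs_mult using in_XD(2)[OF X s, of y] n(2)[of y] that L(1)[of x' y]
      by (intro mult_mono) (auto intro: order_trans[OF abs_ge_zero])
    show "(\<lambda>y. L1 * (B * s powr (-1/4) * M)) integrable_on {0..pi}" by (rule integrable_const_ivl)
  qed (use x ji in auto)
  have d2: "((\<lambda>x. integral {0..pi} (\<lambda>y. heat_kernel \<tau> x y * (fx s y * w y))) has_real_derivative
      integral {0..pi} (\<lambda>y. hkx \<tau> x y * (fx s y * w y))) (at x within {0..pi})"
  proof (rule has_real_derivative_integral_Ioo)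
    show "((\<lambda>x. heat_kernel \<tau> x y * (fx s y * w y)) has_real_derivative hkx \<tau> x y * (fx s y * w y)) (at x within {0..pi})" for x y
      by (rule DERIV_cmult_right[OF heat_kernel_deriv_x[OF \<tau>]])
    show "\<bar>hkx \<tau> x' y * (fx s y * w y)\<bar> \<le> L2 * (B * s powr (-3/4) * M)" if "x' \<in> {0..pi}" "y \<in> {0<..<pi}" for x' y
      unfolding abs_mult using in_XD(3)[OF X s, of y] n(2)[of y] that L(2)[of x' y]
      by (intro mult_mono) (auto intro: order_trans[OF abs_ge_zero])
    show "(\<lambda>y. L2 * (B * s powr (-3/4) * M)) integrable_on {0..pi}" by (rule integrable_const_ivl)
  qed (use x ji in auto)
  have hx: "(\<lambda>y. hkx \<tau> x y * (fx s y * v y)) integrable_on {0..pi}" if "continuous_on {0..pi} v" for v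
  proof -
    have "(\<lambda>y. (hkx \<tau> x y * v y) * fx s y) integrable_on {0..pi}"
      by (rule deriv_times_cont_integrable[OF in_XD(1)[OF X s] in_XD(3)[OF X s]])
         (auto intro!: continuous_intros hkx_continuous that \<tau>)
    then show ?thesis by (simp add: mult_ac)
  qed
  have hxy: "(\<lambda>y. hkxy \<tau> x y * (f s y * v y)) integrable_on {0..pi}" if "continuous_on {0..pi} v" for v
    by (intro integrable_continuous_real continuous_intros hkxy_continuous that \<tau> in_X_cont[OF X s])
  have "((\<lambda>y. hkxy \<tau> x y * (f s y * 1) + hkx \<tau> x y * (fx s y * 1)) has_integral hkx \<tau> x pi * f s pi - hkx \<tau> x 0 * f s 0) {0..pi}"
  proof (rule fundamental_theorem_of_calculus)
    fix y assume y: "y \<in> {0..pi}"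
    show "((\<lambda>y. hkx \<tau> x y * f s y) has_vector_derivative hkxy \<tau> x y * (f s y * 1) + hkx \<tau> x y * (fx s y * 1)) (at y within {0..pi})"
      unfolding has_real_derivative_iff_has_vector_derivative[symmetric]
      by (rule DERIV_cong[OF DERIV_mult[OF hkx_deriv_y[OF \<tau>] in_XD(1)[OF X s y]]]) (simp add: algebra_simps)
  qed simp
  then have "integral {0..pi} (\<lambda>y. hkxy \<tau> x y * (f s y * 1) + hkx \<tau> x y * (fx s y * 1)) = 0" by (simp add: integral_unique)
  then have z: "integral {0..pi} (\<lambda>y. hkxy \<tau> x y * (f s y * 1)) + integral {0..pi} (\<lambda>y. hkx \<tau> x y * (fx s y * 1)) = 0"
    by (subst (asm) integral_add) (intro hx hxy continuous_on_const)+
  have e1: "integral {0..pi} (\<lambda>y. hkxy \<tau> x y * (f s y * (w y - w x))) =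
     integral {0..pi} (\<lambda>y. hkxy \<tau> x y * (f s y * w y)) - w x * integral {0..pi} (\<lambda>y. hkxy \<tau> x y * (f s y * 1))"
  proof -
    have "integral {0..pi} (\<lambda>y. hkxy \<tau> x y * (f s y * (w y - w x))) =
       integral {0..pi} (\<lambda>y. hkxy \<tau> x y * (f s y * w y) - w x * (hkxy \<tau> x y * (f s y * 1)))"
      by (rule integral_cong) (simp add: algebra_simps)
    also have "\<dots> = integral {0..pi} (\<lambda>y. hkxy \<tau> x y * (f s y * w y)) - integral {0..pi} (\<lambda>y. w x * (hkxy \<tau> x y * (f s y * 1)))"
      by (intro integral_diff integrable_on_mult_right hxy n continuous_on_const)
    finally show ?thesis by simp
  qed
  have e2: "integral {0..pi} (\<lambda>y. hkx \<tau> x y * (fx s y * (w y - w x))) =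
     integral {0..pi} (\<lambda>y. hkx \<tau> x y * (fx s y * w y)) - w x * integral {0..pi} (\<lambda>y. hkx \<tau> x y * (fx s y * 1))"
  proof -
    have "integral {0..pi} (\<lambda>y. hkx \<tau> x y * (fx s y * (w y - w x))) =
       integral {0..pi} (\<lambda>y. hkx \<tau> x y * (fx s y * w y) - w x * (hkx \<tau> x y * (fx s y * 1)))"
      by (rule integral_cong) (simp add: algebra_simps)
    also have "\<dots> = integral {0..pi} (\<lambda>y. hkx \<tau> x y * (fx s y * w y)) - integral {0..pi} (\<lambda>y. w x * (hkx \<tau> x y * (fx s y * 1)))"
      by (intro integral_diff integrable_on_mult_right hx n continuous_on_const)
    finally show ?thesis by simp
  qed
  have "w x * integral {0..pi} (\<lambda>y. hkxy \<tau> x y * (f s y * 1)) + w x * integral {0..pi} (\<lambda>y. hkx \<tau> x y * (fx s y * 1)) = 0"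
    unfolding distrib_left[symmetric] z by simp
  then have "- integral {0..pi} (\<lambda>y. hkxy \<tau> x y * (f s y * (w y - w x))) - integral {0..pi} (\<lambda>y. hkx \<tau> x y * (fx s y * (w y - w x)))
     = - integral {0..pi} (\<lambda>y. hkxy \<tau> x y * (f s y * w y)) - integral {0..pi} (\<lambda>y. hkx \<tau> x y * (fx s y * w y))"
    unfolding e1 e2 by linarith
  moreover have "((\<lambda>x. Jop w f fx \<tau> s x) has_real_derivative
     - integral {0..pi} (\<lambda>y. hkxy \<tau> x y * (f s y * w y)) - integral {0..pi} (\<lambda>y. hkx \<tau> x y * (fx s y * w y))) (at x within {0..pi})"
    unfolding Jop_def by (rule DERIV_diff[OF DERIV_minus[OF d1] d2])
  ultimately show ?thesis by simp
qed

text \<open>The Hoelder gain |x - y|^(1/4) is spent on the mixed derivative; in the other term the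
  increment of the path is simply at most 2 M. The factor 64 is 8 / (1 - 7/8).\<close>

lemma Jop_derivative_bound:
  assumes X: "in_X T B f fx" and N: "noise_bound M w" and s: "s \<in> {0<..T}" and \<tau>: "\<tau> \<in> {0<..T}" and x: "x \<in> {0..pi}"
  shows "\<bar>- integral {0..pi} (\<lambda>y. hkxy \<tau> x y * (f s y * (w y - w x))) - integral {0..pi} (\<lambda>y. hkx \<tau> x y * (fx s y * (w y - w x)))\<bar>
   \<le> 64 * C * B * M * (\<tau> powr (-15/16) * s powr (-1/4) + \<tau> powr (-3/4) * s powr (-3/4))"
proof -
  have B: "0 \<le> B" by (rule in_X_nonneg[OF X T_pos])
  note n = noise_boundD[OF N]
  have t0: "\<tau> > 0" using \<tau> by simp
  have hx: "(\<lambda>y. hkx \<tau> x y * (fx s y * (w y - w x))) integrable_on {0..pi}"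
  proof -
    have "(\<lambda>y. (hkx \<tau> x y * (w y - w x)) * fx s y) integrable_on {0..pi}"
      by (rule deriv_times_cont_integrable[OF in_XD(1)[OF X s] in_XD(3)[OF X s]])
         (auto intro!: continuous_intros hkx_continuous n t0)
    then show ?thesis by (simp add: mult_ac)
  qed
  have hxy: "(\<lambda>y. hkxy \<tau> x y * (f s y * (w y - w x))) integrable_on {0..pi}"
    by (intro integrable_continuous_real continuous_intros hkxy_continuous n t0 in_X_cont[OF X s])
  have a: "\<bar>integral {0..pi} (\<lambda>y. hkxy \<tau> x y * (f s y * (w y - w x)))\<bar> \<le> (C * \<tau> powr (-15/16) * (B * s powr (-1/4) * M)) * (8 / (1 - 7/8))"
  proof (rule integral_abs_bound_singular[OF hxy x])
    fix y assume y: "y \<in> {0..pi}" "x \<noteq> y"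
    have "\<bar>hkxy \<tau> x y * (f s y * (w y - w x))\<bar> = \<bar>f s y\<bar> * (\<bar>hkxy \<tau> x y\<bar> * \<bar>w x - w y\<bar>)" by (simp add: abs_mult abs_minus_commute)
    also have "\<dots> \<le> (B * s powr (-1/4)) * (\<bar>hkxy \<tau> x y\<bar> * (M * \<bar>x - y\<bar> powr (1/4)))"
      using in_XD(2)[OF X s y(1)] n(3)[OF x y(1)] B by (intro mult_mono) auto
    also have "\<dots> = (B * s powr (-1/4) * M) * (\<bar>hkxy \<tau> x y\<bar> * \<bar>x - y\<bar> powr (1/4))" by (simp add: mult_ac)
    also have "\<dots> \<le> (B * s powr (-1/4) * M) * (C * \<tau> powr (-15/16) * \<bar>x - y\<bar> powr (-7/8))"
      using hkxy_le[OF \<tau> x y] B n(4) by (intro mult_left_mono) auto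
    finally show "\<bar>hkxy \<tau> x y * (f s y * (w y - w x))\<bar> \<le> C * \<tau> powr (-15/16) * (B * s powr (-1/4) * M) * \<bar>x - y\<bar> powr - (7/8)"
      by (simp add: mult_ac)
  qed (use B C_pos n(4) in auto)
  have b: "\<bar>integral {0..pi} (\<lambda>y. hkx \<tau> x y * (fx s y * (w y - w x)))\<bar> \<le> (C * \<tau> powr (-3/4) * (B * s powr (-3/4) * (2 * M))) * (8 / (1 - 1/2))"
  proof (rule integral_abs_bound_singular[OF hx x])
    fix y assume y: "y \<in> {0..pi}" "x \<noteq> y"
    have "\<bar>w y - w x\<bar> \<le> 2 * M" using n(2)[OF y(1)] n(2)[OF x] by linarith
    have "\<bar>hkx \<tau> x y * (fx s y * (w y - w x))\<bar> = \<bar>hkx \<tau> x y\<bar> * (\<bar>fx s y\<bar> * \<bar>w y - w x\<bar>)" by (simp add: abs_mult)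
    also have "\<dots> \<le> (C * \<tau> powr (-3/4) * \<bar>x - y\<bar> powr (-1/2)) * (B * s powr (-3/4) * (2 * M))"
      using hkx_le[OF \<tau> x y] in_XD(3)[OF X s y(1)] \<open>\<bar>w y - w x\<bar> \<le> 2 * M\<close> B C_pos n(4) by (intro mult_mono) auto
    finally show "\<bar>hkx \<tau> x y * (fx s y * (w y - w x))\<bar> \<le> C * \<tau> powr (-3/4) * (B * s powr (-3/4) * (2 * M)) * \<bar>x - y\<bar> powr - (1/2)"
      by (simp add: mult_ac)
  qed (use B C_pos n(4) in auto)
  have "\<bar>- integral {0..pi} (\<lambda>y. hkxy \<tau> x y * (f s y * (w y - w x))) - integral {0..pi} (\<lambda>y. hkx \<tau> x y * (fx s y * (w y - w x)))\<bar>
    \<le> (C * \<tau> powr (-15/16) * (B * s powr (-1/4) * M)) * (8 / (1 - 7/8)) + (C * \<tau> powr (-3/4) * (B * s powr (-3/4) * (2 * M))) * (8 / (1 - 1/2))"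
    using add_mono[OF a b] by linarith
  also have "\<dots> = 64 * (C * B * M * (\<tau> powr (-15/16) * s powr (-1/4))) + 32 * (C * B * M * (\<tau> powr (-3/4) * s powr (-3/4)))"
    by (simp add: algebra_simps)
  also have "\<dots> \<le> 64 * (C * B * M * (\<tau> powr (-15/16) * s powr (-1/4))) + 64 * (C * B * M * (\<tau> powr (-3/4) * s powr (-3/4)))"
    using B C_pos n(4) by (intro add_left_mono mult_right_mono) auto
  finally show ?thesis by (simp add: algebra_simps)
qed

lemma Jop_lipschitz:
  assumes X: "in_X T B f fx" and N: "noise_bound M w" and s: "s \<in> {0<..T}" and \<tau>: "\<tau> \<in> {0<..T}"
    and x: "x \<in> {0..pi}" "x' \<in> {0..pi}"
  shows "\<bar>Jop w f fx \<tau> s x - Jop w f fx \<tau> s x'\<bar>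
   \<le> 64 * C * B * M * (\<tau> powr (-15/16) * s powr (-1/4) + \<tau> powr (-3/4) * s powr (-3/4)) * \<bar>x - x'\<bar>"
proof -
  have t0: "\<tau> > 0" using \<tau> by simp
  from field_differentiable_bound[OF _ Jop_has_derivative[OF X N s t0] _ x(2) x(1), of
     "64 * C * B * M * (\<tau> powr (-15/16) * s powr (-1/4) + \<tau> powr (-3/4) * s powr (-3/4))"]
    Jop_derivative_bound[OF X N s \<tau>]
  show ?thesis by (auto simp: abs_minus_commute)
qed

section \<open>Mapping properties after integration in time\<close>

text \<open>Collects the Beta values of the four time integrals below; powers of T convert their
  powers of t into the weights with exponents -1/4 and -3/4. Absolute values avoid discussing the
  sign of Beta, and the final 1 makes the constant positive.\<close>

definition KK :: real where
  "KK = 64 * C * ((\<bar>Beta (3/4) (1/4)\<bar> + \<bar>Beta (1/4) (3/4)\<bar>) * (1 + T powr (1/4))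
     + \<bar>Beta (3/4) (1/16)\<bar> * T powr (9/16) + \<bar>Beta (1/4) (1/4)\<bar> * T powr (1/4)) + 1"

lemma KK_pos: "KK > 0"
  unfolding KK_def using C_pos by (intro add_nonneg_pos mult_nonneg_nonneg add_nonneg_nonneg) auto

text \<open>The unweighted bound is used at the final time; the weighted one keeps the image in the
  function space when the operator is iterated.\<close>

lemma Kop_bound:
  assumes X: "in_X T B f fx" and N: "noise_bound M w" and t: "t \<in> {0<..T}" and x: "x \<in> {0..pi}"
    and int: "(\<lambda>s. Jop w f fx (t - s) s x) integrable_on {0..t}"
  shows "\<bar>Kop w f fx t x\<bar> \<le> KK * B * M" "\<bar>Kop w f fx t x\<bar> \<le> KK * B * M * t powr (-1/4)"
proof -
  have B: "0 \<le> B" by (rule in_X_nonneg[OF X T_pos])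
  have M: "0 \<le> M" using noise_boundD[OF N] by simp
  have t0: "t > 0" using t by simp
  note b1 = integral_powr_Beta[of "3/4" "1/4" t] and b2 = integral_powr_Beta[of "1/4" "3/4" t]
  let ?g = "\<lambda>s. 16 * C * B * M * ((t - s) powr (-3/4) * s powr (-1/4) + (t - s) powr (-1/4) * s powr (-3/4))"
  let ?b = "\<bar>Beta (3/4) (1/4)\<bar> + \<bar>Beta (1/4) (3/4)\<bar> :: real"
  have gi: "(?g has_integral 16 * C * B * M * (Beta (3/4) (1/4) + Beta (1/4) (3/4))) {0..t}"
    using has_integral_mult_right[OF has_integral_add[OF b1 b2], of "16 * C * B * M"] t0 by simp
  have "\<bar>Kop w f fx t x\<bar> \<le> integral {0..t} ?g"
    unfolding Kop_def
  proof (rule integral_abs_bound_Ioo[OF int has_integral_integrable[OF gi]])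
    fix s assume "s \<in> {0<..<t}"
    then show "\<bar>Jop w f fx (t - s) s x\<bar> \<le> ?g s" using t by (intro Jop_bound[OF X N _ _ x]) auto
  qed
  also have "\<dots> = 16 * C * B * M * (Beta (3/4) (1/4) + Beta (1/4) (3/4))" by (rule integral_unique[OF gi])
  also have "\<dots> \<le> 16 * C * B * M * ?b" using B M C_pos by (intro mult_left_mono) auto
  finally have le: "\<bar>Kop w f fx t x\<bar> \<le> (16 * C * ?b) * (B * M)" by (simp add: mult_ac)
  have 0: "0 \<le> ?b" by simp
  have TT: "T powr (1/4) \<ge> 0" by simp
  have base: "64 * C * (?b * (1 + T powr (1/4))) \<le> KK"
    unfolding KK_def using C_pos by (simp add: distrib_left)
  have "16 * C * ?b \<le> 64 * C * (?b * (1 + T powr (1/4)))"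
    unfolding mult.assoc using C_pos 0 TT by (intro mult_mono mult_left_mono) (auto simp: mult_le_cancel_left1)
  then have "16 * C * ?b \<le> KK" using base by linarith
  then have "(16 * C * ?b) * (B * M) \<le> KK * (B * M)" using B M by (intro mult_right_mono) auto
  then show "\<bar>Kop w f fx t x\<bar> \<le> KK * B * M" using le by (simp add: mult_ac)
  have one: "1 \<le> T powr (1/4) * t powr (-1/4)"
  proof -
    have "t powr (1/4) \<le> T powr (1/4)" using t by (intro powr_mono2) auto
    then have "t powr (1/4) * t powr (-1/4) \<le> T powr (1/4) * t powr (-1/4)" by (intro mult_right_mono) auto
    then show ?thesis using t0 by (simp add: powr_add[symmetric])
  qed
  have "16 * C * ?b \<le> (64 * C * ?b) * 1" using C_pos by simp
  also have "\<dots> \<le> (64 * C * ?b) * (T powr (1/4) * t powr (-1/4))" using one C_pos by (intro mult_left_mono) auto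
  also have "\<dots> = (64 * C * (?b * T powr (1/4))) * t powr (-1/4)" by (simp add: mult_ac)
  also have "\<dots> \<le> KK * t powr (-1/4)"
  proof (rule mult_right_mono)
    have "64 * C * (?b * T powr (1/4)) \<le> 64 * C * (?b * (1 + T powr (1/4)))" using C_pos by (intro mult_left_mono) auto
    then show "64 * C * (?b * T powr (1/4)) \<le> KK" using base by linarith
  qed simp
  finally have "(16 * C * ?b) * (B * M) \<le> KK * t powr (-1/4) * (B * M)" using B M by (intro mult_right_mono) auto
  then show "\<bar>Kop w f fx t x\<bar> \<le> KK * B * M * t powr (-1/4)" using le by (simp add: mult_ac)
qed

text \<open>Instead of the derivative, the Lipschitz bound is integrated in time. The resulting
  powers t^(-3/16) and t^(-1/2) are milder than the weight t^(-3/4).\<close>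

lemma Kop_lipschitz:
  assumes X: "in_X T B f fx" and N: "noise_bound M w" and t: "t \<in> {0<..T}" and x: "x \<in> {0..pi}" "x' \<in> {0..pi}"
    and int: "\<And>x. x \<in> {0..pi} \<Longrightarrow> (\<lambda>s. Jop w f fx (t - s) s x) integrable_on {0..t}"
  shows "\<bar>Kop w f fx t x - Kop w f fx t x'\<bar> \<le> KK * B * M * t powr (-3/4) * \<bar>x - x'\<bar>"
proof -
  have B: "0 \<le> B" by (rule in_X_nonneg[OF X T_pos])
  have M: "0 \<le> M" using noise_boundD[OF N] by simp
  have t0: "t > 0" using t by simp
  note b1 = integral_powr_Beta[of "15/16" "1/4" t] and b2 = integral_powr_Beta[of "3/4" "3/4" t]
  let ?c = "64 * C * B * M * \<bar>x - x'\<bar>"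
  let ?g = "\<lambda>s. ?c * ((t - s) powr (-15/16) * s powr (-1/4) + (t - s) powr (-3/4) * s powr (-3/4))"
  have gi: "(?g has_integral ?c * (t powr (-3/16) * Beta (3/4) (1/16) + t powr (-1/2) * Beta (1/4) (1/4))) {0..t}"
    using has_integral_mult_right[OF has_integral_add[OF b1 b2], of ?c] t0 by simp
  have "\<bar>Kop w f fx t x - Kop w f fx t x'\<bar> = \<bar>integral {0..t} (\<lambda>s. Jop w f fx (t - s) s x - Jop w f fx (t - s) s x')\<bar>"
    unfolding Kop_def using int x by (simp add: integral_diff)
  also have "\<dots> \<le> integral {0..t} ?g"
  proof (rule integral_abs_bound_Ioo[OF _ has_integral_integrable[OF gi]])
    show "(\<lambda>s. Jop w f fx (t - s) s x - Jop w f fx (t - s) s x') integrable_on {0..t}"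
      using int x by (intro integrable_diff) auto
    fix s assume "s \<in> {0<..<t}"
    then have "\<bar>Jop w f fx (t - s) s x - Jop w f fx (t - s) s x'\<bar>
      \<le> 64 * C * B * M * ((t-s) powr (-15/16) * s powr (-1/4) + (t-s) powr (-3/4) * s powr (-3/4)) * \<bar>x - x'\<bar>"
      using t by (intro Jop_lipschitz[OF X N _ _ x]) auto
    also have "\<dots> = ?g s" by (simp only: mult_ac)
    finally show "\<bar>Jop w f fx (t - s) s x - Jop w f fx (t - s) s x'\<bar> \<le> ?g s" .
  qed
  also have "\<dots> = ?c * (t powr (-3/16) * Beta (3/4) (1/16) + t powr (-1/2) * Beta (1/4) (1/4))" by (rule integral_unique[OF gi])
  also have "\<dots> \<le> ?c * ((T powr (9/16) * t powr (-3/4)) * \<bar>Beta (3/4) (1/16)\<bar> + (T powr (1/4) * t powr (-3/4)) * \<bar>Beta (1/4) (1/4)\<bar>)"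
  proof -
    have p: "t powr (a - 3/4) \<le> T powr a * t powr (-3/4)" if "a \<ge> 0" for a
    proof -
      have "t powr a \<le> T powr a" using t that by (intro powr_mono2) auto
      then have "t powr a * t powr (-3/4) \<le> T powr a * t powr (-3/4)" by (intro mult_right_mono) auto
      then show ?thesis by (simp add: powr_add[symmetric])
    qed
    have q: "z * c \<le> Z * \<bar>c\<bar>" if "0 \<le> z" "z \<le> Z" for z Z c :: real
      using mult_left_mono[OF abs_ge_self[of c] that(1)] mult_right_mono[OF that(2) abs_ge_zero[of c]] by (rule order_trans)
    have "t powr (-3/16) * Beta (3/4) (1/16) \<le> (T powr (9/16) * t powr (-3/4)) * \<bar>Beta (3/4) (1/16)\<bar>"
      using p[of "9/16"] by (intro q) auto
    moreover have "t powr (-1/2) * Beta (1/4) (1/4) \<le> (T powr (1/4) * t powr (-3/4)) * \<bar>Beta (1/4) (1/4)\<bar>"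
      using p[of "1/4"] by (intro q) auto
    ultimately show ?thesis using B M C_pos by (intro mult_left_mono add_mono) auto
  qed
  also have "\<dots> = (64 * C * (\<bar>Beta (3/4) (1/16)\<bar> * T powr (9/16) + \<bar>Beta (1/4) (1/4)\<bar> * T powr (1/4))) * (B * M * t powr (-3/4) * \<bar>x - x'\<bar>)"
    by (simp add: algebra_simps)
  also have "\<dots> \<le> KK * (B * M * t powr (-3/4) * \<bar>x - x'\<bar>)"
  proof (rule mult_right_mono)
    have "0 \<le> (\<bar>Beta (3/4) (1/4)\<bar> + \<bar>Beta (1/4) (3/4)\<bar>) * (1 + T powr (1/4))" by (intro mult_nonneg_nonneg) auto
    then have "64 * C * (\<bar>Beta (3/4) (1/16)\<bar> * T powr (9/16) + \<bar>Beta (1/4) (1/4)\<bar> * T powr (1/4))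
       \<le> 64 * C * ((\<bar>Beta (3/4) (1/4)\<bar> + \<bar>Beta (1/4) (3/4)\<bar>) * (1 + T powr (1/4))
     + \<bar>Beta (3/4) (1/16)\<bar> * T powr (9/16) + \<bar>Beta (1/4) (1/4)\<bar> * T powr (1/4))" using C_pos by (intro mult_left_mono) linarith+
    then show "64 * C * (\<bar>Beta (3/4) (1/16)\<bar> * T powr (9/16) + \<bar>Beta (1/4) (1/4)\<bar> * T powr (1/4)) \<le> KK"
      unfolding KK_def by linarith
  qed (use B M in auto)
  finally show ?thesis by (simp add: mult_ac)
qed

text \<open>Differentiability of the image is a hypothesis because each use has it from another
  source, the mild solution itself or the smoothness of the noise. What has to be proved is the size
  of the derivative, through the Lipschitz bound.\<close>

lemma Kop_in_X:
  assumes X: "in_X T B f fx" and N: "noise_bound M w"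
    and int: "\<And>t x. t \<in> {0<..T} \<Longrightarrow> x \<in> {0..pi} \<Longrightarrow> (\<lambda>s. Jop w f fx (t - s) s x) integrable_on {0..t}"
    and g: "\<And>t x. t \<in> {0<..T} \<Longrightarrow> x \<in> {0..pi} \<Longrightarrow> g t x = Kop w f fx t x"
    and gx: "\<And>t x. t \<in> {0<..T} \<Longrightarrow> x \<in> {0..pi} \<Longrightarrow> (g t has_real_derivative gx t x) (at x within {0..pi})"
  shows "in_X T (KK * B * M) g gx"
  unfolding in_X_def
proof (intro ballI conjI)
  fix t x assume t: "t \<in> {0<..T}" and x: "x \<in> {0..pi}"
  show "(g t has_real_derivative gx t x) (at x within {0..pi})" by (rule gx[OF t x])
  show "\<bar>g t x\<bar> \<le> KK * B * M * t powr (-1/4)" unfolding g[OF t x] by (rule Kop_bound(2)[OF X N t x int[OF t x]])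
  show "\<bar>gx t x\<bar> \<le> KK * B * M * t powr (-3/4)"
  proof (rule deriv_le_lipschitz[OF gx[OF t x] pi_gt_zero x])
    fix z assume z: "z \<in> {0..pi}"
    show "\<bar>g t z - g t x\<bar> \<le> KK * B * M * t powr (-3/4) * \<bar>z - x\<bar>"
      unfolding g[OF t x] g[OF t z] by (rule Kop_lipschitz[OF X N t z x int[OF t]])
  qed
qed

end

section \<open>Duhamel integrals with smooth noise\<close>

definition Top :: "(real \<Rightarrow> real) \<Rightarrow> (real \<Rightarrow> real \<Rightarrow> real) \<Rightarrow> real \<Rightarrow> real \<Rightarrow> real" where
  "Top h f t x = integral {0..t} (\<lambda>s. integral {0..pi} (\<lambda>y. heat_kernel (t - s) x y * f s y * h y))"

definition Topx :: "(real \<Rightarrow> real) \<Rightarrow> (real \<Rightarrow> real \<Rightarrow> real) \<Rightarrow> real \<Rightarrow> real \<Rightarrow> real" where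
  "Topx h f t x = integral {0..t} (\<lambda>s. integral {0..pi} (\<lambda>y. hkx (t - s) x y * f s y * h y))"

text \<open>When the noise is a bounded function no derivative of \<open>f\<close> occurs, so joint
  continuity and the weight with exponent -1/4 are enough. This is the class on which Duhamel
  integrals with smooth noise are iterated.\<close>

definition cont_X :: "real \<Rightarrow> real \<Rightarrow> (real \<Rightarrow> real \<Rightarrow> real) \<Rightarrow> bool" where
  "cont_X T B f \<longleftrightarrow> continuous_on ({0<..T} \<times> {0..pi}) (\<lambda>p. f (fst p) (snd p)) \<and>
     (\<forall>s\<in>{0<..T}. \<forall>y\<in>{0..pi}. \<bar>f s y\<bar> \<le> B * s powr (-1/4))"

lemma cont_XD:
  assumes "cont_X T B f"
  shows "continuous_on ({0<..T} \<times> {0..pi}) (\<lambda>p. f (fst p) (snd p))"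
    "s \<in> {0<..T} \<Longrightarrow> y \<in> {0..pi} \<Longrightarrow> \<bar>f s y\<bar> \<le> B * s powr (-1/4)"
    "0 < T \<Longrightarrow> 0 \<le> B"
proof -
  show "continuous_on ({0<..T} \<times> {0..pi}) (\<lambda>p. f (fst p) (snd p))"
    and b: "s \<in> {0<..T} \<Longrightarrow> y \<in> {0..pi} \<Longrightarrow> \<bar>f s y\<bar> \<le> B * s powr (-1/4)" for s y
    using assms by (auto simp: cont_X_def)
  assume "0 < T"
  then have "0 \<le> B * T powr (-1/4)" using b[of T 0] by (auto intro: order_trans[OF abs_ge_zero])
  then show "0 \<le> B" using \<open>0 < T\<close> by (simp add: zero_le_mult_iff)
qed

lemma cont_X_compose:
  fixes a b :: "'a::topological_space \<Rightarrow> real"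
  assumes "cont_X T B f" "continuous_on S a" "continuous_on S b"
    "\<And>p. p \<in> S \<Longrightarrow> a p \<in> {0<..T}" "\<And>p. p \<in> S \<Longrightarrow> b p \<in> {0..pi}"
  shows "continuous_on S (\<lambda>p. f (a p) (b p))"
proof -
  have "continuous_on S (\<lambda>p. f (fst (a p, b p)) (snd (a p, b p)))"
    by (rule continuous_on_compose2[OF cont_XD(1)[OF assms(1)]]) (use assms in \<open>auto intro!: continuous_intros\<close>)
  then show ?thesis by simp
qed

lemma integral_continuous_param_pi:
  fixes f :: "'a::topological_space \<Rightarrow> real \<Rightarrow> real"
  assumes "continuous_on (U \<times> {0..pi}) (\<lambda>p. f (fst p) (snd p))"
  shows "continuous_on U (\<lambda>x. integral {0..pi} (f x))"
  using integral_continuous_on_param[of U 0 pi f] assms by (simp add: case_prod_unfold)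

lemma cont_X_linear:
  assumes "cont_X T B f" "cont_X T B' g" "0 < T"
  shows "cont_X T (\<bar>a\<bar> * B + \<bar>b\<bar> * B') (\<lambda>s y. a * f s y + b * g s y)"
  unfolding cont_X_def
proof (intro conjI ballI)
  show "continuous_on ({0<..T} \<times> {0..pi}) (\<lambda>p. a * f (fst p) (snd p) + b * g (fst p) (snd p))"
    by (intro continuous_intros cont_XD(1)[OF assms(1)] cont_XD(1)[OF assms(2)])
  fix s y assume sy: "s \<in> {0<..T}" "y \<in> {0..pi}"
  have "\<bar>a * f s y + b * g s y\<bar> \<le> \<bar>a\<bar> * \<bar>f s y\<bar> + \<bar>b\<bar> * \<bar>g s y\<bar>" 
    by (rule order_trans[OF abs_triangle_ineq]) (simp add: abs_mult)
  also have "\<dots> \<le> \<bar>a\<bar> * (B * s powr (-1/4)) + \<bar>b\<bar> * (B' * s powr (-1/4))"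
    using cont_XD(2)[OF assms(1) sy] cont_XD(2)[OF assms(2) sy] by (intro add_mono mult_left_mono) auto
  finally show "\<bar>a * f s y + b * g s y\<bar> \<le> (\<bar>a\<bar> * B + \<bar>b\<bar> * B') * s powr (-1/4)" by (simp add: algebra_simps)
qed

context heat_bounds begin

lemma Top_inner_integrable:
  assumes f: "cont_X T B f" and h: "continuous_on {0..pi} h" and s: "s \<in> {0<..T}" and \<tau>: "\<tau> > 0"
  shows "(\<lambda>y. heat_kernel \<tau> x y * f s y * h y) integrable_on {0..pi}"
    "(\<lambda>y. hkx \<tau> x y * f s y * h y) integrable_on {0..pi}"
  by (intro integrable_continuous_real continuous_intros heat_kernel_continuous hkx_continuous h cont_X_compose[OF f]; use s \<tau> in force)+

lemma Top_inner_bound: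
  assumes f: "cont_X T B f" and h: "continuous_on {0..pi} h" "\<And>y. y \<in> {0..pi} \<Longrightarrow> \<bar>h y\<bar> \<le> H"
    and s: "s \<in> {0<..T}" and \<tau>: "\<tau> \<in> {0<..T}" and x: "x \<in> {0..pi}"
  shows "\<bar>integral {0..pi} (\<lambda>y. heat_kernel \<tau> x y * f s y * h y)\<bar> \<le> 16 * C * B * H * (\<tau> powr (-1/4) * s powr (-1/4))"
    "\<bar>integral {0..pi} (\<lambda>y. hkx \<tau> x y * f s y * h y)\<bar> \<le> 16 * C * B * H * (\<tau> powr (-3/4) * s powr (-1/4))"
proof -
  have B: "0 \<le> B" by (rule cont_XD(3)[OF f T_pos])
  have H: "0 \<le> H" using h(2)[of 0] by (auto intro: order_trans[OF abs_ge_zero])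
  have t0: "\<tau> > 0" using \<tau> by simp
  note i = Top_inner_integrable[OF f h(1) s t0, of x]
  have "\<bar>integral {0..pi} (\<lambda>y. heat_kernel \<tau> x y * f s y * h y)\<bar> \<le> (C * \<tau> powr (-1/4) * (B * s powr (-1/4) * H)) * (8 / (1 - 1/2))"
  proof (rule integral_abs_bound_singular[OF i(1) x])
    fix y assume y: "y \<in> {0..pi}" "x \<noteq> y"
    have "\<bar>heat_kernel \<tau> x y * f s y * h y\<bar> = \<bar>heat_kernel \<tau> x y\<bar> * (\<bar>f s y\<bar> * \<bar>h y\<bar>)" by (simp add: abs_mult)
    also have "\<dots> \<le> (C * \<tau> powr (-1/4) * \<bar>x - y\<bar> powr (-1/2)) * (B * s powr (-1/4) * H)"
      using hk_le_sing[OF \<tau> x y] cont_XD(2)[OF f s y(1)] h(2)[OF y(1)] B C_pos H by (intro mult_mono) auto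
    finally show "\<bar>heat_kernel \<tau> x y * f s y * h y\<bar> \<le> C * \<tau> powr (-1/4) * (B * s powr (-1/4) * H) * \<bar>x - y\<bar> powr - (1/2)"
      by (simp add: mult_ac)
  qed (use B C_pos H in auto)
  then show "\<bar>integral {0..pi} (\<lambda>y. heat_kernel \<tau> x y * f s y * h y)\<bar> \<le> 16 * C * B * H * (\<tau> powr (-1/4) * s powr (-1/4))"
    by (simp add: mult_ac)
  have "\<bar>integral {0..pi} (\<lambda>y. hkx \<tau> x y * f s y * h y)\<bar> \<le> (C * \<tau> powr (-3/4) * (B * s powr (-1/4) * H)) * (8 / (1 - 1/2))"
  proof (rule integral_abs_bound_singular[OF i(2) x])
    fix y assume y: "y \<in> {0..pi}" "x \<noteq> y"
    have "\<bar>hkx \<tau> x y * f s y * h y\<bar> = \<bar>hkx \<tau> x y\<bar> * (\<bar>f s y\<bar> * \<bar>h y\<bar>)" by (simp add: abs_mult)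
    also have "\<dots> \<le> (C * \<tau> powr (-3/4) * \<bar>x - y\<bar> powr (-1/2)) * (B * s powr (-1/4) * H)"
      using hkx_le[OF \<tau> x y] cont_XD(2)[OF f s y(1)] h(2)[OF y(1)] B C_pos H by (intro mult_mono) auto
    finally show "\<bar>hkx \<tau> x y * f s y * h y\<bar> \<le> C * \<tau> powr (-3/4) * (B * s powr (-1/4) * H) * \<bar>x - y\<bar> powr - (1/2)"
      by (simp add: mult_ac)
  qed (use B C_pos H in auto)
  then show "\<bar>integral {0..pi} (\<lambda>y. hkx \<tau> x y * f s y * h y)\<bar> \<le> 16 * C * B * H * (\<tau> powr (-3/4) * s powr (-1/4))"
    by (simp add: mult_ac)
qed

lemma bounded_on_pi:
  assumes "continuous_on {0..pi} (h :: real \<Rightarrow> real)"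
  obtains H where "\<And>y. y \<in> {0..pi} \<Longrightarrow> \<bar>h y\<bar> \<le> H" "H > 0"
proof -
  have "bounded (h ` {0..pi})" using assms by (intro compact_imp_bounded compact_continuous_image) auto
  then obtain H where "H > 0" "\<forall>z\<in>h ` {0..pi}. norm z \<le> H" unfolding bounded_pos by blast
  then show ?thesis using that by force
qed

lemma Top_integrable:
  assumes f: "cont_X T B f" and h: "continuous_on {0..pi} h" and t: "t \<in> {0<..T}" and x: "x \<in> {0..pi}"
  shows "(\<lambda>s. integral {0..pi} (\<lambda>y. heat_kernel (t - s) x y * f s y * h y)) integrable_on {0..t}"
    "(\<lambda>s. integral {0..pi} (\<lambda>y. hkx (t - s) x y * f s y * h y)) integrable_on {0..t}"
proof -
  obtain H where H: "\<And>y. y \<in> {0..pi} \<Longrightarrow> \<bar>h y\<bar> \<le> H" using bounded_on_pi[OF h] by blast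
  have t0: "t > 0" using t by simp
  show "(\<lambda>s. integral {0..pi} (\<lambda>y. heat_kernel (t - s) x y * f s y * h y)) integrable_on {0..t}"
  proof (rule integrable_on_Ioo_dominated(2))
    show "continuous_on {0<..<t} (\<lambda>s. integral {0..pi} (\<lambda>y. heat_kernel (t - s) x y * f s y * h y))"
      by (intro integral_continuous_param_pi continuous_intros heat_kernel_continuous cont_X_compose[OF f] 
            continuous_on_compose2[OF h]) (use t in auto)
    show "(\<lambda>s. 16 * C * B * H * ((t - s) powr -(1/4) * s powr -(1/4))) integrable_on {0..t}"
      using integral_powr_Beta[of "1/4" "1/4" t] t0 by (intro integrable_on_mult_right) (auto intro: has_integral_integrable)
    show "\<bar>integral {0..pi} (\<lambda>y. heat_kernel (t - s) x y * f s y * h y)\<bar> \<le> 16 * C * B * H * ((t - s) powr -(1/4) * s powr -(1/4))"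
      if "s \<in> {0<..<t}" for s
      using Top_inner_bound(1)[OF f h H _ _ x, of s "t - s"] that t by auto
  qed
  show "(\<lambda>s. integral {0..pi} (\<lambda>y. hkx (t - s) x y * f s y * h y)) integrable_on {0..t}"
  proof (rule integrable_on_Ioo_dominated(2))
    show "continuous_on {0<..<t} (\<lambda>s. integral {0..pi} (\<lambda>y. hkx (t - s) x y * f s y * h y))"
      by (intro integral_continuous_param_pi continuous_intros hkx_continuous cont_X_compose[OF f] 
            continuous_on_compose2[OF h]) (use t in auto)
    show "(\<lambda>s. 16 * C * B * H * ((t - s) powr -(3/4) * s powr -(1/4))) integrable_on {0..t}"
      using integral_powr_Beta[of "3/4" "1/4" t] t0 by (intro integrable_on_mult_right) (auto intro: has_integral_integrable)
    show "\<bar>integral {0..pi} (\<lambda>y. hkx (t - s) x y * f s y * h y)\<bar> \<le> 16 * C * B * H * ((t - s) powr -(3/4) * s powr -(1/4))"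
      if "s \<in> {0<..<t}" for s
      using Top_inner_bound(2)[OF f h H _ _ x, of s "t - s"] that t by auto
  qed
qed

lemma Top_bound:
  assumes f: "cont_X T B f" and h: "continuous_on {0..pi} h" "\<And>y. y \<in> {0..pi} \<Longrightarrow> \<bar>h y\<bar> \<le> H"
    and t: "t \<in> {0<..T}" and x: "x \<in> {0..pi}"
  shows "\<bar>Top h f t x\<bar> \<le> 16 * C * B * H * \<bar>Beta (3/4) (3/4)\<bar> * T powr (3/4) * t powr (-1/4)"
proof -
  have B: "0 \<le> B" by (rule cont_XD(3)[OF f T_pos])
  have H: "0 \<le> H" using h(2)[of 0] by (auto intro: order_trans[OF abs_ge_zero])
  have t0: "t > 0" using t by simp
  let ?g = "\<lambda>s. 16 * C * B * H * ((t - s) powr -(1/4) * s powr -(1/4))"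
  have gi: "(?g has_integral 16 * C * B * H * (t powr (1/2) * Beta (3/4) (3/4))) {0..t}"
    using has_integral_mult_right[OF integral_powr_Beta[of "1/4" "1/4" t], of "16 * C * B * H"] t0 by simp
  have "\<bar>Top h f t x\<bar> \<le> integral {0..t} ?g"
    unfolding Top_def
  proof (rule integral_abs_bound_Ioo[OF Top_integrable(1)[OF f h(1) t x] has_integral_integrable[OF gi]])
    fix s assume s: "s \<in> {0<..<t}"
    show "\<bar>integral {0..pi} (\<lambda>y. heat_kernel (t - s) x y * f s y * h y)\<bar> \<le> ?g s"
      using Top_inner_bound(1)[OF f h _ _ x, of s "t - s"] s t by auto
  qed
  also have "\<dots> = 16 * C * B * H * (t powr (1/2) * Beta (3/4) (3/4))" by (rule integral_unique[OF gi])
  also have "\<dots> \<le> 16 * C * B * H * ((T powr (3/4) * t powr (-1/4)) * \<bar>Beta (3/4) (3/4)\<bar>)"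
  proof -
    have "t powr (3/4) * t powr (-1/4) \<le> T powr (3/4) * t powr (-1/4)" using t by (intro mult_right_mono powr_mono2) auto
    then have "t powr (1/2) \<le> T powr (3/4) * t powr (-1/4)" by (simp add: powr_add[symmetric])
    then have "t powr (1/2) * Beta (3/4) (3/4) \<le> (T powr (3/4) * t powr (-1/4)) * \<bar>Beta (3/4) (3/4)\<bar>"
      using order_trans[OF mult_left_mono[OF abs_ge_self[of "Beta (3/4) (3/4) :: real"], of "t powr (1/2)"] mult_right_mono] by simp
    then show ?thesis using B H C_pos by (intro mult_left_mono) auto
  qed
  finally show ?thesis by (simp add: mult_ac)
qed

text \<open>The substitution s = t * \<sigma> moves the time integral to the fixed interval (0,1),
  so that dominated convergence applies while t itself varies.\<close>

lemma Top_continuous: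
  assumes f: "cont_X T B f" and h: "continuous_on {0..pi} h"
  shows "continuous_on ({0<..T} \<times> {0..pi}) (\<lambda>p. Top h f (fst p) (snd p))"
proof -
  obtain H where H: "\<And>y. y \<in> {0..pi} \<Longrightarrow> \<bar>h y\<bar> \<le> H" using bounded_on_pi[OF h] by blast
  have B: "0 \<le> B" by (rule cont_XD(3)[OF f T_pos])
  have H0: "0 \<le> H" using H[of 0] by (auto intro: order_trans[OF abs_ge_zero])
  let ?G = "\<lambda>p \<sigma>. integral {0..pi} (\<lambda>y. heat_kernel (fst p - fst p * \<sigma>) (snd p) y * f (fst p * \<sigma>) y * h y)"
  have scale: "Top h f t x = t * integral {0..1} (?G (t,x))" "?G (t,x) integrable_on {0..1}" if t: "t \<in> {0<..T}" and x: "x \<in> {0..pi}" for t x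
  proof -
    have t0: "t > 0" using t by simp
    have "((\<lambda>s. integral {0..pi} (\<lambda>y. heat_kernel (t - s) x y * f s y * h y)) has_integral Top h f t x) (cbox 0 t)"
      using Top_integrable(1)[OF f h t x] by (simp add: Top_def integrable_integral)
    from has_integral_affinity[OF this, of t 0] t0
    have *: "(?G (t,x) has_integral Top h f t x / t) {0..1}"
      using image_mult_atLeastAtMost[of "1/t" 0 t] by (simp add: divide_inverse_commute mult.commute)
    then show "?G (t,x) integrable_on {0..1}" by (rule has_integral_integrable)
    show "Top h f t x = t * integral {0..1} (?G (t,x))" using integral_unique[OF *] t0 by simp
  qed
  have Gc: "continuous_on ({0<..T} \<times> {0..pi}) (\<lambda>p. ?G p \<sigma>)" if "\<sigma> \<in> {0<..<1}" for \<sigma>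
  proof (intro integral_continuous_param_pi continuous_intros heat_kernel_continuous cont_X_compose[OF f] continuous_on_compose2[OF h])
    fix p :: "(real \<times> real) \<times> real" assume "p \<in> ({0<..T} \<times> {0..pi}) \<times> {0..pi}"
    then have a: "fst (fst p) > 0" "fst (fst p) \<le> T" by auto
    have "fst (fst p) * \<sigma> < fst (fst p) * 1" using that a by (intro mult_strict_left_mono) auto
    then show "0 < fst (fst p) - fst (fst p) * \<sigma>" by simp
    have "0 < fst (fst p) * \<sigma>" using that a by simp
    moreover have "fst (fst p) * \<sigma> \<le> T" using \<open>fst (fst p) * \<sigma> < fst (fst p) * 1\<close> a by linarith
    ultimately show "fst (fst p) * \<sigma> \<in> {0<..T}" by (simp only: greaterThanAtMost_iff)
  qed auto
  show ?thesis
    unfolding continuous_on_sequentially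
  proof (intro allI ballI impI)
    fix X :: "nat \<Rightarrow> real \<times> real" and p assume p: "p \<in> {0<..T} \<times> {0..pi}" and X: "(\<forall>n. X n \<in> {0<..T} \<times> {0..pi}) \<and> X \<longlonglongrightarrow> p"
    have fX: "(\<lambda>n. fst (X n)) \<longlonglongrightarrow> fst p" by (rule tendsto_fst[OF conjunct2[OF X]])
    \<comment> \<open>Rescaling the two factors of exponent -1/4 produces
      \<open>fst (X n) powr (-1/2)\<close>; it stays bounded along the sequence because the limiting
      time is positive.\<close>
    have "(\<lambda>n. fst (X n) powr (-1/2)) \<longlonglongrightarrow> fst p powr (-1/2)" by (rule tendsto_powr[OF fX tendsto_const]) (use p in auto)
    then have "Bseq (\<lambda>n. fst (X n) powr (-1/2))" by (intro convergent_imp_Bseq) (auto simp: convergent_def)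
    then obtain L where L: "\<And>n. norm (fst (X n) powr (-1/2)) \<le> L" unfolding Bseq_def by blast
    have "(\<lambda>n. integral {0..1} (?G (X n))) \<longlonglongrightarrow> integral {0..1} (?G p)"
    proof (rule dominated_convergence_Ioo(2))
      show "?G (X n) integrable_on {0..1}" for n using scale(2)[of "fst (X n)" "snd (X n)"] X by (auto simp: mem_Times_iff)
      show "(\<lambda>\<sigma>. 16 * C * B * H * L * ((1 - \<sigma>) powr -(1/4) * \<sigma> powr -(1/4))) integrable_on {0..1}"
        using integral_powr_Beta[of "1/4" "1/4" 1] by (intro integrable_on_mult_right) (auto intro: has_integral_integrable)
      show "\<bar>?G (X n) \<sigma>\<bar> \<le> 16 * C * B * H * L * ((1 - \<sigma>) powr -(1/4) * \<sigma> powr -(1/4))" if s: "\<sigma> \<in> {0<..<1}" for n \<sigma>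
      proof -
        let ?t = "fst (X n)"
        have t: "?t > 0" "?t \<le> T" "snd (X n) \<in> {0..pi}" using X by (auto simp: mem_Times_iff)
        have "?t * \<sigma> < ?t * 1" using s t by (intro mult_strict_left_mono) auto
        moreover have "0 < ?t * \<sigma>" using s t by simp
        ultimately have m: "?t * \<sigma> \<in> {0<..T}" "?t - ?t * \<sigma> \<in> {0<..T}"
          using t unfolding greaterThanAtMost_iff by linarith+
        have "\<bar>?G (X n) \<sigma>\<bar> \<le> 16 * C * B * H * ((?t - ?t * \<sigma>) powr (-1/4) * (?t * \<sigma>) powr (-1/4))"
          by (rule Top_inner_bound(1)[OF f h H m t(3)])
        also have "(?t - ?t * \<sigma>) powr (-1/4) = ?t powr (-1/4) * (1 - \<sigma>) powr (-1/4)"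
          using t s by (subst powr_mult[symmetric]) (auto simp: algebra_simps)
        also have "(?t * \<sigma>) powr (-1/4) = ?t powr (-1/4) * \<sigma> powr (-1/4)" using t s by (subst powr_mult) auto
        also have "16 * C * B * H * (?t powr (-1/4) * (1 - \<sigma>) powr (-1/4) * (?t powr (-1/4) * \<sigma> powr (-1/4))) =
          16 * C * B * H * (?t powr (-1/4) * ?t powr (-1/4)) * ((1 - \<sigma>) powr (-1/4) * \<sigma> powr (-1/4))" by (simp only: mult_ac)
        also have "?t powr (-1/4) * ?t powr (-1/4) = ?t powr (-1/2)" by (simp add: powr_add[symmetric])
        also have "16 * C * B * H * ?t powr (-1/2) * ((1 - \<sigma>) powr (-1/4) * \<sigma> powr (-1/4)) \<le> 16 * C * B * H * L * ((1 - \<sigma>) powr (-1/4) * \<sigma> powr (-1/4))"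
          using L[of n] B H0 C_pos by (intro mult_right_mono mult_left_mono) auto
        finally show ?thesis by simp
      qed
      show "(\<lambda>n. ?G (X n) \<sigma>) \<longlonglongrightarrow> ?G p \<sigma>" if "\<sigma> \<in> {0<..<1}" for \<sigma>
        using Gc[OF that, unfolded continuous_on_sequentially, rule_format, OF p X] by (simp only: o_def)
    qed
    then have "(\<lambda>n. fst (X n) * integral {0..1} (?G (X n))) \<longlonglongrightarrow> fst p * integral {0..1} (?G p)"
      using fX by (intro tendsto_mult)
    moreover have "Top h f (fst q) (snd q) = fst q * integral {0..1} (?G q)" if "q \<in> {0<..T} \<times> {0..pi}" for q
      using scale(1)[of "fst q" "snd q"] that by (auto simp: mem_Times_iff)
    ultimately show "((\<lambda>p. Top h f (fst p) (snd p)) \<circ> X) \<longlonglongrightarrow> Top h f (fst p) (snd p)"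
      using X p by (simp only: o_def)
  qed
qed

lemma Top_cont_X:
  assumes f: "cont_X T B f" and h: "continuous_on {0..pi} h" "\<And>y. y \<in> {0..pi} \<Longrightarrow> \<bar>h y\<bar> \<le> H"
  shows "cont_X T (16 * C * B * H * \<bar>Beta (3/4) (3/4)\<bar> * T powr (3/4)) (Top h f)"
  unfolding cont_X_def using Top_continuous[OF f h(1)] Top_bound[OF f h] by blast

lemma Top_has_derivative:
  assumes f: "cont_X T B f" and h: "continuous_on {0..pi} h" and t: "t \<in> {0<..T}" and x: "x \<in> {0..pi}"
  shows "(Top h f t has_real_derivative Topx h f t x) (at x within {0..pi})"
proof -
  obtain H where H: "\<And>y. y \<in> {0..pi} \<Longrightarrow> \<bar>h y\<bar> \<le> H" using bounded_on_pi[OF h] by blast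
  have t0: "t > 0" using t by simp
  have "((\<lambda>x. integral {0..t} (\<lambda>s. integral {0..pi} (\<lambda>y. heat_kernel (t - s) x y * f s y * h y))) has_real_derivative
     integral {0..t} (\<lambda>s. integral {0..pi} (\<lambda>y. hkx (t - s) x y * f s y * h y))) (at x within {0..pi})"
  proof (rule has_real_derivative_integral_Ioo)
    show "(\<lambda>s. integral {0..pi} (\<lambda>y. heat_kernel (t - s) x y * f s y * h y)) integrable_on {0..t}" if "x \<in> {0..pi}" for x
      by (rule Top_integrable(1)[OF f h t that])
    show "((\<lambda>x. integral {0..pi} (\<lambda>y. heat_kernel (t - s) x y * f s y * h y)) has_real_derivative
       integral {0..pi} (\<lambda>y. hkx (t - s) x y * f s y * h y)) (at x within {0..pi})" if x: "x \<in> {0..pi}" and s: "s \<in> {0<..<t}" for x s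
    proof -
      have "((\<lambda>x. integral (cbox 0 pi) (\<lambda>y. heat_kernel (t - s) x y * f s y * h y)) has_real_derivative
         integral (cbox 0 pi) (\<lambda>y. hkx (t - s) x y * f s y * h y)) (at x within {0..pi})"
      proof (rule leibniz_rule_field_derivative)
        show "((\<lambda>x. heat_kernel (t - s) x y * f s y * h y) has_real_derivative hkx (t - s) x y * f s y * h y) (at x within {0..pi})" for x y
          using DERIV_cmult_right[OF DERIV_cmult_right[OF heat_kernel_deriv_x[of "t - s" y x "{0..pi}"]]] s by simp
        show "(\<lambda>y. heat_kernel (t - s) x y * f s y * h y) integrable_on cbox 0 pi" for x
          using Top_inner_integrable(1)[OF f h, of s "t - s" x] s t by simp
        show "continuous_on ({0..pi} \<times> cbox 0 pi) (\<lambda>(x, y). hkx (t - s) x y * f s y * h y)"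
          unfolding case_prod_unfold
          by (intro continuous_intros hkx_continuous cont_X_compose[OF f] continuous_on_compose2[OF h]) (use s t in auto)
      qed (use x in auto)
      then show ?thesis by simp
    qed
    show "(\<lambda>s. 16 * C * B * H * ((t - s) powr -(3/4) * s powr -(1/4))) integrable_on {0..t}"
      using integral_powr_Beta[of "3/4" "1/4" t] t0 by (intro integrable_on_mult_right) (auto intro: has_integral_integrable)
    show "\<bar>integral {0..pi} (\<lambda>y. hkx (t - s) x y * f s y * h y)\<bar> \<le> 16 * C * B * H * ((t - s) powr -(3/4) * s powr -(1/4))"
      if "x \<in> {0..pi}" "s \<in> {0<..<t}" for x s
      using Top_inner_bound(2)[OF f h H _ _ that(1), of s "t - s"] that t by auto
  qed (use x in auto)
  then show ?thesis by (simp add: Top_def[abs_def] Topx_def)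
qed

lemma Top_linear:
  assumes f: "cont_X T B f" "cont_X T B' g" and h: "continuous_on {0..pi} h" and t: "t \<in> {0<..T}" and x: "x \<in> {0..pi}"
  shows "Top h (\<lambda>s y. a * f s y + b * g s y) t x = a * Top h f t x + b * Top h g t x"
proof -
  have "Top h (\<lambda>s y. a * f s y + b * g s y) t x = integral {0..t} (\<lambda>s. a * integral {0..pi} (\<lambda>y. heat_kernel (t - s) x y * f s y * h y)
      + b * integral {0..pi} (\<lambda>y. heat_kernel (t - s) x y * g s y * h y))"
    unfolding Top_def integral_open_interval_real[of 0 t]
  proof (rule integral_cong)
    fix s assume "s \<in> {0<..<t}"
    then have s: "s \<in> {0<..T}" "t - s > 0" using t by auto
    have "integral {0..pi} (\<lambda>y. heat_kernel (t - s) x y * (a * f s y + b * g s y) * h y) =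
       integral {0..pi} (\<lambda>y. a * (heat_kernel (t - s) x y * f s y * h y) + b * (heat_kernel (t - s) x y * g s y * h y))"
      by (rule integral_cong) (simp add: algebra_simps)
    also have "\<dots> = a * integral {0..pi} (\<lambda>y. heat_kernel (t - s) x y * f s y * h y) + b * integral {0..pi} (\<lambda>y. heat_kernel (t - s) x y * g s y * h y)"
      using Top_inner_integrable(1)[OF f(1) h s] Top_inner_integrable(1)[OF f(2) h s]
      by (subst integral_add) (auto intro: integrable_on_mult_right)
    finally show "integral {0..pi} (\<lambda>y. heat_kernel (t - s) x y * (a * f s y + b * g s y) * h y) =
      a * integral {0..pi} (\<lambda>y. heat_kernel (t - s) x y * f s y * h y) + b * integral {0..pi} (\<lambda>y. heat_kernel (t - s) x y * g s y * h y)" .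
  qed
  also have "\<dots> = a * Top h f t x + b * Top h g t x"
    unfolding Top_def using Top_integrable(1)[OF f(1) h t x] Top_integrable(1)[OF f(2) h t x]
    by (subst integral_add) (auto intro: integrable_on_mult_right)
  finally show ?thesis .
qed

lemma Top_linear_noise:
  assumes f: "cont_X T B f" and h: "continuous_on {0..pi} h" "continuous_on {0..pi} h'" and t: "t \<in> {0<..T}" and x: "x \<in> {0..pi}"
  shows "Top (\<lambda>y. a * h y + b * h' y) f t x = a * Top h f t x + b * Top h' f t x"
proof -
  have "Top (\<lambda>y. a * h y + b * h' y) f t x = integral {0..t} (\<lambda>s. a * integral {0..pi} (\<lambda>y. heat_kernel (t - s) x y * f s y * h y)
      + b * integral {0..pi} (\<lambda>y. heat_kernel (t - s) x y * f s y * h' y))"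
    unfolding Top_def integral_open_interval_real[of 0 t]
  proof (rule integral_cong)
    fix s assume "s \<in> {0<..<t}"
    then have s: "s \<in> {0<..T}" "t - s > 0" using t by auto
    have "integral {0..pi} (\<lambda>y. heat_kernel (t - s) x y * f s y * (a * h y + b * h' y)) =
       integral {0..pi} (\<lambda>y. a * (heat_kernel (t - s) x y * f s y * h y) + b * (heat_kernel (t - s) x y * f s y * h' y))"
      by (rule integral_cong) (simp add: algebra_simps)
    also have "\<dots> = a * integral {0..pi} (\<lambda>y. heat_kernel (t - s) x y * f s y * h y) + b * integral {0..pi} (\<lambda>y. heat_kernel (t - s) x y * f s y * h' y)"
      using Top_inner_integrable(1)[OF f h(1) s] Top_inner_integrable(1)[OF f h(2) s]
      by (subst integral_add) (auto intro: integrable_on_mult_right)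
    finally show "integral {0..pi} (\<lambda>y. heat_kernel (t - s) x y * f s y * (a * h y + b * h' y)) =
       a * integral {0..pi} (\<lambda>y. heat_kernel (t - s) x y * f s y * h y) + b * integral {0..pi} (\<lambda>y. heat_kernel (t - s) x y * f s y * h' y)" .
  qed
  also have "\<dots> = a * Top h f t x + b * Top h' f t x"
    unfolding Top_def using Top_integrable(1)[OF f h(1) t x] Top_integrable(1)[OF f h(2) t x]
    by (subst integral_add) (auto intro: integrable_on_mult_right)
  finally show ?thesis .
qed

end

definition heat_solx :: "(real \<Rightarrow> real) \<Rightarrow> real \<Rightarrow> real \<Rightarrow> real" where
  "heat_solx \<phi> t x = integral {0..pi} (\<lambda>y. hkx t x y * \<phi> y)"

locale heat_phi = heat_bounds +
  fixes \<phi> :: "real \<Rightarrow> real" and P :: real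
  assumes phi_cont: "continuous_on {0..pi} \<phi>" and phi_le: "\<And>y. y \<in> {0..pi} \<Longrightarrow> \<bar>\<phi> y\<bar> \<le> P"
begin

definition B0 :: real where "B0 = 16 * C * P"

lemma P_nonneg: "0 \<le> P" using phi_le[of 0] by (auto intro: order_trans[OF abs_ge_zero])
lemma B0_nonneg: "0 \<le> B0" using P_nonneg C_pos by (simp add: B0_def)

lemma heat_sol_in_X: "in_X T B0 (heat_sol \<phi>) (heat_solx \<phi>)"
  unfolding in_X_def
proof (intro ballI conjI)
  fix s x assume s: "s \<in> {0<..T}" and x: "x \<in> {0..pi}"
  then have s0: "s > 0" by simp
  have i: "(\<lambda>y. heat_kernel s x y * \<phi> y) integrable_on {0..pi}" "(\<lambda>y. hkx s x y * \<phi> y) integrable_on {0..pi}" for x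
    by (intro integrable_continuous_real continuous_intros heat_kernel_continuous hkx_continuous phi_cont s0)+
  have "((\<lambda>x. integral (cbox 0 pi) (\<lambda>y. heat_kernel s x y * \<phi> y)) has_real_derivative
     integral (cbox 0 pi) (\<lambda>y. hkx s x y * \<phi> y)) (at x within {0..pi})"
  proof (rule leibniz_rule_field_derivative)
    show "((\<lambda>x. heat_kernel s x y * \<phi> y) has_real_derivative hkx s x y * \<phi> y) (at x within {0..pi})" for x y
      by (rule DERIV_cmult_right[OF heat_kernel_deriv_x[OF s0]])
    show "continuous_on ({0..pi} \<times> cbox 0 pi) (\<lambda>(x, y). hkx s x y * \<phi> y)"
      unfolding case_prod_unfold by (intro continuous_intros hkx_continuous continuous_on_compose2[OF phi_cont]) (use s0 in auto)
  qed (use i x in auto)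
  then show "(heat_sol \<phi> s has_real_derivative heat_solx \<phi> s x) (at x within {0..pi})"
    by (simp add: heat_sol_def[abs_def] heat_solx_def)
  have "\<bar>heat_sol \<phi> s x\<bar> \<le> (C * s powr (-1/4) * P) * (8 / (1 - 1/2))"
    unfolding heat_sol_def
  proof (rule integral_abs_bound_singular[OF i(1) x])
    fix y assume y: "y \<in> {0..pi}" "x \<noteq> y"
    have "\<bar>heat_kernel s x y * \<phi> y\<bar> \<le> (C * s powr (-1/4) * \<bar>x - y\<bar> powr (-1/2)) * P"
      unfolding abs_mult using hk_le_sing[OF s x y] phi_le[OF y(1)] C_pos by (intro mult_mono) auto
    then show "\<bar>heat_kernel s x y * \<phi> y\<bar> \<le> C * s powr (-1/4) * P * \<bar>x - y\<bar> powr - (1/2)" by (simp add: mult_ac)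
  qed (use P_nonneg C_pos in auto)
  then show "\<bar>heat_sol \<phi> s x\<bar> \<le> B0 * s powr (-1/4)" by (simp add: B0_def mult_ac)
  have "\<bar>heat_solx \<phi> s x\<bar> \<le> (C * s powr (-3/4) * P) * (8 / (1 - 1/2))"
    unfolding heat_solx_def
  proof (rule integral_abs_bound_singular[OF i(2) x])
    fix y assume y: "y \<in> {0..pi}" "x \<noteq> y"
    have "\<bar>hkx s x y * \<phi> y\<bar> \<le> (C * s powr (-3/4) * \<bar>x - y\<bar> powr (-1/2)) * P"
      unfolding abs_mult using hkx_le[OF s x y] phi_le[OF y(1)] C_pos by (intro mult_mono) auto
    then show "\<bar>hkx s x y * \<phi> y\<bar> \<le> C * s powr (-3/4) * P * \<bar>x - y\<bar> powr - (1/2)" by (simp add: mult_ac)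
  qed (use P_nonneg C_pos in auto)
  then show "\<bar>heat_solx \<phi> s x\<bar> \<le> B0 * s powr (-3/4)" by (simp add: B0_def mult_ac)
qed

lemma heat_sol_continuous:
  "continuous_on ({0<..} \<times> {0..pi}) (\<lambda>p. heat_sol \<phi> (fst p) (snd p))"
  "continuous_on ({0<..} \<times> {0..pi}) (\<lambda>p. heat_solx \<phi> (fst p) (snd p))"
  unfolding heat_sol_def heat_solx_def
  by (intro integral_continuous_param_pi continuous_intros heat_kernel_continuous hkx_continuous continuous_on_compose2[OF phi_cont]; force)+

lemma heat_sol_cont_X: "cont_X T B0 (heat_sol \<phi>)"
  unfolding cont_X_def using heat_sol_in_X in_XD(2)[OF heat_sol_in_X]
  by (auto intro: continuous_on_subset[OF heat_sol_continuous(1)])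

text \<open>The spatial derivative of the heat flow is jointly continuous, so the integrand is
  continuous in s. For a mild solution the corresponding integrability is part of the solution
  concept.\<close>

lemma Jop_heat_sol_integrable:
  assumes N: "noise_bound M w" and t: "t \<in> {0<..T}" and x: "x \<in> {0..pi}"
  shows "(\<lambda>s. Jop w (heat_sol \<phi>) (heat_solx \<phi>) (t - s) s x) integrable_on {0..t}"
proof (rule integrable_on_Ioo_dominated(2))
  have c: "continuous_on S (\<lambda>p. heat_sol \<phi> (a p) (b p))" "continuous_on S (\<lambda>p. heat_solx \<phi> (a p) (b p))"
    if "continuous_on S a" "continuous_on S b" "\<And>p. p \<in> S \<Longrightarrow> a p \<in> {0<..}" "\<And>p. p \<in> S \<Longrightarrow> b p \<in> {0..pi}" 
    for S and a b :: "real \<times> real \<Rightarrow> real"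
    using continuous_on_compose2[OF heat_sol_continuous(1) continuous_on_Pair[OF that(1,2)]] 
      continuous_on_compose2[OF heat_sol_continuous(2) continuous_on_Pair[OF that(1,2)]] that(3,4) by (auto simp: image_subset_iff)
  note n = noise_boundD[OF N]
  show "continuous_on {0<..<t} (\<lambda>s. Jop w (heat_sol \<phi>) (heat_solx \<phi>) (t - s) s x)"
    unfolding Jop_def
    by (intro continuous_intros integral_continuous_param_pi hky_continuous heat_kernel_continuous c continuous_on_compose2[OF n(1)]) auto
  let ?g = "\<lambda>s. 16 * C * B0 * M * ((t - s) powr (-(3/4)) * s powr (-(1/4)) + (t - s) powr (-(1/4)) * s powr (-(3/4)))"
  show "?g integrable_on {0..t}"
    using t integral_powr_Beta[of "3/4" "1/4" t] integral_powr_Beta[of "1/4" "3/4" t]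
    by (intro integrable_on_mult_right integrable_add) (auto intro: has_integral_integrable)
  fix s assume s: "s \<in> {0<..<t}"
  then show "\<bar>Jop w (heat_sol \<phi>) (heat_solx \<phi>) (t - s) s x\<bar> \<le> ?g s"
    using Jop_bound[OF heat_sol_in_X N _ _ x, of s "t - s"] t by auto
qed

end

section \<open>Second-order expansion of the Stratonovich solution\<close>

context heat_phi begin

abbreviation "u0 \<equiv> heat_sol \<phi>"
abbreviation "u0x \<equiv> heat_solx \<phi>"

lemma in_X_mono: "in_X T B f fx \<Longrightarrow> B \<le> B' \<Longrightarrow> in_X T B' f fx"
  unfolding in_X_def by (meson mult_right_mono order_trans powr_ge_zero)

text \<open>The solution class bounds v, and its derivative by a multiple of s^(-1/2), which is
  stronger than the weights; the factor T^(1/4) s^(-1/4) \<ge> 1 converts. The constant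
  \<open>B\<close> obtained here may depend on \<epsilon> in an uncontrolled way.\<close>

lemma strat_solution_in_X:
  assumes S: "strat_mild_solution \<epsilon> w \<phi> v" and N: "noise_bound M w"
  obtains vx B where "in_X T B v vx" "cont_X T B v"
    "\<And>t x. t \<in> {0<..T} \<Longrightarrow> x \<in> {0..pi} \<Longrightarrow> (\<lambda>s. Jop w v vx (t - s) s x) integrable_on {0..t}"
    "\<And>t x. t \<in> {0<..T} \<Longrightarrow> x \<in> {0..pi} \<Longrightarrow> v t x = u0 t x + \<epsilon> * Kop w v vx t x"
proof -
  from S[unfolded strat_mild_solution_def] obtain vx where V: "continuous_on ({0<..} \<times> {0..pi}) (\<lambda>(s, y). v s y) \<and>
       (\<forall>s>0. \<forall>y\<in>{0..pi}. (v s has_real_derivative vx s y) (at y within {0..pi})) \<and>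
       (\<forall>T>0. \<exists>C. \<forall>s\<in>{0<..T}. \<forall>y\<in>{0..pi}. \<bar>v s y\<bar> \<le> C \<and> \<bar>vx s y\<bar> \<le> C / sqrt s) \<and>
       (\<forall>t>0. \<forall>x\<in>{0..pi}.
          (\<forall>s\<in>{0<..<t}.
             (\<lambda>y. deriv (heat_kernel (t - s) x) y * (v s y * w y)) integrable_on {0..pi} \<and>
             (\<lambda>y. heat_kernel (t - s) x y * (vx s y * w y)) integrable_on {0..pi}) \<and>
          (\<lambda>s. integral {0..pi} (\<lambda>y. deriv (heat_kernel (t - s) x) y * (v s y * w y)))
             integrable_on {0..t} \<and>
          (\<lambda>s. integral {0..pi} (\<lambda>y. heat_kernel (t - s) x y * (vx s y * w y)))
             integrable_on {0..t} \<and>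
          v t x =
            \<epsilon> * integral {0..t} (\<lambda>s. - integral {0..pi}
                   (\<lambda>y. deriv (heat_kernel (t - s) x) y * (v s y * w y)))
          - \<epsilon> * integral {0..t} (\<lambda>s. integral {0..pi}
                   (\<lambda>y. heat_kernel (t - s) x y * (vx s y * w y)))
          + integral {0..pi} (\<lambda>y. heat_kernel t x y * \<phi> y))" ..
  note V1 = V[THEN conjunct1] and V2 = V[THEN conjunct2]
  note c = V1 and d = V2[THEN conjunct1, rule_format] and b = V2[THEN conjunct2, THEN conjunct1, rule_format]
    and V4 = V2[THEN conjunct2, THEN conjunct2, THEN spec, THEN mp, THEN bspec, THEN conjunct2]
  note i1 = V4[THEN conjunct1] and i2 = V4[THEN conjunct2, THEN conjunct1] and e = V4[THEN conjunct2, THEN conjunct2]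
  obtain D where D: "\<And>s y. s \<in> {0<..T} \<Longrightarrow> y \<in> {0..pi} \<Longrightarrow> \<bar>v s y\<bar> \<le> D \<and> \<bar>vx s y\<bar> \<le> D / sqrt s"
    using b[OF T_pos] by blast
  have D0: "D \<ge> 0" using D[of T 0] T_pos by (auto intro: order_trans[OF abs_ge_zero])
  define B where "B = D * T powr (1/4)"
  have one: "1 \<le> T powr (1/4) * s powr (-1/4)" if "s \<in> {0<..T}" for s
  proof -
    have "s powr (1/4) * s powr (-1/4) \<le> T powr (1/4) * s powr (-1/4)" using that by (intro mult_right_mono powr_mono2) auto
    then show ?thesis using that by (simp add: powr_add[symmetric])
  qed
  have vb: "\<bar>v s y\<bar> \<le> B * s powr (-1/4)" if "s \<in> {0<..T}" "y \<in> {0..pi}" for s y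
  proof -
    have "\<bar>v s y\<bar> \<le> D * 1" using D[OF that] by simp
    also have "\<dots> \<le> D * (T powr (1/4) * s powr (-1/4))" using D0 one[OF that(1)] by (intro mult_left_mono)
    finally show ?thesis by (simp add: B_def)
  qed
  have vxb: "\<bar>vx s y\<bar> \<le> B * s powr (-3/4)" if "s \<in> {0<..T}" "y \<in> {0..pi}" for s y
  proof -
    have "\<bar>vx s y\<bar> \<le> D * s powr (-1/2) * 1" using D[OF that] that by (simp add: powr_minus_divide powr_half_sqrt)
    also have "\<dots> \<le> D * s powr (-1/2) * (T powr (1/4) * s powr (-1/4))" using D0 one[OF that(1)] by (intro mult_left_mono) auto
    also have "\<dots> = B * (s powr (-1/2) * s powr (-1/4))" by (simp add: B_def)
    also have "s powr (-1/2) * s powr (-1/4) = s powr (-3/4)" by (simp add: powr_add[symmetric])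
    finally show ?thesis .
  qed
  have X: "in_X T B v vx" unfolding in_X_def using vb vxb d by auto
  have cX: "cont_X T B v" unfolding cont_X_def using vb
    by (auto intro!: continuous_on_subset[OF c[unfolded case_prod_unfold]])
  have dy: "deriv (heat_kernel (t - s) x) y = hky (t - s) x y" if "s \<in> {0<..<t}" for s t x y
    using that by (intro deriv_heat_kernel) auto
  have J: "Jop w v vx (t - s) s x = - integral {0..pi} (\<lambda>y. deriv (heat_kernel (t - s) x) y * (v s y * w y)) -
      integral {0..pi} (\<lambda>y. heat_kernel (t - s) x y * (vx s y * w y))" if "s \<in> {0<..<t}" for s t x
    unfolding Jop_def by (simp add: dy[OF that])
  have main: "((\<lambda>s. Jop w v vx (t - s) s x) has_integral - integral {0..t} (\<lambda>s. integral {0..pi} (\<lambda>y. deriv (heat_kernel (t - s) x) y * (v s y * w y)))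
      - integral {0..t} (\<lambda>s. integral {0..pi} (\<lambda>y. heat_kernel (t - s) x y * (vx s y * w y)))) {0..t}" if t: "t > 0" and x: "x \<in> {0..pi}" for t x
  proof -
    have "((\<lambda>s. - integral {0..pi} (\<lambda>y. deriv (heat_kernel (t - s) x) y * (v s y * w y)) -
      integral {0..pi} (\<lambda>y. heat_kernel (t - s) x y * (vx s y * w y))) has_integral - integral {0..t} (\<lambda>s. integral {0..pi} (\<lambda>y. deriv (heat_kernel (t - s) x) y * (v s y * w y)))
      - integral {0..t} (\<lambda>s. integral {0..pi} (\<lambda>y. heat_kernel (t - s) x y * (vx s y * w y)))) {0..t}"
      by (intro has_integral_diff has_integral_neg integrable_integral i1 i2 t x)
    then show ?thesis unfolding has_integral_Icc_iff_Ioo by (rule has_integral_eq[rotated]) (simp add: J)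
  qed
  show thesis
  proof (rule that[OF X cX])
    fix t x assume t: "t \<in> {0<..T}" and x: "x \<in> {0..pi}"
    then have t0: "t > 0" by simp
    show "(\<lambda>s. Jop w v vx (t - s) s x) integrable_on {0..t}" using main[OF t0 x] by (rule has_integral_integrable)
    show "v t x = u0 t x + \<epsilon> * Kop w v vx t x"
      unfolding Kop_def integral_unique[OF main[OF t0 x]] using e[OF t0 x]
      by (simp add: heat_sol_def algebra_simps)
  qed
qed

text \<open>Inserting a bound \<open>B\<close> into the equation returns \<open>B0 + B / 2\<close>,
  by the smallness of \<epsilon>. Iteration from the uncontrolled initial bound converges to the
  fixed point \<open>2 * B0\<close>, which depends neither on \<epsilon> nor on the
  solution.\<close>

lemma strat_contraction:
  assumes N: "noise_bound M w" and X: "in_X T B v vx"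
    and int: "\<And>t x. t \<in> {0<..T} \<Longrightarrow> x \<in> {0..pi} \<Longrightarrow> (\<lambda>s. Jop w v vx (t - s) s x) integrable_on {0..t}"
    and eq: "\<And>t x. t \<in> {0<..T} \<Longrightarrow> x \<in> {0..pi} \<Longrightarrow> v t x = u0 t x + \<epsilon> * Kop w v vx t x"
    and small: "\<bar>\<epsilon>\<bar> * KK * M \<le> 1/2"
  shows "in_X T (2 * B0) v vx"
proof -
  have step: "in_X T (B0 + B / 2) v vx" if X: "in_X T B v vx" for B
    unfolding in_X_def
  proof (intro ballI conjI)
    fix t x assume t: "t \<in> {0<..T}" and x: "x \<in> {0..pi}"
    have B: "0 \<le> B" by (rule in_X_nonneg[OF X T_pos])
    show d: "(v t has_real_derivative vx t x) (at x within {0..pi})" by (rule in_XD(1)[OF X t x])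
    have sm: "\<bar>\<epsilon>\<bar> * (KK * B * M * r) \<le> B / 2 * r" if "0 \<le> r" for r
    proof -
      have "(\<bar>\<epsilon>\<bar> * KK * M) * (B * r) \<le> (1/2) * (B * r)" using small B that by (intro mult_right_mono) auto
      then show ?thesis by (simp add: mult_ac)
    qed
    have "\<bar>\<epsilon> * Kop w v vx t x\<bar> \<le> \<bar>\<epsilon>\<bar> * (KK * B * M * t powr (-1/4))"
      unfolding abs_mult by (intro mult_left_mono Kop_bound(2)[OF X N t x int[OF t x]]) auto
    also have "\<dots> \<le> B / 2 * t powr (-1/4)" by (rule sm) simp
    finally have "\<bar>\<epsilon> * Kop w v vx t x\<bar> \<le> B / 2 * t powr (-1/4)" .
    then show "\<bar>v t x\<bar> \<le> (B0 + B / 2) * t powr (-1/4)"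
      unfolding eq[OF t x] distrib_right
      by (rule order_trans[OF abs_triangle_ineq add_mono[OF in_XD(2)[OF heat_sol_in_X t x]]])
    have "((\<lambda>x. v t x - u0 t x) has_real_derivative vx t x - u0x t x) (at x within {0..pi})"
      by (rule DERIV_diff[OF d in_XD(1)[OF heat_sol_in_X t x]])
    then have "\<bar>vx t x - u0x t x\<bar> \<le> B / 2 * t powr (-3/4)"
    proof (rule deriv_le_lipschitz[OF _ pi_gt_zero x])
      fix z assume z: "z \<in> {0..pi}"
      have "\<bar>(v t z - u0 t z) - (v t x - u0 t x)\<bar> = \<bar>\<epsilon>\<bar> * \<bar>Kop w v vx t z - Kop w v vx t x\<bar>"
        unfolding eq[OF t x] eq[OF t z] abs_mult[symmetric] by (simp add: algebra_simps)
      also have "\<dots> \<le> \<bar>\<epsilon>\<bar> * (KK * B * M * t powr (-3/4) * \<bar>z - x\<bar>)"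
        by (intro mult_left_mono Kop_lipschitz[OF X N t z x int[OF t]]) auto
      also have "\<dots> = \<bar>\<epsilon>\<bar> * (KK * B * M * t powr (-3/4)) * \<bar>z - x\<bar>" by simp
      also have "\<dots> \<le> B / 2 * t powr (-3/4) * \<bar>z - x\<bar>" by (intro mult_right_mono sm) auto
      finally show "\<bar>(v t z - u0 t z) - (v t x - u0 t x)\<bar> \<le> B / 2 * t powr (-3/4) * \<bar>z - x\<bar>" .
    qed
    then show "\<bar>vx t x\<bar> \<le> (B0 + B / 2) * t powr (-3/4)"
      using in_XD(3)[OF heat_sol_in_X t x] unfolding distrib_right by linarith
  qed
  have it: "in_X T (2 * B0 + \<bar>B\<bar> / 2 ^ n) v vx" for n
  proof (induction n)
    case 0
    show ?case by (rule in_X_mono[OF X]) (use B0_nonneg in auto)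
  next
    case (Suc n)
    from step[OF Suc] show ?case by (simp add: add_divide_distrib mult.commute)
  qed
  have lim: "(\<lambda>n. (2 * B0 + \<bar>B\<bar> / 2 ^ n) * r) \<longlonglongrightarrow> (2 * B0 + 0) * r" for r
    by (intro tendsto_intros LIMSEQ_divide_realpow_zero) auto
  show ?thesis
    unfolding in_X_def
  proof (intro ballI conjI)
    fix t x assume t: "t \<in> {0<..T}" and x: "x \<in> {0..pi}"
    show "(v t has_real_derivative vx t x) (at x within {0..pi})" by (rule in_XD(1)[OF X t x])
    show "\<bar>v t x\<bar> \<le> 2 * B0 * t powr (-1/4)"
      using LIMSEQ_le_const[OF lim[of "t powr (-1/4)"], of "\<bar>v t x\<bar>"] in_XD(2)[OF it t x] by auto
    show "\<bar>vx t x\<bar> \<le> 2 * B0 * t powr (-3/4)"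
      using LIMSEQ_le_const[OF lim[of "t powr (-3/4)"], of "\<bar>vx t x\<bar>"] in_XD(3)[OF it t x] by auto
  qed
qed

lemma Jop_Top_integrable:
  assumes X: "in_X T B f fx" and c: "cont_X T B' f" and t: "t \<in> {0<..T}" and x: "x \<in> {0..pi}"
    and d: "\<forall>y\<in>{0..pi}. (w has_real_derivative w' y) (at y within {0..pi})" "continuous_on {0..pi} w'"
  shows "(\<lambda>s. Jop w f fx (t - s) s x) integrable_on {0..t}" "Kop w f fx t x = Top w' f t x"
proof -
  have eq: "Jop w f fx (t - s) s x = integral {0..pi} (\<lambda>y. heat_kernel (t - s) x y * f s y * w' y)" if "s \<in> {0<..<t}" for s
    using Jop_smooth[OF X _ _ d(1)[rule_format] d(2), of s "t - s"] that t by auto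
  show "(\<lambda>s. Jop w f fx (t - s) s x) integrable_on {0..t}"
    using Top_integrable(1)[OF c d(2) t x] unfolding integrable_on_Icc_iff_Ioo
    by (rule integrable_eq) (simp add: eq)
  show "Kop w f fx t x = Top w' f t x"
    unfolding Kop_def Top_def integral_open_interval_real[of 0 t] by (rule integral_cong) (simp add: eq)
qed

lemma Kop_diff:
  assumes "in_X T B f fx" "in_X T B' g gx" "continuous_on {0..pi} w" "t \<in> {0<..T}"
    "(\<lambda>s. Jop w f fx (t - s) s x) integrable_on {0..t}" "(\<lambda>s. Jop w g gx (t - s) s x) integrable_on {0..t}"
  shows "(\<lambda>s. Jop w (\<lambda>s y. f s y - g s y) (\<lambda>s y. fx s y - gx s y) (t - s) s x) integrable_on {0..t}"
    "Kop w (\<lambda>s y. f s y - g s y) (\<lambda>s y. fx s y - gx s y) t x = Kop w f fx t x - Kop w g gx t x"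
proof -
  have eq: "Jop w (\<lambda>s y. f s y - g s y) (\<lambda>s y. fx s y - gx s y) (t - s) s x = Jop w f fx (t - s) s x - Jop w g gx (t - s) s x"
    if "s \<in> {0<..<t}" for s using that assms(4) by (intro Jop_diff[OF assms(1,2)] assms) auto
  show "(\<lambda>s. Jop w (\<lambda>s y. f s y - g s y) (\<lambda>s y. fx s y - gx s y) (t - s) s x) integrable_on {0..t}"
    using integrable_diff[OF assms(5,6)] unfolding integrable_on_Icc_iff_Ioo by (rule integrable_eq) (simp add: eq)
  have "Kop w (\<lambda>s y. f s y - g s y) (\<lambda>s y. fx s y - gx s y) t x = integral {0..t} (\<lambda>s. Jop w f fx (t - s) s x - Jop w g gx (t - s) s x)"
    unfolding Kop_def integral_open_interval_real[of 0 t] by (rule integral_cong) (simp add: eq)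
  then show "Kop w (\<lambda>s y. f s y - g s y) (\<lambda>s y. fx s y - gx s y) t x = Kop w f fx t x - Kop w g gx t x"
    unfolding Kop_def using integral_diff[OF assms(5,6)] by simp
qed

lemma Kop_noise_diff:
  assumes "in_X T B f fx" "continuous_on {0..pi} w" "continuous_on {0..pi} w'" "t \<in> {0<..T}"
    "(\<lambda>s. Jop w f fx (t - s) s x) integrable_on {0..t}" "(\<lambda>s. Jop w' f fx (t - s) s x) integrable_on {0..t}"
  shows "(\<lambda>s. Jop (\<lambda>y. w y - w' y) f fx (t - s) s x) integrable_on {0..t}"
    "Kop (\<lambda>y. w y - w' y) f fx t x = Kop w f fx t x - Kop w' f fx t x"
proof -
  have eq: "Jop (\<lambda>y. w y - w' y) f fx (t - s) s x = Jop w f fx (t - s) s x - Jop w' f fx (t - s) s x"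
    if "s \<in> {0<..<t}" for s using that assms(4) by (intro Jop_noise_diff[OF assms(1)] assms) auto
  show "(\<lambda>s. Jop (\<lambda>y. w y - w' y) f fx (t - s) s x) integrable_on {0..t}"
    using integrable_diff[OF assms(5,6)] unfolding integrable_on_Icc_iff_Ioo by (rule integrable_eq) (simp add: eq)
  have "Kop (\<lambda>y. w y - w' y) f fx t x = integral {0..t} (\<lambda>s. Jop w f fx (t - s) s x - Jop w' f fx (t - s) s x)"
    unfolding Kop_def integral_open_interval_real[of 0 t] by (rule integral_cong) (simp add: eq)
  then show "Kop (\<lambda>y. w y - w' y) f fx t x = Kop w f fx t x - Kop w' f fx t x"
    unfolding Kop_def using integral_diff[OF assms(5,6)] by simp
qed

lemma in_X_diff:
  assumes "in_X T B f fx" "in_X T B' g gx"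
  shows "in_X T (B + B') (\<lambda>s y. f s y - g s y) (\<lambda>s y. fx s y - gx s y)"
  unfolding in_X_def
proof (intro ballI conjI)
  fix s y assume a: "s \<in> {0<..T}" "y \<in> {0..pi}"
  show "((\<lambda>y. f s y - g s y) has_real_derivative fx s y - gx s y) (at y within {0..pi})"
    by (rule DERIV_diff[OF in_XD(1)[OF assms(1) a] in_XD(1)[OF assms(2) a]])
  show "\<bar>f s y - g s y\<bar> \<le> (B + B') * s powr (-1/4)" "\<bar>fx s y - gx s y\<bar> \<le> (B + B') * s powr (-3/4)"
    unfolding distrib_right using in_XD(2,3)[OF assms(1) a] in_XD(2,3)[OF assms(2) a] by linarith+
qed

text \<open>Linear and homogeneous in \<epsilon> and \<eta> jointly: the \<eta> part disappears
  along approximations of the path with \<epsilon> fixed, and what remains is a multiple of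
  \<epsilon>.\<close>

definition second_order_error :: "real \<Rightarrow> real \<Rightarrow> real \<Rightarrow> real" where
  "second_order_error M \<epsilon> \<eta> = KK * (KK * (\<epsilon> * (2 * KK * B0 * M)) * M + KK * B0 * \<eta>) * M + KK * (2 * KK * B0 * M) * \<eta>"

text \<open>The operator is linear in the path and becomes a Duhamel integral on the smooth one, so
  only the operator belonging to the small difference has to be estimated.\<close>

lemma Kop_heat_sol_approx:
  assumes N: "noise_bound M w" and t: "t \<in> {0<..T}" and x: "x \<in> {0..pi}" and c: "continuous_on {0..pi} wN"
    and d: "\<forall>y\<in>{0..pi}. (wN has_real_derivative wN' y) (at y within {0..pi})" "continuous_on {0..pi} wN'"
    and e: "noise_bound \<eta> (\<lambda>y. w y - wN y)"
  shows "\<bar>Kop w u0 u0x t x - Top wN' u0 t x\<bar> \<le> KK * B0 * \<eta>"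
proof -
  note 1 = Jop_Top_integrable[OF heat_sol_in_X heat_sol_cont_X t x d]
  note 2 = Kop_noise_diff[OF heat_sol_in_X noise_boundD(1)[OF N] c t Jop_heat_sol_integrable[OF N t x] 1(1)]
  show ?thesis using Kop_bound(1)[OF heat_sol_in_X e t x 2(1)] unfolding 2(2) 1(2) .
qed

text \<open>The second iterate of the operator on \<open>u0\<close> is never formed: for a rough
  path no derivative of the first iterate has been constructed. Instead \<open>R\<close> is the
  operator applied to f = (v - u0) / \<epsilon>, which equals the operator applied to v and inherits
  its derivative from v and u0. It is compared directly with the twofold Duhamel integral of any
  smooth path close to \<open>w\<close>.\<close>

theorem strat_second_order:
  assumes S: "strat_mild_solution \<epsilon> w \<phi> v" and N: "noise_bound M w" and eps: "\<epsilon> \<noteq> 0" and small: "\<bar>\<epsilon>\<bar> * KK * M \<le> 1/2"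
    and x0: "x0 \<in> {0..pi}"
  shows "\<exists>R. v T x0 = u0 T x0 + \<epsilon> * Kop w u0 u0x T x0 + \<epsilon>\<^sup>2 * R \<and>
    (\<forall>wN wN' \<eta>. (\<forall>y\<in>{0..pi}. (wN has_real_derivative wN' y) (at y within {0..pi})) \<longrightarrow> continuous_on {0..pi} wN' \<longrightarrow>
       noise_bound M wN \<longrightarrow> noise_bound \<eta> (\<lambda>y. w y - wN y) \<longrightarrow>
       \<bar>R - Top wN' (Top wN' u0) T x0\<bar> \<le> second_order_error M \<bar>\<epsilon>\<bar> \<eta>)"
proof -
  obtain vx B where X: "in_X T B v vx" and cX: "cont_X T B v"
    and int: "\<And>t x. t \<in> {0<..T} \<Longrightarrow> x \<in> {0..pi} \<Longrightarrow> (\<lambda>s. Jop w v vx (t - s) s x) integrable_on {0..t}"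
    and eq: "\<And>t x. t \<in> {0<..T} \<Longrightarrow> x \<in> {0..pi} \<Longrightarrow> v t x = u0 t x + \<epsilon> * Kop w v vx t x"
    by (rule strat_solution_in_X[OF S N]) (rule that; assumption)
  have M: "0 \<le> M" using noise_boundD[OF N] by simp
  have cw: "continuous_on {0..pi} w" by (rule noise_boundD[OF N])
  have X2: "in_X T (2 * B0) v vx" by (rule strat_contraction[OF N X int eq small])
  have TT: "T \<in> {0<..T}" using T_pos by simp
  define g where "g = (\<lambda>s y. v s y - u0 s y)"
  define gx where "gx = (\<lambda>s y. vx s y - u0x s y)"
  define f where "f = (\<lambda>s y. g s y / \<epsilon>)"
  define fx where "fx = (\<lambda>s y. gx s y / \<epsilon>)"
  have gX: "in_X T (2 * B0 + B0) g gx" unfolding g_def gx_def by (rule in_X_diff[OF X2 heat_sol_in_X])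
  have ig: "(\<lambda>s. Jop w g gx (t - s) s x) integrable_on {0..t}" and Kg: "Kop w g gx t x = Kop w v vx t x - Kop w u0 u0x t x"
    if "t \<in> {0<..T}" "x \<in> {0..pi}" for t x
    unfolding g_def gx_def using Kop_diff[OF X2 heat_sol_in_X cw that(1) int[OF that] Jop_heat_sol_integrable[OF N that]] by auto
  have f_eq: "f t x = Kop w v vx t x" if "t \<in> {0<..T}" "x \<in> {0..pi}" for t x
    using eq[OF that] eps by (simp add: f_def g_def)
  have f_der: "(f t has_real_derivative fx t x) (at x within {0..pi})" if "t \<in> {0<..T}" "x \<in> {0..pi}" for t x
    unfolding f_def fx_def by (rule DERIV_cdivide[OF in_XD(1)[OF gX that]])
  have fX: "in_X T (KK * (2 * B0) * M) f fx" by (rule Kop_in_X[OF X2 N int f_eq f_der])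
  have fX': "in_X T (2 * KK * B0 * M) f fx" using fX by (simp add: mult_ac)
  have fc: "cont_X T (\<bar>1/\<epsilon>\<bar> * B + \<bar>-1/\<epsilon>\<bar> * B0) f"
    using cont_X_linear[OF cX heat_sol_cont_X T_pos, of "1/\<epsilon>" "-1/\<epsilon>"] by (simp add: f_def g_def diff_divide_distrib)
  \<comment> \<open>Since g = \<epsilon> f and f is bounded in the space uniformly in \<epsilon>,
    the difference v - u0 has size \<epsilon>.\<close>
  have "in_X T (\<bar>\<epsilon>\<bar> * (2 * KK * B0 * M)) g gx"
    unfolding in_X_def
  proof (intro ballI conjI)
    fix s y assume sy: "s \<in> {0<..T}" "y \<in> {0..pi}"
    show "(g s has_real_derivative gx s y) (at y within {0..pi})" by (rule in_XD(1)[OF gX sy])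
    have "\<bar>g s y\<bar> = \<bar>\<epsilon>\<bar> * \<bar>f s y\<bar>" "\<bar>gx s y\<bar> = \<bar>\<epsilon>\<bar> * \<bar>fx s y\<bar>" using eps by (simp_all add: f_def fx_def abs_divide)
    then show "\<bar>g s y\<bar> \<le> \<bar>\<epsilon>\<bar> * (2 * KK * B0 * M) * s powr (-1/4)" "\<bar>gx s y\<bar> \<le> \<bar>\<epsilon>\<bar> * (2 * KK * B0 * M) * s powr (-3/4)"
      unfolding mult.assoc[of "\<bar>\<epsilon>\<bar>"] using in_XD(2,3)[OF fX' sy] by (auto intro!: mult_left_mono)
  qed
  then have gX2: "in_X T (\<bar>\<epsilon>\<bar> * (2 * KK * B0 * M)) g gx" .
  have ifw: "(\<lambda>s. Jop w f fx (t - s) s x) integrable_on {0..t}" if "t \<in> {0<..T}" "x \<in> {0..pi}" for t x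
    unfolding f_def fx_def Jop_scale by (rule integrable_on_divide[OF ig[OF that]])
  have Kf: "Kop w f fx t x = Kop w g gx t x / \<epsilon>" for t x
    unfolding f_def fx_def Kop_def Jop_scale by simp
  show ?thesis
  proof (intro exI[of _ "Kop w f fx T x0"] conjI allI impI)
    have "Kop w v vx T x0 = Kop w u0 u0x T x0 + \<epsilon> * Kop w f fx T x0"
      using Kf[of T x0] Kg[OF TT x0] eps by simp
    then show "v T x0 = u0 T x0 + \<epsilon> * Kop w u0 u0x T x0 + \<epsilon>\<^sup>2 * Kop w f fx T x0"
      using eq[OF TT x0] by (simp add: power2_eq_square algebra_simps)
  next
    fix wN wN' \<eta>
    assume d: "\<forall>y\<in>{0..pi}. (wN has_real_derivative wN' y) (at y within {0..pi})" and cN': "continuous_on {0..pi} wN'"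
      and NN: "noise_bound M wN" and Nd: "noise_bound \<eta> (\<lambda>y. w y - wN y)"
    have eta: "0 \<le> \<eta>" using noise_boundD[OF Nd] by simp
    have cwN: "continuous_on {0..pi} wN" by (rule noise_boundD[OF NN])
    define k where "k = Top wN' u0"
    define kx where "kx = Topx wN' u0"
    note JT = Jop_Top_integrable[OF heat_sol_in_X heat_sol_cont_X _ _ d cN']
    have k_eq: "k t x = Kop wN u0 u0x t x" if "t \<in> {0<..T}" "x \<in> {0..pi}" for t x
      unfolding k_def using JT(2)[OF that] by simp
    have k_der: "(k t has_real_derivative kx t x) (at x within {0..pi})" if "t \<in> {0<..T}" "x \<in> {0..pi}" for t x
      unfolding k_def kx_def by (rule Top_has_derivative[OF heat_sol_cont_X cN' that])
    have kX: "in_X T (KK * B0 * M) k kx" by (rule Kop_in_X[OF heat_sol_in_X NN JT(1) k_eq k_der])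
    obtain H where H: "\<And>y. y \<in> {0..pi} \<Longrightarrow> \<bar>wN' y\<bar> \<le> H" using bounded_on_pi[OF cN'] by blast
    obtain B' where kc: "cont_X T B' k" using Top_cont_X[OF heat_sol_cont_X cN' H] unfolding k_def by blast
    have iu: "(\<lambda>s. Jop (\<lambda>y. w y - wN y) u0 u0x (t - s) s x) integrable_on {0..t}"
      and Ku: "Kop (\<lambda>y. w y - wN y) u0 u0x t x = Kop w u0 u0x t x - Kop wN u0 u0x t x" if "t \<in> {0<..T}" "x \<in> {0..pi}" for t x
      using Kop_noise_diff[OF heat_sol_in_X cw cwN that(1) Jop_heat_sol_integrable[OF N that] JT(1)[OF that]] by auto
    define r where "r = (\<lambda>s y. f s y - k s y)"
    define rx where "rx = (\<lambda>s y. fx s y - kx s y)"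
    \<comment> \<open>Here f is the operator of \<open>w\<close> on v, and k that of
      \<open>wN\<close> on u0. Their difference splits into the operator of \<open>w\<close> on v -
      u0, of order \<epsilon>, and the operator of \<open>w - wN\<close> on u0, of order
      \<eta>.\<close>
    have r_eq: "r t x = Kop w g gx t x + Kop (\<lambda>y. w y - wN y) u0 u0x t x" if "t \<in> {0<..T}" "x \<in> {0..pi}" for t x
      unfolding r_def f_eq[OF that] k_eq[OF that] Kg[OF that] Ku[OF that] by simp
    define E where "E = KK * (\<bar>\<epsilon>\<bar> * (2 * KK * B0 * M)) * M + KK * B0 * \<eta>"
    have rX0: "in_X T (2 * KK * B0 * M + KK * B0 * M) r rx" unfolding r_def rx_def by (rule in_X_diff[OF fX' kX])
    have rX: "in_X T E r rx"
      unfolding in_X_def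
    proof (intro ballI conjI)
      fix t x assume tx: "t \<in> {0<..T}" "x \<in> {0..pi}"
      show rd: "(r t has_real_derivative rx t x) (at x within {0..pi})" by (rule in_XD(1)[OF rX0 tx])
      show "\<bar>r t x\<bar> \<le> E * t powr (-1/4)"
        unfolding r_eq[OF tx] E_def distrib_right
        by (rule order_trans[OF abs_triangle_ineq add_mono[OF Kop_bound(2)[OF gX2 N tx ig[OF tx]] Kop_bound(2)[OF heat_sol_in_X Nd tx iu[OF tx]]]])
      show "\<bar>rx t x\<bar> \<le> E * t powr (-3/4)"
      proof (rule deriv_le_lipschitz[OF rd pi_gt_zero tx(2)])
        fix z assume z: "z \<in> {0..pi}"
        have "\<bar>r t z - r t x\<bar> \<le> \<bar>Kop w g gx t z - Kop w g gx t x\<bar> + \<bar>Kop (\<lambda>y. w y - wN y) u0 u0x t z - Kop (\<lambda>y. w y - wN y) u0 u0x t x\<bar>"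
          unfolding r_eq[OF tx] r_eq[OF tx(1) z] by linarith
        also have "\<dots> \<le> E * t powr (-3/4) * \<bar>z - x\<bar>"
          unfolding E_def distrib_right
          by (rule add_mono[OF Kop_lipschitz[OF gX2 N tx(1) z tx(2) ig[OF tx(1)]] Kop_lipschitz[OF heat_sol_in_X Nd tx(1) z tx(2) iu[OF tx(1)]]])
        finally show "\<bar>r t z - r t x\<bar> \<le> E * t powr (-3/4) * \<bar>z - x\<bar>" .
      qed
    qed
    note fT = Jop_Top_integrable[OF fX' fc TT x0 d cN']
    note kT = Jop_Top_integrable[OF kX kc TT x0 d cN']
    note fd = Kop_noise_diff[OF fX' cw cwN TT ifw[OF TT x0] fT(1)]
    note rd = Kop_diff[OF fX' kX cwN TT fT(1) kT(1), folded r_def rx_def]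
    \<comment> \<open>Second layer: the smooth path acts on f - k, already small, and the path
      difference acts on f, which is merely bounded.\<close>
    have split: "Kop w f fx T x0 - Top wN' k T x0 = Kop wN r rx T x0 + Kop (\<lambda>y. w y - wN y) f fx T x0"
      using fd(2) rd(2) kT(2) by linarith
    have "\<bar>Kop w f fx T x0 - Top wN' k T x0\<bar> \<le> KK * E * M + KK * (2 * KK * B0 * M) * \<eta>"
      unfolding split
      by (rule order_trans[OF abs_triangle_ineq add_mono[OF Kop_bound(1)[OF rX NN TT x0 rd(1)] Kop_bound(1)[OF fX' Nd TT x0 fd(1)]]])
    then show "\<bar>Kop w f fx T x0 - Top wN' (Top wN' u0) T x0\<bar> \<le> second_order_error M \<bar>\<epsilon>\<bar> \<eta>"
      unfolding second_order_error_def E_def k_def by simp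
  qed
qed

end

section \<open>Fejer means\<close>

definition cospoly :: "(nat \<Rightarrow> real) \<Rightarrow> nat \<Rightarrow> real \<Rightarrow> real" where
  "cospoly a n v = 1/2 + (\<Sum>k=1..n. a k * cos (real k * v))"

text \<open>\<open>ckern\<close> is the multiplier \<open>a\<close> acting on cosine series,
  \<open>skern\<close> the same multiplier on sine series. A path is averaged with the former, since
  it need not vanish at pi; differentiation turns the average into the latter, that is, into the
  basis \<open>mk\<close>.\<close>

definition ckern :: "(nat \<Rightarrow> real) \<Rightarrow> nat \<Rightarrow> real \<Rightarrow> real \<Rightarrow> real" where
  "ckern a n x z = (cospoly a n (x - z) + cospoly a n (x + z)) / pi"

definition skern :: "(nat \<Rightarrow> real) \<Rightarrow> nat \<Rightarrow> real \<Rightarrow> real \<Rightarrow> real" where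
  "skern a n x z = (cospoly a n (x - z) - cospoly a n (x + z)) / pi"

definition fejw :: "nat \<Rightarrow> nat \<Rightarrow> real" where
  "fejw n k = 1 - real k / real (Suc n)"

lemma cospoly_continuous [continuous_intros]:
  fixes f :: "'a::t2_space \<Rightarrow> real"
  shows "continuous_on S f \<Longrightarrow> continuous_on S (\<lambda>x. cospoly a n (f x))"
  unfolding cospoly_def by (intro continuous_intros)

lemma ckern_continuous [continuous_intros]:
  fixes f g :: "'a::t2_space \<Rightarrow> real"
  shows "continuous_on S f \<Longrightarrow> continuous_on S g \<Longrightarrow> continuous_on S (\<lambda>x. ckern a n (f x) (g x))"
  unfolding ckern_def by (intro continuous_intros) auto

lemma skern_continuous [continuous_intros]:
  fixes f g :: "'a::t2_space \<Rightarrow> real"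
  shows "continuous_on S f \<Longrightarrow> continuous_on S g \<Longrightarrow> continuous_on S (\<lambda>x. skern a n (f x) (g x))"
  unfolding skern_def by (intro continuous_intros) auto

lemma cospoly_deriv:
  "(cospoly a n has_real_derivative (\<Sum>k=1..n. - a k * real k * sin (real k * v))) (at v within S)"
  unfolding cospoly_def[abs_def] by (auto intro!: derivative_eq_intros sum.cong)

lemma cos_nat_periodic: "cos (real k * (v + 2 * pi)) = cos (real k * v)"
proof -
  have "real k * (v + 2 * pi) = real k * v + 2 * real k * pi" by (simp add: algebra_simps)
  then show ?thesis by (simp only: cos_add sin_2npi cos_2npi)
qed

lemma cospoly_periodic: "cospoly a n (v + 2 * pi) = cospoly a n v"
  unfolding cospoly_def cos_nat_periodic ..

lemma ckern_product: "ckern a n x z = (2 / pi) * (1/2 + (\<Sum>k=1..n. a k * cos (real k * x) * cos (real k * z)))"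
proof -
  have "cospoly a n (x - z) + cospoly a n (x + z) = 1 + (\<Sum>k=1..n. a k * cos (real k * (x - z)) + a k * cos (real k * (x + z)))"
    by (simp add: cospoly_def sum.distrib)
  also have "(\<Sum>k=1..n. a k * cos (real k * (x - z)) + a k * cos (real k * (x + z))) = (\<Sum>k=1..n. 2 * (a k * cos (real k * x) * cos (real k * z)))"
    by (intro sum.cong refl) (simp add: right_diff_distrib distrib_left cos_add cos_diff)
  finally show ?thesis by (simp add: ckern_def sum_distrib_left field_simps)
qed

lemma skern_product: "skern a n x z = (\<Sum>k=1..n. a k * mk k x * mk k z)"
proof -
  have "cospoly a n (x - z) - cospoly a n (x + z) = (\<Sum>k=1..n. a k * cos (real k * (x - z)) - a k * cos (real k * (x + z)))"
    by (simp add: cospoly_def sum_subtractf)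
  also have "\<dots> = (\<Sum>k=1..n. pi * (a k * mk k x * mk k z))"
  proof (intro sum.cong refl)
    fix k
    have "mk k x * mk k z = 2 / pi * (sin (real k * x) * sin (real k * z))"
      by (simp add: mk_def mult_ac)
    then have "pi * (a k * mk k x * mk k z) = 2 * (a k * sin (real k * x) * sin (real k * z))" by (simp add: field_simps)
    moreover have "a k * cos (real k * (x - z)) - a k * cos (real k * (x + z)) = 2 * (a k * sin (real k * x) * sin (real k * z))"
      by (simp add: right_diff_distrib distrib_left cos_add cos_diff)
    ultimately show "a k * cos (real k * (x - z)) - a k * cos (real k * (x + z)) = pi * (a k * mk k x * mk k z)"
      by linarith
  qed
  also have "\<dots> = pi * (\<Sum>k=1..n. a k * mk k x * mk k z)" by (simp add: sum_distrib_left)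
  finally show ?thesis by (simp add: skern_def)
qed

text \<open>The left-hand side is the squared modulus of the sum of exp(i j v) over j < n. In the
  inductive step the cross terms with the new exponential contribute each frequency from 1 to n
  once. Positivity of the Fejer kernel follows.\<close>

lemma fejer_sum:
  "(\<Sum>j<n. cos (real j * v))\<^sup>2 + (\<Sum>j<n. sin (real j * v))\<^sup>2 = real n + 2 * (\<Sum>k=1..n. (real n - real k) * cos (real k * v))"
proof (induction n)
  case (Suc n)
  let ?C = "\<Sum>j<n. cos (real j * v)" and ?S = "\<Sum>j<n. sin (real j * v)"
  have "?C * cos (real n * v) + ?S * sin (real n * v) = (\<Sum>j<n. cos (real (n - j) * v))"
    unfolding sum_distrib_right sum.distrib[symmetric]
  proof (intro sum.cong refl)
    fix j assume "j \<in> {..<n}"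
    then have "real (n - j) * v = real n * v - real j * v" by (simp add: of_nat_diff left_diff_distrib)
    then show "cos (real j * v) * cos (real n * v) + sin (real j * v) * sin (real n * v) = cos (real (n - j) * v)"
      by (simp only: cos_diff mult.commute)
  qed
  also have "\<dots> = (\<Sum>k=1..n. cos (real k * v))"
    by (rule sum.reindex_bij_witness[of _ "\<lambda>k. n - k" "\<lambda>j. n - j"]) auto
  finally have cross: "?C * cos (real n * v) + ?S * sin (real n * v) = (\<Sum>k=1..n. cos (real k * v))" .
  have "(\<Sum>j<Suc n. cos (real j * v))\<^sup>2 + (\<Sum>j<Suc n. sin (real j * v))\<^sup>2 =
     ?C\<^sup>2 + ?S\<^sup>2 + 2 * (?C * cos (real n * v) + ?S * sin (real n * v)) + ((cos (real n * v))\<^sup>2 + (sin (real n * v))\<^sup>2)"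
    by (simp add: power2_eq_square algebra_simps)
  also have "\<dots> = real n + 2 * (\<Sum>k=1..n. (real n - real k) * cos (real k * v)) + 2 * (\<Sum>k=1..n. cos (real k * v)) + 1"
    unfolding cross Suc.IH by simp
  also have "\<dots> = real (Suc n) + 2 * (\<Sum>k=1..n. (real n - real k) * cos (real k * v) + cos (real k * v))"
    by (simp add: sum.distrib)
  also have "(\<Sum>k=1..n. (real n - real k) * cos (real k * v) + cos (real k * v)) = (\<Sum>k=1..Suc n. (real (Suc n) - real k) * cos (real k * v))"
    by (simp add: algebra_simps)
  finally show ?case .
qed simp

lemma fejer_nonneg: "0 \<le> cospoly (fejw n) n v"
proof -
  have "real (Suc n) + 2 * (\<Sum>k=1..Suc n. (real (Suc n) - real k) * cos (real k * v)) \<ge> 0"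
    unfolding fejer_sum[symmetric] by simp
  moreover have "real (Suc n) + 2 * (\<Sum>k=1..Suc n. (real (Suc n) - real k) * cos (real k * v)) = 2 * real (Suc n) * cospoly (fejw n) n v"
  proof -
    have "(\<Sum>k=1..Suc n. (real (Suc n) - real k) * cos (real k * v)) = (\<Sum>k=1..n. (real (Suc n) - real k) * cos (real k * v))"
      by simp
    also have "\<dots> = real (Suc n) * (\<Sum>k=1..n. fejw n k * cos (real k * v))"
      unfolding sum_distrib_left by (intro sum.cong refl) (simp add: fejw_def field_simps)
    finally have "(\<Sum>k=1..Suc n. (real (Suc n) - real k) * cos (real k * v)) = real (Suc n) * (\<Sum>k=1..n. fejw n k * cos (real k * v))" .
    moreover have "m + 2 * (m * X) = 2 * m * (1/2 + X)" for m X :: real by (simp add: field_simps)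
    ultimately show ?thesis unfolding cospoly_def by (simp only:)
  qed
  ultimately show ?thesis by (simp add: zero_le_mult_iff)
qed

lemma fejw_range: "k \<le> Suc n \<Longrightarrow> 0 \<le> fejw n k" "fejw n k \<le> 1"
  by (simp_all add: fejw_def field_simps)

lemma fejw_tendsto: "(\<lambda>n. fejw n k) \<longlonglongrightarrow> 1"
proof -
  have "(\<lambda>n. 1 - real k * (1 / real (Suc n))) \<longlonglongrightarrow> 1 - real k * 0"
    by (intro tendsto_intros LIMSEQ_Suc[OF lim_1_over_n])
  then show ?thesis by (simp add: fejw_def)
qed

lemma has_integral_cos_nat:
  "((\<lambda>z. cos (real k * z)) has_integral (if k = 0 then pi else 0)) {0..pi}"
proof (cases "k = 0")
  case True
  then show ?thesis using has_integral_const_real[of "1::real" 0 pi] by simp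
next
  case False
  have "((\<lambda>z. cos (real k * z)) has_integral sin (real k * pi) / real k - sin (real k * 0) / real k) {0..pi}"
    using False by (intro fundamental_theorem_of_calculus)
      (auto intro!: derivative_eq_intros simp: has_real_derivative_iff_has_vector_derivative[symmetric])
  then show ?thesis using False by (simp add: sin_nat_pi)
qed

lemma has_integral_cos_cos:
  assumes "k \<ge> 1" "l \<ge> 1"
  shows "((\<lambda>z. cos (real k * z) * cos (real l * z)) has_integral (if k = l then pi/2 else 0)) {0..pi}"
proof -
  let ?d = "if k \<ge> l then k - l else l - k"
  have c: "cos (real ?d * z) = cos (real k * z - real l * z)" for z
  proof (cases "k \<ge> l")
    case False
    then have "cos (real ?d * z) = cos (- (real k * z - real l * z))" by (simp add: of_nat_diff algebra_simps)
    then show ?thesis by (simp only: cos_minus)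
  qed (simp add: of_nat_diff algebra_simps)
  have "((\<lambda>z. (cos (real ?d * z) + cos (real (k + l) * z)) / 2) has_integral ((if ?d = 0 then pi else 0) + (if k + l = 0 then pi else 0)) / 2) {0..pi}"
    by (intro has_integral_divide has_integral_add has_integral_cos_nat)
  moreover have "(cos (real ?d * z) + cos (real (k + l) * z)) / 2 = cos (real k * z) * cos (real l * z)" for z
    unfolding c by (simp add: distrib_right cos_add cos_diff)
  moreover have "?d = 0 \<longleftrightarrow> k = l" by auto
  ultimately show ?thesis using assms by (cases "k = l") simp_all
qed

lemma has_integral_sym_cos:
  "((\<lambda>z. cos (real k * (x - z)) + cos (real k * (x + z))) has_integral (if k = 0 then 2 * pi else 0)) {0..pi}"
proof -
  have "((\<lambda>z. 2 * cos (real k * x) * cos (real k * z)) has_integral 2 * cos (real k * x) * (if k = 0 then pi else 0)) {0..pi}"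
    by (rule has_integral_mult_right[OF has_integral_cos_nat])
  moreover have "2 * cos (real k * x) * cos (real k * z) = cos (real k * (x - z)) + cos (real k * (x + z))" for z
    by (simp add: right_diff_distrib distrib_left cos_add cos_diff)
  ultimately show ?thesis by (cases "k = 0") simp_all
qed

lemma ckern_integral: "((\<lambda>z. ckern a n x z) has_integral 1) {0..pi}"
proof -
  have "((\<lambda>z. (2 / pi) * (1/2 + (\<Sum>k=1..n. a k * cos (real k * x) * cos (real k * z)))) has_integral
      (2 / pi) * ((pi - 0) * (1/2) + (\<Sum>k=1..n. a k * cos (real k * x) * (if k = 0 then pi else 0)))) {0..pi}"
    using has_integral_const_real[of "1/2::real" 0 pi]
    by (intro has_integral_mult_right has_integral_add has_integral_sum has_integral_cos_nat) auto
  moreover have "(\<Sum>k=1..n. a k * cos (real k * x) * (if k = 0 then pi else 0)) = 0" by (intro sum.neutral) auto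
  ultimately show ?thesis unfolding ckern_product[symmetric] by simp
qed

text \<open>The terms in x - z and x + z over [0,pi] together make up a full period. Multiplication
  by 1 - cos shifts frequencies by one, so only the constant mode and k = 1 survive integration: 1 -
  a 1 measures how far the kernel is from a point mass.\<close>

lemma cospoly_weighted_integral:
  assumes "n \<ge> 1"
  shows "((\<lambda>z. cospoly a n (x - z) * (1 - cos (x - z)) + cospoly a n (x + z) * (1 - cos (x + z))) has_integral pi * (1 - a 1)) {0..pi}"
proof -
  let ?s = "\<lambda>k z. cos (real k * (x - z)) + cos (real k * (x + z))"
  have id: "cospoly a n v * (1 - cos v) = cospoly a n v - (1/2 * cos (real 1 * v) + (\<Sum>k=1..n. a k * (1/2) * (cos (real (k+1) * v) + cos (real (k-1) * v))))" for v
  proof -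
    have "(\<Sum>k=1..n. a k * cos (real k * v)) * cos v = (\<Sum>k=1..n. a k * (1/2) * (cos (real (k+1) * v) + cos (real (k-1) * v)))"
      unfolding sum_distrib_right
    proof (intro sum.cong refl)
      fix k assume "k \<in> {1..n}"
      then have "real (k - 1) * v = real k * v - v" "real (k + 1) * v = real k * v + v" by (auto simp: of_nat_diff algebra_simps)
      then show "a k * cos (real k * v) * cos v = a k * (1/2) * (cos (real (k+1) * v) + cos (real (k-1) * v))"
        by (simp add: cos_add cos_diff)
    qed
    moreover have "(1/2 + X) * (1 - c) = (1/2 + X) - (1/2 * c + X * c)" for X c :: real by (simp add: field_simps)
    ultimately show ?thesis by (simp only: cospoly_def of_nat_1 mult_1_left)
  qed
  have eq: "cospoly a n (x - z) * (1 - cos (x - z)) + cospoly a n (x + z) * (1 - cos (x + z)) =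
      pi * ckern a n x z - (1/2 * ?s 1 z + (\<Sum>k=1..n. a k * (1/2) * (?s (k+1) z + ?s (k-1) z)))" for z
  proof -
    have "pi * ckern a n x z = cospoly a n (x - z) + cospoly a n (x + z)" by (simp add: ckern_def)
    then show ?thesis unfolding id by (simp add: sum.distrib algebra_simps)
  qed
  have s: "(\<Sum>k=1..n. a k * (1/2) * ((if k + 1 = 0 then 2 * pi else 0) + (if k - 1 = 0 then 2 * pi else 0))) = pi * a 1"
  proof -
    have "(\<Sum>k=1..n. a k * (1/2) * ((if k + 1 = 0 then 2 * pi else 0) + (if k - 1 = 0 then 2 * pi else 0))) = (\<Sum>k\<in>{1..n}. if k = 1 then pi * a 1 else 0)"
      by (intro sum.cong refl) auto
    also have "\<dots> = pi * a 1" using assms by (subst sum.delta) auto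
    finally show ?thesis .
  qed
  have "((\<lambda>z. pi * ckern a n x z - (1/2 * ?s 1 z + (\<Sum>k=1..n. a k * (1/2) * (?s (k+1) z + ?s (k-1) z)))) has_integral
    pi * 1 - (1/2 * (if (1::nat) = 0 then 2 * pi else 0) + (\<Sum>k=1..n. a k * (1/2) * ((if k + 1 = 0 then 2 * pi else 0) + (if k - 1 = 0 then 2 * pi else 0))))) {0..pi}"
    by (intro has_integral_diff has_integral_mult_right ckern_integral has_integral_add has_integral_sum has_integral_sym_cos) auto
  then show ?thesis unfolding eq s by (simp add: algebra_simps)
qed

section \<open>Convergence of positive means by a Korovkin argument\<close>

lemma ckern_weighted:
  assumes pos: "\<And>v. 0 \<le> cospoly a n v" and n: "n \<ge> 1" and x: "x \<in> {0..pi}"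
  shows "integral {0..pi} (\<lambda>z. ckern a n x z * (1 - cos (x - z))) \<le> 1 - a 1"
proof -
  let ?f = "\<lambda>z. (cospoly a n (x - z) * (1 - cos (x - z)) + cospoly a n (x + z) * (1 - cos (x + z))) / pi"
  have i: "(?f has_integral pi * (1 - a 1) / pi) {0..pi}" by (intro has_integral_divide cospoly_weighted_integral n)
  have "integral {0..pi} (\<lambda>z. ckern a n x z * (1 - cos (x - z))) \<le> integral {0..pi} ?f"
  proof (rule integral_le)
    show "(\<lambda>z. ckern a n x z * (1 - cos (x - z))) integrable_on {0..pi}"
      by (intro integrable_continuous_real continuous_intros)
    show "?f integrable_on {0..pi}" using i by (rule has_integral_integrable)
    fix z assume z: "z \<in> {0..pi}"
    have "cospoly a n (x + z) * (1 - cos (x - z)) \<le> cospoly a n (x + z) * (1 - cos (x + z))"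
      using cos_diff_ge_cos_add[OF x z] pos by (intro mult_left_mono) auto
    then have "cospoly a n (x - z) * (1 - cos (x - z)) + cospoly a n (x + z) * (1 - cos (x - z)) \<le>
       cospoly a n (x - z) * (1 - cos (x - z)) + cospoly a n (x + z) * (1 - cos (x + z))" by simp
    from divide_right_mono[OF this pi_ge_zero]
    show "ckern a n x z * (1 - cos (x - z)) \<le> ?f z" by (simp add: ckern_def distrib_right)
  qed
  also have "\<dots> = 1 - a 1" using integral_unique[OF i] by simp
  finally show ?thesis .
qed

lemma ckern_nonneg: "(\<And>v. 0 \<le> cospoly a n v) \<Longrightarrow> 0 \<le> ckern a n x z"
  by (simp add: ckern_def)

text \<open>Uniform continuity expressed through the test function 1 - cos, the form that the moment
  bound for the kernel can absorb. With D = 16 L / d^2, a distance of at least d gives D (1 - cos)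
  \<ge> 2 L, the largest possible oscillation.\<close>

lemma modulus_cos:
  assumes w: "continuous_on {0..pi} w" and e: "e > 0"
  obtains D where "D \<ge> 0" "\<And>x y. x \<in> {0..pi} \<Longrightarrow> y \<in> {0..pi} \<Longrightarrow> \<bar>w x - w y\<bar> \<le> e + D * (1 - cos (x - y))"
proof -
  have "uniformly_continuous_on {0..pi} w" using w by (intro compact_uniformly_continuous) auto
  then obtain d where d: "d > 0" "\<And>x y. x \<in> {0..pi} \<Longrightarrow> y \<in> {0..pi} \<Longrightarrow> \<bar>y - x\<bar> < d \<Longrightarrow> \<bar>w y - w x\<bar> < e"
    using e unfolding uniformly_continuous_on_def dist_real_def by metis
  have "bounded (w ` {0..pi})" using w by (intro compact_imp_bounded compact_continuous_image) auto
  then obtain L where L: "L > 0" "\<And>x. x \<in> {0..pi} \<Longrightarrow> \<bar>w x\<bar> \<le> L" unfolding bounded_pos by force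
  define D where "D = 16 * L / d\<^sup>2"
  show thesis
  proof (rule that[of D])
    show "D \<ge> 0" using L by (simp add: D_def)
    fix x y assume xy: "x \<in> {0..pi}" "y \<in> {0..pi}"
    have c: "(x - y)\<^sup>2 / 4 \<le> 2 - 2 * cos (x - y)" using xy by (intro one_minus_cos_ge) auto
    show "\<bar>w x - w y\<bar> \<le> e + D * (1 - cos (x - y))"
    proof (cases "\<bar>x - y\<bar> < d")
      case True
      then have "\<bar>w x - w y\<bar> < e" using d(2)[of y x] xy by auto
      moreover have "0 \<le> D * (1 - cos (x - y))" using \<open>D \<ge> 0\<close> by simp
      ultimately show ?thesis by linarith
    next
      case False
      then have "d\<^sup>2 \<le> (x - y)\<^sup>2" using d(1) by (simp add: abs_le_square_iff[symmetric])
      then have "d\<^sup>2 / 8 \<le> 1 - cos (x - y)" using c by linarith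
      then have "D * (d\<^sup>2 / 8) \<le> D * (1 - cos (x - y))" using \<open>D \<ge> 0\<close> by (intro mult_left_mono)
      moreover have "D * (d\<^sup>2 / 8) = 2 * L" using d(1) by (simp add: D_def)
      ultimately show ?thesis using L(2)[OF xy(1)] L(2)[OF xy(2)] e by linarith
    qed
  qed
qed

definition cmean :: "(nat \<Rightarrow> real) \<Rightarrow> nat \<Rightarrow> (real \<Rightarrow> real) \<Rightarrow> real \<Rightarrow> real" where
  "cmean a n w x = integral {0..pi} (\<lambda>z. ckern a n x z * w z)"

text \<open>A positive kernel of mass one turns the modulus of continuity into e plus D times its 1
  - cos moment, and this moment is at most 1 - a 1.\<close>

lemma cmean_close:
  assumes pos: "\<And>v. 0 \<le> cospoly a n v" and n: "n \<ge> 1" and x: "x \<in> {0..pi}" and w: "continuous_on {0..pi} w"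
    and D: "D \<ge> 0" "\<And>y. y \<in> {0..pi} \<Longrightarrow> \<bar>w x - w y\<bar> \<le> e + D * (1 - cos (x - y))"
  shows "\<bar>w x - cmean a n w x\<bar> \<le> e + D * (1 - a 1)"
proof -
  have wx: "integral {0..pi} (\<lambda>z. ckern a n x z * w x) = w x"
    using integral_unique[OF has_integral_mult_left[OF ckern_integral[of a n x], of "w x"]] by (simp only: mult_1_left)
  have "\<bar>w x - cmean a n w x\<bar> = \<bar>integral {0..pi} (\<lambda>z. ckern a n x z * w x) - integral {0..pi} (\<lambda>z. ckern a n x z * w z)\<bar>"
    by (simp only: wx cmean_def)
  also have "\<dots> = \<bar>integral {0..pi} (\<lambda>z. ckern a n x z * w x - ckern a n x z * w z)\<bar>"
    by (subst integral_diff) (auto intro!: integrable_continuous_real continuous_intros w)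
  also have "\<dots> \<le> integral {0..pi} (\<lambda>z. e * ckern a n x z + D * (ckern a n x z * (1 - cos (x - z))))"
  proof (rule integral_abs_bound_Ioo)
    show "(\<lambda>z. ckern a n x z * w x - ckern a n x z * w z) integrable_on {0..pi}"
      by (intro integrable_continuous_real continuous_intros w)
    show "(\<lambda>z. e * ckern a n x z + D * (ckern a n x z * (1 - cos (x - z)))) integrable_on {0..pi}"
      by (intro integrable_continuous_real continuous_intros)
    fix z assume "z \<in> {0<..<pi}"
    then have z: "z \<in> {0..pi}" by simp
    have k: "0 \<le> ckern a n x z" by (rule ckern_nonneg[OF pos])
    have "\<bar>ckern a n x z * w x - ckern a n x z * w z\<bar> = ckern a n x z * \<bar>w x - w z\<bar>"
      using k by (simp add: right_diff_distrib[symmetric] abs_mult)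
    also have "\<dots> \<le> ckern a n x z * (e + D * (1 - cos (x - z)))" by (intro mult_left_mono D k z)
    finally show "\<bar>ckern a n x z * w x - ckern a n x z * w z\<bar> \<le> e * ckern a n x z + D * (ckern a n x z * (1 - cos (x - z)))"
      by (simp add: algebra_simps)
  qed
  also have "\<dots> = e * 1 + D * integral {0..pi} (\<lambda>z. ckern a n x z * (1 - cos (x - z)))"
    using integral_unique[OF ckern_integral[of a n x]]
    by (subst integral_add) (auto intro!: integrable_continuous_real continuous_intros)
  also have "\<dots> \<le> e + D * (1 - a 1)" using ckern_weighted[OF pos n x] D by (auto intro: mult_left_mono)
  finally show ?thesis .
qed

lemma cmean_bound:
  assumes pos: "\<And>v. 0 \<le> cospoly a n v" and w: "continuous_on {0..pi} w" "\<And>x. x \<in> {0..pi} \<Longrightarrow> \<bar>w x\<bar> \<le> M"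
  shows "\<bar>cmean a n w x\<bar> \<le> M"
proof -
  have "\<bar>cmean a n w x\<bar> \<le> integral {0..pi} (\<lambda>z. ckern a n x z * M)"
    unfolding cmean_def
  proof (rule integral_abs_bound_Ioo)
    show "\<bar>ckern a n x z * w z\<bar> \<le> ckern a n x z * M" if "z \<in> {0<..<pi}" for z
      using w(2)[of z] that ckern_nonneg[OF pos, of x z] by (auto simp: abs_mult intro: mult_left_mono)
  qed (intro integrable_continuous_real continuous_intros w)+
  also have "\<dots> = M" using integral_unique[OF has_integral_mult_left[OF ckern_integral[of a n x], of M]] by (simp only: mult_1_left)
  finally show ?thesis .
qed

lemma cmean_diff:
  assumes "continuous_on {0..pi} w" "continuous_on {0..pi} w'"
  shows "cmean a n (\<lambda>z. w z - w' z) x = cmean a n w x - cmean a n w' x"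
  unfolding cmean_def right_diff_distrib
  by (intro integral_diff integrable_continuous_real continuous_intros assms)

lemma skern_boundary: "skern a n x 0 = 0" "skern a n x pi = 0"
proof -
  show "skern a n x 0 = 0" by (simp add: skern_def)
  have "x + pi = (x - pi) + 2 * pi" by simp
  then have "cospoly a n (x + pi) = cospoly a n (x - pi)" using cospoly_periodic by metis
  then show "skern a n x pi = 0" by (simp add: skern_def)
qed

text \<open>The x-derivative of \<open>ckern\<close> is minus the z-derivative of
  \<open>skern\<close>, so an integration by parts moves the derivative onto \<open>w\<close>; the
  boundary terms vanish with \<open>skern\<close>.\<close>

lemma cmean_deriv:
  assumes w: "\<And>z. z \<in> {0..pi} \<Longrightarrow> (w has_real_derivative w' z) (at z within {0..pi})" "continuous_on {0..pi} w'"
    and x: "x \<in> {0..pi}"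
  shows "(cmean a n w has_real_derivative integral {0..pi} (\<lambda>z. skern a n x z * w' z)) (at x within {0..pi})"
proof -
  have cw: "continuous_on {0..pi} w" by (rule DERIV_continuous_on[OF w(1)])
  define d where "d = (\<lambda>v. \<Sum>k=1..n. - a k * real k * sin (real k * v))"
  have dc: "continuous_on S (\<lambda>x. d (f x))" if "continuous_on S f" for S and f :: "'b::t2_space \<Rightarrow> real"
    unfolding d_def by (intro continuous_intros that)
  have cd: "(cospoly a n has_real_derivative d v) (at v within S)" for v S unfolding d_def by (rule cospoly_deriv)
  let ?k = "\<lambda>x z. (d (x - z) + d (x + z)) / pi"
  have kx: "((\<lambda>x. ckern a n x z) has_real_derivative ?k x z) (at x within {0..pi})" for x z
    unfolding ckern_def
    by (rule DERIV_cdivide DERIV_add)+ (auto intro!: DERIV_cong[OF DERIV_chain2[OF cd]] derivative_eq_intros)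
  have sz: "(skern a n x has_real_derivative - ?k x z) (at z within {0..pi})" for z
    unfolding skern_def[abs_def]
    by (rule DERIV_cong[OF DERIV_cdivide[OF DERIV_diff[OF DERIV_chain2[OF cd, of "\<lambda>z. x - z" "-1"] DERIV_chain2[OF cd, of "\<lambda>z. x + z" 1]]]])
       (auto intro!: derivative_eq_intros simp: diff_divide_distrib add_divide_distrib)
  have "((\<lambda>x. integral (cbox 0 pi) (\<lambda>z. ckern a n x z * w z)) has_real_derivative integral (cbox 0 pi) (\<lambda>z. ?k x z * w z)) (at x within {0..pi})"
  proof (rule leibniz_rule_field_derivative)
    show "((\<lambda>x. ckern a n x z * w z) has_real_derivative ?k x z * w z) (at x within {0..pi})" for x z
      by (rule DERIV_cmult_right[OF kx])
    show "(\<lambda>z. ckern a n x z * w z) integrable_on cbox 0 pi" for x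
      unfolding cbox_interval by (intro integrable_continuous_real continuous_intros cw)
    show "continuous_on ({0..pi} \<times> cbox 0 pi) (\<lambda>(x, z). ?k x z * w z)"
      unfolding case_prod_unfold by (intro continuous_intros dc continuous_on_compose2[OF cw]) auto
  qed (use x in auto)
  moreover have "integral {0..pi} (\<lambda>z. ?k x z * w z) = integral {0..pi} (\<lambda>z. skern a n x z * w' z)"
  proof -
    have "((\<lambda>z. skern a n x z * w' z - ?k x z * w z) has_integral skern a n x pi * w pi - skern a n x 0 * w 0) {0..pi}"
    proof (rule fundamental_theorem_of_calculus)
      fix z assume z: "z \<in> {0..pi}"
      show "((\<lambda>z. skern a n x z * w z) has_vector_derivative skern a n x z * w' z - ?k x z * w z) (at z within {0..pi})"
        unfolding has_real_derivative_iff_has_vector_derivative[symmetric]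
        by (rule DERIV_cong[OF DERIV_mult[OF sz w(1)[OF z]]]) (simp add: algebra_simps)
    qed simp
    then have "integral {0..pi} (\<lambda>z. skern a n x z * w' z - ?k x z * w z) = 0" by (simp add: integral_unique skern_boundary)
    then show ?thesis
      by (subst (asm) integral_diff) (auto intro!: integrable_continuous_real continuous_intros dc w cw)
  qed
  ultimately show ?thesis by (simp add: cmean_def[abs_def])
qed

lemma abs_skern_le:
  assumes "\<And>v. 0 \<le> cospoly a n v" shows "\<bar>skern a n x z\<bar> \<le> ckern a n x z"
proof -
  have "\<bar>cospoly a n (x - z) - cospoly a n (x + z)\<bar> \<le> cospoly a n (x - z) + cospoly a n (x + z)"
    using assms[of "x - z"] assms[of "x + z"] by linarith
  then show ?thesis by (simp add: skern_def ckern_def abs_divide divide_right_mono)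
qed

text \<open>Interpolation: at scale \<open>\<tau> = \<bar>x - y\<bar>\<close> split \<open>w\<close> into its Steklov average, which is Lipschitz,
  and a small remainder.\<close>
lemma cmean_hoelder:
  assumes pos: "\<And>v. 0 \<le> cospoly a n v" and w: "continuous_on {0..pi} w"
    and H: "\<And>x y. x \<in> {0..pi} \<Longrightarrow> y \<in> {0..pi} \<Longrightarrow> \<bar>w x - w y\<bar> \<le> M * \<bar>x - y\<bar> powr \<gamma>" and g: "0 < \<gamma>" "0 \<le> M"
    and xy: "x \<in> {0..pi}" "y \<in> {0..pi}"
  shows "\<bar>cmean a n w x - cmean a n w y\<bar> \<le> 3 * M * \<bar>x - y\<bar> powr \<gamma>"
proof (cases "x = y")
  case False
  define t where "t = \<bar>x - y\<bar>"
  have t: "t > 0" using False by (simp add: t_def)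
  \<comment> \<open>Constant extension of \<open>w\<close> beyond [0,pi] by clamping the argument,
    so that averages over [z, z + t] make sense near pi. Clamping is 1-Lipschitz and keeps the
    Hoelder constant.\<close>
  define e where "e = (\<lambda>z. w (min (max z 0) pi))"
  have ec: "continuous_on S (\<lambda>z. e (f z))" if "continuous_on S f" for S and f :: "real \<Rightarrow> real"
    unfolding e_def by (rule continuous_on_compose2[OF w]) (auto intro!: continuous_intros that)
  have eH: "\<bar>e r - e s\<bar> \<le> M * t powr \<gamma>" if "\<bar>r - s\<bar> \<le> t" for r s
  proof -
    have "\<bar>min (max r 0) pi - min (max s 0) pi\<bar> \<le> t" using that by linarith
    moreover have "\<bar>e r - e s\<bar> \<le> M * \<bar>min (max r 0) pi - min (max s 0) pi\<bar> powr \<gamma>"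
      unfolding e_def by (intro H) auto
    ultimately show ?thesis using g by (meson abs_ge_zero mult_left_mono order_trans powr_mono2 less_imp_le)
  qed
  define b where "b = (\<lambda>z. integral {0..t} (\<lambda>r. e (z + r)) / t)"
  define I where "I = (\<lambda>z. integral {0..z} e)"
  have e0: "continuous_on {0..2 * pi + 1} e" using ec[of _ "\<lambda>z. z"] by (simp add: continuous_on_id)
  have tpi: "t \<le> pi" using xy by (auto simp: t_def)
  have b_eq: "b z = (I (z + t) - I z) / t" if "z \<in> {0..pi}" for z
  proof -
    have "integral {0..t} (\<lambda>r. e (z + r)) = integral {z..z + t} e"
    proof -
      have "(e has_integral integral {z..z+t} e) (cbox z (z+t))"
        using ec[of "{z..z+t}" "\<lambda>z. z"] by (auto intro!: integrable_integral integrable_continuous_real)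
      from has_integral_affinity[OF this, of 1 z] show ?thesis
        by (simp add: image_affinity_atLeastAtMost add.commute integral_unique)
    qed
    moreover have "I z + integral {z..z+t} e = I (z + t)"
      unfolding I_def using that t ec[of "{0..z+t}" "\<lambda>z. z"]
      by (intro Henstock_Kurzweil_Integration.integral_combine integrable_continuous_real) auto
    ultimately show ?thesis by (simp add: b_def)
  qed
  have Id: "(I has_real_derivative e z) (at z within {0..2*pi+1})" if "z \<in> {0..2 * pi + 1}" for z
    unfolding I_def using integral_has_real_derivative[OF e0 that] .
  have bd: "(b has_real_derivative (e (z + t) - e z) / t) (at z within {0..pi})" if z: "z \<in> {0..pi}" for z
  proof -
    have "((\<lambda>z. I (z + t)) has_real_derivative e (z + t) * 1) (at z within {0..pi})"
    proof -
      have "((\<lambda>z. z + t) has_real_derivative 1) (at z within {0..pi})" by (auto intro!: derivative_eq_intros)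
      moreover have "(I has_real_derivative e (z + t)) (at (z + t) within (\<lambda>z. z + t) ` {0..pi})"
        by (rule DERIV_subset[OF Id]) (use z t tpi pi_gt3 in auto)
      ultimately show ?thesis using DERIV_image_chain[of I "e (z + t)" "\<lambda>z. z + t" z "{0..pi}" 1] by (simp add: o_def)
    qed
    moreover have "(I has_real_derivative e z) (at z within {0..pi})"
      by (rule DERIV_subset[OF Id]) (use z in auto)
    ultimately have "((\<lambda>z. (I (z + t) - I z) / t) has_real_derivative (e (z + t) - e z) / t) (at z within {0..pi})"
      by (intro DERIV_cdivide DERIV_diff) simp_all
    then show ?thesis 
      by (rule has_field_derivative_transform_within[OF _ zero_less_one z]) (simp add: b_eq)
  qed
  have bd': "continuous_on {0..pi} (\<lambda>z. (e (z + t) - e z) / t)" using t by (intro continuous_intros ec) auto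
  have bdb: "\<bar>(e (z + t) - e z) / t\<bar> \<le> M * t powr \<gamma> / t" for z
    using eH[of "z + t" z] t by (simp add: abs_divide divide_right_mono)
  have cb: "continuous_on {0..pi} b" by (rule DERIV_continuous_on[OF bd])
  have wb: "\<bar>w z - b z\<bar> \<le> M * t powr \<gamma>" if z: "z \<in> {0..pi}" for z
  proof -
    have "w z - b z = integral {0..t} (\<lambda>r. e z - e (z + r)) / t"
    proof -
      have "integral {0..t} (\<lambda>r. e z - e (z + r)) = t * e z - integral {0..t} (\<lambda>r. e (z + r))"
        using t by (subst integral_diff) (auto intro!: integrable_continuous_real continuous_intros ec)
      moreover have "e z = w z" using z by (simp add: e_def)
      ultimately show ?thesis using t by (simp add: b_def diff_divide_distrib)
    qed
    moreover have "\<bar>integral {0..t} (\<lambda>r. e z - e (z + r))\<bar> \<le> integral {0..t} (\<lambda>r. M * t powr \<gamma>)"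
    proof (rule integral_abs_bound_Ioo)
      show "\<bar>e z - e (z + r)\<bar> \<le> M * t powr \<gamma>" if "r \<in> {0<..<t}" for r using that by (intro eH) auto
    qed (auto intro!: integrable_continuous_real continuous_intros ec)
    ultimately show ?thesis using t by (simp add: abs_divide divide_le_eq mult_ac)
  qed
  have "\<bar>cmean a n b x - cmean a n b y\<bar> \<le> M * t powr \<gamma> / t * \<bar>x - y\<bar>"
  proof -
    have "\<bar>integral {0..pi} (\<lambda>z. skern a n x z * ((e (z + t) - e z) / t))\<bar> \<le> M * t powr \<gamma> / t" for x
    proof -
      have "\<bar>integral {0..pi} (\<lambda>z. skern a n x z * ((e (z + t) - e z) / t))\<bar> \<le> integral {0..pi} (\<lambda>z. ckern a n x z * (M * t powr \<gamma> / t))"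
      proof (rule integral_abs_bound_Ioo)
        show "\<bar>skern a n x z * ((e (z + t) - e z) / t)\<bar> \<le> ckern a n x z * (M * t powr \<gamma> / t)" for z
          unfolding abs_mult using abs_skern_le[OF pos, of x z] bdb[of z] ckern_nonneg[OF pos, of x z] by (intro mult_mono) auto
      qed (use t in \<open>auto intro!: integrable_continuous_real continuous_intros ec\<close>)
      also have "\<dots> = M * t powr \<gamma> / t"
        using integral_unique[OF has_integral_mult_left[OF ckern_integral[of a n x], of "M * t powr \<gamma> / t"]] by (simp only: mult_1_left)
      finally show ?thesis .
    qed
    then have bnd: "norm (integral {0..pi} (\<lambda>z. skern a n x z * ((e (z + t) - e z) / t))) \<le> M * t powr \<gamma> / t" for x
      unfolding real_norm_def .
    show ?thesis
      unfolding real_norm_def[symmetric]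
      by (rule field_differentiable_bound[where S = "{0..pi}", OF _ cmean_deriv[OF bd bd'] bnd]) (use xy in auto)
  qed
  also have "M * t powr \<gamma> / t * \<bar>x - y\<bar> = M * t powr \<gamma>" using t by (simp add: t_def)
  finally have 1: "\<bar>cmean a n b x - cmean a n b y\<bar> \<le> M * t powr \<gamma>" .
  have 2: "\<bar>cmean a n w x - cmean a n b x\<bar> \<le> M * t powr \<gamma>" for x
    using cmean_bound[OF pos continuous_on_diff[OF w cb] wb, of x] by (simp add: cmean_diff[OF w cb])
  \<comment> \<open>One share for the Steklov average, whose mean has derivative at most M
    t^\<gamma> / t over the distance t, and one for the remainder at each of the two points.\<close>
  have "\<bar>cmean a n w x - cmean a n w y\<bar> \<le> 3 * (M * t powr \<gamma>)" using 1 2[of x] 2[of y] by linarith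
  then show ?thesis by (simp add: t_def)
qed simp

section \<open>Fejer means of a path and its Gaussian coefficients\<close>

definition path_xi :: "(real \<Rightarrow> real) \<Rightarrow> nat \<Rightarrow> real" where
  "path_xi w k = - integral {0..pi} (\<lambda>y. deriv (mk k) y * w y)"

lemma xi_eq_path_xi: "xi W k \<omega> = path_xi (W \<omega>) k"
  by (simp add: xi_def path_xi_def)

lemma mk_has_derivative: "(mk k has_real_derivative sqrt (2/pi) * (real k * cos (real k * y))) (at y within S)"
  unfolding mk_def[abs_def] by (auto intro!: derivative_eq_intros)

lemma deriv_mk: "deriv (mk k) y = sqrt (2/pi) * (real k * cos (real k * y))"
  using mk_has_derivative[of k y UNIV] by (simp add: DERIV_imp_deriv)

lemma mk_continuous: "continuous_on S (mk k)"
  using DERIV_continuous_on[OF mk_has_derivative] by blast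

lemma path_xi_cos:
  "path_xi w k = - (sqrt (2/pi) * real k) * integral {0..pi} (\<lambda>z. cos (real k * z) * w z)"
proof -
  have "integral {0..pi} (\<lambda>y. deriv (mk k) y * w y) = integral {0..pi} (\<lambda>z. (sqrt (2/pi) * real k) * (cos (real k * z) * w z))"
    by (rule integral_cong) (simp add: deriv_mk)
  then show ?thesis by (simp add: path_xi_def)
qed

text \<open>Differentiating cos(k x) produces -k sin(k x), and -k times the cosine coefficient of
  \<open>w\<close> is, up to normalisation, the pathwise integral of \<open>mk k\<close> against the
  path. This links averaged paths to Gaussian coefficients.\<close>

lemma cmean_has_derivative_sum:
  assumes w: "continuous_on {0..pi} w"
  shows "(cmean a n w has_real_derivative (\<Sum>k=1..n. a k * path_xi w k * mk k x)) (at x within S)"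
proof -
  let ?I = "\<lambda>k. integral {0..pi} (\<lambda>z. cos (real k * z) * w z)"
  have eq: "cmean a n w x = (2/pi) * (1/2 * integral {0..pi} w + (\<Sum>k=1..n. a k * cos (real k * x) * ?I k))" for x
  proof -
    have "cmean a n w x = integral {0..pi} (\<lambda>z. (2/pi) * (1/2 * w z + (\<Sum>k=1..n. a k * cos (real k * x) * (cos (real k * z) * w z))))"
      unfolding cmean_def ckern_product
      by (rule integral_cong) (simp add: distrib_right sum_distrib_right mult.assoc)
    also have "((\<lambda>z. (2/pi) * (1/2 * w z + (\<Sum>k=1..n. a k * cos (real k * x) * (cos (real k * z) * w z)))) has_integral
       (2/pi) * (1/2 * integral {0..pi} w + (\<Sum>k=1..n. a k * cos (real k * x) * ?I k))) {0..pi}"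
      by (intro has_integral_mult_right has_integral_add has_integral_sum integrable_integral integrable_continuous_real continuous_intros w) auto
    then have "integral {0..pi} (\<lambda>z. (2/pi) * (1/2 * w z + (\<Sum>k=1..n. a k * cos (real k * x) * (cos (real k * z) * w z)))) =
       (2/pi) * (1/2 * integral {0..pi} w + (\<Sum>k=1..n. a k * cos (real k * x) * ?I k))" by (rule integral_unique)
    finally show ?thesis .
  qed
  have "((\<lambda>x. (2/pi) * (1/2 * integral {0..pi} w + (\<Sum>k=1..n. a k * cos (real k * x) * ?I k))) has_real_derivative
     (2/pi) * (\<Sum>k=1..n. - (a k * (real k * sin (real k * x))) * ?I k)) (at x within S)"
    by (auto intro!: derivative_eq_intros sum.cong)
  moreover have "(2/pi) * (\<Sum>k=1..n. - (a k * (real k * sin (real k * x))) * ?I k) = (\<Sum>k=1..n. a k * path_xi w k * mk k x)"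
    unfolding sum_distrib_left
  proof (intro sum.cong refl)
    fix k
    have "sqrt (2/pi) * sqrt (2/pi) = 2/pi" by simp
    moreover have "a k * path_xi w k * mk k x = - (a k * (real k * sin (real k * x))) * ?I k * (sqrt (2/pi) * sqrt (2/pi))"
      by (simp only: path_xi_cos mk_def) (simp only: mult_ac mult_minus_left mult_minus_right)
    ultimately show "2 / pi * (- (a k * (real k * sin (real k * x))) * ?I k) = a k * path_xi w k * mk k x" by (simp only: mult.commute)
  qed
  moreover have "cmean a n w = (\<lambda>x. (2/pi) * (1/2 * integral {0..pi} w + (\<Sum>k=1..n. a k * cos (real k * x) * ?I k)))"
    by (rule ext) (rule eq)
  ultimately show ?thesis by (simp only:)
qed

lemma hoelder_continuous:
  assumes "\<And>x y. x \<in> S \<Longrightarrow> y \<in> S \<Longrightarrow> \<bar>w x - w y\<bar> \<le> M * \<bar>x - y\<bar> powr g" "0 < g"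
  shows "continuous_on S (w :: real \<Rightarrow> real)"
  unfolding continuous_on_def
proof
  fix x assume x: "x \<in> S"
  have "((\<lambda>y. M * \<bar>y - x\<bar> powr g) \<longlongrightarrow> M * \<bar>x - x\<bar> powr g) (at x within S)"
    using assms(2) by (intro tendsto_intros) auto
  then have "((\<lambda>y. M * \<bar>y - x\<bar> powr g) \<longlongrightarrow> 0) (at x within S)" by simp
  then have "((\<lambda>y. w y - w x) \<longlongrightarrow> 0) (at x within S)"
  proof (rule Lim_null_comparison[rotated])
    show "\<forall>\<^sub>F y in at x within S. norm (w y - w x) \<le> M * \<bar>y - x\<bar> powr g"
      unfolding eventually_at_topological using assms(1) x by (intro exI[of _ UNIV]) auto
  qed
  then show "(w \<longlongrightarrow> w x) (at x within S)" by (simp add: LIM_zero_iff)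
qed

text \<open>The shift to \<open>Suc n\<close> keeps at least the frequency 1 in the mean, as the
  convergence estimates demand.\<close>

definition fmean :: "nat \<Rightarrow> (real \<Rightarrow> real) \<Rightarrow> real \<Rightarrow> real" where
  "fmean n w = cmean (fejw (Suc n)) (Suc n) w"

lemma fmean_uniform:
  assumes w: "continuous_on {0..pi} w" and e: "e > 0"
  shows "\<exists>N. \<forall>n\<ge>N. \<forall>x\<in>{0..pi}. \<bar>w x - fmean n w x\<bar> \<le> e"
proof -
  obtain D where D: "D \<ge> 0" "\<And>x y. x \<in> {0..pi} \<Longrightarrow> y \<in> {0..pi} \<Longrightarrow> \<bar>w x - w y\<bar> \<le> e/2 + D * (1 - cos (x - y))"
    using modulus_cos[OF w, of "e/2"] e by auto
  have "(\<lambda>n. D * (1 - fejw (Suc n) 1)) \<longlonglongrightarrow> D * (1 - 1)"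
    by (intro tendsto_intros LIMSEQ_Suc[OF fejw_tendsto])
  then have "\<forall>\<^sub>F n in sequentially. D * (1 - fejw (Suc n) 1) < e/2"
    using e by (intro order_tendstoD(2)) auto
  then obtain N where N: "\<And>n. n \<ge> N \<Longrightarrow> D * (1 - fejw (Suc n) 1) < e/2" unfolding eventually_sequentially by blast
  show ?thesis
  proof (intro exI[of _ N] allI impI ballI)
    fix n x assume "N \<le> n" "x \<in> {0..pi}"
    then have "\<bar>w x - fmean n w x\<bar> \<le> e/2 + D * (1 - fejw (Suc n) 1)"
      unfolding fmean_def by (intro cmean_close fejer_nonneg w D) auto
    then show "\<bar>w x - fmean n w x\<bar> \<le> e" using N[OF \<open>N \<le> n\<close>] by linarith
  qed
qed

text \<open>Uniform convergence, interpolated with a common Hoelder bound of order 3/8, gives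
  convergence of order 1/4, since 2/3 * 3/8 = 1/4. This loss is why the paths are first taken with a
  better order than the operator asks for.\<close>

lemma fmean_noise_bounds:
  assumes H: "\<And>x y. x \<in> {0..pi} \<Longrightarrow> y \<in> {0..pi} \<Longrightarrow> \<bar>w x - w y\<bar> \<le> M0 * \<bar>x - y\<bar> powr (3/8)" and M0: "0 \<le> M0"
  obtains M \<eta> where "M > 0" "noise_bound M w" "\<eta> \<longlonglongrightarrow> (0::real)" "\<And>n. noise_bound M (fmean n w)"
    "\<And>n. noise_bound (\<eta> n) (\<lambda>y. w y - fmean n w y)"
proof -
  have w: "continuous_on {0..pi} w" by (rule hoelder_continuous[OF H]) auto
  have "bounded (w ` {0..pi})" using w by (intro compact_imp_bounded compact_continuous_image) auto
  then obtain L where L: "L > 0" "\<And>x. x \<in> {0..pi} \<Longrightarrow> \<bar>w x\<bar> \<le> L" unfolding bounded_pos by force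
  have fb: "\<bar>fmean n w x\<bar> \<le> L" for n x unfolding fmean_def by (rule cmean_bound[OF fejer_nonneg w L(2)])
  have fH: "\<bar>fmean n w x - fmean n w y\<bar> \<le> 3 * M0 * \<bar>x - y\<bar> powr (3/8)" if "x \<in> {0..pi}" "y \<in> {0..pi}" for n x y
    unfolding fmean_def by (rule cmean_hoelder[OF fejer_nonneg w H _ M0 that]) auto
  have fc: "continuous_on {0..pi} (fmean n w)" for n by (rule hoelder_continuous[OF fH]) auto
  \<comment> \<open>Passage from order 3/8 to order 1/4 for distances up to pi; the factor 2 covers
    pi^(1/8).\<close>
  have lower: "r powr (3/8) \<le> 2 * r powr (1/4)" if "0 \<le> r" "r \<le> pi" for r :: real
  proof (cases "r \<le> 1")
    case True
    then have "r powr (3/8) \<le> r powr (1/4)" using that by (intro powr_mono') auto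
    also have "\<dots> \<le> 2 * r powr (1/4)" by simp
    finally show ?thesis .
  next
    case False
    have "r powr (1/8) \<le> 2"
    proof -
      have "r powr (1/8) \<le> (2 powr 8) powr (1/8)" using that pi_less_4 by (intro powr_mono2) (auto simp: powr_numeral)
      then show ?thesis by (simp add: powr_powr)
    qed
    then have "r powr (1/8) * r powr (1/4) \<le> 2 * r powr (1/4)" by (intro mult_right_mono) auto
    then show ?thesis by (simp add: powr_add[symmetric])
  qed
  have dpi: "0 \<le> \<bar>x - y\<bar>" "\<bar>x - y\<bar> \<le> pi" if "x \<in> {0..pi}" "y \<in> {0..pi}" for x y using that by auto
  define M where "M = L + 6 * M0"
  have nb: "noise_bound M f" if "continuous_on {0..pi} f" "\<And>x. x \<in> {0..pi} \<Longrightarrow> \<bar>f x\<bar> \<le> L"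
    "\<And>x y. x \<in> {0..pi} \<Longrightarrow> y \<in> {0..pi} \<Longrightarrow> \<bar>f x - f y\<bar> \<le> 3 * M0 * \<bar>x - y\<bar> powr (3/8)" for f
    unfolding noise_bound_def
  proof (intro conjI ballI that(1))
    fix x assume "x \<in> {0..pi}" then show "\<bar>f x\<bar> \<le> M" using that(2)[of x] M0 by (auto simp: M_def)
  next
    fix x y assume xy: "x \<in> {0..pi}" "y \<in> {0..pi}"
    have "\<bar>f x - f y\<bar> \<le> 3 * M0 * (2 * \<bar>x - y\<bar> powr (1/4))"
      using that(3)[OF xy] mult_left_mono[OF lower[OF dpi[OF xy]], of "3 * M0"] M0 by simp
    also have "\<dots> = (6 * M0) * \<bar>x - y\<bar> powr (1/4)" by simp
    also have "\<dots> \<le> M * \<bar>x - y\<bar> powr (1/4)" using L by (intro mult_right_mono) (auto simp: M_def)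
    finally show "\<bar>f x - f y\<bar> \<le> M * \<bar>x - y\<bar> powr (1/4)" .
  qed
  define e where "e = (\<lambda>n. SUP x\<in>{0..pi}. \<bar>w x - fmean n w x\<bar>)"
  have eb: "\<bar>w x - fmean n w x\<bar> \<le> e n" if "x \<in> {0..pi}" for n x
    unfolding e_def
  proof (rule cSUP_upper[OF that])
    show "bdd_above ((\<lambda>x. \<bar>w x - fmean n w x\<bar>) ` {0..pi})"
      using L(2) fb by (intro bdd_aboveI2[where M = "L + L"]) (meson abs_triangle_ineq4 add_mono order_trans)
  qed
  have e0: "0 \<le> e n" for n using eb[of 0 n] by (auto intro: order_trans[OF abs_ge_zero])
  have elim: "e \<longlonglongrightarrow> 0"
  proof (rule LIMSEQ_I)
    fix r :: real assume r: "r > 0"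
    obtain N where "\<forall>n\<ge>N. \<forall>x\<in>{0..pi}. \<bar>w x - fmean n w x\<bar> \<le> r/2"
      using fmean_uniform[OF w half_gt_zero[OF r]] by blast
    note N = this[rule_format]
    show "\<exists>N. \<forall>n\<ge>N. norm (e n - 0) < r"
    proof (intro exI[of _ N] allI impI)
      fix n assume "N \<le> n"
      then have "e n \<le> r/2" unfolding e_def by (intro cSUP_least N) auto
      then show "norm (e n - 0) < r" using e0[of n] r by simp
    qed
  qed
  \<comment> \<open>The supremum distance plus the interpolation between 2 * e n, which bounds an
    increment of the difference, and its Hoelder constant 4 * M0 = M0 + 3 * M0.\<close>
  define \<eta> where "\<eta> = (\<lambda>n. e n + (2 * e n) powr (1/3) * (4 * M0) powr (2/3))"
  show thesis
  proof (rule that[of M \<eta>])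
    show "M > 0" using L M0 by (simp add: M_def add_pos_nonneg)
    show "noise_bound M w"
    proof (rule nb[OF w L(2)])
      fix x y assume xy: "x \<in> {0..pi}" "y \<in> {0..pi}"
      have "M0 * \<bar>x - y\<bar> powr (3/8) \<le> 3 * M0 * \<bar>x - y\<bar> powr (3/8)" using M0 by (intro mult_right_mono) auto
      then show "\<bar>w x - w y\<bar> \<le> 3 * M0 * \<bar>x - y\<bar> powr (3/8)" using H[OF xy] by linarith
    qed
    show "noise_bound M (fmean n w)" for n by (rule nb[OF fc fb fH])
    have "\<eta> \<longlonglongrightarrow> 0 + (2 * 0) powr (1/3) * (4 * M0) powr (2/3)"
      unfolding \<eta>_def by (intro tendsto_intros elim tendsto_powr' eventuallyI) (auto simp: e0)
    then show "\<eta> \<longlonglongrightarrow> 0" by simp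
    fix n
    have pp: "0 \<le> (2 * e n) powr (1/3) * (4 * M0) powr (2/3)" by simp
    show "noise_bound (\<eta> n) (\<lambda>y. w y - fmean n w y)"
      unfolding noise_bound_def
    proof (intro conjI ballI)
      show "continuous_on {0..pi} (\<lambda>y. w y - fmean n w y)" by (intro continuous_intros w fc)
      fix x assume "x \<in> {0..pi}"
      then show "\<bar>w x - fmean n w x\<bar> \<le> \<eta> n" using eb[of x n] pp unfolding \<eta>_def by linarith
    next
      fix x y assume xy: "x \<in> {0..pi}" "y \<in> {0..pi}"
      let ?p = "\<bar>(w x - fmean n w x) - (w y - fmean n w y)\<bar>"
      have p1: "?p \<le> 2 * e n" using eb[OF xy(1), of n] eb[OF xy(2), of n] by linarith
      have p2: "?p \<le> 4 * M0 * \<bar>x - y\<bar> powr (3/8)" using H[OF xy] fH[OF xy, of n] by linarith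
      from powr_interpolate[OF _ p1 p2, of "2/3"]
      have "?p \<le> (2 * e n) powr (1/3) * (4 * M0 * \<bar>x - y\<bar> powr (3/8)) powr (2/3)" by simp
      also have "\<dots> = (2 * e n) powr (1/3) * (4 * M0) powr (2/3) * \<bar>x - y\<bar> powr (1/4)"
        using M0 by (subst powr_mult) (auto simp: powr_powr)
      also have "\<dots> \<le> \<eta> n * \<bar>x - y\<bar> powr (1/4)" using e0[of n] by (intro mult_right_mono) (auto simp: \<eta>_def)
      finally show "?p \<le> \<eta> n * \<bar>x - y\<bar> powr (1/4)" .
    qed
  qed
qed

section \<open>Squared Fejer weights and the trace kernel\<close>

text \<open>cos(k v) is a polynomial in cos v, by the Chebyshev recursion. It allows an arbitrary
  angle to be replaced by one in [0,pi].\<close>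

lemma cos_nat_cong:
  assumes "cos v = cos v'" shows "cos (real k * v) = cos (real k * v')"
proof (induction k rule: less_induct)
  case (less k)
  show ?case
  proof (cases "k \<ge> 2")
    case False
    then have "k = 0 \<or> k = 1" by auto
    then show ?thesis using assms by auto
  next
    case True
    have rec: "cos (real k * v) = 2 * cos v * cos (real (k-1) * v) - cos (real (k-2) * v)" for v
    proof -
      have "real k * v = real (k-1) * v + v" "real (k-2) * v = real (k-1) * v - v" using True by (simp_all add: of_nat_diff algebra_simps)
      then show ?thesis by (simp add: cos_add cos_diff)
    qed
    show ?thesis unfolding rec[of v] rec[of v'] using less.IH[of "k-1"] less.IH[of "k-2"] True assms by simp
  qed
qed

text \<open>Squaring the coefficients is a convolution of the kernel with itself: the integral over
  y of \<open>cospoly a n y\<close> against the symmetrised kernel at z is pi/2 times the polynomial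
  with squared coefficients, and both factors are nonnegative.\<close>

lemma cospoly_sq_nonneg:
  assumes pos: "\<And>v. 0 \<le> cospoly a n v" shows "0 \<le> cospoly (\<lambda>k. (a k)\<^sup>2) n v"
proof -
  define z where "z = arccos (cos v)"
  have z: "cos v = cos z" by (simp add: z_def)
  let ?A = "\<lambda>y. 1/2 + (\<Sum>k=1..n. a k * cos (real k * y))" and ?B = "\<lambda>y. 1/2 + (\<Sum>l=1..n. a l * cos (real l * z) * cos (real l * y))"
  have ex: "?A y * ?B y = 1/4 + (\<Sum>k=1..n. 1/2 * a k * cos (real k * y)) + (\<Sum>l=1..n. 1/2 * (a l * cos (real l * z)) * cos (real l * y))
     + (\<Sum>k=1..n. \<Sum>l=1..n. a k * (a l * cos (real l * z)) * (cos (real k * y) * cos (real l * y)))" for y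
  proof -
    have "(1/2 + X) * (1/2 + Y) = 1/4 + 1/2 * X + 1/2 * Y + X * Y" for X Y :: real by (simp add: field_simps)
    moreover have "1/2 * (\<Sum>k=1..n. a k * cos (real k * y)) = (\<Sum>k=1..n. 1/2 * a k * cos (real k * y))"
      by (simp only: sum_distrib_left mult.assoc)
    moreover have "1/2 * (\<Sum>l=1..n. a l * cos (real l * z) * cos (real l * y)) = (\<Sum>l=1..n. 1/2 * (a l * cos (real l * z)) * cos (real l * y))"
      by (simp only: sum_distrib_left mult.assoc)
    moreover have "(\<Sum>k=1..n. a k * cos (real k * y)) * (\<Sum>l=1..n. a l * cos (real l * z) * cos (real l * y)) =
       (\<Sum>k=1..n. \<Sum>l=1..n. a k * (a l * cos (real l * z)) * (cos (real k * y) * cos (real l * y)))"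
      unfolding sum_product by (intro sum.cong refl) (simp only: mult_ac)
    ultimately show ?thesis by (simp only:)
  qed
  have i: "((\<lambda>y. 1/4 + (\<Sum>k=1..n. 1/2 * a k * cos (real k * y)) + (\<Sum>l=1..n. 1/2 * (a l * cos (real l * z)) * cos (real l * y))
     + (\<Sum>k=1..n. \<Sum>l=1..n. a k * (a l * cos (real l * z)) * (cos (real k * y) * cos (real l * y)))) has_integral
     (pi - 0) * (1/4) + (\<Sum>k=1..n. 1/2 * a k * (if k = 0 then pi else 0)) + (\<Sum>l=1..n. 1/2 * (a l * cos (real l * z)) * (if l = 0 then pi else 0))
     + (\<Sum>k=1..n. \<Sum>l=1..n. a k * (a l * cos (real l * z)) * (if k = l then pi/2 else 0))) {0..pi}"
    using has_integral_const_real[of "1/4::real" 0 pi]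
    by (intro has_integral_add has_integral_sum has_integral_mult_right has_integral_cos_nat has_integral_cos_cos) auto
  have z1: "(\<Sum>k=1..n. 1/2 * f k * (if k = 0 then pi else 0)) = 0" for f :: "nat \<Rightarrow> real" by (intro sum.neutral) auto
  have z2: "(\<Sum>k=1..n. \<Sum>l=1..n. a k * (a l * cos (real l * z)) * (if k = l then pi/2 else 0)) = pi/2 * (\<Sum>k=1..n. (a k)\<^sup>2 * cos (real k * z))"
  proof -
    have "(\<Sum>l=1..n. a k * (a l * cos (real l * z)) * (if k = l then pi/2 else 0)) = pi/2 * ((a k)\<^sup>2 * cos (real k * z))" if "k \<in> {1..n}" for k
    proof -
      have "(\<Sum>l=1..n. a k * (a l * cos (real l * z)) * (if k = l then pi/2 else 0)) = (\<Sum>l\<in>{1..n}. if k = l then pi/2 * ((a k)\<^sup>2 * cos (real k * z)) else 0)"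
        by (intro sum.cong refl) (auto simp: power2_eq_square)
      then show ?thesis using that by simp
    qed
    then have "(\<Sum>k=1..n. \<Sum>l=1..n. a k * (a l * cos (real l * z)) * (if k = l then pi/2 else 0)) = (\<Sum>k=1..n. pi/2 * ((a k)\<^sup>2 * cos (real k * z)))"
      by (rule sum.cong[OF refl])
    then show ?thesis by (simp only: sum_distrib_left)
  qed
  have tot: "(pi - 0) * (1/4) + 0 + 0 + pi/2 * X = pi/2 * (1/2 + X)" for X by (simp add: field_simps)
  have "((\<lambda>y. ?A y * ?B y) has_integral pi/2 * cospoly (\<lambda>k. (a k)\<^sup>2) n z) {0..pi}"
    using i unfolding ex z1 z2 tot cospoly_def .
  moreover have "0 \<le> ?A y * ?B y" for y
  proof -
    have "?A y = cospoly a n y" by (simp add: cospoly_def)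
    moreover have "0 \<le> ?B y" 
    proof -
      have e: "?B y = pi/2 * ckern a n z y" by (simp add: ckern_product)
      have "0 \<le> pi/2 * ckern a n z y" using ckern_nonneg[OF pos, of z y] by simp
      then show ?thesis unfolding e .
    qed
    ultimately show ?thesis using pos by simp
  qed
  ultimately have "0 \<le> pi/2 * cospoly (\<lambda>k. (a k)\<^sup>2) n z" by (rule has_integral_nonneg)
  then have "0 \<le> cospoly (\<lambda>k. (a k)\<^sup>2) n z" 
    using mult_le_cancel_left_pos[OF pi_half_gt_zero, of 0 "cospoly (\<lambda>k. (a k)\<^sup>2) n z"] by simp
  moreover have "cospoly (\<lambda>k. (a k)\<^sup>2) n v = cospoly (\<lambda>k. (a k)\<^sup>2) n z"
    unfolding cospoly_def cos_nat_cong[OF z] ..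
  ultimately show ?thesis by simp
qed

lemma skern_integral_bound:
  assumes pos: "\<And>v. 0 \<le> cospoly a n v" and g: "continuous_on {0..pi} g" "\<And>z. z \<in> {0..pi} \<Longrightarrow> \<bar>g z\<bar> \<le> G"
  shows "\<bar>integral {0..pi} (\<lambda>z. skern a n y z * g z)\<bar> \<le> G"
proof -
  have "\<bar>integral {0..pi} (\<lambda>z. skern a n y z * g z)\<bar> \<le> integral {0..pi} (\<lambda>z. ckern a n y z * G)"
  proof (rule integral_abs_bound_Ioo)
    show "\<bar>skern a n y z * g z\<bar> \<le> ckern a n y z * G" if "z \<in> {0<..<pi}" for z
      unfolding abs_mult using abs_skern_le[OF pos, of y z] g(2)[of z] ckern_nonneg[OF pos, of y z] that by (intro mult_mono) auto
  qed (intro integrable_continuous_real continuous_intros g)+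
  also have "\<dots> = G" using integral_unique[OF has_integral_mult_left[OF ckern_integral[of a n y], of G]] by (simp only: mult_1_left)
  finally show ?thesis .
qed

text \<open>The two kernels differ by the image term. For y inside the interval, y + z stays away
  from multiples of 2 pi, with 1 - cos (y + z) \<ge> 1 - |cos y|, so the mass of the image term is
  at most a 1 - cos moment divided by 1 - |cos y|. The bound degenerates at the ends.\<close>

lemma skern_close:
  assumes pos: "\<And>v. 0 \<le> cospoly a n v" and n: "n \<ge> 1" and y: "y \<in> {0<..<pi}" and g: "continuous_on {0..pi} g" "\<And>z. z \<in> {0..pi} \<Longrightarrow> \<bar>g z\<bar> \<le> G"
  shows "\<bar>cmean a n g y - integral {0..pi} (\<lambda>z. skern a n y z * g z)\<bar> \<le> 2 * G / (1 - \<bar>cos y\<bar>) * (1 - a 1)"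
proof -
  have cy: "\<bar>cos y\<bar> < 1"
  proof -
    have "cos pi < cos y" "cos y < cos 0" by (rule cos_monotone_0_pi; use y in auto)+
    then show ?thesis by (simp add: abs_less_iff)
  qed
  have G0: "0 \<le> G" using g(2)[of 0] by (auto intro: order_trans[OF abs_ge_zero])
  let ?m = "1 - \<bar>cos y\<bar>"
  have cz: "?m \<le> 1 - cos (y + z)" if z: "z \<in> {0..pi}" for z
  proof (cases "y + z \<le> pi")
    case True
    then have "cos (y + z) \<le> cos y" using y z by (intro cos_monotone_0_pi_le) auto
    then show ?thesis by linarith
  next
    case False
    have "cos (y + z) = cos (2 * pi - (y + z))" by (simp add: cos_diff)
    also have "\<dots> \<le> cos (pi - y)" using y z False by (intro cos_monotone_0_pi_le) auto
    also have "\<dots> = - cos y" by (simp add: cos_diff)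
    finally show ?thesis by linarith
  qed
  let ?h = "\<lambda>z. cospoly a n (y - z) * (1 - cos (y - z)) + cospoly a n (y + z) * (1 - cos (y + z))"
  have hi: "((\<lambda>z. 2 * G / (pi * ?m) * ?h z) has_integral 2 * G / (pi * ?m) * (pi * (1 - a 1))) {0..pi}"
    by (intro has_integral_mult_right cospoly_weighted_integral n)
  have "cmean a n g y - integral {0..pi} (\<lambda>z. skern a n y z * g z) = integral {0..pi} (\<lambda>z. ckern a n y z * g z - skern a n y z * g z)"
    unfolding cmean_def by (intro integral_diff[symmetric] integrable_continuous_real continuous_intros g)
  then have "\<bar>cmean a n g y - integral {0..pi} (\<lambda>z. skern a n y z * g z)\<bar> = \<bar>integral {0..pi} (\<lambda>z. ckern a n y z * g z - skern a n y z * g z)\<bar>"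
    by (rule arg_cong)
  also have "\<dots> \<le> integral {0..pi} (\<lambda>z. 2 * G / (pi * ?m) * ?h z)"
  proof (rule integral_abs_bound_Ioo)
    show "(\<lambda>z. ckern a n y z * g z - skern a n y z * g z) integrable_on {0..pi}"
      by (intro integrable_continuous_real continuous_intros g)
    show "(\<lambda>z. 2 * G / (pi * ?m) * ?h z) integrable_on {0..pi}" using hi by (rule has_integral_integrable)
    fix z assume "z \<in> {0<..<pi}" then have z: "z \<in> {0..pi}" by simp
    have c: "0 \<le> cospoly a n (y + z)" by (rule pos)
    have "ckern a n y z - skern a n y z = 2 / pi * cospoly a n (y + z)"
      by (simp add: ckern_def skern_def add_divide_distrib diff_divide_distrib)
    then have "ckern a n y z * g z - skern a n y z * g z = 2 / pi * (cospoly a n (y + z) * g z)"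
      by (simp only: left_diff_distrib[symmetric] mult.assoc)
    then have "\<bar>ckern a n y z * g z - skern a n y z * g z\<bar> = 2 / pi * (cospoly a n (y + z) * \<bar>g z\<bar>)"
      using c by (simp add: abs_mult)
    also have "\<dots> \<le> 2 / pi * (cospoly a n (y + z) * G)" using c g(2)[OF z] by (intro mult_left_mono) auto
    also have "\<dots> = 2 * G / (pi * ?m) * (cospoly a n (y + z) * ?m)"
    proof -
      have "2 / pi * (c * G) = 2 * G / (pi * m) * (c * m)" if "m \<noteq> 0" for c m :: real using that by simp
      then show ?thesis using cy by (metis less_irrefl right_minus_eq)
    qed
    also have "\<dots> \<le> 2 * G / (pi * ?m) * ?h z"
    proof (rule mult_left_mono)
      have "cospoly a n (y + z) * ?m \<le> cospoly a n (y + z) * (1 - cos (y + z))" using cz[OF z] c by (intro mult_left_mono) auto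
      moreover have "0 \<le> cospoly a n (y - z) * (1 - cos (y - z))" using pos by simp
      ultimately show "cospoly a n (y + z) * ?m \<le> ?h z" by linarith
    qed (use cy G0 in auto)
    finally show "\<bar>ckern a n y z * g z - skern a n y z * g z\<bar> \<le> 2 * G / (pi * ?m) * ?h z" .
  qed
  also have "\<dots> = 2 * G / (pi * ?m) * (pi * (1 - a 1))" by (rule integral_unique[OF hi])
  also have "\<dots> = 2 * G / ?m * (1 - a 1)"
  proof -
    have "2 * G / (pi * m) * (pi * r) = 2 * G / m * r" for m r :: real by simp
    then show ?thesis .
  qed
  finally show ?thesis .
qed

text \<open>The positive multiplier with squared Fejer weights on sine series; this kernel arises
  from the subtracted 1 in the second Hermite polynomial.\<close>

definition sfej :: "nat \<Rightarrow> real \<Rightarrow> real \<Rightarrow> real" where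
  "sfej n = skern (\<lambda>k. (fejw (Suc n) k)\<^sup>2) (Suc n)"

lemma sfej_bound:
  assumes "continuous_on {0..pi} g" "\<And>z. z \<in> {0..pi} \<Longrightarrow> \<bar>g z\<bar> \<le> G"
  shows "\<bar>integral {0..pi} (\<lambda>z. sfej n y z * g z)\<bar> \<le> G"
  unfolding sfej_def by (rule skern_integral_bound[OF cospoly_sq_nonneg[OF fejer_nonneg] assms])

text \<open>Convergence is pointwise in the open interval, since the sine kernel gives 0 at the ends
  for every g. Together with the uniform bound this is enough for dominated convergence.\<close>

lemma sfej_tendsto:
  assumes g: "continuous_on {0..pi} g" and y: "y \<in> {0<..<pi}"
  shows "(\<lambda>n. integral {0..pi} (\<lambda>z. sfej n y z * g z)) \<longlonglongrightarrow> g y"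
proof (rule LIMSEQ_I)
  fix r :: real assume r: "r > 0"
  let ?a = "\<lambda>n k. (fejw (Suc n) k)\<^sup>2"
  have pos: "0 \<le> cospoly (?a n) (Suc n) v" for n v by (rule cospoly_sq_nonneg[OF fejer_nonneg])
  have "bounded (g ` {0..pi})" using g by (intro compact_imp_bounded compact_continuous_image) auto
  then obtain G where G: "\<And>z. z \<in> {0..pi} \<Longrightarrow> \<bar>g z\<bar> \<le> G" unfolding bounded_pos by force
  obtain D where D: "D \<ge> 0" "\<And>x y. x \<in> {0..pi} \<Longrightarrow> y \<in> {0..pi} \<Longrightarrow> \<bar>g x - g y\<bar> \<le> r/2 + D * (1 - cos (x - y))"
    using modulus_cos[OF g, of "r/2"] r by auto
  let ?K = "D + 2 * G / (1 - \<bar>cos y\<bar>)"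
  have "(\<lambda>n. ?K * (1 - ?a n 1)) \<longlonglongrightarrow> ?K * (1 - 1\<^sup>2)"
    by (intro tendsto_intros LIMSEQ_Suc[OF fejw_tendsto])
  then have "\<forall>\<^sub>F n in sequentially. ?K * (1 - ?a n 1) < r/2" using r by (intro order_tendstoD(2)) auto
  then obtain N where N: "\<And>n. n \<ge> N \<Longrightarrow> ?K * (1 - ?a n 1) < r/2" unfolding eventually_sequentially by blast
  show "\<exists>N. \<forall>n\<ge>N. norm (integral {0..pi} (\<lambda>z. sfej n y z * g z) - g y) < r"
  proof (intro exI[of _ N] allI impI)
    fix n assume n: "N \<le> n"
    have y': "y \<in> {0..pi}" using y by simp
    have "\<bar>g y - cmean (?a n) (Suc n) g y\<bar> \<le> r/2 + D * (1 - ?a n 1)"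
      by (rule cmean_close[OF pos _ y' g D(1) D(2)[OF y']]) auto
    moreover have "\<bar>cmean (?a n) (Suc n) g y - integral {0..pi} (\<lambda>z. sfej n y z * g z)\<bar> \<le> 2 * G / (1 - \<bar>cos y\<bar>) * (1 - ?a n 1)"
      unfolding sfej_def by (rule skern_close[OF pos _ y g G]) auto
    ultimately have "\<bar>integral {0..pi} (\<lambda>z. sfej n y z * g z) - g y\<bar> \<le> r/2 + ?K * (1 - ?a n 1)"
      unfolding distrib_right by linarith
    then show "norm (integral {0..pi} (\<lambda>z. sfej n y z * g z) - g y) < r" using N[OF n] by simp
  qed
qed

section \<open>Hermite polynomials and Gaussian moments\<close>

fun hermite_poly :: "nat \<Rightarrow> real poly" where
  "hermite_poly 0 = 1"
| "hermite_poly (Suc n) = [:0, 1:] * hermite_poly n - pderiv (hermite_poly n)"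

lemma deriv_iter_gauss:
  "(deriv ^^ n) (\<lambda>z. exp (- z\<^sup>2 / 2)) = (\<lambda>z. (-1) ^ n * poly (hermite_poly n) z * exp (- z\<^sup>2 / 2))"
proof (induction n)
  case (Suc n)
  have "deriv (\<lambda>z. (-1) ^ n * poly (hermite_poly n) z * exp (- z\<^sup>2 / 2)) z =
      (-1) ^ Suc n * poly (hermite_poly (Suc n)) z * exp (- z\<^sup>2 / 2)" for z :: real
    by (rule DERIV_imp_deriv) (auto intro!: derivative_eq_intros simp: algebra_simps)
  then show ?case using Suc by auto
qed auto

lemma hermite_eq_poly: "hermite n x = poly (hermite_poly n) x"
proof -
  have "hermite n x = exp (x\<^sup>2 / 2) * exp (- x\<^sup>2 / 2) * ((-1) ^ n * (-1) ^ n) * poly (hermite_poly n) x"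
    unfolding hermite_def deriv_iter_gauss by (simp only: mult_ac)
  also have "exp (x\<^sup>2 / 2) * exp (- x\<^sup>2 / 2) = 1" by (simp add: exp_add[symmetric])
  also have "(-1) ^ n * (-1) ^ n = (1::real)"
    using power_mult_distrib[of "-1::real" "-1" n] by simp
  finally show ?thesis by simp
qed

lemma hermite_poly_pderiv: "pderiv (hermite_poly (Suc n)) = smult (real (Suc n)) (hermite_poly n)"
proof (induction n)
  case 0
  show ?case by (simp add: pderiv_pCons)
next
  case (Suc n)
  let ?H = hermite_poly
  have "pderiv (?H (Suc (Suc n))) = pderiv ([:0, 1:] * ?H (Suc n)) - pderiv (pderiv (?H (Suc n)))"
    by (subst hermite_poly.simps(2)) (rule pderiv_diff)
  also have "pderiv ([:0, 1:] * ?H (Suc n)) = [:0, 1:] * pderiv (?H (Suc n)) + ?H (Suc n) * pderiv [:0, 1:]"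
    by (rule pderiv_mult)
  also have "pderiv [:0, 1::real:] = 1" by (simp add: pderiv_pCons)
  finally have "pderiv (?H (Suc (Suc n))) = [:0, 1:] * smult (real (Suc n)) (?H n) + ?H (Suc n) - pderiv (smult (real (Suc n)) (?H n))"
    unfolding Suc by simp
  also have "\<dots> = smult (real (Suc n)) ([:0, 1:] * ?H n - pderiv (?H n)) + ?H (Suc n)"
    unfolding mult_smult_right pderiv_smult smult_diff_right by (simp only: diff_add_eq)
  also have "\<dots> = smult (real (Suc n)) (?H (Suc n)) + ?H (Suc n)" by (simp only: hermite_poly.simps)
  also have "\<dots> = smult (real (Suc n) + 1) (?H (Suc n))" by (simp only: smult_add_left smult_1_left)
  also have "real (Suc n) + 1 = real (Suc (Suc n))" by simp
  finally show ?case .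
qed

definition gauss_expect :: "real poly \<Rightarrow> real" where
  "gauss_expect q = (LINT x|std_normal_distribution. poly q x)"

lemma integrable_std_normal_poly: "integrable std_normal_distribution (poly q)"
proof -
  have "integrable std_normal_distribution (\<lambda>x. \<Sum>i\<le>degree q. coeff q i * x ^ i)"
    by (intro Bochner_Integration.integrable_sum integrable_mult_right integrable_std_normal_distribution_moment)
  then show ?thesis by (simp add: poly_altdef[abs_def])
qed

lemma gauss_expect_add: "gauss_expect (p + q) = gauss_expect p + gauss_expect q"
  unfolding gauss_expect_def poly_add by (intro Bochner_Integration.integral_add integrable_std_normal_poly)

lemma gauss_expect_diff: "gauss_expect (p - q) = gauss_expect p - gauss_expect q"
  unfolding gauss_expect_def poly_diff by (intro Bochner_Integration.integral_diff integrable_std_normal_poly)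

lemma gauss_expect_smult: "gauss_expect (smult c q) = c * gauss_expect q"
  unfolding gauss_expect_def poly_smult by simp

lemma gauss_expect_sum: "gauss_expect (sum f A) = (\<Sum>a\<in>A. gauss_expect (f a))"
proof (induction A rule: infinite_finite_induct)
  case (infinite A) then show ?case by (simp add: gauss_expect_def)
qed (simp_all add: gauss_expect_add, simp add: gauss_expect_def)

lemma gauss_expect_1: "gauss_expect 1 = 1"
  using prob_space.prob_space[OF real_distribution.axioms(1)[OF real_dist_normal_dist]]
  by (simp add: gauss_expect_def)

text \<open>Gaussian integration by parts on monomials, read off from the even moments (2k)! / (2^k
  k!) and the vanishing of the odd ones.\<close>

lemma gauss_moment_rec: "(LINT x|std_normal_distribution. x ^ Suc (Suc m)) = real (Suc m) * (LINT x|std_normal_distribution. x ^ m)"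
proof (cases "even m")
  case True
  then obtain k where m: "m = 2 * k" by auto
  have "Suc (Suc m) = 2 * Suc k" using m by simp
  then have "(LINT x|std_normal_distribution. x ^ Suc (Suc m)) = fact (2 * Suc k) / (2 ^ Suc k * fact (Suc k))"
    using std_normal_distribution_even_moments(1)[of "Suc k"] by simp
  also have "fact (2 * Suc k) = (2 * real (Suc k)) * real (Suc m) * fact (2 * k)" unfolding m by (simp add: algebra_simps)
  also have "2 ^ Suc k * fact (Suc k) = 2 * 2 ^ k * (real (Suc k) * fact k)" by simp
  also have "(2 * real (Suc k)) * real (Suc m) * fact (2 * k) / (2 * 2 ^ k * (real (Suc k) * fact k)) = real (Suc m) * (fact (2 * k) / (2 ^ k * fact k))"
  proof -
    have gen: "(2 * a) * b * F / (2 * p * (a * q)) = b * (F / (p * q))" if "a \<noteq> 0" for a b F p q :: real using that by simp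
    show ?thesis by (rule gen) simp
  qed
  finally show ?thesis using std_normal_distribution_even_moments(1)[of k] m by simp
next
  case False
  then show ?thesis by (simp add: integral_std_normal_distribution_moment_odd del: power_Suc)
qed

lemma pderiv_sum: "pderiv (sum f A) = (\<Sum>a\<in>A. pderiv (f a))"
  by (induction A rule: infinite_finite_induct) (simp_all add: pderiv_add)

text \<open>Stein's identity. By linearity it reduces to monomials, where it is the moment
  recursion.\<close>

lemma gauss_expect_stein: "gauss_expect ([:0, 1:] * q) = gauss_expect (pderiv q)"
proof -
  have mon: "gauss_expect ([:0, 1:] * monom c m) = gauss_expect (pderiv (monom c m))" for c m
  proof (cases m)
    case 0
    have "poly ([:0, 1:] * monom c 0) = (\<lambda>x. c * x ^ 1)" by (rule ext) (simp add: poly_monom mult.commute)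
    then have "gauss_expect ([:0, 1:] * monom c 0) = c * (LINT x|std_normal_distribution. x ^ 1)"
      unfolding gauss_expect_def by (simp only: integral_mult_right_zero)
    also have "\<dots> = 0" using integral_std_normal_distribution_moment_odd[of 1] by simp
    finally show ?thesis using 0 by (simp add: pderiv_monom gauss_expect_def)
  next
    case (Suc m')
    have "poly ([:0, 1:] * monom c m) = (\<lambda>x. c * x ^ Suc (Suc m'))" by (rule ext) (simp add: Suc poly_monom mult_ac)
    then have "gauss_expect ([:0, 1:] * monom c m) = c * (LINT x|std_normal_distribution. x ^ Suc (Suc m'))"
      unfolding gauss_expect_def by (simp only: integral_mult_right_zero)
    moreover have "poly (pderiv (monom c m)) = (\<lambda>x. c * (real (Suc m') * x ^ m'))"
      by (rule ext) (simp add: Suc poly_monom pderiv_monom mult_ac)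
    then have "gauss_expect (pderiv (monom c m)) = c * (real (Suc m') * (LINT x|std_normal_distribution. x ^ m'))"
      unfolding gauss_expect_def by (simp only: integral_mult_right_zero)
    ultimately show ?thesis by (simp only: gauss_moment_rec)
  qed
  have "gauss_expect ([:0, 1:] * (\<Sum>i\<le>degree q. monom (coeff q i) i)) = gauss_expect (pderiv (\<Sum>i\<le>degree q. monom (coeff q i) i))"
    unfolding sum_distrib_left gauss_expect_sum mon by (simp add: pderiv_sum gauss_expect_sum)
  then show ?thesis by (simp only: poly_as_sum_of_monoms)
qed

text \<open>Multiplication by x minus differentiation, the step that raises the Hermite degree, is
  the adjoint of differentiation under the Gaussian measure.\<close>

lemma gauss_expect_hermite_Suc: "gauss_expect (hermite_poly (Suc n) * q) = gauss_expect (hermite_poly n * pderiv q)"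
proof -
  have "hermite_poly (Suc n) * q = [:0, 1:] * (hermite_poly n * q) - pderiv (hermite_poly n) * q"
    by (simp add: algebra_simps)
  then have "gauss_expect (hermite_poly (Suc n) * q) = gauss_expect (pderiv (hermite_poly n * q)) - gauss_expect (pderiv (hermite_poly n) * q)"
    by (simp only: gauss_expect_diff gauss_expect_stein)
  also have "\<dots> = gauss_expect (hermite_poly n * pderiv q)"
    by (simp add: pderiv_mult gauss_expect_add mult.commute)
  finally show ?thesis .
qed

text \<open>Derivatives are moved from one Hermite polynomial to the other until one of them is used
  up; by the derivative formula each move contributes the degree, and the degrees multiply to the
  factorial.\<close>

lemma hermite_orthogonal: "gauss_expect (hermite_poly n * hermite_poly m) = (if n = m then fact n else 0)"
proof (induction n arbitrary: m)
  case 0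
  show ?case
  proof (cases m)
    case (Suc m')
    have "gauss_expect (hermite_poly (Suc m') * 1) = gauss_expect (hermite_poly m' * pderiv 1)" by (rule gauss_expect_hermite_Suc)
    then show ?thesis using Suc by (simp add: gauss_expect_def)
  qed (simp add: gauss_expect_1)
next
  case (Suc n)
  show ?case
  proof (cases m)
    case 0
    then show ?thesis by (simp only: gauss_expect_hermite_Suc) (simp add: gauss_expect_def)
  next
    case (Suc m')
    have "gauss_expect (hermite_poly (Suc n) * hermite_poly m) = real m * gauss_expect (hermite_poly n * hermite_poly m')"
      unfolding Suc gauss_expect_hermite_Suc hermite_poly_pderiv by (simp add: gauss_expect_smult)
    then show ?thesis using Suc.IH[of m'] Suc by auto
  qed
qed

section \<open>Moments and Fourier transforms\<close>

text \<open>On a finite measure space this class is an algebra containing the constants, so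
  integrability of every polynomial expression in the Gaussian variables needs no bookkeeping of
  exponents.\<close>

definition all_moments :: "'w measure \<Rightarrow> ('w \<Rightarrow> real) \<Rightarrow> bool" where
  "all_moments M X \<longleftrightarrow> X \<in> borel_measurable M \<and> (\<forall>m. integrable M (\<lambda>\<omega>. \<bar>X \<omega>\<bar> ^ m))"

lemma all_moments_mult:
  assumes "all_moments M X" "all_moments M Y" shows "all_moments M (\<lambda>\<omega>. X \<omega> * Y \<omega>)"
  unfolding all_moments_def
proof (intro conjI allI)
  have [measurable]: "X \<in> borel_measurable M" "Y \<in> borel_measurable M" using assms by (auto simp: all_moments_def)
  show "(\<lambda>\<omega>. X \<omega> * Y \<omega>) \<in> borel_measurable M" by measurable
  fix m
  show "integrable M (\<lambda>\<omega>. \<bar>X \<omega> * Y \<omega>\<bar> ^ m)"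
  proof (rule Bochner_Integration.integrable_bound)
    show "integrable M (\<lambda>\<omega>. \<bar>X \<omega>\<bar> ^ (2 * m) + \<bar>Y \<omega>\<bar> ^ (2 * m))" using assms by (auto simp: all_moments_def)
    have ab: "a * b \<le> a\<^sup>2 + b\<^sup>2" for a b :: real
    proof -
      have "2 * (a * b) \<le> a\<^sup>2 + b\<^sup>2" using sum_squares_bound[of a b] by simp
      moreover have "0 \<le> a\<^sup>2 + b\<^sup>2" by simp
      ultimately show ?thesis by linarith
    qed
    have "\<bar>X \<omega> * Y \<omega>\<bar> ^ m \<le> \<bar>X \<omega>\<bar> ^ (2 * m) + \<bar>Y \<omega>\<bar> ^ (2 * m)" for \<omega>
    proof -
      have "\<bar>z\<bar> ^ (2 * m) = (\<bar>z\<bar> ^ m)\<^sup>2" for z :: real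
        using power_mult[of "\<bar>z\<bar>" m 2] by (simp only: mult.commute[of m 2])
      then show ?thesis using ab[of "\<bar>X \<omega>\<bar> ^ m" "\<bar>Y \<omega>\<bar> ^ m"] by (simp only: abs_mult power_mult_distrib)
    qed
    then show "AE \<omega> in M. norm (\<bar>X \<omega> * Y \<omega>\<bar> ^ m) \<le> norm (\<bar>X \<omega>\<bar> ^ (2 * m) + \<bar>Y \<omega>\<bar> ^ (2 * m))"
      by (intro AE_I2) (simp add: add_nonneg_nonneg)
  qed measurable
qed

lemma all_moments_add:
  assumes "all_moments M X" "all_moments M Y" shows "all_moments M (\<lambda>\<omega>. X \<omega> + Y \<omega>)"
  unfolding all_moments_def
proof (intro conjI allI)
  have [measurable]: "X \<in> borel_measurable M" "Y \<in> borel_measurable M" using assms by (auto simp: all_moments_def)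
  show "(\<lambda>\<omega>. X \<omega> + Y \<omega>) \<in> borel_measurable M" by measurable
  fix m
  show "integrable M (\<lambda>\<omega>. \<bar>X \<omega> + Y \<omega>\<bar> ^ m)"
  proof (rule Bochner_Integration.integrable_bound)
    show "integrable M (\<lambda>\<omega>. 2 ^ m * (\<bar>X \<omega>\<bar> ^ m + \<bar>Y \<omega>\<bar> ^ m))" using assms by (auto simp: all_moments_def)
    have "\<bar>X \<omega> + Y \<omega>\<bar> ^ m \<le> 2 ^ m * (\<bar>X \<omega>\<bar> ^ m + \<bar>Y \<omega>\<bar> ^ m)" for \<omega>
    proof -
      have "\<bar>X \<omega> + Y \<omega>\<bar> ^ m \<le> (2 * max \<bar>X \<omega>\<bar> \<bar>Y \<omega>\<bar>) ^ m" by (intro power_mono) auto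
      also have "\<dots> = 2 ^ m * (max \<bar>X \<omega>\<bar> \<bar>Y \<omega>\<bar>) ^ m" by (rule power_mult_distrib)
      also have "\<dots> \<le> 2 ^ m * (\<bar>X \<omega>\<bar> ^ m + \<bar>Y \<omega>\<bar> ^ m)" by (intro mult_left_mono) (auto simp: max_def)
      finally show ?thesis .
    qed
    then show "AE \<omega> in M. norm (\<bar>X \<omega> + Y \<omega>\<bar> ^ m) \<le> norm (2 ^ m * (\<bar>X \<omega>\<bar> ^ m + \<bar>Y \<omega>\<bar> ^ m))"
      by (intro AE_I2) (simp add: add_nonneg_nonneg)
  qed measurable
qed

lemma all_moments_const: "finite_measure M \<Longrightarrow> all_moments M (\<lambda>\<omega>. c)"
  unfolding all_moments_def by (auto intro: finite_measure.integrable_const)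

lemma all_moments_poly:
  assumes "finite_measure M" "all_moments M X" shows "all_moments M (\<lambda>\<omega>. poly q (X \<omega>))"
proof (induction q)
  case (pCons a q)
  have "all_moments M (\<lambda>\<omega>. a + X \<omega> * poly q (X \<omega>))"
    by (intro all_moments_add all_moments_const all_moments_mult assms pCons)
  then show ?case by simp
qed (simp add: all_moments_const assms)

lemma all_moments_prod:
  assumes "finite_measure M" "finite K" "\<And>k. k \<in> K \<Longrightarrow> all_moments M (X k)" shows "all_moments M (\<lambda>\<omega>. \<Prod>k\<in>K. X k \<omega>)"
  using assms(2,3)
proof (induction K)
  case empty then show ?case using all_moments_const[OF assms(1), of 1] by simp
next
  case (insert k K)
  then show ?case using all_moments_mult[of M "X k" "\<lambda>\<omega>. \<Prod>k\<in>K. X k \<omega>"] by auto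
qed

lemma all_moments_integrable: "all_moments M X \<Longrightarrow> integrable M X"
  using integrable_norm_iff[of X M] by (auto simp: all_moments_def dest: spec[of _ "1::nat"])

lemma norm_iexp_diff: "norm (iexp x - 1) \<le> \<bar>x\<bar>"
  using iexp_approx1[of x 0] by simp

lemma iexp_quotient_tendsto: "(\<lambda>n. complex_of_real (real (Suc n)) * (iexp (x / real (Suc n)) - 1)) \<longlonglongrightarrow> \<i> * complex_of_real x"
proof -
  have b: "norm (complex_of_real (real (Suc n)) * (iexp (x / real (Suc n)) - 1) - \<i> * complex_of_real x) \<le> \<bar>x\<bar>\<^sup>2 * (1 / real (Suc n))" for n
  proof -
    let ?r = "real (Suc n)"
    have r: "?r > 0" by simp
    have e: "norm (iexp (x / ?r) - 1 - \<i> * complex_of_real (x / ?r)) \<le> \<bar>x / ?r\<bar>\<^sup>2 / 2"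
    proof -
      have "(\<Sum>k\<le>1. c ^ k / fact k) = 1 + c" for c :: complex
      proof -
        have "{..1::nat} = {0, 1}" by auto
        then show ?thesis by simp
      qed
      moreover have "Suc 1 = 2" "fact (Suc 1) = (2::real)" by simp_all
      ultimately show ?thesis using iexp_approx1[of "x / ?r" 1] by (simp only: diff_diff_eq)
    qed
    have "complex_of_real ?r * (iexp (x / ?r) - 1) - \<i> * complex_of_real x = complex_of_real ?r * (iexp (x / ?r) - 1 - \<i> * complex_of_real (x / ?r))"
      using r by (simp add: algebra_simps del: of_nat_Suc)
    then have "norm (complex_of_real ?r * (iexp (x / ?r) - 1) - \<i> * complex_of_real x) = ?r * norm (iexp (x / ?r) - 1 - \<i> * complex_of_real (x / ?r))"
      using r by (simp add: norm_mult del: of_nat_Suc)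
    also have "\<dots> \<le> ?r * (\<bar>x / ?r\<bar>\<^sup>2 / 2)" using e r by (intro mult_left_mono) auto
    also have "\<dots> = \<bar>x\<bar>\<^sup>2 * (1 / ?r) / 2" using r by (simp add: power2_eq_square abs_divide del: of_nat_Suc)
    also have "\<dots> \<le> \<bar>x\<bar>\<^sup>2 * (1 / ?r)"
    proof -
      have "q / 2 \<le> q" if "0 \<le> q" for q :: real using that by simp
      note half = this
      show ?thesis by (rule half) simp
    qed
    finally show ?thesis .
  qed
  have "(\<lambda>n. \<bar>x\<bar>\<^sup>2 * (1 / real (Suc n))) \<longlonglongrightarrow> \<bar>x\<bar>\<^sup>2 * 0" by (intro tendsto_intros LIMSEQ_Suc[OF lim_1_over_n])
  then have "(\<lambda>n. complex_of_real (real (Suc n)) * (iexp (x / real (Suc n)) - 1) - \<i> * complex_of_real x) \<longlonglongrightarrow> 0"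
    by (intro Lim_null_comparison[OF always_eventually[OF allI[OF b]]]) simp
  then show ?thesis by (simp only: LIM_zero_iff)
qed

text \<open>The vanishing transform is differentiated m times in s. Each derivative is a limit of
  quotients with step 1/(n+1), dominated by |Z| |X|^(m+1); the induction hypothesis holds for all s,
  so both terms of every quotient vanish.\<close>

lemma fourier_zero_moment:
  fixes Z :: "'w \<Rightarrow> complex" and X :: "'w \<Rightarrow> real"
  assumes meas[measurable]: "Z \<in> borel_measurable M" "X \<in> borel_measurable M"
    and int: "\<And>m. integrable M (\<lambda>\<omega>. Z \<omega> * complex_of_real (X \<omega>) ^ m)"
    and zero: "\<And>s. (CLINT \<omega>|M. Z \<omega> * iexp (s * X \<omega>)) = 0"
  shows "(CLINT \<omega>|M. Z \<omega> * complex_of_real (X \<omega>) ^ m * iexp (s * X \<omega>)) = 0"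
proof (induction m arbitrary: s)
  case 0 then show ?case using zero by simp
next
  case (Suc m)
  let ?Y = "\<lambda>\<omega>. Z \<omega> * complex_of_real (X \<omega>) ^ m"
  have nI: "integrable M (\<lambda>\<omega>. norm (Z \<omega> * complex_of_real (X \<omega>) ^ Suc m))" using int by (rule integrable_norm)
  have iI: "integrable M (\<lambda>\<omega>. ?Y \<omega> * iexp (s * X \<omega>))" for s
    by (rule Bochner_Integration.integrable_bound[OF int[of m]]) (auto simp: norm_mult)
  let ?q = "\<lambda>n \<omega>. ?Y \<omega> * iexp (s * X \<omega>) * (complex_of_real (real (Suc n)) * (iexp (X \<omega> / real (Suc n)) - 1))"
  have "(\<lambda>n. CLINT \<omega>|M. ?q n \<omega>) \<longlonglongrightarrow> (CLINT \<omega>|M. ?Y \<omega> * iexp (s * X \<omega>) * (\<i> * complex_of_real (X \<omega>)))"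
  proof (rule integral_dominated_convergence[OF _ _ nI])
    show "AE \<omega> in M. (\<lambda>n. ?q n \<omega>) \<longlonglongrightarrow> ?Y \<omega> * iexp (s * X \<omega>) * (\<i> * complex_of_real (X \<omega>))"
      by (intro AE_I2 tendsto_mult tendsto_const iexp_quotient_tendsto)
    fix n
    show "AE \<omega> in M. norm (?q n \<omega>) \<le> norm (Z \<omega> * complex_of_real (X \<omega>) ^ Suc m)"
    proof (intro AE_I2)
      fix \<omega>
      have "norm (complex_of_real (real (Suc n)) * (iexp (X \<omega> / real (Suc n)) - 1)) \<le> real (Suc n) * \<bar>X \<omega> / real (Suc n)\<bar>"
        unfolding norm_mult using norm_iexp_diff[of "X \<omega> / real (Suc n)"] by (intro mult_mono) (auto simp del: of_nat_Suc)
      also have "\<dots> = \<bar>X \<omega>\<bar>" by (simp add: abs_divide del: of_nat_Suc)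
      finally have "norm (?Y \<omega> * iexp (s * X \<omega>)) * norm (complex_of_real (real (Suc n)) * (iexp (X \<omega> / real (Suc n)) - 1)) \<le> norm (?Y \<omega> * iexp (s * X \<omega>)) * \<bar>X \<omega>\<bar>"
        by (intro mult_left_mono) auto
      then show "norm (?q n \<omega>) \<le> norm (Z \<omega> * complex_of_real (X \<omega>) ^ Suc m)"
        unfolding norm_mult[of "?Y \<omega> * iexp (s * X \<omega>)"] by (simp add: norm_mult norm_power mult_ac)
    qed
  qed measurable
  moreover have "(CLINT \<omega>|M. ?q n \<omega>) = 0" for n
  proof -
    have "?q n \<omega> = complex_of_real (real (Suc n)) * (?Y \<omega> * iexp ((s + 1 / real (Suc n)) * X \<omega>) - ?Y \<omega> * iexp (s * X \<omega>))" for \<omega>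
    proof -
      have "iexp ((s + 1 / real (Suc n)) * X \<omega>) = iexp (s * X \<omega>) * iexp (X \<omega> / real (Suc n))"
        by (simp add: exp_add[symmetric] distrib_right distrib_left del: of_nat_Suc)
      then show ?thesis by (simp add: algebra_simps del: of_nat_Suc)
    qed
    then have "(CLINT \<omega>|M. ?q n \<omega>) = (CLINT \<omega>|M. complex_of_real (real (Suc n)) * (?Y \<omega> * iexp ((s + 1 / real (Suc n)) * X \<omega>) - ?Y \<omega> * iexp (s * X \<omega>)))"
      by presburger
    also have "\<dots> = complex_of_real (real (Suc n)) * ((CLINT \<omega>|M. ?Y \<omega> * iexp ((s + 1 / real (Suc n)) * X \<omega>)) - (CLINT \<omega>|M. ?Y \<omega> * iexp (s * X \<omega>)))"
      using iI by (simp only: integral_mult_right_zero Bochner_Integration.integral_diff)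
    also have "\<dots> = 0" by (simp only: Suc.IH diff_self mult_zero_right)
    finally show ?thesis .
  qed
  ultimately have "(CLINT \<omega>|M. ?Y \<omega> * iexp (s * X \<omega>) * (\<i> * complex_of_real (X \<omega>))) = 0"
    by (simp add: LIMSEQ_const_iff)
  then have "(CLINT \<omega>|M. \<i> * (Z \<omega> * complex_of_real (X \<omega>) ^ Suc m * iexp (s * X \<omega>))) = 0"
    by (simp add: mult_ac)
  then show ?case by simp
qed

section \<open>Orthonormality of the chaos basis\<close>

definition grid :: "nat \<Rightarrow> nat \<Rightarrow> real" where "grid n i = pi * real i / real (Suc n)"

lemma grid_simps: "grid n 0 = 0" "grid n (Suc n) = pi" "grid n (Suc i) - grid n i = pi / real (Suc n)" "grid n i < grid n (Suc i)"
  "i \<le> Suc n \<Longrightarrow> 0 \<le> grid n i \<and> grid n i \<le> pi"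
proof -
  show "grid n 0 = 0" "grid n (Suc n) = pi" by (simp_all add: grid_def del: of_nat_Suc)
  show d: "grid n (Suc i) - grid n i = pi / real (Suc n)" unfolding grid_def diff_divide_distrib[symmetric] by (simp add: algebra_simps)
  have "0 < pi / real (Suc n)" by simp
  then show "grid n i < grid n (Suc i)" using d by linarith
  show "0 \<le> grid n i \<and> grid n i \<le> pi" if "i \<le> Suc n"
  proof
    have "pi * real i \<le> pi * real (Suc n)" using that by (intro mult_left_mono) auto
    then show "grid n i \<le> pi" unfolding grid_def by (simp add: divide_le_eq del: of_nat_Suc)
  qed (simp add: grid_def)
qed

lemma integral_grid_sum:
  assumes f: "continuous_on {0..pi} (f :: real \<Rightarrow> real)" and "k \<le> Suc n"
  shows "integral {0..grid n k} f = (\<Sum>i<k. integral {grid n i..grid n (Suc i)} f)"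
  using assms(2)
proof (induction k)
  case 0
  show ?case by (simp add: grid_simps)
next
  case (Suc k)
  have "integral {0..grid n k} f + integral {grid n k..grid n (Suc k)} f = integral {0..grid n (Suc k)} f"
    using Suc.prems grid_simps(5)[of k n] grid_simps(5)[of "Suc k" n] grid_simps(4)[of n k]
    by (intro Henstock_Kurzweil_Integration.integral_combine integrable_continuous_real continuous_on_subset[OF f]) auto
  then show ?case using Suc by simp
qed

text \<open>Exact cell integrals of \<open>a\<close> against sampled values of \<open>b\<close> are
  what discrete integration by parts produces, with \<open>a\<close> the derivative of the integrand
  and \<open>b\<close> the path. For a = 1 it is an ordinary Riemann sum, used for the
  variance.\<close>

lemma riemann_sum_tendsto:
  fixes a b :: "real \<Rightarrow> real" and \<tau> :: "nat \<Rightarrow> nat \<Rightarrow> real"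
  assumes a: "continuous_on {0..pi} a" and b: "continuous_on {0..pi} b"
    and \<tau>: "\<And>n i. i \<le> n \<Longrightarrow> grid n i \<le> \<tau> n i \<and> \<tau> n i \<le> grid n (Suc i)"
  shows "(\<lambda>n. \<Sum>i<Suc n. integral {grid n i..grid n (Suc i)} a * b (\<tau> n i)) \<longlonglongrightarrow> integral {0..pi} (\<lambda>y. a y * b y)"
proof (rule LIMSEQ_I)
  fix r :: real assume r: "r > 0"
  have "bounded (a ` {0..pi})" using a by (intro compact_imp_bounded compact_continuous_image) auto
  then obtain A where A: "A > 0" "\<And>y. y \<in> {0..pi} \<Longrightarrow> \<bar>a y\<bar> \<le> A" unfolding bounded_pos by force
  define e where "e = r / (2 * A * pi)"
  have e: "e > 0" using r A by (simp add: e_def)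
  have "uniformly_continuous_on {0..pi} b" using b by (intro compact_uniformly_continuous) auto
  then obtain d where d: "d > 0" "\<And>x y. x \<in> {0..pi} \<Longrightarrow> y \<in> {0..pi} \<Longrightarrow> \<bar>y - x\<bar> < d \<Longrightarrow> \<bar>b y - b x\<bar> < e"
    using e unfolding uniformly_continuous_on_def dist_real_def by metis
  obtain N where N: "pi / d < real N" using reals_Archimedean2 by blast
  show "\<exists>N. \<forall>n\<ge>N. norm ((\<Sum>i<Suc n. integral {grid n i..grid n (Suc i)} a * b (\<tau> n i)) - integral {0..pi} (\<lambda>y. a y * b y)) < r"
  proof (intro exI[of _ N] allI impI)
    fix n assume n: "N \<le> n"
    have small: "pi / real (Suc n) < d"
    proof -
      have "pi / d < real (Suc n)" using N n by linarith
      then show ?thesis using d(1) by (simp add: field_simps)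
    qed
    have gi: "0 \<le> grid n i" "grid n (Suc i) \<le> pi" "grid n i \<le> grid n (Suc i)" if "i < Suc n" for i
      using grid_simps(5)[of i n] grid_simps(5)[of "Suc i" n] grid_simps(4)[of n i] that by auto
    have ai: "a integrable_on {grid n i..grid n (Suc i)}" "(\<lambda>y. a y * b y) integrable_on {grid n i..grid n (Suc i)}" if "i < Suc n" for i
      using gi[OF that] by (intro integrable_continuous_real continuous_intros continuous_on_subset[OF a] continuous_on_subset[OF b]; auto)+
    have piece: "\<bar>integral {grid n i..grid n (Suc i)} a * b (\<tau> n i) - integral {grid n i..grid n (Suc i)} (\<lambda>y. a y * b y)\<bar> \<le> A * e * (pi / real (Suc n))" if i: "i < Suc n" for i
    proof -
      have "integral {grid n i..grid n (Suc i)} a * b (\<tau> n i) - integral {grid n i..grid n (Suc i)} (\<lambda>y. a y * b y) =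
        integral {grid n i..grid n (Suc i)} (\<lambda>y. a y * b (\<tau> n i) - a y * b y)"
        using ai[OF i] by (subst integral_diff) (auto intro: integrable_on_mult_left)
      moreover have "norm (integral {grid n i..grid n (Suc i)} (\<lambda>y. a y * b (\<tau> n i) - a y * b y)) \<le> integral {grid n i..grid n (Suc i)} (\<lambda>y. A * e)"
      proof (rule integral_norm_bound_integral)
        show "(\<lambda>y. a y * b (\<tau> n i) - a y * b y) integrable_on {grid n i..grid n (Suc i)}"
          using ai[OF i] by (intro integrable_diff integrable_on_mult_left) auto
        fix y assume y: "y \<in> {grid n i..grid n (Suc i)}"
        have t: "grid n i \<le> \<tau> n i" "\<tau> n i \<le> grid n (Suc i)" using \<tau>[of i n] i by auto
        have "\<bar>\<tau> n i - y\<bar> < d" using t y grid_simps(3)[of n i] small by auto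
        then have "\<bar>b (\<tau> n i) - b y\<bar> \<le> e" using d(2)[of y "\<tau> n i"] gi[OF i] t y by auto
        moreover have "\<bar>a y\<bar> \<le> A" using A(2)[of y] gi[OF i] y by auto
        ultimately have "\<bar>a y\<bar> * \<bar>b (\<tau> n i) - b y\<bar> \<le> A * e" by (intro mult_mono) auto
        then show "norm (a y * b (\<tau> n i) - a y * b y) \<le> A * e" by (simp add: right_diff_distrib[symmetric] abs_mult)
      qed (rule integrable_const_ivl)
      moreover have "integral {grid n i..grid n (Suc i)} (\<lambda>y. A * e) = A * e * (pi / real (Suc n))"
        using gi[OF i] grid_simps(3)[of n i] by (simp add: mult.commute)
      ultimately show ?thesis by simp
    qed
    have tot: "integral {0..pi} (\<lambda>y. a y * b y) = (\<Sum>i<Suc n. integral {grid n i..grid n (Suc i)} (\<lambda>y. a y * b y))"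
      using integral_grid_sum[OF continuous_on_mult[OF a b], of "Suc n" n] by (simp only: grid_simps order_refl)
    have "\<bar>(\<Sum>i<Suc n. integral {grid n i..grid n (Suc i)} a * b (\<tau> n i)) - integral {0..pi} (\<lambda>y. a y * b y)\<bar>
       \<le> (\<Sum>i<Suc n. A * e * (pi / real (Suc n)))"
      unfolding tot sum_subtractf[symmetric] by (rule order_trans[OF sum_abs sum_mono]) (use piece in auto)
    also have "\<dots> = A * e * pi" by (simp del: of_nat_Suc)
    also have "\<dots> = r / 2" using A by (simp add: e_def)
    finally show "norm ((\<Sum>i<Suc n. integral {grid n i..grid n (Suc i)} a * b (\<tau> n i)) - integral {0..pi} (\<lambda>y. a y * b y)) < r"
      using r by simp
  qed
qed

lemma abel_sum:
  "(\<Sum>i<n. g i * (w (Suc i) - w i)) = g n * w n - g 0 * w 0 - (\<Sum>i<n. (g (Suc i) - g i) * w (Suc i))"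
  for g w :: "nat \<Rightarrow> real"
  by (induction n) (simp_all add: algebra_simps)

lemma has_integral_sin_sin:
  assumes "k \<ge> 1" "l \<ge> 1"
  shows "((\<lambda>z. sin (real k * z) * sin (real l * z)) has_integral (if k = l then pi/2 else 0)) {0..pi}"
proof -
  have c: "((\<lambda>z. cos (real j * z)) has_integral (if j = 0 then pi else 0)) {0..pi}" for j
  proof (cases "j = 0")
    case True
    then show ?thesis using has_integral_const_real[of "1::real" 0 pi] by simp
  next
    case False
    have "((\<lambda>z. cos (real j * z)) has_integral sin (real j * pi) / real j - sin (real j * 0) / real j) {0..pi}"
      using False by (intro fundamental_theorem_of_calculus)
        (auto intro!: derivative_eq_intros simp: has_real_derivative_iff_has_vector_derivative[symmetric])
    then show ?thesis using False by (simp add: mult.commute)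
  qed
  let ?d = "if k \<ge> l then k - l else l - k"
  have d: "cos (real ?d * z) = cos (real k * z - real l * z)" for z
  proof (cases "k \<ge> l")
    case False
    then have "cos (real ?d * z) = cos (- (real k * z - real l * z))" by (simp add: of_nat_diff algebra_simps)
    then show ?thesis by (simp only: cos_minus)
  qed (simp add: of_nat_diff algebra_simps)
  have "((\<lambda>z. (cos (real ?d * z) - cos (real (k + l) * z)) / 2) has_integral ((if ?d = 0 then pi else 0) - (if k + l = 0 then pi else 0)) / 2) {0..pi}"
    by (intro has_integral_divide has_integral_diff c)
  moreover have "(cos (real ?d * z) - cos (real (k + l) * z)) / 2 = sin (real k * z) * sin (real l * z)" for z
    unfolding d by (simp add: distrib_right cos_add cos_diff)
  moreover have "?d = 0 \<longleftrightarrow> k = l" by auto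
  ultimately show ?thesis using assms by (cases "k = l") simp_all
qed

lemma mk_orthonormal:
  assumes "k \<ge> 1" "l \<ge> 1"
  shows "((\<lambda>y. mk k y * mk l y) has_integral (if k = l then 1 else 0)) {0..pi}"
proof -
  have "((\<lambda>y. (2/pi) * (sin (real k * y) * sin (real l * y))) has_integral (2/pi) * (if k = l then pi/2 else 0)) {0..pi}"
    by (intro has_integral_mult_right has_integral_sin_sin assms)
  moreover have "(2/pi) * (sin (real k * y) * sin (real l * y)) = mk k y * mk l y" for y
    by (simp add: mk_def mult_ac)
  ultimately show ?thesis by (cases "k = l") simp_all
qed

lemma mk_sum_norm:
  assumes "finite K" "0 \<notin> K"
  shows "((\<lambda>y. (\<Sum>k\<in>K. c k * mk k y)\<^sup>2) has_integral (\<Sum>k\<in>K. (c k)\<^sup>2)) {0..pi}"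
proof -
  have pos: "k \<ge> 1" if "k \<in> K" for k using assms(2) that by (cases k) auto
  have "((\<lambda>y. \<Sum>k\<in>K. \<Sum>l\<in>K. c k * c l * (mk k y * mk l y)) has_integral (\<Sum>k\<in>K. \<Sum>l\<in>K. c k * c l * (if k = l then 1 else 0))) {0..pi}"
    by (intro has_integral_sum has_integral_mult_right mk_orthonormal pos assms)
  moreover have "(\<Sum>k\<in>K. \<Sum>l\<in>K. c k * c l * (mk k y * mk l y)) = (\<Sum>k\<in>K. c k * mk k y)\<^sup>2" for y
    unfolding power2_eq_square sum_product by (intro sum.cong refl) (simp only: mult_ac)
  moreover have "(\<Sum>l\<in>K. c k * c l * (if k = l then 1 else 0)) = (c k)\<^sup>2" if "k \<in> K" for k
  proof -
    have "(\<Sum>l\<in>K. c k * c l * (if k = l then 1 else 0)) = (\<Sum>l\<in>K. if k = l then (c k)\<^sup>2 else 0)"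
      by (intro sum.cong refl) (auto simp: power2_eq_square)
    then show ?thesis using that assms(1) by simp
  qed
  ultimately show ?thesis by simp
qed

lemma mk_derivative: "(mk k has_real_derivative deriv (mk k) y) (at y within S)"
proof -
  have "(mk k has_real_derivative sqrt (2/pi) * (real k * cos (real k * y))) (at y within S)" for S
    unfolding mk_def[abs_def] by (auto intro!: derivative_eq_intros)
  from this[of S] this[of UNIV] show ?thesis by (simp add: DERIV_imp_deriv)
qed

lemma deriv_mk_continuous: "continuous_on S (deriv (mk k))"
proof -
  have "deriv (mk k) = (\<lambda>y. sqrt (2/pi) * (real k * cos (real k * y)))"
    by (rule ext, rule DERIV_imp_deriv) (unfold mk_def[abs_def], auto intro!: derivative_eq_intros)
  then show ?thesis by (auto intro!: continuous_intros)
qed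

lemma mk_zero: "mk k 0 = 0" "mk k pi = 0"
  by (simp_all add: mk_def mult.commute[of "real k"])

lemma (in prob_space) expect_iexp_normal:
  assumes D: "distributed M lborel X (\<lambda>z. ennreal (normal_density 0 \<sigma> z))" and s: "\<sigma> > 0"
  shows "(CLINT \<omega>|M. iexp (c * X \<omega>)) = complex_of_real (exp (- (c\<^sup>2 * \<sigma>\<^sup>2) / 2))"
proof -
  have Z: "distributed M lborel (\<lambda>\<omega>. X \<omega> / \<sigma>) (\<lambda>z. ennreal (std_normal_density z))"
    using D normal_standard_normal_convert[OF s, of X 0] by simp
  have [measurable]: "X \<in> borel_measurable M" using distributed_measurable[OF D] by simp
  have "(CLINT \<omega>|M. iexp (c * X \<omega>)) = (CLINT \<omega>|M. iexp ((c * \<sigma>) * (X \<omega> / \<sigma>)))" using s by simp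
  also have "\<dots> = (CLINT z|distr M lborel (\<lambda>\<omega>. X \<omega> / \<sigma>). iexp ((c * \<sigma>) * z))"
    by (subst integral_distr) (auto intro: distributed_measurable[OF Z])
  also have "\<dots> = char std_normal_distribution (c * \<sigma>)"
    unfolding distributed_distr_eq_density[OF Z] char_def ..
  also have "\<dots> = complex_of_real (exp (- (c\<^sup>2 * \<sigma>\<^sup>2) / 2))"
    by (simp add: char_std_normal_distribution power_mult_distrib)
  finally show ?thesis .
qed

section \<open>Gaussian coefficients of the Brownian motion\<close>

locale brownian = prob_space M for M :: "'w measure" +
  fixes W :: "'w \<Rightarrow> real \<Rightarrow> real"
  assumes BM: "std_brownian_motion M W"
begin

lemma BM_facts:
  shows W_measurable: "y \<in> {0..pi} \<Longrightarrow> (\<lambda>\<omega>. W \<omega> y) \<in> borel_measurable M"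
    and W_normal: "0 \<le> s \<Longrightarrow> s < t \<Longrightarrow> t \<le> pi \<Longrightarrow> distributed M lborel (\<lambda>\<omega>. W \<omega> t - W \<omega> s) (\<lambda>z. ennreal (normal_density 0 (sqrt (t - s)) z))"
    and W_indep: "0 \<le> ts 0 \<Longrightarrow> ts n \<le> pi \<Longrightarrow> (\<forall>i<n. ts i < ts (Suc i)) \<Longrightarrow>
        indep_vars (\<lambda>_. borel) (\<lambda>i \<omega>. W \<omega> (ts (Suc i)) - W \<omega> (ts i)) {..<n}"
    and W_hoelder: "\<omega> \<in> space M \<Longrightarrow> 0 < \<gamma> \<Longrightarrow> \<gamma> < 1/2 \<Longrightarrow> \<exists>C. \<forall>x\<in>{0..pi}. \<forall>y\<in>{0..pi}. \<bar>W \<omega> x - W \<omega> y\<bar> \<le> C * \<bar>x - y\<bar> powr \<gamma>"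
  using BM unfolding std_brownian_motion_def by simp_all

lemma W_continuous:
  assumes "\<omega> \<in> space M" shows "continuous_on {0..pi} (W \<omega>)"
proof -
  have "\<exists>C. \<forall>x\<in>{0..pi}. \<forall>y\<in>{0..pi}. \<bar>W \<omega> x - W \<omega> y\<bar> \<le> C * \<bar>x - y\<bar> powr (1/4)"
    by (rule W_hoelder[OF assms]) auto
  then obtain C where "\<forall>x\<in>{0..pi}. \<forall>y\<in>{0..pi}. \<bar>W \<omega> x - W \<omega> y\<bar> \<le> C * \<bar>x - y\<bar> powr (1/4)" ..
  note C = this[rule_format]
  show ?thesis
    unfolding continuous_on_def
  proof
    fix x assume x: "x \<in> {0..pi}"
    have "((\<lambda>y. C * \<bar>y - x\<bar> powr (1/4)) \<longlongrightarrow> C * \<bar>x - x\<bar> powr (1/4)) (at x within {0..pi})"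
      by (intro tendsto_intros) auto
    then have "((\<lambda>y. C * \<bar>y - x\<bar> powr (1/4)) \<longlongrightarrow> 0) (at x within {0..pi})" by simp
    then have "((\<lambda>y. W \<omega> y - W \<omega> x) \<longlongrightarrow> 0) (at x within {0..pi})"
    proof (rule Lim_null_comparison[rotated])
      show "\<forall>\<^sub>F y in at x within {0..pi}. norm (W \<omega> y - W \<omega> x) \<le> C * \<bar>y - x\<bar> powr (1/4)"
        unfolding eventually_at_topological using C x by (intro exI[of _ UNIV]) auto
    qed
    then show "(W \<omega> \<longlongrightarrow> W \<omega> x) (at x within {0..pi})" by (simp add: LIM_zero_iff)
  qed
qed

text \<open>Approximates the Wiener integral of the combination of the \<open>mk k\<close>. In terms
  of increments it has an explicit characteristic function by independence; summed by parts it
  converges for every path.\<close>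

definition wiener_sum :: "(nat \<Rightarrow> real) \<Rightarrow> nat set \<Rightarrow> nat \<Rightarrow> 'w \<Rightarrow> real" where
  "wiener_sum c K n \<omega> = (\<Sum>i<Suc n. (\<Sum>k\<in>K. c k * mk k (grid n i)) * (W \<omega> (grid n (Suc i)) - W \<omega> (grid n i)))"

lemma wiener_sum_measurable: "wiener_sum c K n \<in> borel_measurable M"
  unfolding wiener_sum_def
  by (intro borel_measurable_sum borel_measurable_times borel_measurable_const borel_measurable_diff W_measurable)
     (use grid_simps(5)[of _ n] in \<open>auto simp del: of_nat_Suc\<close>)

text \<open>Abel summation moves the differences onto the smooth integrand; the boundary terms
  vanish since \<open>mk k\<close> is zero at 0 and pi. What remains is a Riemann sum for the
  pathwise definition of \<open>xi\<close>.\<close>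

lemma wiener_sum_tendsto:
  assumes K: "finite K" and om: "\<omega> \<in> space M"
  shows "(\<lambda>n. wiener_sum c K n \<omega>) \<longlonglongrightarrow> (\<Sum>k\<in>K. c k * xi W k \<omega>)"
proof -
  define g where "g = (\<lambda>y. \<Sum>k\<in>K. c k * mk k y)"
  define g' where "g' = (\<lambda>y. \<Sum>k\<in>K. c k * deriv (mk k) y)"
  have gd: "(g has_real_derivative g' y) (at y within S)" for y S
    unfolding g_def g'_def by (intro DERIV_sum DERIV_cmult mk_derivative)
  have g'c: "continuous_on S g'" for S unfolding g'_def by (intro continuous_intros deriv_mk_continuous)
  note Wc = W_continuous[OF om]
  have eq: "wiener_sum c K n \<omega> = - (\<Sum>i<Suc n. integral {grid n i..grid n (Suc i)} g' * W \<omega> (grid n (Suc i)))" for n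
  proof -
    have i: "integral {grid n i..grid n (Suc i)} g' = g (grid n (Suc i)) - g (grid n i)" for i
      using fundamental_theorem_of_calculus[of "grid n i" "grid n (Suc i)" g g'] gd grid_simps(4)[of n i]
      by (auto simp: has_real_derivative_iff_has_vector_derivative intro: integral_unique)
    have "wiener_sum c K n \<omega> = (\<Sum>i<Suc n. g (grid n i) * (W \<omega> (grid n (Suc i)) - W \<omega> (grid n i)))"
      unfolding wiener_sum_def g_def ..
    also have "\<dots> = g (grid n (Suc n)) * W \<omega> (grid n (Suc n)) - g (grid n 0) * W \<omega> (grid n 0) - (\<Sum>i<Suc n. (g (grid n (Suc i)) - g (grid n i)) * W \<omega> (grid n (Suc i)))"
      by (rule abel_sum[of "\<lambda>i. g (grid n i)" "\<lambda>i. W \<omega> (grid n i)"])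
    also have "\<dots> = - (\<Sum>i<Suc n. integral {grid n i..grid n (Suc i)} g' * W \<omega> (grid n (Suc i)))"
      unfolding i grid_simps(1,2) by (simp add: g_def mk_zero)
    finally show ?thesis .
  qed
  have "(\<lambda>n. - (\<Sum>i<Suc n. integral {grid n i..grid n (Suc i)} g' * W \<omega> (grid n (Suc i)))) \<longlonglongrightarrow> - integral {0..pi} (\<lambda>y. g' y * W \<omega> y)"
    by (intro tendsto_minus riemann_sum_tendsto g'c Wc) (use grid_simps(4) in \<open>auto intro: less_imp_le\<close>)
  moreover have "- integral {0..pi} (\<lambda>y. g' y * W \<omega> y) = (\<Sum>k\<in>K. c k * xi W k \<omega>)"
  proof -
    have "((\<lambda>y. \<Sum>k\<in>K. c k * (deriv (mk k) y * W \<omega> y)) has_integral (\<Sum>k\<in>K. c k * integral {0..pi} (\<lambda>y. deriv (mk k) y * W \<omega> y))) {0..pi}"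
      by (intro has_integral_sum has_integral_mult_right integrable_integral integrable_continuous_real continuous_intros deriv_mk_continuous Wc K)
    then have "integral {0..pi} (\<lambda>y. g' y * W \<omega> y) = (\<Sum>k\<in>K. c k * integral {0..pi} (\<lambda>y. deriv (mk k) y * W \<omega> y))"
      unfolding g'_def sum_distrib_right mult.assoc by (rule integral_unique)
    then show ?thesis by (simp add: xi_def sum_negf)
  qed
  ultimately show ?thesis unfolding eq by simp
qed

lemma xi_measurable [measurable]: "xi W k \<in> borel_measurable M"
proof (rule borel_measurable_LIMSEQ_real)
  show "(\<lambda>n. wiener_sum (\<lambda>_. 1) {k} n \<omega>) \<longlonglongrightarrow> xi W k \<omega>" if "\<omega> \<in> space M" for \<omega>
    using wiener_sum_tendsto[of "{k}", OF _ that, of "\<lambda>_. 1"] by simp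
  show "wiener_sum (\<lambda>_. 1) {k} n \<in> borel_measurable M" for n by (rule wiener_sum_measurable)
qed

lemma wiener_sum_char:
  "(CLINT \<omega>|M. iexp (wiener_sum c K n \<omega>)) = complex_of_real (exp (- (1/2) * (\<Sum>i<Suc n. (\<Sum>k\<in>K. c k * mk k (grid n i))\<^sup>2 * (pi / real (Suc n)))))"
proof -
  let ?g = "\<lambda>i. \<Sum>k\<in>K. c k * mk k (grid n i)"
  let ?D = "\<lambda>i \<omega>. W \<omega> (grid n (Suc i)) - W \<omega> (grid n i)"
  let ?X = "\<lambda>i \<omega>. ?g i * ?D i \<omega>"
  have "indep_vars (\<lambda>_. borel) ?D {..<Suc n}"
    using grid_simps(4) by (intro W_indep) (auto simp: grid_simps(1,2))
  then have ind: "indep_vars (\<lambda>_. borel) ?X {..<Suc n}"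
    by (rule indep_vars_compose2) auto
  have Dm: "?D i \<in> borel_measurable M" if "i < Suc n" for i
    using grid_simps(5)[of i n] grid_simps(5)[of "Suc i" n] that by (intro borel_measurable_diff W_measurable) auto
  have Xm: "?X i \<in> borel_measurable M" if "i < Suc n" for i using Dm[OF that] by measurable
  have one: "char (distr M borel (?X i)) 1 = complex_of_real (exp (- ((?g i)\<^sup>2 * (pi / real (Suc n))) / 2))" if i: "i < Suc n" for i
  proof -
    have D: "distributed M lborel (?D i) (\<lambda>z. ennreal (normal_density 0 (sqrt (grid n (Suc i) - grid n i)) z))"
      using grid_simps(5)[of i n] grid_simps(5)[of "Suc i" n] grid_simps(4)[of n i] i by (intro W_normal) auto
    have "char (distr M borel (?X i)) 1 = (CLINT \<omega>|M. iexp (?g i * ?D i \<omega>))"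
      unfolding char_def using Xm[OF i] by (subst integral_distr) auto
    also have "\<dots> = complex_of_real (exp (- ((?g i)\<^sup>2 * (sqrt (grid n (Suc i) - grid n i))\<^sup>2) / 2))"
      using grid_simps(4)[of n i] by (intro expect_iexp_normal[OF D]) auto
    also have "(sqrt (grid n (Suc i) - grid n i))\<^sup>2 = pi / real (Suc n)"
      unfolding grid_simps(3) by (simp del: of_nat_Suc)
    finally show ?thesis .
  qed
  have "(CLINT \<omega>|M. iexp (wiener_sum c K n \<omega>)) = char (distr M borel (\<lambda>\<omega>. \<Sum>i<Suc n. ?X i \<omega>)) 1"
    unfolding char_def wiener_sum_def
    by (subst integral_distr) (use Xm in \<open>auto intro!: borel_measurable_sum\<close>)
  also have "\<dots> = (\<Prod>i<Suc n. char (distr M borel (?X i)) 1)" by (rule char_distr_sum[OF ind])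
  also have "\<dots> = (\<Prod>i<Suc n. complex_of_real (exp (- ((?g i)\<^sup>2 * (pi / real (Suc n))) / 2)))"
    by (intro prod.cong refl one) simp
  also have "\<dots> = complex_of_real (exp (\<Sum>i<Suc n. - ((?g i)\<^sup>2 * (pi / real (Suc n))) / 2))"
    by (subst exp_sum) (simp_all del: of_nat_Suc)
  also have "(\<Sum>i<Suc n. - ((?g i)\<^sup>2 * (pi / real (Suc n))) / 2) = - (1/2) * (\<Sum>i<Suc n. (?g i)\<^sup>2 * (pi / real (Suc n)))"
    unfolding sum_distrib_left by (intro sum.cong refl) simp
  finally show ?thesis .
qed

text \<open>Dominated convergence on one side, a Riemann sum for the squared integrand on the other,
  evaluated by orthonormality of the \<open>mk\<close>. The formula expresses that the coefficients
  are independent standard normal variables.\<close>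

lemma xi_sum_char:
  assumes K: "finite K" "0 \<notin> K"
  shows "(CLINT \<omega>|M. iexp (\<Sum>k\<in>K. c k * xi W k \<omega>)) = complex_of_real (exp (- (1/2) * (\<Sum>k\<in>K. (c k)\<^sup>2)))"
proof (rule LIMSEQ_unique)
  show "(\<lambda>n. CLINT \<omega>|M. iexp (wiener_sum c K n \<omega>)) \<longlonglongrightarrow> (CLINT \<omega>|M. iexp (\<Sum>k\<in>K. c k * xi W k \<omega>))"
  proof (rule integral_dominated_convergence[where w = "\<lambda>_. 1"])
    show "AE \<omega> in M. (\<lambda>n. iexp (wiener_sum c K n \<omega>)) \<longlonglongrightarrow> iexp (\<Sum>k\<in>K. c k * xi W k \<omega>)"
      by (intro AE_I2 tendsto_intros wiener_sum_tendsto K)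
    show "(\<lambda>\<omega>. iexp (wiener_sum c K n \<omega>)) \<in> borel_measurable M" for n using wiener_sum_measurable[of c K n] by measurable
  qed auto
  have "(\<lambda>n. \<Sum>i<Suc n. integral {grid n i..grid n (Suc i)} (\<lambda>_. 1) * (\<Sum>k\<in>K. c k * mk k (grid n i))\<^sup>2) \<longlonglongrightarrow> integral {0..pi} (\<lambda>y. 1 * (\<Sum>k\<in>K. c k * mk k y)\<^sup>2)"
    by (rule riemann_sum_tendsto[where \<tau> = grid])
       (auto intro!: continuous_intros less_imp_le[OF grid_simps(4)] simp: mk_def)
  moreover have "integral {0..pi} (\<lambda>y. 1 * (\<Sum>k\<in>K. c k * mk k y)\<^sup>2) = (\<Sum>k\<in>K. (c k)\<^sup>2)"
    using integral_unique[OF mk_sum_norm[OF K]] by simp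
  moreover have "integral {grid n i..grid n (Suc i)} (\<lambda>_. 1) * r = r * (pi / real (Suc n))" for n i and r :: real
    using grid_simps(3,4)[of n i] by (simp add: mult.commute less_imp_le)
  ultimately have "(\<lambda>n. \<Sum>i<Suc n. (\<Sum>k\<in>K. c k * mk k (grid n i))\<^sup>2 * (pi / real (Suc n))) \<longlonglongrightarrow> (\<Sum>k\<in>K. (c k)\<^sup>2)" by simp
  then show "(\<lambda>n. CLINT \<omega>|M. iexp (wiener_sum c K n \<omega>)) \<longlonglongrightarrow> complex_of_real (exp (- (1/2) * (\<Sum>k\<in>K. (c k)\<^sup>2)))"
    unfolding wiener_sum_char by (intro tendsto_intros)
qed

lemma xi_distr:
  assumes "k \<ge> 1" shows "distr M borel (xi W k) = std_normal_distribution"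
proof (rule Levy_uniqueness)
  show "real_distribution (distr M borel (xi W k))" by (intro real_distribution_distr) measurable
  show "real_distribution std_normal_distribution" by (rule real_dist_normal_dist)
  show "char (distr M borel (xi W k)) = char std_normal_distribution"
  proof
    fix t
    have "char (distr M borel (xi W k)) t = (CLINT \<omega>|M. iexp (\<Sum>j\<in>{k}. t * xi W j \<omega>))"
      unfolding char_def by (subst integral_distr) auto
    also have "\<dots> = char std_normal_distribution t"
      using assms by (subst xi_sum_char) (auto simp: char_std_normal_distribution)
    finally show "char (distr M borel (xi W k)) t = char std_normal_distribution t" .
  qed
qed

lemma xi_all_moments:
  assumes "k \<ge> 1" shows "all_moments M (xi W k)"
  unfolding all_moments_def
proof (intro conjI allI)
  fix m
  have "integrable std_normal_distribution (\<lambda>x. \<bar>x\<bar> ^ m)"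
    using integrable_norm[OF integrable_std_normal_distribution_moment[of m]] by (simp add: power_abs)
  then have "integrable (distr M borel (xi W k)) (\<lambda>x. \<bar>x\<bar> ^ m)" by (simp only: xi_distr[OF assms])
  then show "integrable M (\<lambda>\<omega>. \<bar>xi W k \<omega>\<bar> ^ m)" by (subst (asm) integrable_distr_eq) auto
qed measurable

lemma xi_expect_poly:
  assumes "k \<ge> 1" shows "(LINT \<omega>|M. poly q (xi W k \<omega>)) = gauss_expect q"
proof -
  have pm: "poly q \<in> borel_measurable borel" by (intro borel_measurable_continuous_onI continuous_intros)
  have "(LINT \<omega>|M. poly q (xi W k \<omega>)) = (LINT x|distr M borel (xi W k). poly q x)"
    by (subst integral_distr) (auto simp: pm)
  then show ?thesis by (simp add: xi_distr[OF assms] gauss_expect_def)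
qed

lemma poly_prod_all_moments:
  assumes "finite K" "0 \<notin> K" shows "all_moments M (\<lambda>\<omega>. \<Prod>k\<in>K. poly (q k) (xi W k \<omega>))"
proof (rule all_moments_prod[OF finite_measure_axioms assms(1)])
  fix k assume "k \<in> K"
  then have "k \<ge> 1" using assms(2) by (cases k) auto
  then show "all_moments M (\<lambda>\<omega>. poly (q k) (xi W k \<omega>))" by (intro all_moments_poly finite_measure_axioms xi_all_moments)
qed

text \<open>The factors are split off one at a time: as functions of the frequency of \<open>\<xi>\<^sub>j\<close> both sides have the
  same Fourier transform, so all their moments against \<open>\<xi>\<^sub>j\<close> agree.\<close>
lemma poly_prod_iexp_expect:
  assumes "finite K" "finite L" "K \<inter> L = {}" "0 \<notin> K" "0 \<notin> L"
  shows "(CLINT \<omega>|M. complex_of_real (\<Prod>k\<in>K. poly (q k) (xi W k \<omega>)) * iexp (\<Sum>l\<in>L. c l * xi W l \<omega>))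
    = complex_of_real ((\<Prod>k\<in>K. gauss_expect (q k)) * exp (- (1/2) * (\<Sum>l\<in>L. (c l)\<^sup>2)))"
  using assms
proof (induction K arbitrary: L c rule: finite_induct)
  case empty
  then show ?case using xi_sum_char[of L c] by simp
next
  case (insert j K)
  have j: "j \<ge> 1" using insert.prems by (cases j) auto
  have K0: "0 \<notin> K" using insert.prems by auto
  define X where "X = xi W j"
  have [measurable]: "X \<in> borel_measurable M" unfolding X_def by measurable
  define R where "R = (\<lambda>\<omega>. \<Prod>k\<in>K. poly (q k) (xi W k \<omega>))"
  have Rm: "all_moments M R" unfolding R_def by (rule poly_prod_all_moments[OF insert.hyps(1) K0])
  then have [measurable]: "R \<in> borel_measurable M" by (simp add: all_moments_def)
  define Y where "Y = (\<lambda>\<omega>. complex_of_real (R \<omega>) * iexp (\<Sum>l\<in>L. c l * xi W l \<omega>))"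
  have [measurable]: "Y \<in> borel_measurable M" unfolding Y_def by measurable
  define d where "d = (\<Prod>k\<in>K. gauss_expect (q k)) * exp (- (1/2) * (\<Sum>l\<in>L. (c l)\<^sup>2))"
  have Xm: "all_moments M X" unfolding X_def by (rule xi_all_moments[OF j])
  have Xpow: "all_moments M (\<lambda>\<omega>. X \<omega> ^ m)" for m
    using all_moments_poly[OF finite_measure_axioms Xm, of "monom 1 m"] by (simp add: poly_monom)
  have YI: "integrable M (\<lambda>\<omega>. Y \<omega> * complex_of_real (X \<omega>) ^ m)" for m
  proof (rule Bochner_Integration.integrable_bound)
    show "integrable M (\<lambda>\<omega>. R \<omega> * X \<omega> ^ m)" by (intro all_moments_integrable all_moments_mult Rm Xpow)
    show "AE \<omega> in M. norm (Y \<omega> * complex_of_real (X \<omega>) ^ m) \<le> norm (R \<omega> * X \<omega> ^ m)"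
      by (intro AE_I2) (simp add: Y_def norm_mult norm_power abs_mult power_abs)
  qed measurable
  have XI: "integrable M (\<lambda>\<omega>. complex_of_real (X \<omega>) ^ m)" for m
  proof -
    have "integrable M (\<lambda>\<omega>. complex_of_real (X \<omega> ^ m))" by (intro integrable_of_real all_moments_integrable Xpow)
    then show ?thesis by simp
  qed
  have Yiexp: "(CLINT \<omega>|M. Y \<omega> * iexp (s * X \<omega>)) = complex_of_real (d * exp (- (s\<^sup>2) / 2))" for s
  proof -
    \<comment> \<open>The frequency of the new variable joins \<open>L\<close>, where the induction
      hypothesis applies; this is why the statement carries an exponential factor.\<close>
    let ?c = "c(j := s)"
    have jL: "j \<notin> L" using insert.prems by auto
    have sums: "(\<Sum>l\<in>insert j L. ?c l * xi W l \<omega>) = s * X \<omega> + (\<Sum>l\<in>L. c l * xi W l \<omega>)" for \<omega>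
    proof -
      have "(\<Sum>l\<in>L. ?c l * xi W l \<omega>) = (\<Sum>l\<in>L. c l * xi W l \<omega>)" using jL by (intro sum.cong) auto
      then show ?thesis using jL insert.prems(1) by (simp add: X_def)
    qed
    have sq: "(\<Sum>l\<in>insert j L. (?c l)\<^sup>2) = s\<^sup>2 + (\<Sum>l\<in>L. (c l)\<^sup>2)"
    proof -
      have "(\<Sum>l\<in>L. (?c l)\<^sup>2) = (\<Sum>l\<in>L. (c l)\<^sup>2)" using jL by (intro sum.cong) auto
      then show ?thesis using jL insert.prems(1) by simp
    qed
    have "(CLINT \<omega>|M. Y \<omega> * iexp (s * X \<omega>)) = (CLINT \<omega>|M. complex_of_real (\<Prod>k\<in>K. poly (q k) (xi W k \<omega>)) * iexp (\<Sum>l\<in>insert j L. ?c l * xi W l \<omega>))"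
      unfolding sums Y_def R_def by (simp add: exp_add distrib_left mult_ac)
    also have "\<dots> = complex_of_real ((\<Prod>k\<in>K. gauss_expect (q k)) * exp (- (1/2) * (\<Sum>l\<in>insert j L. (?c l)\<^sup>2)))"
      using insert.prems insert.hyps by (intro insert.IH) auto
    also have "exp (- (1/2) * (\<Sum>l\<in>insert j L. (?c l)\<^sup>2)) = exp (- (1/2) * (\<Sum>l\<in>L. (c l)\<^sup>2)) * exp (- (s\<^sup>2) / 2)"
      unfolding sq exp_add[symmetric] by (simp add: algebra_simps)
    finally show ?thesis by (simp add: d_def)
  qed
  have Xiexp: "(CLINT \<omega>|M. iexp (s * X \<omega>)) = complex_of_real (exp (- (s\<^sup>2) / 2))" for s
    using xi_sum_char[of "{j}" "\<lambda>_. s"] j by (simp add: X_def)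
  \<comment> \<open>\<open>Y\<close> and the constant \<open>d\<close> have the same transform
    against \<open>X\<close>, so their difference has vanishing transform at every
    frequency.\<close>
  define Z where "Z = (\<lambda>\<omega>. Y \<omega> - complex_of_real d)"
  have ZI: "integrable M (\<lambda>\<omega>. Z \<omega> * complex_of_real (X \<omega>) ^ m)" for m
    unfolding Z_def left_diff_distrib using YI XI by (intro Bochner_Integration.integrable_diff integrable_mult_right) auto
  have z0: "(CLINT \<omega>|M. Z \<omega> * iexp (s * X \<omega>)) = 0" for s
  proof -
    have "integrable M (\<lambda>\<omega>. Y \<omega> * iexp (s * X \<omega>))"
      by (rule Bochner_Integration.integrable_bound[OF YI[of 0]]) (auto simp: norm_mult)
    moreover have "integrable M (\<lambda>\<omega>. complex_of_real d * iexp (s * X \<omega>))"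
      by (intro integrable_mult_right integrable_const_bound[where B = 1]) auto
    ultimately have "(CLINT \<omega>|M. Z \<omega> * iexp (s * X \<omega>)) = (CLINT \<omega>|M. Y \<omega> * iexp (s * X \<omega>)) - complex_of_real d * (CLINT \<omega>|M. iexp (s * X \<omega>))"
      unfolding Z_def left_diff_distrib by (simp only: Bochner_Integration.integral_diff integral_mult_right_zero)
    then show ?thesis unfolding Yiexp Xiexp by simp
  qed
  have mom: "(CLINT \<omega>|M. Y \<omega> * complex_of_real (X \<omega>) ^ m) = complex_of_real d * (CLINT \<omega>|M. complex_of_real (X \<omega>) ^ m)" for m
  proof -
    have "(CLINT \<omega>|M. Z \<omega> * complex_of_real (X \<omega>) ^ m * iexp (0 * X \<omega>)) = 0"
      by (rule fourier_zero_moment[OF _ _ ZI z0]) (auto simp: Z_def)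
    then have "(CLINT \<omega>|M. Y \<omega> * complex_of_real (X \<omega>) ^ m - complex_of_real d * complex_of_real (X \<omega>) ^ m) = 0"
      by (simp add: Z_def left_diff_distrib)
    then show ?thesis using YI XI by (subst (asm) Bochner_Integration.integral_diff) auto
  qed
  have pe: "complex_of_real (poly (q j) x) = (\<Sum>i\<le>degree (q j). complex_of_real (coeff (q j) i) * complex_of_real x ^ i)" for x
    by (simp add: poly_altdef)
  have "(CLINT \<omega>|M. complex_of_real (\<Prod>k\<in>insert j K. poly (q k) (xi W k \<omega>)) * iexp (\<Sum>l\<in>L. c l * xi W l \<omega>))
    = (CLINT \<omega>|M. \<Sum>i\<le>degree (q j). complex_of_real (coeff (q j) i) * (Y \<omega> * complex_of_real (X \<omega>) ^ i))"
  proof (rule Bochner_Integration.integral_cong[OF refl])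
    fix \<omega>
    have "complex_of_real (\<Prod>k\<in>insert j K. poly (q k) (xi W k \<omega>)) * iexp (\<Sum>l\<in>L. c l * xi W l \<omega>) = complex_of_real (poly (q j) (X \<omega>)) * Y \<omega>"
      using insert.hyps by (simp add: X_def Y_def R_def mult.assoc)
    also have "\<dots> = (\<Sum>i\<le>degree (q j). complex_of_real (coeff (q j) i) * (Y \<omega> * complex_of_real (X \<omega>) ^ i))"
      unfolding pe sum_distrib_right by (intro sum.cong refl) (simp only: mult_ac)
    finally show "complex_of_real (\<Prod>k\<in>insert j K. poly (q k) (xi W k \<omega>)) * iexp (\<Sum>l\<in>L. c l * xi W l \<omega>) =
       (\<Sum>i\<le>degree (q j). complex_of_real (coeff (q j) i) * (Y \<omega> * complex_of_real (X \<omega>) ^ i))" .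
  qed
  also have "\<dots> = (\<Sum>i\<le>degree (q j). complex_of_real (coeff (q j) i) * (complex_of_real d * (CLINT \<omega>|M. complex_of_real (X \<omega>) ^ i)))"
    using YI by (subst Bochner_Integration.integral_sum) (auto simp: mom)
  also have "\<dots> = complex_of_real d * (CLINT \<omega>|M. complex_of_real (poly (q j) (X \<omega>)))"
    unfolding pe using XI by (subst Bochner_Integration.integral_sum) (auto simp: sum_distrib_left mult_ac)
  also have "(CLINT \<omega>|M. complex_of_real (poly (q j) (X \<omega>))) = complex_of_real (gauss_expect (q j))"
    unfolding integral_complex_of_real X_def xi_expect_poly[OF j] ..
  finally show ?case using insert.hyps by (simp add: d_def mult_ac)
qed

lemma poly_prod_expect:
  assumes "finite K" "0 \<notin> K"
  shows "(LINT \<omega>|M. (\<Prod>k\<in>K. poly (q k) (xi W k \<omega>))) = (\<Prod>k\<in>K. gauss_expect (q k))"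
proof -
  have "complex_of_real (LINT \<omega>|M. (\<Prod>k\<in>K. poly (q k) (xi W k \<omega>))) = complex_of_real (\<Prod>k\<in>K. gauss_expect (q k))"
    using poly_prod_iexp_expect[OF assms(1) finite.emptyI, of q "\<lambda>_. 0"] assms(2)
    unfolding integral_complex_of_real[symmetric] by simp
  then show ?thesis by (simp only: of_real_eq_iff)
qed

text \<open>Factors outside the support are the normalised H_0 = 1, so the products for two
  multi-indices can be taken over a common index set.\<close>

lemma xi_mi_prod:
  assumes "multi_index \<alpha>" "finite K" "{k. \<alpha> k \<noteq> 0} \<subseteq> K"
  shows "xi_mi W \<alpha> \<omega> = (\<Prod>k\<in>K. poly (smult (1 / sqrt (fact (\<alpha> k))) (hermite_poly (\<alpha> k))) (xi W k \<omega>))"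
proof -
  have "(\<Prod>k\<in>K. poly (smult (1 / sqrt (fact (\<alpha> k))) (hermite_poly (\<alpha> k))) (xi W k \<omega>)) =
    (\<Prod>k\<in>{k. \<alpha> k \<noteq> 0}. poly (smult (1 / sqrt (fact (\<alpha> k))) (hermite_poly (\<alpha> k))) (xi W k \<omega>))"
    by (rule prod.mono_neutral_right[OF assms(2,3)]) auto
  then show ?thesis by (simp add: xi_mi_def hermite_eq_poly)
qed

lemma xi_mi_all_moments:
  assumes "multi_index \<alpha>" shows "all_moments M (xi_mi W \<alpha>)"
proof -
  let ?K = "{k. \<alpha> k \<noteq> 0}"
  have K: "finite ?K" "0 \<notin> ?K" using assms by (auto simp: multi_index_def)
  show ?thesis using poly_prod_all_moments[OF K] unfolding xi_mi_prod[OF assms K(1) order_refl, abs_def] .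
qed

theorem xi_mi_orthonormal:
  assumes "multi_index \<alpha>" "multi_index \<beta>"
  shows "(LINT \<omega>|M. xi_mi W \<alpha> \<omega> * xi_mi W \<beta> \<omega>) = (if \<alpha> = \<beta> then 1 else 0)"
proof -
  let ?K = "{k. \<alpha> k \<noteq> 0} \<union> {k. \<beta> k \<noteq> 0}"
  have K: "finite ?K" "0 \<notin> ?K" using assms by (auto simp: multi_index_def)
  let ?h = "\<lambda>n. smult (1 / sqrt (fact n)) (hermite_poly n)"
  have h: "gauss_expect (?h n * ?h m) = (if n = m then 1 else 0)" for n m
    by (simp add: gauss_expect_smult hermite_orthogonal)
  have "(LINT \<omega>|M. xi_mi W \<alpha> \<omega> * xi_mi W \<beta> \<omega>) = (LINT \<omega>|M. (\<Prod>k\<in>?K. poly (?h (\<alpha> k) * ?h (\<beta> k)) (xi W k \<omega>)))"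
    by (simp only: xi_mi_prod[OF assms(1) K(1) Un_upper1] xi_mi_prod[OF assms(2) K(1) Un_upper2] prod.distrib[symmetric] poly_mult)
  also have "\<dots> = (\<Prod>k\<in>?K. if \<alpha> k = \<beta> k then 1 else 0)" unfolding poly_prod_expect[OF K] h ..
  also have "\<dots> = (if \<alpha> = \<beta> then 1 else 0)"
  proof (cases "\<alpha> = \<beta>")
    case False
    then obtain k where k: "\<alpha> k \<noteq> \<beta> k" by auto
    then have "k \<in> ?K" by auto
    then show ?thesis using k K(1) False by (subst prod_zero) auto
  qed simp
  finally show ?thesis .
qed

end

section \<open>Mean-square bounds for the chaos coefficients\<close>

lemma has_integral_powr_diff:
  fixes a t :: real
  assumes "a < 1" "t > 0"
  shows "((\<lambda>s. (t - s) powr (-a)) has_integral t powr (1 - a) / (1 - a)) {0..t}"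
proof -
  have "((\<lambda>s. s powr (-a)) has_integral (t powr (-a+1) / (-a+1))) (cbox 0 t)"
    using has_integral_powr_from_0[of "-a" t] assms by auto
  from has_integral_affinity[OF this, of "-1" t]
  have "((\<lambda>s. (-1 * s + t) powr (-a)) has_integral t powr (-a+1) / (-a+1)) {0..t}"
    using assms(2) by (simp add: image_affinity_atLeastAtMost)
  then show ?thesis by (simp add: add.commute[of _ t] add.commute[of "-a"])
qed

lemma mi_minus_unit:
  assumes "multi_index \<alpha>" "\<alpha> k \<noteq> 0"
  shows "multi_index (mi_minus \<alpha> (unit_mi k))" "Suc (mi_len (mi_minus \<alpha> (unit_mi k))) = mi_len \<alpha>"
proof -
  let ?b = "mi_minus \<alpha> (unit_mi k)"
  have b: "?b j = (if j = k then \<alpha> k - 1 else \<alpha> j)" for j by (simp add: mi_minus_def unit_mi_def)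
  have sub: "{j. ?b j \<noteq> 0} \<subseteq> {j. \<alpha> j \<noteq> 0}" by (auto simp: b split: if_splits)
  have fin: "finite {j. \<alpha> j \<noteq> 0}" using assms by (simp add: multi_index_def)
  show "multi_index ?b" using assms finite_subset[OF sub fin] by (auto simp: multi_index_def b)
  have k: "k \<in> {j. \<alpha> j \<noteq> 0}" using assms by simp
  have "mi_len ?b = (\<Sum>j\<in>{j. \<alpha> j \<noteq> 0}. ?b j)"
    unfolding mi_len_def by (rule sum.mono_neutral_left[OF fin sub]) auto
  also have "\<dots> = ?b k + (\<Sum>j\<in>{j. \<alpha> j \<noteq> 0} - {k}. ?b j)" by (rule sum.remove[OF fin k])
  also have "(\<Sum>j\<in>{j. \<alpha> j \<noteq> 0} - {k}. ?b j) = (\<Sum>j\<in>{j. \<alpha> j \<noteq> 0} - {k}. \<alpha> j)" by (intro sum.cong) (auto simp: b)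
  finally have "mi_len ?b = ?b k + (\<Sum>j\<in>{j. \<alpha> j \<noteq> 0} - {k}. \<alpha> j)" .
  moreover have "?b k = \<alpha> k - 1" by (subst b) simp
  moreover have "mi_len \<alpha> = \<alpha> k + (\<Sum>j\<in>{j. \<alpha> j \<noteq> 0} - {k}. \<alpha> j)"
    unfolding mi_len_def by (rule sum.remove[OF fin k])
  moreover have "\<alpha> k \<ge> 1" using assms(2) by simp
  ultimately show "Suc (mi_len ?b) = mi_len \<alpha>" by linarith
qed

lemma mi_minus_unit_inj:
  assumes "mi_minus \<alpha> (unit_mi k) = mi_minus \<beta> (unit_mi k)" "\<alpha> k \<noteq> 0" "\<beta> k \<noteq> 0"
  shows "\<alpha> = \<beta>"
proof
  fix j
  have "\<alpha> j - unit_mi k j = \<beta> j - unit_mi k j" using fun_cong[OF assms(1), of j] by (simp add: mi_minus_def)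
  then show "\<alpha> j = \<beta> j" using assms(2,3) by (auto simp: unit_mi_def split: if_splits)
qed

lemma mi_len_0: "multi_index \<alpha> \<Longrightarrow> mi_len \<alpha> = 0 \<Longrightarrow> \<alpha> = (\<lambda>_. 0)"
  by (auto simp: multi_index_def mi_len_def)

context heat_bounds begin

lemma cont_X_zero: "cont_X T 0 (\<lambda>s y. 0)" by (simp add: cont_X_def)

lemma cont_X_sum:
  assumes "finite K" "\<And>k. k \<in> K \<Longrightarrow> \<exists>B. cont_X T B (f k)"
  shows "\<exists>B. cont_X T B (\<lambda>s y. \<Sum>k\<in>K. c k * f k s y)"
  using assms
proof (induction K)
  case empty
  then show ?case using cont_X_zero by auto
next
  case (insert k K)
  obtain B where B: "cont_X T B (\<lambda>s y. \<Sum>k\<in>K. c k * f k s y)" using insert by auto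
  obtain B' where B': "cont_X T B' (f k)" using insert.prems by auto
  have "cont_X T (\<bar>c k\<bar> * B' + \<bar>1\<bar> * B) (\<lambda>s y. c k * f k s y + 1 * (\<Sum>k\<in>K. c k * f k s y))"
    by (rule cont_X_linear[OF B' B T_pos])
  then show ?case using insert.hyps by auto
qed

lemma Top_zero: "Top (\<lambda>_. 0) f t x = 0" "Top h (\<lambda>_ _. 0) t x = 0"
  by (simp_all add: Top_def)

lemma Top_sum_noise:
  assumes "finite K" "cont_X T B f" "\<And>k. k \<in> K \<Longrightarrow> continuous_on {0..pi} (h k)" "t \<in> {0<..T}" "x \<in> {0..pi}"
  shows "Top (\<lambda>y. \<Sum>k\<in>K. c k * h k y) f t x = (\<Sum>k\<in>K. c k * Top (h k) f t x)"
  using assms(1,3)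
proof (induction K)
  case empty then show ?case by (simp add: Top_zero)
next
  case (insert k K)
  have "Top (\<lambda>y. c k * h k y + 1 * (\<Sum>k\<in>K. c k * h k y)) f t x = c k * Top (h k) f t x + 1 * Top (\<lambda>y. \<Sum>k\<in>K. c k * h k y) f t x"
    using insert.prems by (intro Top_linear_noise[OF assms(2) _ _ assms(4,5)] continuous_on_sum continuous_on_mult continuous_on_const) auto
  then show ?case using insert by simp
qed

lemma Top_sum_arg:
  assumes "finite K" "\<And>k. k \<in> K \<Longrightarrow> \<exists>B. cont_X T B (f k)" "continuous_on {0..pi} h" "t \<in> {0<..T}" "x \<in> {0..pi}"
  shows "Top h (\<lambda>s y. \<Sum>k\<in>K. c k * f k s y) t x = (\<Sum>k\<in>K. c k * Top h (f k) t x)"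
  using assms(1,2)
proof (induction K)
  case empty then show ?case by (simp add: Top_zero)
next
  case (insert k K)
  obtain B where B: "cont_X T B (\<lambda>s y. \<Sum>k\<in>K. c k * f k s y)" using cont_X_sum[of K f c] insert by auto
  obtain B' where B': "cont_X T B' (f k)" using insert.prems by auto
  have "Top h (\<lambda>s y. c k * f k s y + 1 * (\<Sum>k\<in>K. c k * f k s y)) t x = c k * Top h (f k) t x + 1 * Top h (\<lambda>s y. \<Sum>k\<in>K. c k * f k s y) t x"
    by (rule Top_linear[OF B' B assms(3-5)])
  then show ?case using insert by simp
qed

lemma Top_cont_X_ex:
  assumes "cont_X T B f" "continuous_on {0..pi} h" shows "\<exists>B. cont_X T B (Top h f)"
  using bounded_on_pi[OF assms(2)] Top_cont_X[OF assms] by metis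

text \<open>Bessel's inequality without square roots: test against \<open>\<Sum>\<^sub>k c\<^sub>k m\<^sub>k\<close> with \<open>c\<^sub>k\<close> the coefficients
  themselves, split the product by the weighted arithmetic-geometric mean inequality and absorb.\<close>
lemma Top_bessel:
  assumes I: "finite I" and K: "finite K" "0 \<notin> K" and f: "\<And>b. b \<in> I \<Longrightarrow> \<exists>B. cont_X T B (f b)"
    and t: "t \<in> {0<..T}" and x: "x \<in> {0..pi}"
    and A: "\<And>s y. s \<in> {0<..<t} \<Longrightarrow> y \<in> {0..pi} \<Longrightarrow> (\<Sum>b\<in>I. (f b s y)\<^sup>2) \<le> A s" "A integrable_on {0..t}"
  shows "(\<Sum>b\<in>I. \<Sum>k\<in>K. (Top (mk k) (f b) t x)\<^sup>2) \<le> 64 * C\<^sup>2 * t powr (1/4) * integral {0..t} A"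
proof -
  define c where "c = (\<lambda>b k. Top (mk k) (f b) t x)"
  define Q where "Q = (\<lambda>b y. \<Sum>k\<in>K. c b k * mk k y)"
  define S where "S = (\<Sum>b\<in>I. \<Sum>k\<in>K. (c b k)\<^sup>2)"
  have t0: "t > 0" using t by simp
  have S0: "0 \<le> S" unfolding S_def by (intro sum_nonneg) auto
  have Qc: "continuous_on {0..pi} (Q b)" for b unfolding Q_def by (intro continuous_intros mk_continuous)
  have Qn: "((\<lambda>y. (Q b y)\<^sup>2) has_integral (\<Sum>k\<in>K. (c b k)\<^sup>2)) {0..pi}" for b unfolding Q_def by (rule mk_sum_norm[OF K])
  have TQ: "Top (Q b) (f b) t x = (\<Sum>k\<in>K. (c b k)\<^sup>2)" if b: "b \<in> I" for b
  proof -
    obtain B where B: "cont_X T B (f b)" using f[OF b] by blast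
    have "Top (Q b) (f b) t x = (\<Sum>k\<in>K. c b k * Top (mk k) (f b) t x)"
      unfolding Q_def by (rule Top_sum_noise[OF K(1) B mk_continuous t x])
    then show ?thesis by (simp add: c_def power2_eq_square)
  qed
  let ?in = "\<lambda>b s. integral {0..pi} (\<lambda>y. heat_kernel (t - s) x y * f b s y * Q b y)"
  have in_int: "?in b integrable_on {0..t}" if b: "b \<in> I" for b
  proof -
    obtain B where B: "cont_X T B (f b)" using f[OF b] ..
    show ?thesis by (rule Top_integrable(1)[OF B Qc t x])
  qed
  have Seq: "S = integral {0..t} (\<lambda>s. \<Sum>b\<in>I. ?in b s)"
  proof -
    have "S = (\<Sum>b\<in>I. Top (Q b) (f b) t x)" unfolding S_def by (rule sum.cong[OF refl TQ[symmetric]])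
    also have "\<dots> = (\<Sum>b\<in>I. integral {0..t} (?in b))" by (simp only: Top_def)
    also have "\<dots> = integral {0..t} (\<lambda>s. \<Sum>b\<in>I. ?in b s)" by (rule integral_sum[OF I in_int, symmetric])
    finally show ?thesis .
  qed
  \<comment> \<open>Chosen so that the second half of the inequality integrates to exactly S / 2:
    the integral of (t - s)^(-3/4) is 4 t^(1/4).\<close>
  define \<mu> where "\<mu> = 4 * t powr (1/4)"
  have mu: "\<mu> > 0" using t0 by (simp add: \<mu>_def)
  let ?g = "\<lambda>s. 8 * \<mu> * C\<^sup>2 * A s + 1 / (2 * \<mu>) * S * (t - s) powr (-3/4)"
  have gi: "(?g has_integral 8 * \<mu> * C\<^sup>2 * integral {0..t} A + 1 / (2 * \<mu>) * S * (4 * t powr (1/4))) {0..t}"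
  proof (intro has_integral_add has_integral_mult_right integrable_integral A)
    show "((\<lambda>s. (t - s) powr (-3/4)) has_integral 4 * t powr (1/4)) {0..t}"
      using has_integral_powr_diff[of "3/4" t] t0 by (simp add: mult.commute)
  qed
  have "S \<le> integral {0..t} ?g"
  proof -
    \<comment> \<open>The integrand is bounded from above only, so the absolute-value estimate is
      applied to its positive part.\<close>
    have "\<bar>integral {0..t} (\<lambda>s. max 0 (\<Sum>b\<in>I. ?in b s))\<bar> \<le> integral {0..t} ?g" if mi: "(\<lambda>s. max 0 (\<Sum>b\<in>I. ?in b s)) integrable_on {0..t}"
    proof (rule integral_abs_bound_Ioo[OF mi has_integral_integrable[OF gi]])
      fix s assume s: "s \<in> {0<..<t}"
      define \<tau> where "\<tau> = t - s"
      have tau: "\<tau> > 0" "\<tau> \<in> {0<..T}" using s t by (auto simp: \<tau>_def)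
      have sT: "s \<in> {0<..T}" using s t by auto
      have A0: "0 \<le> A s"
      proof -
        have "0 \<le> (\<Sum>b\<in>I. (f b s 0)\<^sup>2)" by (intro sum_nonneg) auto
        also have "\<dots> \<le> A s" by (rule A(1)[OF s]) simp
        finally show ?thesis .
      qed
      have pc: "continuous_on {0..pi} (\<lambda>y. (heat_kernel \<tau> x y)\<^sup>2)" by (intro continuous_intros heat_kernel_continuous tau)
      have p2: "integral {0..pi} (\<lambda>y. (heat_kernel \<tau> x y)\<^sup>2) \<le> 16 * C\<^sup>2 * \<tau> powr (-3/4)"
      proof -
        have "\<bar>integral {0..pi} (\<lambda>y. (heat_kernel \<tau> x y)\<^sup>2)\<bar> \<le> (C\<^sup>2 * \<tau> powr (-3/4)) * (8 / (1 - 1/2))"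
        proof (rule integral_abs_bound_singular[OF integrable_continuous_real[OF pc] x])
          fix y assume y: "y \<in> {0..pi}" "x \<noteq> y"
          have "(heat_kernel \<tau> x y)\<^sup>2 \<le> (C * \<tau> powr (-3/8) * \<bar>x - y\<bar> powr (-1/4))\<^sup>2"
            using hk_le_sing'[OF tau(2) x y] C_pos by (intro power2_le_iff_abs_le[THEN iffD2]) (auto intro: mult_nonneg_nonneg)
          also have "\<dots> = C\<^sup>2 * (\<tau> powr (-3/8) * \<tau> powr (-3/8)) * (\<bar>x - y\<bar> powr (-1/4) * \<bar>x - y\<bar> powr (-1/4))"
            by (simp only: power2_eq_square mult_ac)
          also have "\<dots> = C\<^sup>2 * \<tau> powr (-3/4) * \<bar>x - y\<bar> powr (-(1/2))" using powr_add[of \<tau> "-3/8" "-3/8"] powr_add[of "\<bar>x - y\<bar>" "-1/4" "-1/4"] by simp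
          finally show "\<bar>(heat_kernel \<tau> x y)\<^sup>2\<bar> \<le> C\<^sup>2 * \<tau> powr (-3/4) * \<bar>x - y\<bar> powr (-(1/2))" by simp
        qed auto
        then show ?thesis by simp
      qed
      have "(\<Sum>b\<in>I. ?in b s) = integral {0..pi} (\<lambda>y. \<Sum>b\<in>I. heat_kernel \<tau> x y * f b s y * Q b y)"
        unfolding \<tau>_def
      proof (rule integral_sum[OF I, symmetric])
        fix b assume "b \<in> I"
        then obtain B where "cont_X T B (f b)" using f by blast
        then show "(\<lambda>y. heat_kernel (t - s) x y * f b s y * Q b y) integrable_on {0..pi}"
          using s sT by (intro Top_inner_integrable(1)[OF _ Qc]) auto
      qed
      also have "\<dots> \<le> integral {0..pi} (\<lambda>y. (\<mu> / 2 * \<tau> powr (3/4) * A s) * (heat_kernel \<tau> x y)\<^sup>2 + 1 / (2 * \<mu>) * \<tau> powr (-3/4) * (\<Sum>b\<in>I. (Q b y)\<^sup>2))"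
      proof (rule integral_le)
        show "(\<lambda>y. \<Sum>b\<in>I. heat_kernel \<tau> x y * f b s y * Q b y) integrable_on {0..pi}"
        proof (intro integrable_sum I)
          fix b assume "b \<in> I"
          then obtain B where "cont_X T B (f b)" using f by blast
          then show "(\<lambda>y. heat_kernel \<tau> x y * f b s y * Q b y) integrable_on {0..pi}"
            by (intro Top_inner_integrable(1)[OF _ Qc sT tau(1)])
        qed
        show "(\<lambda>y. (\<mu> / 2 * \<tau> powr (3/4) * A s) * (heat_kernel \<tau> x y)\<^sup>2 + 1 / (2 * \<mu>) * \<tau> powr (-3/4) * (\<Sum>b\<in>I. (Q b y)\<^sup>2)) integrable_on {0..pi}"
          by (intro integrable_continuous_real continuous_intros pc Qc)
        fix y assume y: "y \<in> {0..pi}"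
        let ?p = "heat_kernel \<tau> x y"
        \<comment> \<open>The weight \<tau>^(3/4) is matched to the squared kernel, whose space
          integral is of order \<tau>^(-3/4). The singularity is left on the \<open>Q\<close> term,
          where it is integrable in time.\<close>
        have amgm: "?p * F * q \<le> \<mu> / 2 * \<tau> powr (3/4) * (?p\<^sup>2 * F\<^sup>2) + 1 / (2 * \<mu>) * \<tau> powr (-3/4) * q\<^sup>2" for F q
        proof -
          define \<rho> where "\<rho> = \<mu> * \<tau> powr (3/4)"
          have rho: "\<rho> > 0" using mu tau by (simp add: \<rho>_def)
          have ri: "1 / \<rho> = 1 / \<mu> * \<tau> powr (-3/4)" using tau by (simp add: \<rho>_def powr_minus_divide)
          have "0 \<le> (\<rho> * (?p * F) - q)\<^sup>2 / (2 * \<rho>)" using rho by simp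
          also have "(\<rho> * (?p * F) - q)\<^sup>2 / (2 * \<rho>) = \<rho> / 2 * (?p\<^sup>2 * F\<^sup>2) - ?p * F * q + 1 / \<rho> / 2 * q\<^sup>2"
            using rho by (simp add: power2_eq_square field_simps)
          finally show ?thesis unfolding ri by (simp add: \<rho>_def)
        qed
        have "(\<Sum>b\<in>I. ?p * f b s y * Q b y) \<le> (\<Sum>b\<in>I. \<mu> / 2 * \<tau> powr (3/4) * (?p\<^sup>2 * (f b s y)\<^sup>2) + 1 / (2 * \<mu>) * \<tau> powr (-3/4) * (Q b y)\<^sup>2)"
          by (intro sum_mono amgm)
        also have "\<dots> = (\<mu> / 2 * \<tau> powr (3/4) * ?p\<^sup>2) * (\<Sum>b\<in>I. (f b s y)\<^sup>2) + 1 / (2 * \<mu>) * \<tau> powr (-3/4) * (\<Sum>b\<in>I. (Q b y)\<^sup>2)"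
          by (simp only: sum.distrib sum_distrib_left mult.assoc)
        also have "\<dots> \<le> (\<mu> / 2 * \<tau> powr (3/4) * ?p\<^sup>2) * A s + 1 / (2 * \<mu>) * \<tau> powr (-3/4) * (\<Sum>b\<in>I. (Q b y)\<^sup>2)"
          using A(1)[OF s y] mu by (intro add_right_mono mult_left_mono) auto
        finally show "(\<Sum>b\<in>I. ?p * f b s y * Q b y) \<le> (\<mu> / 2 * \<tau> powr (3/4) * A s) * ?p\<^sup>2 + 1 / (2 * \<mu>) * \<tau> powr (-3/4) * (\<Sum>b\<in>I. (Q b y)\<^sup>2)"
          by (simp only: mult_ac)
      qed
      also have "\<dots> = (\<mu> / 2 * \<tau> powr (3/4) * A s) * integral {0..pi} (\<lambda>y. (heat_kernel \<tau> x y)\<^sup>2) + 1 / (2 * \<mu>) * \<tau> powr (-3/4) * S"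
        unfolding S_def
        by (intro integral_unique has_integral_add has_integral_mult_right has_integral_sum Qn I integrable_integral integrable_continuous_real pc)
      also have "\<dots> \<le> (\<mu> / 2 * \<tau> powr (3/4) * A s) * (16 * C\<^sup>2 * \<tau> powr (-3/4)) + 1 / (2 * \<mu>) * \<tau> powr (-3/4) * S"
        using p2 A0 mu by (intro add_right_mono mult_left_mono) auto
      also have "\<dots> = 8 * \<mu> * C\<^sup>2 * A s * (\<tau> powr (3/4) * \<tau> powr (-3/4)) + 1 / (2 * \<mu>) * S * \<tau> powr (-3/4)"
        by (simp add: mult_ac)
      also have "\<tau> powr (3/4) * \<tau> powr (-3/4) = 1" using tau powr_add[of \<tau> "3/4" "-3/4"] by simp
      finally have "(\<Sum>b\<in>I. ?in b s) \<le> ?g s" by (simp add: \<tau>_def)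
      moreover have "0 \<le> ?g s" using A0 mu S0 by simp
      ultimately show "\<bar>max 0 (\<Sum>b\<in>I. ?in b s)\<bar> \<le> ?g s" by simp
    qed
    moreover have si: "(\<lambda>s. \<Sum>b\<in>I. ?in b s) absolutely_integrable_on {0<..<t}"
    proof (rule absolutely_integrable_sum[OF I])
      fix b assume b: "b \<in> I"
      then obtain B where B: "cont_X T B (f b)" using f by blast
      obtain H where H: "\<And>y. y \<in> {0..pi} \<Longrightarrow> \<bar>Q b y\<bar> \<le> H" using bounded_on_pi[OF Qc] by blast
      have "(\<lambda>s. 16 * C * B * H * ((t - s) powr -(1/4) * s powr -(1/4))) integrable_on {0<..<t}"
        using integral_powr_Beta[of "1/4" "1/4" t] t0 unfolding integrable_on_Icc_iff_Ioo[symmetric]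
        by (intro integrable_on_mult_right) (auto intro: has_integral_integrable)
      moreover have "?in b integrable_on {0<..<t}" using in_int[OF b] by (simp add: integrable_on_Icc_iff_Ioo)
      moreover have "norm (?in b s) \<le> 16 * C * B * H * ((t - s) powr -(1/4) * s powr -(1/4))" if "s \<in> {0<..<t}" for s
        using Top_inner_bound(1)[OF B Qc H _ _ x, of s "t - s"] that t by auto
      ultimately show "?in b absolutely_integrable_on {0<..<t}"
        by (intro absolutely_integrable_integrable_bound[where g = "\<lambda>s. 16 * C * B * H * ((t - s) powr -(1/4) * s powr -(1/4))"]) auto
    qed
    have "(\<lambda>s. max 0 (\<Sum>b\<in>I. ?in b s)) absolutely_integrable_on {0<..<t}"
      by (rule absolutely_integrable_max_1[OF _ si]) simp
    then have mi: "(\<lambda>s. max 0 (\<Sum>b\<in>I. ?in b s)) integrable_on {0..t}"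
      unfolding integrable_on_Icc_iff_Ioo by (rule set_lebesgue_integral_eq_integral)
    moreover have "S \<le> integral {0..t} (\<lambda>s. max 0 (\<Sum>b\<in>I. ?in b s))"
      unfolding Seq using in_int mi by (intro integral_le integrable_sum I) auto
    ultimately show ?thesis by linarith
  qed
  also have "\<dots> = 8 * \<mu> * C\<^sup>2 * integral {0..t} A + 1 / (2 * \<mu>) * S * (4 * t powr (1/4))" by (rule integral_unique[OF gi])
  also have "1 / (2 * \<mu>) * S * (4 * t powr (1/4)) = S / 2" using mu unfolding \<mu>_def[symmetric] by simp
  finally have "S \<le> 16 * \<mu> * C\<^sup>2 * integral {0..t} A" by simp
  then show ?thesis by (simp add: S_def c_def \<mu>_def mult_ac)
qed

end

context heat_phi begin

lemma chaos_Suc: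
  "chaos_coef (Suc n) \<phi> \<epsilon> \<alpha> t x = \<epsilon> * (\<Sum>k\<in>{k. \<alpha> k \<noteq> 0}. sqrt (real (\<alpha> k)) * Top (mk k) (chaos_coef n \<phi> \<epsilon> (mi_minus \<alpha> (unit_mi k))) t x)"
  by (simp add: Top_def)

lemma chaos_cont_X:
  "multi_index \<alpha> \<Longrightarrow> \<exists>B. cont_X T B (chaos_coef n \<phi> 1 \<alpha>)"
proof (induction n arbitrary: \<alpha>)
  case 0
  have "chaos_coef 0 \<phi> 1 \<alpha> = heat_sol \<phi>" by (intro ext) simp
  then show ?case using heat_sol_cont_X by auto
next
  case (Suc n)
  have fin: "finite {k. \<alpha> k \<noteq> 0}" using Suc.prems by (simp add: multi_index_def)
  have "\<exists>B. cont_X T B (\<lambda>s y. \<Sum>k\<in>{k. \<alpha> k \<noteq> 0}. sqrt (real (\<alpha> k)) * Top (mk k) (chaos_coef n \<phi> 1 (mi_minus \<alpha> (unit_mi k))) s y)"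
  proof (rule cont_X_sum[OF fin])
    fix k assume "k \<in> {k. \<alpha> k \<noteq> 0}"
    then have "\<exists>B. cont_X T B (chaos_coef n \<phi> 1 (mi_minus \<alpha> (unit_mi k)))"
      using mi_minus_unit(1)[OF Suc.prems] by (intro Suc.IH) auto
    then show "\<exists>B. cont_X T B (Top (mk k) (chaos_coef n \<phi> 1 (mi_minus \<alpha> (unit_mi k))))"
      using Top_cont_X_ex[OF _ mk_continuous] by blast
  qed
  moreover have "chaos_coef (Suc n) \<phi> 1 \<alpha> = (\<lambda>s y. \<Sum>k\<in>{k. \<alpha> k \<noteq> 0}. sqrt (real (\<alpha> k)) * Top (mk k) (chaos_coef n \<phi> 1 (mi_minus \<alpha> (unit_mi k))) s y)"
    by (intro ext) (simp only: chaos_Suc mult_1_left)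
  ultimately show ?case by simp
qed

text \<open>The square of \<open>B0\<close> covers order zero. In 128 = 2 * 64 the 64 comes from the
  Bessel estimate and the 2 bounds (n + 1) / (n + 1/2) in the inductive step. The 1 keeps the
  constant at least 1.\<close>

definition chaos_const :: real where "chaos_const = B0\<^sup>2 + 128 * C\<^sup>2 * T powr (1/4) + 1"

text \<open>Cauchy-Schwarz over the support costs the factor n + 1, the length of the multi-index,
  but integrating s^(n - 1/2) returns 1 / (n + 1/2). The growth is therefore geometric instead of
  factorial, which gives the power series in \<epsilon> a positive radius.\<close>

lemma chaos_sum_bound:
  assumes "finite F" "F \<subseteq> {\<alpha>. multi_index \<alpha> \<and> mi_len \<alpha> = n}" "t \<in> {0<..T}" "x \<in> {0..pi}"
  shows "(\<Sum>\<alpha>\<in>F. (chaos_coef n \<phi> 1 \<alpha> t x)\<^sup>2) \<le> chaos_const ^ Suc n * t powr (real n - 1/2)"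
  using assms
proof (induction n arbitrary: F t x)
  case 0
  have "F \<subseteq> {\<lambda>_. 0}" using 0 mi_len_0 by auto
  then have "card F \<le> 1" using card_mono[of "{\<lambda>_. 0}" F] by simp
  have "(\<Sum>\<alpha>\<in>F. (chaos_coef 0 \<phi> 1 \<alpha> t x)\<^sup>2) = real (card F) * (heat_sol \<phi> t x)\<^sup>2" by simp
  also have "\<dots> \<le> 1 * (heat_sol \<phi> t x)\<^sup>2" using \<open>card F \<le> 1\<close> by (intro mult_right_mono) auto
  also have "\<dots> \<le> (B0 * t powr (-1/4))\<^sup>2"
    using cont_XD(2)[OF heat_sol_cont_X 0(3,4)] B0_nonneg by (simp add: abs_le_square_iff[symmetric] abs_mult)
  also have "\<dots> = B0\<^sup>2 * (t powr (-1/4) * t powr (-1/4))" by (simp only: power2_eq_square mult_ac)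
  also have "t powr (-1/4) * t powr (-1/4) = t powr (real 0 - 1/2)" using powr_add[of t "-1/4" "-1/4"] by simp
  also have "B0\<^sup>2 * t powr (real 0 - 1/2) \<le> chaos_const ^ Suc 0 * t powr (real 0 - 1/2)"
    by (intro mult_right_mono) (auto simp: chaos_const_def)
  finally show ?case .
next
  case (Suc n)
  let ?supp = "\<lambda>\<alpha> :: nat \<Rightarrow> nat. {k. \<alpha> k \<noteq> 0}"
  define K where "K = (\<Union>\<alpha>\<in>F. ?supp \<alpha>)"
  define I where "I = (\<lambda>(\<alpha>,k). mi_minus \<alpha> (unit_mi k)) ` Sigma F ?supp"
  have mi: "multi_index \<alpha>" "mi_len \<alpha> = Suc n" "finite (?supp \<alpha>)" "\<alpha> 0 = 0" if "\<alpha> \<in> F" for \<alpha>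
    using Suc.prems(2) that by (auto simp: multi_index_def)
  have K: "finite K" "0 \<notin> K" using mi Suc.prems(1) by (auto simp: K_def)
  have I: "finite I" unfolding I_def using mi Suc.prems(1) by auto
  have I2: "I \<subseteq> {\<alpha>. multi_index \<alpha> \<and> mi_len \<alpha> = n}"
    unfolding I_def using mi_minus_unit mi by fastforce
  let ?c = "\<lambda>b k. Top (mk k) (chaos_coef n \<phi> 1 b) t x"
  let ?A = "\<lambda>s. chaos_const ^ Suc n * s powr (real n - 1/2)"
  have t0: "t > 0" using Suc.prems by simp
  have Ai: "(?A has_integral chaos_const ^ Suc n * (t powr (real n + 1/2) / (real n + 1/2))) {0..t}"
  proof (rule has_integral_mult_right)
    show "((\<lambda>s. s powr (real n - 1/2)) has_integral t powr (real n + 1/2) / (real n + 1/2)) {0..t}"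
      using has_integral_powr_from_0[of "real n - 1/2" t] t0 by (simp add: algebra_simps)
  qed
  have CS: "(chaos_coef (Suc n) \<phi> 1 \<alpha> t x)\<^sup>2 \<le> real (Suc n) * (\<Sum>k\<in>?supp \<alpha>. (?c (mi_minus \<alpha> (unit_mi k)) k)\<^sup>2)" if a: "\<alpha> \<in> F" for \<alpha>
  proof -
    have "(chaos_coef (Suc n) \<phi> 1 \<alpha> t x)\<^sup>2 = (\<Sum>k\<in>?supp \<alpha>. sqrt (real (\<alpha> k)) * ?c (mi_minus \<alpha> (unit_mi k)) k)\<^sup>2"
      by (simp only: chaos_Suc mult_1_left)
    also have "\<dots> \<le> (\<Sum>k\<in>?supp \<alpha>. (sqrt (real (\<alpha> k)))\<^sup>2) * (\<Sum>k\<in>?supp \<alpha>. (?c (mi_minus \<alpha> (unit_mi k)) k)\<^sup>2)"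
      by (rule Cauchy_Schwarz_ineq_sum)
    also have "(\<Sum>k\<in>?supp \<alpha>. (sqrt (real (\<alpha> k)))\<^sup>2) = real (mi_len \<alpha>)" by (simp add: mi_len_def)
    finally show ?thesis using mi[OF a] by simp
  qed
  have "(\<Sum>\<alpha>\<in>F. (chaos_coef (Suc n) \<phi> 1 \<alpha> t x)\<^sup>2) \<le> (\<Sum>\<alpha>\<in>F. real (Suc n) * (\<Sum>k\<in>?supp \<alpha>. (?c (mi_minus \<alpha> (unit_mi k)) k)\<^sup>2))"
    by (intro sum_mono CS)
  also have "\<dots> = real (Suc n) * (\<Sum>p\<in>Sigma F ?supp. (case (case p of (\<alpha>,k) \<Rightarrow> (mi_minus \<alpha> (unit_mi k), k)) of (b,k) \<Rightarrow> (?c b k)\<^sup>2))"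
    unfolding sum_distrib_left[symmetric] using Suc.prems(1) mi(3) by (subst sum.Sigma) (auto simp: case_prod_unfold)
  \<comment> \<open>Lowering \<alpha> at k while remembering k is injective, so the double sum
    embeds into a full rectangle \<open>I \<times> K\<close>, the shape that Bessel's inequality
    treats.\<close>
  also have "(\<Sum>p\<in>Sigma F ?supp. (case (case p of (\<alpha>,k) \<Rightarrow> (mi_minus \<alpha> (unit_mi k), k)) of (b,k) \<Rightarrow> (?c b k)\<^sup>2)) =
     (\<Sum>(b,k)\<in>(\<lambda>(\<alpha>,k). (mi_minus \<alpha> (unit_mi k), k)) ` Sigma F ?supp. (?c b k)\<^sup>2)"
  proof (subst sum.reindex)
    show "inj_on (\<lambda>(\<alpha>,k). (mi_minus \<alpha> (unit_mi k), k)) (Sigma F ?supp)"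
      by (auto simp: inj_on_def intro: mi_minus_unit_inj)
  qed (simp add: o_def)
  also have "\<dots> \<le> (\<Sum>(b,k)\<in>I \<times> K. (?c b k)\<^sup>2)"
  proof (rule sum_mono2)
    show "(\<lambda>(\<alpha>,k). (mi_minus \<alpha> (unit_mi k), k)) ` Sigma F ?supp \<subseteq> I \<times> K" by (force simp: I_def K_def)
  qed (use I K in auto)
  also have "\<dots> = (\<Sum>b\<in>I. \<Sum>k\<in>K. (?c b k)\<^sup>2)" by (simp add: sum.cartesian_product)
  also have "\<dots> \<le> 64 * C\<^sup>2 * t powr (1/4) * integral {0..t} ?A"
  proof (rule Top_bessel[OF I K _ Suc.prems(3,4)])
    show "\<exists>B. cont_X T B (chaos_coef n \<phi> 1 b)" if "b \<in> I" for b using I2 that by (intro chaos_cont_X) auto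
    show "(\<Sum>b\<in>I. (chaos_coef n \<phi> 1 b s y)\<^sup>2) \<le> ?A s" if "s \<in> {0<..<t}" "y \<in> {0..pi}" for s y
      using that Suc.prems by (intro Suc.IH I I2) auto
    show "?A integrable_on {0..t}" using Ai by (rule has_integral_integrable)
  qed
  also have "integral {0..t} ?A = chaos_const ^ Suc n * (t powr (real n + 1/2) / (real n + 1/2))" by (rule integral_unique[OF Ai])
  finally have le: "(\<Sum>\<alpha>\<in>F. (chaos_coef (Suc n) \<phi> 1 \<alpha> t x)\<^sup>2) \<le> real (Suc n) * (64 * C\<^sup>2 * t powr (1/4) * (chaos_const ^ Suc n * (t powr (real n + 1/2) / (real n + 1/2))))"
    by simp
  also have "\<dots> = (real (Suc n) / (real n + 1/2)) * (64 * C\<^sup>2 * t powr (1/4)) * (chaos_const ^ Suc n * t powr (real n + 1/2))"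
    by simp
  also have "\<dots> \<le> 2 * (64 * C\<^sup>2 * T powr (1/4)) * (chaos_const ^ Suc n * t powr (real n + 1/2))"
  proof (intro mult_right_mono mult_mono mult_left_mono)
    show "real (Suc n) / (real n + 1/2) \<le> 2" by (simp add: field_simps)
    show "t powr (1/4) \<le> T powr (1/4)" using Suc.prems by (intro powr_mono2) auto
    show "0 \<le> chaos_const ^ Suc n * t powr (real n + 1/2)" using C_pos by (auto simp: chaos_const_def intro!: add_nonneg_nonneg mult_nonneg_nonneg zero_le_power)
  qed auto
  also have "\<dots> \<le> chaos_const * (chaos_const ^ Suc n * t powr (real n + 1/2))"
  proof (rule mult_right_mono)
    show "2 * (64 * C\<^sup>2 * T powr (1/4)) \<le> chaos_const" by (simp add: chaos_const_def)
    show "0 \<le> chaos_const ^ Suc n * t powr (real n + 1/2)" using C_pos by (auto simp: chaos_const_def intro!: add_nonneg_nonneg mult_nonneg_nonneg zero_le_power)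
  qed
  also have "\<dots> = chaos_const ^ Suc (Suc n) * t powr (real (Suc n) - 1/2)" by (simp add: algebra_simps)
  finally show ?case .
qed

end

section \<open>The trace correction\<close>

lemma heat_kernel_measurable [measurable (raw)]:
  assumes [measurable]: "a \<in> borel_measurable M" "b \<in> borel_measurable M" "c \<in> borel_measurable M"
  shows "(\<lambda>\<omega>. heat_kernel (a \<omega>) (b \<omega>) (c \<omega>)) \<in> borel_measurable M"
  unfolding heat_kernel_def by measurable

text \<open>Lebesgue integrals over the whole line depend measurably on further parameters, so
  iterated integrals can be fed back into Fubini's theorem. The cut-off inside the integrand keeps
  the singular end points out.\<close>

lemma integral_eq_LINT_Ioo:
  fixes f g :: "real \<Rightarrow> real"
  assumes [measurable]: "f \<in> borel_measurable borel" and g: "g integrable_on {a..b}"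
    and bnd: "\<And>s. s \<in> {a<..<b} \<Longrightarrow> \<bar>f s\<bar> \<le> g s"
  shows "f integrable_on {a..b}" "integral {a..b} f = (LINT s|lborel. (if a < s \<and> s < b then f s else 0))"
proof -
  have ab: "f absolutely_integrable_on {a<..<b}"
  proof (rule measurable_bounded_by_integrable_imp_absolutely_integrable)
    show "f \<in> borel_measurable (lebesgue_on {a<..<b})"
      by (intro measurable_restrict_space1 measurable_completion) simp
    show "g integrable_on {a<..<b}" using g by (simp add: integrable_on_Icc_iff_Ioo)
  qed (use bnd in auto)
  then show "f integrable_on {a..b}"
    unfolding integrable_on_Icc_iff_Ioo by (rule set_lebesgue_integral_eq_integral)
  have "integral {a..b} f = (LINT s:{a<..<b}|lebesgue. f s)"
    using set_lebesgue_integral_eq_integral(2)[OF ab] by (simp add: integral_open_interval_real)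
  also have "\<dots> = (LINT s|lborel. indicator {a<..<b} s *\<^sub>R f s)"
    unfolding set_lebesgue_integral_def by (rule integral_completion) measurable
  also have "\<dots> = (LINT s|lborel. (if a < s \<and> s < b then f s else 0))"
    by (intro Bochner_Integration.integral_cong refl) (auto simp: indicator_def)
  finally show "integral {a..b} f = (LINT s|lborel. (if a < s \<and> s < b then f s else 0))" .
qed

lemma integrable_on_powr_diff:
  fixes a t :: real
  assumes "a < 1" "t > 0"
  shows "(\<lambda>s. (t - s) powr (-a)) integrable_on {0..t}"
  using has_integral_powr_diff[OF assms] by (rule has_integral_integrable)

text \<open>The formal value of \<open>Top h f s y\<close> when the noise \<open>h\<close> is a
  point mass at y.\<close>

definition diag_op :: "(real \<Rightarrow> real \<Rightarrow> real) \<Rightarrow> real \<Rightarrow> real \<Rightarrow> real" where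
  "diag_op f s y = integral {0..s} (\<lambda>r. heat_kernel (s - r) y y * f r y)"

context heat_bounds begin

lemma cont_X_times:
  assumes f: "cont_X T B f" and h: "continuous_on {0..pi} h"
  shows "\<exists>B. cont_X T B (\<lambda>s y. h y * f s y)"
proof -
  obtain H where H: "\<And>y. y \<in> {0..pi} \<Longrightarrow> \<bar>h y\<bar> \<le> H" "H > 0" using bounded_on_pi[OF h] by blast
  have "cont_X T (H * B) (\<lambda>s y. h y * f s y)"
    unfolding cont_X_def
  proof (intro conjI ballI)
    show "continuous_on ({0<..T} \<times> {0..pi}) (\<lambda>p. h (snd p) * f (fst p) (snd p))"
      by (intro continuous_on_mult cont_XD(1)[OF f] continuous_on_compose2[OF h]) (auto intro: continuous_intros)
    fix s y assume s: "s \<in> {0<..T}" "y \<in> {0..pi}"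
    have "\<bar>h y * f s y\<bar> \<le> H * (B * s powr (-1/4))"
      unfolding abs_mult using H(1)[OF s(2)] H(2) cont_XD(2)[OF f s] by (intro mult_mono) auto
    then show "\<bar>h y * f s y\<bar> \<le> H * B * s powr (-1/4)" by (simp add: mult.assoc)
  qed
  then show ?thesis ..
qed

text \<open>The noise \<open>sfej n y\<close> concentrates at y, so the spatial integrability of the
  kernel is of no help. The supremum bound with exponent -1/2 is uniform in n, and it is integrable
  in time.\<close>

lemma Top_sfej_bound:
  assumes f: "cont_X T B f" and s: "s \<in> {0<..T}" and y: "y \<in> {0..pi}"
  shows "\<bar>Top (sfej n y) f s y\<bar> \<le> C * B * (T powr (1/4) * \<bar>Beta (3/4) (1/2)\<bar>)" (is ?A)
    and "y \<in> {0<..<pi} \<Longrightarrow> (\<lambda>n. Top (sfej n y) f s y) \<longlonglongrightarrow> diag_op f s y"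
proof -
  have B: "0 \<le> B" by (rule cont_XD(3)[OF f T_pos])
  have s0: "s > 0" using s by simp
  have sc: "continuous_on {0..pi} (sfej n y)" for n
    unfolding sfej_def skern_product by (intro continuous_intros mk_continuous)
  let ?g = "\<lambda>r. C * B * ((s - r) powr -(1/2) * r powr -(1/4))"
  have gi: "(?g has_integral C * B * (s powr (1 - 1/2 - 1/4) * Beta (1 - 1/4) (1 - 1/2))) {0..s}"
    using integral_powr_Beta[of "1/2" "1/4" s] s0 by (intro has_integral_mult_right) auto
  let ?f = "\<lambda>n r. integral {0..pi} (\<lambda>z. heat_kernel (s - r) y z * f r z * sfej n y z)"
  have fi: "?f n integrable_on {0..s}" for n by (rule Top_integrable(1)[OF f sc s y])
  have fc: "continuous_on {0..pi} (\<lambda>z. heat_kernel (s - r) y z * f r z)" if r: "r \<in> {0<..<s}" for r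
    by (intro continuous_intros heat_kernel_continuous cont_X_compose[OF f]) (use r s in auto)
  have comm: "?f n r = integral {0..pi} (\<lambda>z. sfej n y z * (heat_kernel (s - r) y z * f r z))" for n r
    by (simp only: mult_ac)
  have fb: "\<bar>?f n r\<bar> \<le> ?g r" if r: "r \<in> {0<..<s}" for n r
    unfolding comm
  proof (rule sfej_bound[OF fc[OF r]])
    fix z assume z: "z \<in> {0..pi}"
    have "\<bar>heat_kernel (s - r) y z * f r z\<bar> \<le> (C * (s - r) powr (-1/2)) * (B * r powr (-1/4))"
      unfolding abs_mult using r s y z C_pos B by (intro mult_mono hk_le cont_XD(2)[OF f]) auto
    then show "\<bar>heat_kernel (s - r) y z * f r z\<bar> \<le> ?g r" by (simp add: mult_ac)
  qed
  have "\<bar>Top (sfej n y) f s y\<bar> \<le> integral {0..s} ?g"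
    unfolding Top_def by (rule integral_abs_bound_Ioo[OF fi has_integral_integrable[OF gi] fb])
  also have "\<dots> = C * B * (s powr (1/4) * Beta (3/4) (1/2))" using integral_unique[OF gi] by simp
  also have "\<dots> \<le> C * B * (s powr (1/4) * \<bar>Beta (3/4) (1/2)\<bar>)"
    using C_pos B by (intro mult_left_mono) auto
  also have "\<dots> \<le> C * B * (T powr (1/4) * \<bar>Beta (3/4) (1/2)\<bar>)"
    using C_pos B s by (intro mult_left_mono mult_right_mono powr_mono2) auto
  finally show ?A .
  assume y: "y \<in> {0<..<pi}"
  show "(\<lambda>n. Top (sfej n y) f s y) \<longlonglongrightarrow> diag_op f s y"
    unfolding Top_def diag_op_def
  proof (rule dominated_convergence_Ioo(2)[OF fi has_integral_integrable[OF gi] fb])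
    fix r assume r: "r \<in> {0<..<s}"
    show "(\<lambda>n. ?f n r) \<longlonglongrightarrow> heat_kernel (s - r) y y * f r y"
      unfolding comm by (rule sfej_tendsto[OF fc[OF r] y])
  qed
qed

text \<open>The outer noise factor \<open>mk k y\<close> is moved into the integrand, so that the
  sum becomes one Duhamel integral with noise 1 and integrand \<open>Top (sfej n y) f s y\<close>.
  The limit is taken by dominated convergence in y and then in s; the end points in y, where
  convergence may fail, are null.\<close>

lemma fejer_trace_tendsto:
  assumes f: "cont_X T B f" and x: "x \<in> {0..pi}"
  shows "(\<lambda>n. \<Sum>k=1..Suc n. (fejw (Suc n) k)\<^sup>2 * Top (mk k) (Top (mk k) f) T x)
    \<longlonglongrightarrow> integral {0..T} (\<lambda>s. integral {0..pi} (\<lambda>y. heat_kernel (T - s) x y * diag_op f s y))"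
proof -
  have TT: "T \<in> {0<..T}" using T_pos by simp
  define g where "g = (\<lambda>n s y. \<Sum>k=1..Suc n. (fejw (Suc n) k)\<^sup>2 * (mk k y * Top (mk k) f s y))"
  have cX: "\<exists>B. cont_X T B (\<lambda>s y. mk k y * Top (mk k) f s y)" for k
  proof -
    obtain H where H: "\<And>y. y \<in> {0..pi} \<Longrightarrow> \<bar>mk k y\<bar> \<le> H" using bounded_on_pi[OF mk_continuous] by blast
    show ?thesis by (rule cont_X_times[OF Top_cont_X[OF f mk_continuous H] mk_continuous])
  qed
  have gX: "\<exists>B. cont_X T B (g n)" for n
    unfolding g_def by (rule cont_X_sum) (use cX in auto)
  have one: "Top (\<lambda>_. 1) (\<lambda>s y. mk k y * Top (mk k) f s y) T x = Top (mk k) (Top (mk k) f) T x" for k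
    by (simp add: Top_def mult_ac)
  have gT: "g n s y = Top (sfej n y) f s y" if "s \<in> {0<..T}" "y \<in> {0..pi}" for n s y
  proof -
    have "Top (sfej n y) f s y = Top (\<lambda>z. \<Sum>k=1..Suc n. ((fejw (Suc n) k)\<^sup>2 * mk k y) * mk k z) f s y"
      by (rule arg_cong[where f = "\<lambda>h. Top h f s y"]) (rule ext, simp only: sfej_def skern_product)
    also have "\<dots> = (\<Sum>k=1..Suc n. ((fejw (Suc n) k)\<^sup>2 * mk k y) * Top (mk k) f s y)"
      by (rule Top_sum_noise[OF _ f _ that]) (auto intro: mk_continuous)
    finally show ?thesis by (simp only: g_def mult.assoc)
  qed
  define G where "G = C * B * (T powr (1/4) * \<bar>Beta (3/4) (1/2)\<bar>)"
  have gb: "\<bar>g n s y\<bar> \<le> G" if "s \<in> {0<..T}" "y \<in> {0..pi}" for n s y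
    unfolding gT[OF that] G_def by (rule Top_sfej_bound(1)[OF f that])
  have G0: "0 \<le> G" using gb[OF TT, of 0 0] by (auto intro: order_trans[OF abs_ge_zero])
  have eq: "(\<Sum>k=1..Suc n. (fejw (Suc n) k)\<^sup>2 * Top (mk k) (Top (mk k) f) T x) = Top (\<lambda>_. 1) (g n) T x" for n
    unfolding g_def one[symmetric] by (rule Top_sum_arg[symmetric]) (use cX TT x in auto)
  have c1: "continuous_on {0..pi} (\<lambda>_. 1::real)" by simp
  let ?i = "\<lambda>n s. integral {0..pi} (\<lambda>y. heat_kernel (T - s) x y * g n s y * 1)"
  have inner_int: "(\<lambda>y. heat_kernel (T - s) x y * g n s y * 1) integrable_on {0..pi}" if "s \<in> {0<..<T}" for n s
  proof -
    obtain B' where B': "cont_X T B' (g n)" using gX ..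
    show ?thesis by (rule Top_inner_integrable(1)[OF B' c1]) (use that in auto)
  qed
  have inner_b: "\<bar>heat_kernel (T - s) x y * g n s y * 1\<bar> \<le> C * (T - s) powr (-(1/2)) * G" if s: "s \<in> {0<..<T}" "y \<in> {0..pi}" for n s y
    using s x gb[of s y n] hk_le[of "T - s" x y] C_pos by (auto simp: abs_mult intro!: mult_mono)
  have ci: "(\<lambda>y. C * (T - s) powr (-(1/2)) * G) integrable_on {0..pi}" for s by auto
  show ?thesis
    unfolding eq unfolding Top_def
  proof (rule dominated_convergence_Ioo(2)[where g = "\<lambda>s. pi * G * C * (T - s) powr (-(1/2))"])
    show "?i n integrable_on {0..T}" for n
    proof -
      obtain B' where B': "cont_X T B' (g n)" using gX ..
      show ?thesis by (rule Top_integrable(1)[OF B' c1 TT x])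
    qed
    show "(\<lambda>s. pi * G * C * (T - s) powr (-(1/2))) integrable_on {0..T}"
      by (intro integrable_on_mult_right integrable_on_powr_diff T_pos) auto
    show "\<bar>?i n s\<bar> \<le> pi * G * C * (T - s) powr (-(1/2))" if s: "s \<in> {0<..<T}" for n s
    proof -
      have "\<bar>?i n s\<bar> \<le> integral {0..pi} (\<lambda>y. C * (T - s) powr (-(1/2)) * G)"
        by (rule integral_abs_bound_Ioo[OF inner_int[OF s] ci]) (use inner_b[OF s] in auto)
      then show ?thesis by (simp add: mult_ac)
    qed
    show "(\<lambda>n. ?i n s) \<longlonglongrightarrow> integral {0..pi} (\<lambda>y. heat_kernel (T - s) x y * diag_op f s y)" if s: "s \<in> {0<..<T}" for s
    proof (rule dominated_convergence_Ioo(2)[OF inner_int[OF s] ci])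
      fix y assume y: "y \<in> {0<..<pi}"
      then show "\<bar>heat_kernel (T - s) x y * g n s y * 1\<bar> \<le> C * (T - s) powr (-(1/2)) * G" for n by (intro inner_b[OF s]) auto
      have sy: "s \<in> {0<..T}" "y \<in> {0..pi}" using s y by auto
      have "(\<lambda>n. g n s y) \<longlonglongrightarrow> diag_op f s y" unfolding gT[OF sy] by (rule Top_sfej_bound(2)[OF f sy y])
      then show "(\<lambda>n. heat_kernel (T - s) x y * g n s y * 1) \<longlonglongrightarrow> heat_kernel (T - s) x y * diag_op f s y"
        unfolding mult_1_right by (rule tendsto_mult_left)
    qed
  qed
qed

end

context heat_phi begin

text \<open>Four interchanges bring the integral over the initial variable z to the outside, leaving
  the order prescribed by \<open>p3\<close>. Every kernel is estimated by its supremum bound; the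
  innermost time integral is then bounded by the constant \<open>Q\<close>, since the exponents -1/2
  and -1/2 give a Beta value free of s.\<close>

lemma diag_heat_sol_eq_p3:
  assumes x: "x \<in> {0..pi}"
  shows "integral {0..T} (\<lambda>s. integral {0..pi} (\<lambda>y. heat_kernel (T - s) x y * diag_op (heat_sol \<phi>) s y))
    = integral {0..pi} (\<lambda>z. p3 T x z * \<phi> z)"
proof -
  let ?p = heat_kernel
  \<comment> \<open>The datum is known to be continuous on [0,pi] only; the cut-off is Borel on the
    whole line.\<close>
  define \<phi>' where "\<phi>' = (\<lambda>z. indicator {0..pi} z * \<phi> z)"
  have phi'[measurable]: "\<phi>' \<in> borel_measurable borel"
    using borel_measurable_continuous_on_indicator[OF _ phi_cont] by (simp add: \<phi>'_def)
  have phi'_eq: "\<phi>' z = \<phi> z" if "z \<in> {0<..<pi}" for z using that by (simp add: \<phi>'_def)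
  have phi'_le: "\<bar>\<phi>' z\<bar> \<le> P" for z using phi_le[of z] P_nonneg by (simp add: \<phi>'_def indicator_def)
  \<comment> \<open>\<open>q\<close>, \<open>F\<close> and \<open>v\<close> are the successive
    partial integrals, over r, over r and z, and over r and s; they are written as Lebesgue
    integrals for the sake of joint measurability.\<close>
  define q where "q = (\<lambda>s y z. LINT r|lborel. (if 0 < r \<and> r < s then ?p (s - r) y y * ?p r y z else 0))"
  have q_meas[measurable (raw)]: "(\<lambda>\<omega>. q (a \<omega>) (b \<omega>) (c \<omega>)) \<in> borel_measurable N"
    if [measurable]: "a \<in> borel_measurable N" "b \<in> borel_measurable N" "c \<in> borel_measurable N" for a b c and N :: "'z measure"
    unfolding q_def by measurable
  define F where "F = (\<lambda>s y. LINT z|lborel. (if 0 < z \<and> z < pi then q s y z * \<phi>' z else 0))"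
  define v where "v = (\<lambda>y z. LINT s|lborel. (if 0 < s \<and> s < T then ?p (T - s) x y * q s y z else 0))"
  define Q where "Q = C\<^sup>2 * Beta (1/2) (1/2)"
  let ?h = "\<lambda>s r. C\<^sup>2 * ((s - r) powr -(1/2) * r powr -(1/2))"
  have hI: "(?h s has_integral Q) {0..s}" if "s > 0" for s
  proof -
    have "(?h s has_integral C\<^sup>2 * (s powr (1 - 1/2 - 1/2) * Beta (1 - 1/2) (1 - 1/2))) {0..s}"
      using that by (intro has_integral_mult_right integral_powr_Beta) auto
    then show ?thesis using that by (simp add: Q_def)
  qed
  have DB: "\<bar>?p (s - r) y y * ?p r y z\<bar> \<le> ?h s r" if "s \<in> {0<..T}" "y \<in> {0..pi}" "z \<in> {0..pi}" "r \<in> {0<..<s}" for s y z r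
  proof -
    have "\<bar>?p (s - r) y y * ?p r y z\<bar> \<le> (C * (s - r) powr (-1/2)) * (C * r powr (-1/2))"
      unfolding abs_mult using that C_pos by (intro mult_mono hk_le) auto
    then show ?thesis by (simp add: power2_eq_square mult_ac)
  qed
  have q_eq: "q s y z = integral {0..s} (\<lambda>r. ?p (s - r) y y * ?p r y z)"
    and q_le: "\<bar>q s y z\<bar> \<le> Q" if s: "s \<in> {0<..T}" and y: "y \<in> {0..pi}" and z: "z \<in> {0..pi}" for s y z
  proof -
    have s0: "s > 0" using s by simp
    note I = integral_eq_LINT_Ioo[where f = "\<lambda>r. ?p (s - r) y y * ?p r y z", OF _ has_integral_integrable[OF hI[OF s0]] DB[OF s y z]]
    show e: "q s y z = integral {0..s} (\<lambda>r. ?p (s - r) y y * ?p r y z)"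
      unfolding q_def by (rule I(2)[symmetric]) measurable
    have "\<bar>integral {0..s} (\<lambda>r. ?p (s - r) y y * ?p r y z)\<bar> \<le> integral {0..s} (?h s)"
      by (rule integral_abs_bound_Ioo[OF I(1) has_integral_integrable[OF hI[OF s0]] DB[OF s y z]]) measurable
    then show "\<bar>q s y z\<bar> \<le> Q" using integral_unique[OF hI[OF s0]] e by simp
  qed
  have Q0: "0 \<le> Q" using q_le[of T 0 0] T_pos by (auto intro: order_trans[OF abs_ge_zero])
  have qphi: "\<bar>q s y z * \<phi>' z\<bar> \<le> Q * P" if "s \<in> {0<..T}" "y \<in> {0..pi}" "z \<in> {0<..<pi}" for s y z
    unfolding abs_mult using that Q0 by (intro mult_mono q_le phi'_le) auto
  have ci: "(\<lambda>_. c) integrable_on {0..pi}" for c :: real by auto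
  have F_eq: "F s y = integral {0..pi} (\<lambda>z. q s y z * \<phi>' z)" and F_le: "\<bar>F s y\<bar> \<le> pi * (Q * P)"
    if s: "s \<in> {0<..T}" and y: "y \<in> {0..pi}" for s y
  proof -
    note I = integral_eq_LINT_Ioo[where f = "\<lambda>z. q s y z * \<phi>' z" and g = "\<lambda>_. Q * P", OF _ ci qphi[OF s y]]
    show e: "F s y = integral {0..pi} (\<lambda>z. q s y z * \<phi>' z)" unfolding F_def by (rule I(2)[symmetric]) measurable
    have "\<bar>integral {0..pi} (\<lambda>z. q s y z * \<phi>' z)\<bar> \<le> integral {0..pi} (\<lambda>_. Q * P)"
      by (rule integral_abs_bound_Ioo[OF I(1) ci qphi[OF s y]]) measurable
    then show "\<bar>F s y\<bar> \<le> pi * (Q * P)" using e by (simp add: mult_ac)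
  qed
  have diag: "diag_op (heat_sol \<phi>) s y = F s y" if s: "s \<in> {0<..T}" and y: "y \<in> {0..pi}" for s y
  proof -
    have s0: "s > 0" using s by simp
    have "diag_op (heat_sol \<phi>) s y = integral {0..s} (\<lambda>r. integral {0..pi} (\<lambda>z. ?p (s - r) y y * ?p r y z * \<phi>' z))"
      unfolding diag_op_def
    proof (rule integral_cong)
      fix r
      have "heat_sol \<phi> r y = integral {0..pi} (\<lambda>z. ?p r y z * \<phi>' z)"
        unfolding heat_sol_def by (intro integral_cong) (auto simp: \<phi>'_def)
      then show "?p (s - r) y y * heat_sol \<phi> r y = integral {0..pi} (\<lambda>z. ?p (s - r) y y * ?p r y z * \<phi>' z)"
        by (simp add: mult.assoc)
    qed
    also have "\<dots> = integral {0..pi} (\<lambda>z. integral {0..s} (\<lambda>r. ?p (s - r) y y * ?p r y z * \<phi>' z))"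
    proof (rule fubini_Ioo[where h = "\<lambda>r. ?h s r * P"])
      show "(\<lambda>(r, z). ?p (s - r) y y * ?p r y z * \<phi>' z) \<in> borel_measurable borel"
        unfolding borel_prod[symmetric] by measurable
      show "(\<lambda>r. ?h s r * P) integrable_on {0..s}"
        by (intro integrable_on_mult_left has_integral_integrable[OF hI[OF s0]])
      show "(\<lambda>r. ?h s r * P) \<in> borel_measurable borel" by measurable
      show "\<bar>?p (s - r) y y * ?p r y z * \<phi>' z\<bar> \<le> ?h s r * P" if "r \<in> {0<..<s}" "z \<in> {0<..<pi}" for r z
        unfolding abs_mult[of "_ * _"] using that s y P_nonneg by (intro mult_mono DB phi'_le) auto
      show "0 \<le> ?h s r * P" for r using P_nonneg by simp
    qed
    also have "\<dots> = integral {0..pi} (\<lambda>z. q s y z * \<phi>' z)"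
      by (intro integral_cong) (simp add: q_eq[OF s y])
    finally show ?thesis using F_eq[OF s y] by simp
  qed
  let ?k = "\<lambda>s. C * (T - s) powr -(1/2)"
  have ki: "(\<lambda>s. ?k s * c) integrable_on {0..T}" for c
    by (intro integrable_on_mult_left integrable_on_mult_right integrable_on_powr_diff T_pos) auto
  have pk: "\<bar>?p (T - s) x y\<bar> \<le> ?k s" if "s \<in> {0<..<T}" "y \<in> {0..pi}" for s y
    using that hk_le[of "T - s" x y] x by simp
  have pq: "\<bar>?p (T - s) x y * q s y z\<bar> \<le> ?k s * Q" if "s \<in> {0<..<T}" "y \<in> {0..pi}" "z \<in> {0..pi}" for s y z
    unfolding abs_mult using that C_pos by (intro mult_mono pk q_le) auto
  have v_eq: "v y z = integral {0..T} (\<lambda>s. ?p (T - s) x y * q s y z)"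
    and v_le: "\<bar>v y z\<bar> \<le> integral {0..T} (\<lambda>s. ?k s * Q)" if y: "y \<in> {0..pi}" and z: "z \<in> {0..pi}" for y z
  proof -
    note I = integral_eq_LINT_Ioo[where f = "\<lambda>s. ?p (T - s) x y * q s y z" and g = "\<lambda>s. ?k s * Q", OF _ ki pq[OF _ y z]]
    show e: "v y z = integral {0..T} (\<lambda>s. ?p (T - s) x y * q s y z)" unfolding v_def by (rule I(2)[symmetric]) measurable
    show "\<bar>v y z\<bar> \<le> integral {0..T} (\<lambda>s. ?k s * Q)"
      unfolding e by (rule integral_abs_bound_Ioo[OF I(1) ki pq[OF _ y z]]) measurable
  qed
  have "integral {0..T} (\<lambda>s. integral {0..pi} (\<lambda>y. ?p (T - s) x y * diag_op (heat_sol \<phi>) s y))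
     = integral {0..T} (\<lambda>s. integral {0..pi} (\<lambda>y. ?p (T - s) x y * F s y))"
    unfolding integral_open_interval_real[of 0 T] by (intro integral_cong) (auto simp: diag)
  also have "\<dots> = integral {0..pi} (\<lambda>y. integral {0..T} (\<lambda>s. ?p (T - s) x y * F s y))"
  proof (rule fubini_Ioo[where h = "\<lambda>s. ?k s * (pi * (Q * P))"])
    show "(\<lambda>(s, y). ?p (T - s) x y * F s y) \<in> borel_measurable borel"
      unfolding borel_prod[symmetric] F_def by measurable
    show "\<bar>?p (T - s) x y * F s y\<bar> \<le> ?k s * (pi * (Q * P))" if "s \<in> {0<..<T}" "y \<in> {0<..<pi}" for s y
      unfolding abs_mult using that C_pos by (intro mult_mono pk F_le) auto
    show "0 \<le> ?k s * (pi * (Q * P))" for s using C_pos Q0 P_nonneg by simp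
  qed (use ki in auto)
  also have "\<dots> = integral {0..pi} (\<lambda>y. integral {0..pi} (\<lambda>z. v y z * \<phi>' z))"
  proof (rule integral_cong)
    fix y assume y: "y \<in> {0..pi}"
    have "integral {0..T} (\<lambda>s. ?p (T - s) x y * F s y) = integral {0..T} (\<lambda>s. integral {0..pi} (\<lambda>z. ?p (T - s) x y * q s y z * \<phi>' z))"
      unfolding integral_open_interval_real[of 0 T]
      by (intro integral_cong) (use y in \<open>auto simp: F_eq mult.assoc\<close>)
    also have "\<dots> = integral {0..pi} (\<lambda>z. integral {0..T} (\<lambda>s. ?p (T - s) x y * q s y z * \<phi>' z))"
    proof (rule fubini_Ioo[where h = "\<lambda>s. ?k s * Q * P"])
      show "(\<lambda>(s, z). ?p (T - s) x y * q s y z * \<phi>' z) \<in> borel_measurable borel"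
        unfolding borel_prod[symmetric] by measurable
      show "\<bar>?p (T - s) x y * q s y z * \<phi>' z\<bar> \<le> ?k s * Q * P" if "s \<in> {0<..<T}" "z \<in> {0<..<pi}" for s z
        unfolding abs_mult[of "_ * _"] using that y C_pos Q0 by (intro mult_mono pq phi'_le) auto
      show "0 \<le> ?k s * Q * P" for s using C_pos Q0 P_nonneg by simp
      show "(\<lambda>s. ?k s * Q * P) integrable_on {0..T}" using ki[of "Q * P"] by (simp add: mult.assoc)
    qed measurable
    also have "\<dots> = integral {0..pi} (\<lambda>z. v y z * \<phi>' z)"
      by (intro integral_cong) (use y in \<open>simp add: v_eq\<close>)
    finally show "integral {0..T} (\<lambda>s. ?p (T - s) x y * F s y) = integral {0..pi} (\<lambda>z. v y z * \<phi>' z)" .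
  qed
  also have "\<dots> = integral {0..pi} (\<lambda>z. integral {0..pi} (\<lambda>y. v y z * \<phi>' z))"
  proof (rule fubini_Ioo[where h = "\<lambda>_. integral {0..T} (\<lambda>s. ?k s * Q) * P"])
    have K0: "0 \<le> integral {0..T} (\<lambda>s. ?k s * Q)" using v_le[of 0 0] by (auto intro: order_trans[OF abs_ge_zero])
    show "(\<lambda>(y, z). v y z * \<phi>' z) \<in> borel_measurable borel"
      unfolding borel_prod[symmetric] v_def by measurable
    show "\<bar>v y z * \<phi>' z\<bar> \<le> integral {0..T} (\<lambda>s. ?k s * Q) * P" if "y \<in> {0<..<pi}" "z \<in> {0<..<pi}" for y z
      unfolding abs_mult using that K0 by (intro mult_mono v_le phi'_le) auto
    show "0 \<le> integral {0..T} (\<lambda>s. ?k s * Q) * P" using K0 P_nonneg by simp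
  qed auto
  also have "\<dots> = integral {0..pi} (\<lambda>z. p3 T x z * \<phi> z)"
    unfolding integral_open_interval_real[of 0 pi "\<lambda>z. integral {0..pi} (\<lambda>y. v y z * \<phi>' z)"]
      integral_open_interval_real[of 0 pi "\<lambda>z. p3 T x z * \<phi> z"]
  proof (rule integral_cong)
    fix z assume z: "z \<in> {0<..<pi}"
    have "p3 T x z = integral {0..pi} (\<lambda>y. v y z)"
      unfolding p3_def
    proof (rule integral_cong)
      fix y assume y: "y \<in> {0..pi}"
      have "integral {0..T} (\<lambda>s. integral {0..s} (\<lambda>r. ?p (T - s) x y * ?p (s - r) y y * ?p r y z)) = integral {0..T} (\<lambda>s. ?p (T - s) x y * q s y z)"
        unfolding integral_open_interval_real[of 0 T]
        by (intro integral_cong) (use y z in \<open>auto simp: q_eq mult.assoc\<close>)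
      then show "integral {0..T} (\<lambda>s. integral {0..s} (\<lambda>r. ?p (T - s) x y * ?p (s - r) y y * ?p r y z)) = v y z"
        using v_eq[OF y, of z] z by simp
    qed
    then show "integral {0..pi} (\<lambda>y. v y z * \<phi>' z) = p3 T x z * \<phi> z" by (simp add: phi'_eq[OF z])
  qed
  finally show ?thesis .
qed

end

section \<open>Weighted chaos sums of orders one and two\<close>

definition mi_plus :: "(nat \<Rightarrow> nat) \<Rightarrow> nat \<Rightarrow> nat \<Rightarrow> nat" where
  "mi_plus \<beta> k = (\<lambda>j. \<beta> j + unit_mi k j)"

text \<open>The multi-indices of length \<open>n\<close> supported in \<open>{1..N+1}\<close>; summing over them the chaos terms weighted by
  \<open>\<Prod>\<^sub>k c\<^sub>k\<^bsup>\<alpha>\<^sub>k\<^esup>\<close> amounts to replacing the white noise by the derivative of the Fejer mean of the path.\<close>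
definition mi_box :: "nat \<Rightarrow> nat \<Rightarrow> (nat \<Rightarrow> nat) set" where
  "mi_box n N = {\<alpha>. multi_index \<alpha> \<and> mi_len \<alpha> = n \<and> {k. \<alpha> k \<noteq> 0} \<subseteq> {1..Suc N}}"

text \<open>The guard sets the weight to 0 outside the box, where a factor
  \<open>fejw (Suc N) k\<close> with large k would be negative.\<close>

definition mi_weight :: "nat \<Rightarrow> (nat \<Rightarrow> nat) \<Rightarrow> real" where
  "mi_weight N \<alpha> = (if {k. \<alpha> k \<noteq> 0} \<subseteq> {1..Suc N} then \<Prod>k\<in>{k. \<alpha> k \<noteq> 0}. fejw (Suc N) k ^ \<alpha> k else 0)"

section \<open>Combinatorics of the multi-index boxes\<close>

lemma mi_minus_mi_plus: "mi_minus (mi_plus \<beta> k) (unit_mi k) = \<beta>"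
  by (auto simp: mi_minus_def mi_plus_def)

lemma mi_plus_mi_minus: "\<alpha> k \<noteq> 0 \<Longrightarrow> mi_plus (mi_minus \<alpha> (unit_mi k)) k = \<alpha>"
  by (rule ext) (simp add: mi_minus_def mi_plus_def unit_mi_def)

lemma supp_mi_plus: "{j. mi_plus \<beta> k j \<noteq> 0} = insert k {j. \<beta> j \<noteq> 0}"
  by (auto simp: mi_plus_def unit_mi_def)

lemma mi_plus_multi_index:
  assumes "multi_index \<beta>" "k \<ge> 1"
  shows "multi_index (mi_plus \<beta> k)" "mi_len (mi_plus \<beta> k) = Suc (mi_len \<beta>)"
proof -
  show m: "multi_index (mi_plus \<beta> k)"
    using assms supp_mi_plus[of \<beta> k] by (auto simp: multi_index_def mi_plus_def unit_mi_def)
  have "mi_plus \<beta> k k \<noteq> 0" by (simp add: mi_plus_def unit_mi_def)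
  from mi_minus_unit(2)[OF m this] show "mi_len (mi_plus \<beta> k) = Suc (mi_len \<beta>)" by (simp add: mi_minus_mi_plus)
qed

lemma mi_box_finite: "finite (mi_box n N)"
proof (rule finite_subset)
  show "mi_box n N \<subseteq> {f. \<forall>x. (x \<in> {1..Suc N} \<longrightarrow> f x \<in> {..n}) \<and> (x \<notin> {1..Suc N} \<longrightarrow> f x = 0)}"
  proof
    fix \<alpha> assume a: "\<alpha> \<in> mi_box n N"
    have "\<alpha> j \<le> n" for j
    proof (cases "\<alpha> j = 0")
      case False
      have "\<alpha> j \<le> (\<Sum>k\<in>{k. \<alpha> k \<noteq> 0}. \<alpha> k)"
        using a False by (intro member_le_sum) (auto simp: mi_box_def multi_index_def)
      then show ?thesis using a by (simp add: mi_box_def mi_len_def)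
    qed simp
    then show "\<alpha> \<in> {f. \<forall>x. (x \<in> {1..Suc N} \<longrightarrow> f x \<in> {..n}) \<and> (x \<notin> {1..Suc N} \<longrightarrow> f x = 0)}"
      using a by (auto simp: mi_box_def)
  qed
qed (rule finite_set_of_finite_funs; simp)

text \<open>These are the hypotheses of the convergence result for weighted orthogonal series. A
  fixed multi-index lies in the box from some N on, and from then on its weight is a fixed finite
  product of factors tending to 1.\<close>

lemma mi_weight_bounds:
  assumes "multi_index \<alpha>"
  shows "0 \<le> mi_weight N \<alpha>" "mi_weight N \<alpha> \<le> 1" "(\<lambda>N. mi_weight N \<alpha>) \<longlonglongrightarrow> 1"
proof -
  let ?S = "{k. \<alpha> k \<noteq> 0}"
  have r: "0 \<le> fejw (Suc N) k" if "?S \<subseteq> {1..Suc N}" "k \<in> ?S" for k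
    using that by (intro fejw_range(1)) auto
  show "0 \<le> mi_weight N \<alpha>" unfolding mi_weight_def using r by (auto intro!: prod_nonneg)
  show "mi_weight N \<alpha> \<le> 1" unfolding mi_weight_def using r fejw_range(2)
    by (auto intro!: prod_le_1 power_le_one)
  have fin: "finite ?S" "0 \<notin> ?S" using assms by (auto simp: multi_index_def)
  obtain m where m: "\<And>k. k \<in> ?S \<Longrightarrow> k \<le> m" using fin(1) by (metis finite_nat_set_iff_bounded_le)
  have "?S \<subseteq> {1..Suc N}" if "N \<ge> m" for N
  proof
    fix k assume k: "k \<in> ?S"
    have "k \<noteq> 0" using k fin(2) by metis
    then show "k \<in> {1..Suc N}" using m[OF k] that by auto
  qed
  then have ev: "\<forall>\<^sub>F N in sequentially. (\<Prod>k\<in>?S. fejw (Suc N) k ^ \<alpha> k) = mi_weight N \<alpha>"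
    unfolding eventually_sequentially mi_weight_def by (intro exI[of _ m]) simp
  have "(\<lambda>N. \<Prod>k\<in>?S. fejw (Suc N) k ^ \<alpha> k) \<longlonglongrightarrow> (\<Prod>k\<in>?S. 1 ^ \<alpha> k)"
    by (intro tendsto_prod tendsto_power LIMSEQ_Suc[OF fejw_tendsto])
  then show "(\<lambda>N. mi_weight N \<alpha>) \<longlonglongrightarrow> 1" using Lim_transform_eventually[OF _ ev] by simp
qed

lemma mi_box_subset: "mi_box n N \<subseteq> {\<alpha>. multi_index \<alpha> \<and> mi_len \<alpha> = n}"
  by (auto simp: mi_box_def)

lemma mi_weight_outside: "multi_index \<alpha> \<Longrightarrow> mi_len \<alpha> = n \<Longrightarrow> \<alpha> \<notin> mi_box n N \<Longrightarrow> mi_weight N \<alpha> = 0"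
  by (auto simp: mi_box_def mi_weight_def)

lemma mi_zero: "multi_index (\<lambda>_. 0)" "mi_len (\<lambda>_. 0) = 0"
  by (simp_all add: multi_index_def mi_len_def)

lemma mi_box_0: "mi_box 0 N = {\<lambda>_. 0}"
proof (intro equalityI subsetI)
  fix \<alpha> assume "\<alpha> \<in> mi_box 0 N"
  then have "\<alpha> = (\<lambda>_. 0)" by (intro mi_len_0) (simp_all add: mi_box_def)
  then show "\<alpha> \<in> {\<lambda>_. 0}" by simp
next
  fix \<alpha> :: "nat \<Rightarrow> nat" assume "\<alpha> \<in> {\<lambda>_. 0}"
  then show "\<alpha> \<in> mi_box 0 N" using mi_zero by (simp add: mi_box_def)
qed

lemma mi_plus_in_box: "\<beta> \<in> mi_box n N \<Longrightarrow> k \<in> {1..Suc N} \<Longrightarrow> mi_plus \<beta> k \<in> mi_box (Suc n) N"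
  using supp_mi_plus[of \<beta> k] mi_plus_multi_index[of \<beta> k] by (auto simp: mi_box_def)

lemma mi_minus_in_box:
  assumes "\<alpha> \<in> mi_box (Suc n) N" "\<alpha> k \<noteq> 0"
  shows "mi_minus \<alpha> (unit_mi k) \<in> mi_box n N" "k \<in> {1..Suc N}"
proof -
  have "{j. mi_minus \<alpha> (unit_mi k) j \<noteq> 0} \<subseteq> {j. \<alpha> j \<noteq> 0}" by (auto simp: mi_minus_def)
  then show "mi_minus \<alpha> (unit_mi k) \<in> mi_box n N"
    using assms mi_minus_unit[of \<alpha> k] by (auto simp: mi_box_def)
  show "k \<in> {1..Suc N}" using assms by (auto simp: mi_box_def)
qed

lemma mi_box_1: "mi_box (Suc 0) N = unit_mi ` {1..Suc N}"
proof -
  have u: "mi_plus (\<lambda>_. 0) k = unit_mi k" for k by (simp add: mi_plus_def)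
  show ?thesis
  proof (intro equalityI subsetI)
    fix \<alpha> assume a: "\<alpha> \<in> mi_box (Suc 0) N"
    then have "mi_len \<alpha> \<noteq> 0" by (simp add: mi_box_def)
    then obtain k where k: "\<alpha> k \<noteq> 0" unfolding mi_len_def by (metis (mono_tags, lifting) mem_Collect_eq sum.neutral)
    have "mi_minus \<alpha> (unit_mi k) = (\<lambda>_. 0)" using mi_minus_in_box(1)[OF a k] by (simp add: mi_box_0)
    then have "\<alpha> = unit_mi k" using mi_plus_mi_minus[of \<alpha> k, OF k] u by simp
    then show "\<alpha> \<in> unit_mi ` {1..Suc N}" using mi_minus_in_box(2)[OF a k] by simp
  next
    fix \<alpha> assume "\<alpha> \<in> unit_mi ` {1..Suc N}"
    then obtain k where k: "k \<in> {1..Suc N}" "\<alpha> = unit_mi k" by auto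
    then show "\<alpha> \<in> mi_box (Suc 0) N" using mi_plus_in_box[of "\<lambda>_. 0" 0 N k] u by (simp add: mi_box_0)
  qed
qed

lemma unit_mi_inj: "inj_on unit_mi A"
proof (rule inj_onI)
  fix k l assume "unit_mi k = unit_mi l"
  from fun_cong[OF this, of k] show "k = l" by (simp add: unit_mi_def split: if_splits)
qed

lemma sum_mi_box_1: "(\<Sum>\<beta>\<in>mi_box (Suc 0) N. g \<beta>) = (\<Sum>k=1..Suc N. g (unit_mi k))"
  unfolding mi_box_1 by (subst sum.reindex[OF unit_mi_inj]) (simp add: o_def)

text \<open>Pairs of a multi-index of length n + 1 and a point k of its support correspond to pairs
  of a multi-index of length n and an arbitrary k in the range of the box. The recursion for the
  coefficients thus becomes an unrestricted double sum.\<close>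

lemma sum_mi_box_Suc:
  fixes g :: "(nat \<Rightarrow> nat) \<Rightarrow> nat \<Rightarrow> real"
  shows "(\<Sum>\<alpha>\<in>mi_box (Suc n) N. \<Sum>k\<in>{k. \<alpha> k \<noteq> 0}. g (mi_minus \<alpha> (unit_mi k)) k) = (\<Sum>\<beta>\<in>mi_box n N. \<Sum>k=1..Suc N. g \<beta> k)"
proof -
  have fin: "\<forall>\<alpha>\<in>mi_box (Suc n) N. finite {k. \<alpha> k \<noteq> 0}" by (auto simp: mi_box_def multi_index_def)
  have "(\<Sum>\<alpha>\<in>mi_box (Suc n) N. \<Sum>k\<in>{k. \<alpha> k \<noteq> 0}. g (mi_minus \<alpha> (unit_mi k)) k) =
    (\<Sum>(\<alpha>,k)\<in>Sigma (mi_box (Suc n) N) (\<lambda>\<alpha>. {k. \<alpha> k \<noteq> 0}). g (mi_minus \<alpha> (unit_mi k)) k)"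
    by (rule sum.Sigma[OF mi_box_finite fin])
  also have "\<dots> = (\<Sum>(\<beta>,k)\<in>mi_box n N \<times> {1..Suc N}. g \<beta> k)"
  proof (rule sum.reindex_bij_witness[where i = "\<lambda>(\<beta>,k). (mi_plus \<beta> k, k)" and j = "\<lambda>(\<alpha>,k). (mi_minus \<alpha> (unit_mi k), k)"])
    fix a assume "a \<in> Sigma (mi_box (Suc n) N) (\<lambda>\<alpha>. {k. \<alpha> k \<noteq> 0})"
    then obtain \<alpha> k where a: "a = (\<alpha>, k)" "\<alpha> \<in> mi_box (Suc n) N" "\<alpha> k \<noteq> 0" by auto
    note [simp] = a(1) mi_plus_mi_minus[of \<alpha> k, OF a(3)]
    show "(case (case a of (\<alpha>,k) \<Rightarrow> (mi_minus \<alpha> (unit_mi k), k)) of (\<beta>,k) \<Rightarrow> (mi_plus \<beta> k, k)) = a" by simp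
    show "(case a of (\<alpha>,k) \<Rightarrow> (mi_minus \<alpha> (unit_mi k), k)) \<in> mi_box n N \<times> {1..Suc N}"
      using mi_minus_in_box[OF a(2,3)] by simp
    show "(case (case a of (\<alpha>,k) \<Rightarrow> (mi_minus \<alpha> (unit_mi k), k)) of (\<beta>,k) \<Rightarrow> g \<beta> k) = (case a of (\<alpha>,k) \<Rightarrow> g (mi_minus \<alpha> (unit_mi k)) k)" by simp
  next
    fix b assume "b \<in> mi_box n N \<times> {1..Suc N}"
    then obtain \<beta> k where b: "b = (\<beta>, k)" "\<beta> \<in> mi_box n N" "k \<in> {1..Suc N}" by auto
    note [simp] = b(1) mi_minus_mi_plus
    show "(case (case b of (\<beta>,k) \<Rightarrow> (mi_plus \<beta> k, k)) of (\<alpha>,k) \<Rightarrow> (mi_minus \<alpha> (unit_mi k), k)) = b" by simp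
    show "(case b of (\<beta>,k) \<Rightarrow> (mi_plus \<beta> k, k)) \<in> Sigma (mi_box (Suc n) N) (\<lambda>\<alpha>. {k. \<alpha> k \<noteq> 0})"
      using mi_plus_in_box[OF b(2,3)] by (simp add: mi_plus_def unit_mi_def)
  qed
  also have "\<dots> = (\<Sum>\<beta>\<in>mi_box n N. \<Sum>k=1..Suc N. g \<beta> k)" by (rule sum.cartesian_product[symmetric])
  finally show ?thesis .
qed

lemma supp_unit_mi: "{j. unit_mi k j \<noteq> 0} = {k}" by (auto simp: unit_mi_def)

lemma hermite_1_2: "hermite (Suc 0) x = x" "hermite (Suc (Suc 0)) x = x\<^sup>2 - 1"
  by (simp_all add: hermite_eq_poly pderiv_pCons power2_eq_square)

lemma mi_weight_unit: "k \<in> {1..Suc N} \<Longrightarrow> mi_weight N (unit_mi k) = fejw (Suc N) k"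
  unfolding mi_weight_def supp_unit_mi by (simp add: unit_mi_def)

lemma xi_mi_unit: "xi_mi W (unit_mi k) \<omega> = xi W k \<omega>"
  unfolding xi_mi_def supp_unit_mi by (simp add: unit_mi_def hermite_1_2)

lemma mi_weight_pair:
  assumes "k \<in> {1..Suc N}" "l \<in> {1..Suc N}"
  shows "mi_weight N (mi_plus (unit_mi l) k) = fejw (Suc N) k * fejw (Suc N) l"
proof -
  have s: "{j. mi_plus (unit_mi l) k j \<noteq> 0} = {k, l}" unfolding supp_mi_plus supp_unit_mi by simp
  show ?thesis
  proof (cases "k = l")
    case True
    have P: "(\<Prod>j\<in>{k,l}. h j) = h k" for h :: "nat \<Rightarrow> real" using True by simp
    have v: "mi_plus (unit_mi l) k k = 2" using True by (simp add: mi_plus_def unit_mi_def)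
    show ?thesis unfolding mi_weight_def s P v using assms True by (simp add: power2_eq_square)
  next
    case False
    have P: "(\<Prod>j\<in>{k,l}. h j) = h k * h l" for h :: "nat \<Rightarrow> real" using False by simp
    have v: "mi_plus (unit_mi l) k k = 1" "mi_plus (unit_mi l) k l = 1" using False by (simp_all add: mi_plus_def unit_mi_def)
    show ?thesis unfolding mi_weight_def s P v using assms by simp
  qed
qed

text \<open>On the diagonal the square root cancels the normalisation sqrt(2!) of H_2, so no
  combinatorial factor survives, and the -1 in H_2 becomes a Kronecker delta.\<close>

lemma xi_mi_pair:
  "sqrt (real (Suc (unit_mi l k))) * xi_mi W (mi_plus (unit_mi l) k) \<omega> = xi W k \<omega> * xi W l \<omega> - (if k = l then 1 else 0)"
proof -
  have s: "{j. mi_plus (unit_mi l) k j \<noteq> 0} = {k, l}" unfolding supp_mi_plus supp_unit_mi by simp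
  show ?thesis
  proof (cases "k = l")
    case True
    have P: "(\<Prod>j\<in>{k,l}. h j) = h k" for h :: "nat \<Rightarrow> real" using True by simp
    have v: "mi_plus (unit_mi l) k k = Suc (Suc 0)" "unit_mi l k = 1" using True by (simp_all add: mi_plus_def unit_mi_def)
    have f: "fact (Suc (Suc 0)) = (2::real)" "real (Suc 1) = 2" by simp_all
    have "sqrt 2 * (((xi W k \<omega>)\<^sup>2 - 1) / sqrt 2) = (xi W k \<omega>)\<^sup>2 - 1" by simp
    then show ?thesis unfolding xi_mi_def s P v f hermite_1_2 using True by (simp only: power2_eq_square simp_thms if_True)
  next
    case False
    have P: "(\<Prod>j\<in>{k,l}. h j) = h k * h l" for h :: "nat \<Rightarrow> real" using False by simp
    have v: "mi_plus (unit_mi l) k k = Suc 0" "mi_plus (unit_mi l) k l = Suc 0" "unit_mi l k = 0" using False by (simp_all add: mi_plus_def unit_mi_def)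
    show ?thesis unfolding xi_mi_def s P v hermite_1_2 using False by simp
  qed
qed

lemma Top_cong:
  assumes "\<And>s y. s \<in> {0<..<t} \<Longrightarrow> y \<in> {0..pi} \<Longrightarrow> f s y = g s y"
  shows "Top h f t x = Top h g t x"
  unfolding Top_def integral_open_interval_real[of 0 t]
  by (intro integral_cong) (simp add: assms)

text \<open>For a continuous path this is the derivative of \<open>fmean N w\<close>; the index
  \<open>Suc N\<close> matches the shift made there.\<close>

definition path_noise :: "nat \<Rightarrow> (real \<Rightarrow> real) \<Rightarrow> real \<Rightarrow> real" where
  "path_noise N w y = (\<Sum>k=1..Suc N. fejw (Suc N) k * path_xi w k * mk k y)"

lemma path_noise_continuous: "continuous_on S (path_noise N w)"
  unfolding path_noise_def by (intro continuous_intros mk_continuous)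

context heat_phi begin

text \<open>\<open>c\<close> and \<open>X\<close> stay arbitrary so that orders one and two are both
  covered. The square root from the recursion is grouped with \<open>X\<close>, where it cancels
  against the Hermite normalisation.\<close>

lemma chaos_weighted_sum:
  "(\<Sum>\<alpha>\<in>mi_box (Suc n) N. c \<alpha> * chaos_coef (Suc n) \<phi> 1 \<alpha> t x * X \<alpha>) =
   (\<Sum>\<beta>\<in>mi_box n N. \<Sum>k=1..Suc N. c (mi_plus \<beta> k) * Top (mk k) (chaos_coef n \<phi> 1 \<beta>) t x * (sqrt (real (Suc (\<beta> k))) * X (mi_plus \<beta> k)))"
proof -
  let ?g = "\<lambda>\<beta> k. c (mi_plus \<beta> k) * Top (mk k) (chaos_coef n \<phi> 1 \<beta>) t x * (sqrt (real (Suc (\<beta> k))) * X (mi_plus \<beta> k))"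
  have "c \<alpha> * chaos_coef (Suc n) \<phi> 1 \<alpha> t x * X \<alpha> = (\<Sum>k\<in>{k. \<alpha> k \<noteq> 0}. ?g (mi_minus \<alpha> (unit_mi k)) k)" for \<alpha>
  proof -
    have eq: "?g (mi_minus \<alpha> (unit_mi k)) k = c \<alpha> * (sqrt (real (\<alpha> k)) * Top (mk k) (chaos_coef n \<phi> 1 (mi_minus \<alpha> (unit_mi k))) t x) * X \<alpha>"
      if k: "k \<in> {k. \<alpha> k \<noteq> 0}" for k
    proof -
      have "Suc (mi_minus \<alpha> (unit_mi k) k) = \<alpha> k" using k by (simp add: mi_minus_def unit_mi_def)
      moreover have "mi_plus (mi_minus \<alpha> (unit_mi k)) k = \<alpha>" by (rule mi_plus_mi_minus) (use k in simp)
      ultimately show ?thesis by (simp only: mult_ac)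
    qed
    have "c \<alpha> * chaos_coef (Suc n) \<phi> 1 \<alpha> t x * X \<alpha> =
      (\<Sum>k\<in>{k. \<alpha> k \<noteq> 0}. c \<alpha> * (sqrt (real (\<alpha> k)) * Top (mk k) (chaos_coef n \<phi> 1 (mi_minus \<alpha> (unit_mi k))) t x) * X \<alpha>)"
      by (simp only: chaos_Suc mult_1_left sum_distrib_left sum_distrib_right)
    also have "\<dots> = (\<Sum>k\<in>{k. \<alpha> k \<noteq> 0}. ?g (mi_minus \<alpha> (unit_mi k)) k)" by (rule sum.cong[OF refl eq[symmetric]])
    finally show ?thesis .
  qed
  then show ?thesis by (simp only: sum_mi_box_Suc[of ?g])
qed

lemma first_chaos_sum:
  assumes x: "x \<in> {0..pi}"
  shows "(\<Sum>\<alpha>\<in>mi_box 1 N. mi_weight N \<alpha> * chaos_coef 1 \<phi> 1 \<alpha> T x * xi_mi W \<alpha> \<omega>) = Top (path_noise N (W \<omega>)) u0 T x"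
proof -
  have TT: "T \<in> {0<..T}" using T_pos by simp
  have u: "mi_plus (\<lambda>_. 0) k = unit_mi k" for k by (simp add: mi_plus_def)
  have c0: "chaos_coef 0 \<phi> 1 \<alpha> = u0" for \<alpha> by (intro ext) simp
  have "(\<Sum>\<alpha>\<in>mi_box (Suc 0) N. mi_weight N \<alpha> * chaos_coef (Suc 0) \<phi> 1 \<alpha> T x * xi_mi W \<alpha> \<omega>)
     = (\<Sum>k=1..Suc N. mi_weight N (unit_mi k) * Top (mk k) u0 T x * (sqrt 1 * xi_mi W (unit_mi k) \<omega>))"
    unfolding chaos_weighted_sum mi_box_0 c0 by (simp add: u)
  also have "\<dots> = (\<Sum>k=1..Suc N. fejw (Suc N) k * path_xi (W \<omega>) k * Top (mk k) u0 T x)"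
    by (intro sum.cong refl) (simp add: mi_weight_unit xi_mi_unit xi_eq_path_xi mult_ac)
  also have "\<dots> = Top (path_noise N (W \<omega>)) u0 T x"
    unfolding path_noise_def[abs_def] by (rule Top_sum_noise[OF _ heat_sol_cont_X mk_continuous TT x, symmetric]) simp
  finally show ?thesis by simp
qed

lemma second_chaos_sum:
  assumes x: "x \<in> {0..pi}"
  shows "(\<Sum>\<alpha>\<in>mi_box 2 N. mi_weight N \<alpha> * chaos_coef 2 \<phi> 1 \<alpha> T x * xi_mi W \<alpha> \<omega>) =
    Top (path_noise N (W \<omega>)) (Top (path_noise N (W \<omega>)) u0) T x - (\<Sum>k=1..Suc N. (fejw (Suc N) k)\<^sup>2 * Top (mk k) (Top (mk k) u0) T x)"
proof -
  let ?K = "{1..Suc N}" let ?c = "fejw (Suc N)" let ?\<xi> = "path_xi (W \<omega>)"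
  let ?a = "\<lambda>k l. Top (mk k) (Top (mk l) u0) T x"
  have TT: "T \<in> {0<..T}" using T_pos by simp
  have c0: "chaos_coef 0 \<phi> 1 \<alpha> = u0" for \<alpha> by (intro ext) simp
  have c1: "chaos_coef (Suc 0) \<phi> 1 (unit_mi l) = Top (mk l) u0" for l
    unfolding fun_eq_iff chaos_Suc supp_unit_mi c0 by (simp add: unit_mi_def)
  have cX: "\<exists>B. cont_X T B (Top (mk l) u0)" for l by (rule Top_cont_X_ex[OF heat_sol_cont_X mk_continuous])
  have alg: "(p * q) * a * (r * s - d) = (q * s) * ((p * r) * a) - p * q * a * d" for p q a r s d :: real
    by (simp add: algebra_simps)
  \<comment> \<open>Here k is the mode of the outer and l that of the inner Duhamel integral. The
    product part factorises over k and l, the Kronecker part is the trace.\<close>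
  have split_diag: "(?c k * ?c l) * ?a k l * (?\<xi> k * ?\<xi> l - (if k = l then 1 else 0)) =
    (?c l * ?\<xi> l) * ((?c k * ?\<xi> k) * ?a k l) - (if k = l then (?c k)\<^sup>2 * ?a k k else 0)" for k l
    unfolding alg by (cases "k = l") (simp_all only: power2_eq_square if_True if_False mult_1_right mult_zero_right simp_thms)
  have "(\<Sum>\<alpha>\<in>mi_box (Suc (Suc 0)) N. mi_weight N \<alpha> * chaos_coef (Suc (Suc 0)) \<phi> 1 \<alpha> T x * xi_mi W \<alpha> \<omega>)
     = (\<Sum>l\<in>?K. \<Sum>k\<in>?K. mi_weight N (mi_plus (unit_mi l) k) * ?a k l * (sqrt (real (Suc (unit_mi l k))) * xi_mi W (mi_plus (unit_mi l) k) \<omega>))"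
    unfolding chaos_weighted_sum sum_mi_box_1 c1 ..
  also have "\<dots> = (\<Sum>l\<in>?K. \<Sum>k\<in>?K. (?c k * ?c l) * ?a k l * (?\<xi> k * ?\<xi> l - (if k = l then 1 else 0)))"
    unfolding xi_mi_pair xi_eq_path_xi by (intro sum.cong refl) (simp only: mi_weight_pair)
  also have "\<dots> = (\<Sum>l\<in>?K. \<Sum>k\<in>?K. (?c l * ?\<xi> l) * ((?c k * ?\<xi> k) * ?a k l)) - (\<Sum>l\<in>?K. \<Sum>k\<in>?K. if k = l then (?c k)\<^sup>2 * ?a k k else 0)"
    unfolding sum_subtractf[symmetric] by (intro sum.cong refl) (rule split_diag)
  also have "(\<Sum>l\<in>?K. \<Sum>k\<in>?K. if k = l then (?c k)\<^sup>2 * ?a k k else 0) = (\<Sum>k\<in>?K. (?c k)\<^sup>2 * ?a k k)"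
    by (intro sum.cong refl) simp
  also have "(\<Sum>l\<in>?K. \<Sum>k\<in>?K. (?c l * ?\<xi> l) * ((?c k * ?\<xi> k) * ?a k l)) = (\<Sum>l\<in>?K. (?c l * ?\<xi> l) * Top (path_noise N (W \<omega>)) (Top (mk l) u0) T x)"
  proof (intro sum.cong refl)
    fix l
    obtain B where B: "cont_X T B (Top (mk l) u0)" using cX ..
    have "Top (path_noise N (W \<omega>)) (Top (mk l) u0) T x = (\<Sum>k\<in>?K. (?c k * ?\<xi> k) * ?a k l)"
      unfolding path_noise_def[abs_def] by (rule Top_sum_noise[OF _ B mk_continuous TT x]) simp
    then show "(\<Sum>k\<in>?K. (?c l * ?\<xi> l) * ((?c k * ?\<xi> k) * ?a k l)) = (?c l * ?\<xi> l) * Top (path_noise N (W \<omega>)) (Top (mk l) u0) T x"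
      by (simp only: sum_distrib_left)
  qed
  also have "\<dots> = Top (path_noise N (W \<omega>)) (\<lambda>s y. \<Sum>l\<in>?K. (?c l * ?\<xi> l) * Top (mk l) u0 s y) T x"
    by (rule Top_sum_arg[OF _ cX path_noise_continuous TT x, symmetric]) simp
  also have "\<dots> = Top (path_noise N (W \<omega>)) (Top (path_noise N (W \<omega>)) u0) T x"
  proof (rule Top_cong)
    fix s y assume "s \<in> {0<..<T}" "y \<in> {0..pi}"
    then show "(\<Sum>l\<in>?K. (?c l * ?\<xi> l) * Top (mk l) u0 s y) = Top (path_noise N (W \<omega>)) u0 s y"
      unfolding path_noise_def[abs_def] by (intro Top_sum_noise[OF _ heat_sol_cont_X mk_continuous, symmetric]) auto
  qed
  finally show ?thesis by (simp add: numeral_2_eq_2)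
qed

end

section \<open>Weighted orthogonal series\<close>

definition sq_int :: "'w measure \<Rightarrow> ('w \<Rightarrow> real) \<Rightarrow> bool" where
  "sq_int M f \<longleftrightarrow> f \<in> borel_measurable M \<and> integrable M (\<lambda>\<omega>. (f \<omega>)\<^sup>2)"

lemma two_sq_bound: "(a + b)\<^sup>2 \<le> 2 * a\<^sup>2 + 2 * (b::real)\<^sup>2"
proof -
  have "0 \<le> (a - b)\<^sup>2" by simp
  then show ?thesis by (simp add: power2_eq_square algebra_simps)
qed

lemma sq_int_add:
  assumes "sq_int M f" "sq_int M g"
  shows "sq_int M (\<lambda>\<omega>. f \<omega> + g \<omega>)"
    "(LINT \<omega>|M. (f \<omega> + g \<omega>)\<^sup>2) \<le> 2 * (LINT \<omega>|M. (f \<omega>)\<^sup>2) + 2 * (LINT \<omega>|M. (g \<omega>)\<^sup>2)"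
proof -
  have [measurable]: "f \<in> borel_measurable M" "g \<in> borel_measurable M" using assms by (auto simp: sq_int_def)
  have i: "integrable M (\<lambda>\<omega>. 2 * (f \<omega>)\<^sup>2 + 2 * (g \<omega>)\<^sup>2)" using assms by (auto simp: sq_int_def)
  have j: "integrable M (\<lambda>\<omega>. (f \<omega> + g \<omega>)\<^sup>2)"
    by (rule Bochner_Integration.integrable_bound[OF i]) (auto intro!: AE_I2 order_trans[OF two_sq_bound])
  then show "sq_int M (\<lambda>\<omega>. f \<omega> + g \<omega>)" by (simp add: sq_int_def)
  have "(LINT \<omega>|M. (f \<omega> + g \<omega>)\<^sup>2) \<le> (LINT \<omega>|M. 2 * (f \<omega>)\<^sup>2 + 2 * (g \<omega>)\<^sup>2)"
    by (intro integral_mono i j two_sq_bound)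
  also have "\<dots> = 2 * (LINT \<omega>|M. (f \<omega>)\<^sup>2) + 2 * (LINT \<omega>|M. (g \<omega>)\<^sup>2)"
    using assms by (subst Bochner_Integration.integral_add) (auto simp: sq_int_def)
  finally show "(LINT \<omega>|M. (f \<omega> + g \<omega>)\<^sup>2) \<le> 2 * (LINT \<omega>|M. (f \<omega>)\<^sup>2) + 2 * (LINT \<omega>|M. (g \<omega>)\<^sup>2)" .
qed

lemma sq_int_minus: "sq_int M f \<Longrightarrow> sq_int M (\<lambda>\<omega>. - f \<omega>)"
  by (simp add: sq_int_def)

lemma sq_int_diff: "sq_int M f \<Longrightarrow> sq_int M g \<Longrightarrow> sq_int M (\<lambda>\<omega>. f \<omega> - g \<omega>)"
  using sq_int_add(1)[of M f "\<lambda>\<omega>. - g \<omega>"] sq_int_minus[of M g] by simp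

locale orthonormal_family =
  fixes M :: "'w measure" and A :: "'i set" and X :: "'i \<Rightarrow> 'w \<Rightarrow> real"
  assumes X_meas: "\<And>a. a \<in> A \<Longrightarrow> X a \<in> borel_measurable M"
    and X_int: "\<And>a b. a \<in> A \<Longrightarrow> b \<in> A \<Longrightarrow> integrable M (\<lambda>\<omega>. X a \<omega> * X b \<omega>)"
    and X_orth: "\<And>a b. a \<in> A \<Longrightarrow> b \<in> A \<Longrightarrow> (LINT \<omega>|M. X a \<omega> * X b \<omega>) = (if a = b then 1 else 0)"
begin

lemma sum_sq:
  assumes "finite F" "F \<subseteq> A"
  shows "sq_int M (\<lambda>\<omega>. \<Sum>a\<in>F. d a * X a \<omega>)" "(LINT \<omega>|M. (\<Sum>a\<in>F. d a * X a \<omega>)\<^sup>2) = (\<Sum>a\<in>F. (d a)\<^sup>2)"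
proof -
  have ex: "(\<Sum>a\<in>F. d a * X a \<omega>)\<^sup>2 = (\<Sum>a\<in>F. \<Sum>b\<in>F. d a * d b * (X a \<omega> * X b \<omega>))" for \<omega>
    unfolding power2_eq_square sum_product by (intro sum.cong refl) (simp only: mult_ac)
  have i: "integrable M (\<lambda>\<omega>. d a * d b * (X a \<omega> * X b \<omega>))" if "a \<in> F" "b \<in> F" for a b
    using that assms by (intro integrable_mult_right X_int) auto
  show "sq_int M (\<lambda>\<omega>. \<Sum>a\<in>F. d a * X a \<omega>)"
    unfolding sq_int_def ex using assms i X_meas
    by (auto intro!: Bochner_Integration.integrable_sum borel_measurable_sum borel_measurable_times)
  have "(LINT \<omega>|M. (\<Sum>a\<in>F. d a * X a \<omega>)\<^sup>2) = (\<Sum>a\<in>F. \<Sum>b\<in>F. d a * d b * (LINT \<omega>|M. X a \<omega> * X b \<omega>))"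
    unfolding ex using i by (simp add: Bochner_Integration.integral_sum)
  also have "\<dots> = (\<Sum>a\<in>F. \<Sum>b\<in>F. if a = b then (d a)\<^sup>2 else 0)"
  proof (intro sum.cong refl)
    fix a b assume "a \<in> F" "b \<in> F"
    then have "a \<in> A" "b \<in> A" using assms(2) by auto
    from X_orth[OF this] show "d a * d b * (LINT \<omega>|M. X a \<omega> * X b \<omega>) = (if a = b then (d a)\<^sup>2 else 0)"
      by (simp add: power2_eq_square)
  qed
  also have "\<dots> = (\<Sum>a\<in>F. (d a)\<^sup>2)" using assms(1) by simp
  finally show "(LINT \<omega>|M. (\<Sum>a\<in>F. d a * X a \<omega>)\<^sup>2) = (\<Sum>a\<in>F. (d a)\<^sup>2)" .
qed

context
  fixes U :: "'w \<Rightarrow> real" and u :: "'i \<Rightarrow> real" and B :: real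
  assumes U: "sq_int M U"
    and net: "((\<lambda>F. LINT \<omega>|M. (U \<omega> - (\<Sum>a\<in>F. u a * X a \<omega>))\<^sup>2) \<longlongrightarrow> 0) (finite_subsets_at_top A)"
    and B: "\<And>F. finite F \<Longrightarrow> F \<subseteq> A \<Longrightarrow> (\<Sum>a\<in>F. (u a)\<^sup>2) \<le> B"
begin

lemma net_obtain:
  assumes "e > 0" "finite G" "G \<subseteq> A"
  obtains F where "finite F" "G \<subseteq> F" "F \<subseteq> A" "(LINT \<omega>|M. (U \<omega> - (\<Sum>a\<in>F. u a * X a \<omega>))\<^sup>2) < e"
proof -
  have "\<forall>\<^sub>F F in finite_subsets_at_top A. (LINT \<omega>|M. (U \<omega> - (\<Sum>a\<in>F. u a * X a \<omega>))\<^sup>2) < e"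
    by (rule order_tendstoD(2)[OF net assms(1)])
  then have "\<exists>F0. finite F0 \<and> F0 \<subseteq> A \<and> (\<forall>F. finite F \<and> F0 \<subseteq> F \<and> F \<subseteq> A \<longrightarrow> (LINT \<omega>|M. (U \<omega> - (\<Sum>a\<in>F. u a * X a \<omega>))\<^sup>2) < e)"
    unfolding eventually_finite_subsets_at_top .
  then obtain F0 where F0: "finite F0 \<and> F0 \<subseteq> A \<and> (\<forall>F. finite F \<and> F0 \<subseteq> F \<and> F \<subseteq> A \<longrightarrow> (LINT \<omega>|M. (U \<omega> - (\<Sum>a\<in>F. u a * X a \<omega>))\<^sup>2) < e)" ..
  have sub: "finite (F0 \<union> G)" "F0 \<subseteq> F0 \<union> G" "G \<subseteq> F0 \<union> G" "F0 \<union> G \<subseteq> A" using F0 assms(2,3) by auto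
  then have "(LINT \<omega>|M. (U \<omega> - (\<Sum>a\<in>F0 \<union> G. u a * X a \<omega>))\<^sup>2) < e" using F0 by simp
  then show thesis by (rule that[OF sub(1,3,4)])
qed

text \<open>One finite sum at mean-square distance below 1 suffices. The constants are crude, but
  later only geometric growth in the order of the chaos counts.\<close>

lemma second_moment_bound: "(LINT \<omega>|M. (U \<omega>)\<^sup>2) \<le> 2 + 2 * B"
proof -
  obtain F where F: "finite F" "F \<subseteq> A" "(LINT \<omega>|M. (U \<omega> - (\<Sum>a\<in>F. u a * X a \<omega>))\<^sup>2) < 1"
    by (rule net_obtain[of 1 "{}"]) auto
  note S = sum_sq[OF F(1,2), of u]
  have "(LINT \<omega>|M. (U \<omega>)\<^sup>2) = (LINT \<omega>|M. ((U \<omega> - (\<Sum>a\<in>F. u a * X a \<omega>)) + (\<Sum>a\<in>F. u a * X a \<omega>))\<^sup>2)" by simp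
  also have "\<dots> \<le> 2 * (LINT \<omega>|M. (U \<omega> - (\<Sum>a\<in>F. u a * X a \<omega>))\<^sup>2) + 2 * (LINT \<omega>|M. (\<Sum>a\<in>F. u a * X a \<omega>)\<^sup>2)"
    by (rule sq_int_add(2)[OF sq_int_diff[OF U S(1)] S(1)])
  also have "\<dots> \<le> 2 * 1 + 2 * B" using F(3) B[OF F(1,2)] S(2) by (intro add_mono mult_left_mono) auto
  finally show ?thesis by simp
qed

text \<open>A finite set \<open>F0\<close> carries all but e of the total square sum. For each N the
  net supplies a finite set F containing \<open>F0\<close> and the box, and U minus the weighted sum
  is U minus the plain sum over F plus an orthogonal sum with coefficients (1 - c) u. The latter is
  small on \<open>F0\<close> for large N and on the rest of F by the tail bound.\<close>

lemma weighted_sums_tendsto: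
  fixes c :: "nat \<Rightarrow> 'i \<Rightarrow> real"
  assumes c: "\<And>N a. a \<in> A \<Longrightarrow> 0 \<le> c N a" "\<And>N a. a \<in> A \<Longrightarrow> c N a \<le> 1" "\<And>a. a \<in> A \<Longrightarrow> (\<lambda>N. c N a) \<longlonglongrightarrow> 1"
    and G: "\<And>N. finite (G N)" "\<And>N. G N \<subseteq> A" "\<And>N a. a \<in> A \<Longrightarrow> a \<notin> G N \<Longrightarrow> c N a = 0"
  shows "(\<lambda>N. LINT \<omega>|M. (U \<omega> - (\<Sum>a\<in>G N. c N a * u a * X a \<omega>))\<^sup>2) \<longlonglongrightarrow> 0"
proof (rule LIMSEQ_I)
  fix r :: real assume r: "r > 0"
  \<comment> \<open>The final bound is 2 e + 2 (2 e) = 6 e, below r = 8 e.\<close>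
  define e where "e = r / 8"
  have e: "e > 0" using r by (simp add: e_def)
  let ?S = "\<lambda>F. \<Sum>a\<in>F. (u a)\<^sup>2"
  let ?Fs = "{F. finite F \<and> F \<subseteq> A}"
  have bdd: "bdd_above (?S ` ?Fs)" using B by (intro bdd_aboveI2[where M = B]) auto
  have ne: "?S ` ?Fs \<noteq> {}" by auto
  have "Sup (?S ` ?Fs) - e < Sup (?S ` ?Fs)" using e by simp
  then obtain F0 where F0: "finite F0" "F0 \<subseteq> A" "Sup (?S ` ?Fs) - e < ?S F0"
    using less_cSup_iff[OF ne bdd] by auto
  have tail: "?S F \<le> e" if "finite F" "F \<subseteq> A" "F \<inter> F0 = {}" for F
  proof -
    have "?S (F \<union> F0) \<le> Sup (?S ` ?Fs)" using that F0 by (intro cSup_upper bdd) auto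
    moreover have "?S (F \<union> F0) = ?S F + ?S F0" using that F0 by (intro sum.union_disjoint) auto
    ultimately show ?thesis using F0(3) by linarith
  qed
  have "(\<lambda>N. \<Sum>a\<in>F0. (1 - c N a)\<^sup>2 * (u a)\<^sup>2) \<longlonglongrightarrow> (\<Sum>a\<in>F0. (1 - 1)\<^sup>2 * (u a)\<^sup>2)"
    using c(3) F0(2) by (intro tendsto_intros) auto
  then have "\<forall>\<^sub>F N in sequentially. (\<Sum>a\<in>F0. (1 - c N a)\<^sup>2 * (u a)\<^sup>2) < e" using e by (intro order_tendstoD(2)) auto
  then obtain N0 where N0: "\<And>N. N \<ge> N0 \<Longrightarrow> (\<Sum>a\<in>F0. (1 - c N a)\<^sup>2 * (u a)\<^sup>2) < e" unfolding eventually_sequentially by blast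
  show "\<exists>N0. \<forall>N\<ge>N0. norm ((LINT \<omega>|M. (U \<omega> - (\<Sum>a\<in>G N. c N a * u a * X a \<omega>))\<^sup>2) - 0) < r"
  proof (intro exI[of _ N0] allI impI)
    fix N assume N: "N0 \<le> N"
    obtain F where F: "finite F" "G N \<union> F0 \<subseteq> F" "F \<subseteq> A" "(LINT \<omega>|M. (U \<omega> - (\<Sum>a\<in>F. u a * X a \<omega>))\<^sup>2) < e"
      by (rule net_obtain[OF e, of "G N \<union> F0"]) (use G F0 in auto)
    note S = sum_sq[OF F(1,3), of u]
    note D = sum_sq[OF F(1,3), of "\<lambda>a. (1 - c N a) * u a"]
    have ext: "(\<Sum>a\<in>G N. c N a * u a * X a \<omega>) = (\<Sum>a\<in>F. c N a * u a * X a \<omega>)" for \<omega>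
      using F G by (intro sum.mono_neutral_left) auto
    have eq: "U \<omega> - (\<Sum>a\<in>G N. c N a * u a * X a \<omega>) = (U \<omega> - (\<Sum>a\<in>F. u a * X a \<omega>)) + (\<Sum>a\<in>F. (1 - c N a) * u a * X a \<omega>)" for \<omega>
      unfolding ext by (simp add: left_diff_distrib sum_subtractf)
    have "(LINT \<omega>|M. (U \<omega> - (\<Sum>a\<in>G N. c N a * u a * X a \<omega>))\<^sup>2) \<le> 2 * (LINT \<omega>|M. (U \<omega> - (\<Sum>a\<in>F. u a * X a \<omega>))\<^sup>2) + 2 * (LINT \<omega>|M. (\<Sum>a\<in>F. (1 - c N a) * u a * X a \<omega>)\<^sup>2)"
      unfolding eq by (rule sq_int_add(2)[OF sq_int_diff[OF U S(1)] D(1)])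
    also have "\<dots> \<le> 2 * e + 2 * (2 * e)"
    proof (intro add_mono mult_left_mono)
      have "(\<Sum>a\<in>F. ((1 - c N a) * u a)\<^sup>2) = (\<Sum>a\<in>F0. (1 - c N a)\<^sup>2 * (u a)\<^sup>2) + (\<Sum>a\<in>F - F0. (1 - c N a)\<^sup>2 * (u a)\<^sup>2)"
        using F by (simp add: power_mult_distrib sum.subset_diff[of F0 F] add.commute)
      also have "(\<Sum>a\<in>F - F0. (1 - c N a)\<^sup>2 * (u a)\<^sup>2) \<le> ?S (F - F0)"
      proof (rule sum_mono)
        fix a assume "a \<in> F - F0"
        then have a: "a \<in> A" using F by auto
        have "(1 - c N a)\<^sup>2 \<le> 1" using c(1,2)[OF a, of N] by (simp add: abs_square_le_1)
        then show "(1 - c N a)\<^sup>2 * (u a)\<^sup>2 \<le> (u a)\<^sup>2" by (simp add: mult_left_le_one_le)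
      qed
      also have "?S (F - F0) \<le> e" using F by (intro tail) auto
      finally show "(LINT \<omega>|M. (\<Sum>a\<in>F. (1 - c N a) * u a * X a \<omega>)\<^sup>2) \<le> 2 * e" using N0[OF N] D(2) by simp
    qed (use F in auto)
    also have "\<dots> < r" using r by (simp add: e_def)
    finally show "norm ((LINT \<omega>|M. (U \<omega> - (\<Sum>a\<in>G N. c N a * u a * X a \<omega>))\<^sup>2) - 0) < r" by simp
  qed
qed

text \<open>Mean-square convergence gives almost sure convergence along a subsequence, and this is
  enough to identify the limit path by path.\<close>

lemma weighted_sums_AE_subseq:
  fixes c :: "nat \<Rightarrow> 'i \<Rightarrow> real"
  assumes c: "\<And>N a. a \<in> A \<Longrightarrow> 0 \<le> c N a" "\<And>N a. a \<in> A \<Longrightarrow> c N a \<le> 1" "\<And>a. a \<in> A \<Longrightarrow> (\<lambda>N. c N a) \<longlonglongrightarrow> 1"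
    and G: "\<And>N. finite (G N)" "\<And>N. G N \<subseteq> A" "\<And>N a. a \<in> A \<Longrightarrow> a \<notin> G N \<Longrightarrow> c N a = 0"
  shows "\<exists>\<rho> :: nat \<Rightarrow> nat. strict_mono \<rho> \<and> (AE \<omega> in M. (\<lambda>n. \<Sum>a\<in>G (\<rho> n). c (\<rho> n) a * u a * X a \<omega>) \<longlonglongrightarrow> U \<omega>)"
proof -
  let ?S = "\<lambda>N \<omega>. \<Sum>a\<in>G N. c N a * u a * X a \<omega>"
  have si: "integrable M (\<lambda>\<omega>. (U \<omega> - ?S N \<omega>)\<^sup>2)" for N
    using sq_int_diff[OF U sum_sq(1)[OF G(1)[of N] G(2)[of N], of "\<lambda>a. c N a * u a"]] by (simp add: sq_int_def)
  have "(\<lambda>N. LINT \<omega>|M. norm ((U \<omega> - ?S N \<omega>)\<^sup>2)) \<longlonglongrightarrow> 0"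
    using weighted_sums_tendsto[OF c G] by simp
  from tendsto_L1_AE_subseq[OF si this] obtain \<rho> :: "nat \<Rightarrow> nat" where \<rho>: "strict_mono \<rho>" "AE \<omega> in M. (\<lambda>n. (U \<omega> - ?S (\<rho> n) \<omega>)\<^sup>2) \<longlonglongrightarrow> 0"
    by blast
  have "AE \<omega> in M. (\<lambda>n. ?S (\<rho> n) \<omega>) \<longlonglongrightarrow> U \<omega>"
    using \<rho>(2)
  proof eventually_elim
    fix \<omega> assume "(\<lambda>n. (U \<omega> - ?S (\<rho> n) \<omega>)\<^sup>2) \<longlonglongrightarrow> 0"
    then have "(\<lambda>n. sqrt ((U \<omega> - ?S (\<rho> n) \<omega>)\<^sup>2)) \<longlonglongrightarrow> sqrt 0" by (rule tendsto_real_sqrt)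
    then have "(\<lambda>n. U \<omega> - ?S (\<rho> n) \<omega>) \<longlonglongrightarrow> 0" by (simp add: tendsto_rabs_zero_iff)
    from tendsto_diff[OF tendsto_const[of "U \<omega>"] this] show "(\<lambda>n. ?S (\<rho> n) \<omega>) \<longlonglongrightarrow> U \<omega>" by simp
  qed
  then show ?thesis using \<rho>(1) by blast
qed

end
end

text \<open>First absolute moments are at most 1 plus second moments, and are summed with a
  non-random radius r, so one null set serves all \<epsilon> with |\<epsilon>| \<le> r. The choice r
  = 1 / (2 (1 + E)) makes both r and r E at most 1/2.\<close>

lemma (in prob_space) AE_summable_geometric:
  fixes U :: "nat \<Rightarrow> 'a \<Rightarrow> real"
  assumes U: "\<And>n. sq_int M (U n)" and E: "E > 0" "\<And>n. (LINT \<omega>|M. (U n \<omega>)\<^sup>2) \<le> 2 + 2 * E ^ Suc n"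
  shows "\<exists>r>0. AE \<omega> in M. summable (\<lambda>n. r ^ n * \<bar>U n \<omega>\<bar>)"
proof -
  define r where "r = 1 / (2 * (1 + E))"
  have r: "0 < r" "r * (1 + E) = 1/2" "r \<le> 1/2" using E(1) by (auto simp: r_def field_simps)
  let ?a = "\<lambda>n \<omega>. r ^ n * \<bar>U n \<omega>\<bar>"
  have [measurable]: "U n \<in> borel_measurable M" for n using U by (simp add: sq_int_def)
  have i1: "integrable M (\<lambda>\<omega>. 1 + (U n \<omega>)\<^sup>2)" for n using U by (auto simp: sq_int_def)
  have ab: "\<bar>z\<bar> \<le> 1 + z\<^sup>2" for z :: real
  proof -
    have "0 \<le> (\<bar>z\<bar> - 1)\<^sup>2" by simp
    then show ?thesis using abs_ge_zero[of z] by (simp add: power2_eq_square algebra_simps) 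
  qed
  have i2: "integrable M (\<lambda>\<omega>. \<bar>U n \<omega>\<bar>)" for n
    by (rule Bochner_Integration.integrable_bound[OF i1[of n]]) (auto intro!: AE_I2 order_trans[OF ab])
  have Eb: "(LINT \<omega>|M. \<bar>U n \<omega>\<bar>) \<le> 3 + 2 * E ^ Suc n" for n
  proof -
    have "(LINT \<omega>|M. \<bar>U n \<omega>\<bar>) \<le> (LINT \<omega>|M. 1 + (U n \<omega>)\<^sup>2)" by (intro integral_mono i1 i2 ab)
    also have "\<dots> = 1 + (LINT \<omega>|M. (U n \<omega>)\<^sup>2)"
      using U by (subst Bochner_Integration.integral_add) (auto simp: sq_int_def prob_space)
    finally show ?thesis using E(2)[of n] by simp
  qed
  let ?b = "\<lambda>n. (3 + 2 * E) * (1/2::real) ^ n"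
  have bb: "(LINT \<omega>|M. ?a n \<omega>) \<le> ?b n" for n
  proof -
    have "(LINT \<omega>|M. ?a n \<omega>) \<le> r ^ n * (3 + 2 * E ^ Suc n)" using Eb[of n] r by (simp add: mult_left_mono)
    also have "\<dots> = 3 * r ^ n + 2 * E * (r * E) ^ n" by (simp add: power_mult_distrib algebra_simps)
    also have "\<dots> \<le> 3 * (1/2) ^ n + 2 * E * (1/2) ^ n"
    proof (intro add_mono mult_left_mono power_mono)
      show "r * E \<le> 1/2" using r by (simp add: distrib_left)
    qed (use r E in auto)
    finally show ?thesis by (simp add: algebra_simps)
  qed
  have sb: "summable ?b" by (intro summable_mult summable_geometric) auto
  have "(\<integral>\<^sup>+\<omega>. (\<Sum>n. ennreal (?a n \<omega>)) \<partial>M) = (\<Sum>n. \<integral>\<^sup>+\<omega>. ennreal (?a n \<omega>) \<partial>M)"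
    by (rule nn_integral_suminf) measurable
  also have "\<dots> = (\<Sum>n. ennreal (LINT \<omega>|M. ?a n \<omega>))"
    using i2 r by (intro suminf_cong nn_integral_eq_integral) auto
  also have "\<dots> \<le> (\<Sum>n. ennreal (?b n))" by (intro suminf_le ennreal_leI bb) auto
  also have "\<dots> = ennreal (\<Sum>n. ?b n)" using E(1) by (intro suminf_ennreal2 sb) auto
  finally have "(\<integral>\<^sup>+\<omega>. (\<Sum>n. ennreal (?a n \<omega>)) \<partial>M) \<noteq> \<infinity>" by (auto simp: top_unique)
  then have "AE \<omega> in M. (\<Sum>n. ennreal (?a n \<omega>)) \<noteq> \<infinity>"
    by (intro nn_integral_PInf_AE) auto
  then have "AE \<omega> in M. summable (\<lambda>n. ?a n \<omega>)"
  proof eventually_elim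
    fix \<omega> assume "(\<Sum>n. ennreal (?a n \<omega>)) \<noteq> \<infinity>"
    then show "summable (\<lambda>n. ?a n \<omega>)" using r by (intro summable_suminf_not_top) auto
  qed
  then show ?thesis using r(1) by blast
qed

section \<open>Comparison of the two solutions\<close>

lemma power_series_tail:
  fixes U :: "nat \<Rightarrow> real"
  assumes r: "r > 0" and S: "summable (\<lambda>n. r ^ n * \<bar>U n\<bar>)" and e: "\<bar>\<epsilon>\<bar> \<le> r"
  shows "\<bar>(\<Sum>n. \<epsilon> ^ n * U n) - (U 0 + \<epsilon> * U 1 + \<epsilon>\<^sup>2 * U 2)\<bar> \<le> \<bar>\<epsilon>\<bar> ^ 3 * (\<Sum>n. r ^ n * \<bar>U (n + 3)\<bar>)"
proof -
  have "summable (\<lambda>n. (1 / r ^ 3) * (r ^ (n + 3) * \<bar>U (n + 3)\<bar>))"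
    by (rule summable_mult[OF summable_ignore_initial_segment[OF S]])
  moreover have "(1 / r ^ 3) * (r ^ (n + 3) * \<bar>U (n + 3)\<bar>) = r ^ n * \<bar>U (n + 3)\<bar>" for n
    using r by (simp add: power_add)
  ultimately have S3: "summable (\<lambda>n. r ^ n * \<bar>U (n + 3)\<bar>)" by (simp only:)
  have b: "norm (\<epsilon> ^ (n + 3) * U (n + 3)) \<le> \<bar>\<epsilon>\<bar> ^ 3 * (r ^ n * \<bar>U (n + 3)\<bar>)" for n
  proof -
    have "norm (\<epsilon> ^ (n + 3) * U (n + 3)) = \<bar>\<epsilon>\<bar> ^ 3 * (\<bar>\<epsilon>\<bar> ^ n * \<bar>U (n + 3)\<bar>)"
      by (simp only: power_add real_norm_def abs_mult power_abs mult_ac)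
    also have "\<dots> \<le> \<bar>\<epsilon>\<bar> ^ 3 * (r ^ n * \<bar>U (n + 3)\<bar>)"
      using e by (intro mult_left_mono mult_right_mono power_mono) auto
    finally show ?thesis .
  qed
  have T: "summable (\<lambda>n. norm (\<epsilon> ^ (n + 3) * U (n + 3)))"
    by (rule summable_comparison_test'[OF summable_mult[OF S3, of "\<bar>\<epsilon>\<bar> ^ 3"], of 0]) (use b in simp)
  have "summable (\<lambda>n. \<epsilon> ^ n * U n)" using summable_norm_cancel[OF T] by (subst (asm) summable_iff_shift)
  from suminf_minus_initial_segment[OF this, of 3]
  have "(\<Sum>n. \<epsilon> ^ n * U n) - (U 0 + \<epsilon> * U 1 + \<epsilon>\<^sup>2 * U 2) = (\<Sum>n. \<epsilon> ^ (n + 3) * U (n + 3))"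
    by (simp add: numeral_3_eq_3 numeral_2_eq_2)
  also have "\<bar>(\<Sum>n. \<epsilon> ^ (n + 3) * U (n + 3))\<bar> \<le> (\<Sum>n. norm (\<epsilon> ^ (n + 3) * U (n + 3)))"
    using summable_norm[OF T] by simp
  also have "\<dots> \<le> (\<Sum>n. \<bar>\<epsilon>\<bar> ^ 3 * (r ^ n * \<bar>U (n + 3)\<bar>))" by (intro suminf_le b T summable_mult S3)
  also have "\<dots> = \<bar>\<epsilon>\<bar> ^ 3 * (\<Sum>n. r ^ n * \<bar>U (n + 3)\<bar>)" by (rule suminf_mult[OF S3])
  finally show ?thesis .
qed

text \<open>Orders 0 and 1 agree, so division by \<epsilon>^2 leaves R - U 2 and the tail of the
  series, together within (D + L) |\<epsilon>| of Q, where L controls the tail. The order bound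
  follows from the limit, since a quantity with a limit is bounded near 0.\<close>

lemma second_order_comparison:
  fixes U :: "nat \<Rightarrow> real" and v :: "real \<Rightarrow> real"
  assumes r: "r > 0" and S: "summable (\<lambda>n. r ^ n * \<bar>U n\<bar>)" and e0: "e0 > 0"
    and v: "\<And>\<epsilon>. \<epsilon> \<noteq> 0 \<Longrightarrow> \<bar>\<epsilon>\<bar> \<le> e0 \<Longrightarrow> \<exists>R. v \<epsilon> = U 0 + \<epsilon> * U 1 + \<epsilon>\<^sup>2 * R \<and> \<bar>R - (U 2 + Q)\<bar> \<le> D * \<bar>\<epsilon>\<bar>"
  shows "(\<lambda>\<epsilon>. \<bar>(\<Sum>n. \<epsilon> ^ n * U n) - v \<epsilon>\<bar>) \<in> O[at 0](\<lambda>\<epsilon>. \<epsilon>\<^sup>2)"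
    and "((\<lambda>\<epsilon>. (v \<epsilon> - (\<Sum>n. \<epsilon> ^ n * U n)) / \<epsilon>\<^sup>2) \<longlongrightarrow> Q) (at 0)"
proof -
  define L where "L = (\<Sum>n. r ^ n * \<bar>U (n + 3)\<bar>)"
  define e1 where "e1 = min e0 r"
  let ?f = "\<lambda>\<epsilon>. (v \<epsilon> - (\<Sum>n. \<epsilon> ^ n * U n)) / \<epsilon>\<^sup>2"
  have e1: "e1 > 0" using e0 r by (simp add: e1_def)
  have key: "\<bar>?f \<epsilon> - Q\<bar> \<le> (D + L) * \<bar>\<epsilon>\<bar>" if e: "\<epsilon> \<noteq> 0" "\<bar>\<epsilon>\<bar> \<le> e1" for \<epsilon>
  proof -
    obtain R where R: "v \<epsilon> = U 0 + \<epsilon> * U 1 + \<epsilon>\<^sup>2 * R" "\<bar>R - (U 2 + Q)\<bar> \<le> D * \<bar>\<epsilon>\<bar>"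
      using v[of \<epsilon>] e by (auto simp: e1_def)
    define t where "t = (\<Sum>n. \<epsilon> ^ n * U n) - (U 0 + \<epsilon> * U 1 + \<epsilon>\<^sup>2 * U 2)"
    have t: "\<bar>t\<bar> \<le> \<bar>\<epsilon>\<bar> ^ 3 * L" unfolding t_def L_def using e by (intro power_series_tail r S) (simp add: e1_def)
    have "v \<epsilon> - (\<Sum>n. \<epsilon> ^ n * U n) = \<epsilon>\<^sup>2 * (R - U 2) - t" unfolding R(1) t_def by (simp add: algebra_simps)
    then have "?f \<epsilon> - Q = (R - (U 2 + Q)) - t / \<epsilon>\<^sup>2" using e by (simp add: field_simps)
    moreover have "\<bar>t / \<epsilon>\<^sup>2\<bar> \<le> L * \<bar>\<epsilon>\<bar>"
    proof -
      have "\<bar>t / \<epsilon>\<^sup>2\<bar> \<le> (\<bar>\<epsilon>\<bar> ^ 3 * L) / \<epsilon>\<^sup>2" using t by (simp add: divide_right_mono abs_divide)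
      also have "\<bar>\<epsilon>\<bar> ^ 3 = \<bar>\<epsilon>\<bar> * \<epsilon>\<^sup>2" by (simp add: power3_eq_cube power2_eq_square)
      finally show ?thesis using e by (simp add: mult_ac)
    qed
    ultimately show ?thesis using R(2) unfolding distrib_right by linarith
  qed
  have near: "\<forall>\<^sub>F \<epsilon> in at 0. \<epsilon> \<noteq> 0 \<and> \<bar>\<epsilon>\<bar> \<le> e1"
    unfolding eventually_at using e1 by (intro exI[of _ e1]) auto
  have "((\<lambda>\<epsilon>. ?f \<epsilon> - Q) \<longlongrightarrow> 0) (at 0)"
  proof (rule Lim_null_comparison)
    show "\<forall>\<^sub>F \<epsilon> in at 0. norm (?f \<epsilon> - Q) \<le> (D + L) * \<bar>\<epsilon>\<bar>"
      using near by eventually_elim (simp add: key)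
    have "((\<lambda>\<epsilon>. (D + L) * \<bar>\<epsilon>\<bar>) \<longlongrightarrow> (D + L) * \<bar>0\<bar>) (at (0::real))" by (intro tendsto_intros)
    then show "((\<lambda>\<epsilon>. (D + L) * \<bar>\<epsilon>\<bar>) \<longlongrightarrow> 0) (at (0::real))" by simp
  qed
  then show lim: "(?f \<longlongrightarrow> Q) (at 0)" by (rule LIM_zero_cancel)
  have "\<forall>\<^sub>F \<epsilon> in at 0. \<bar>?f \<epsilon>\<bar> < \<bar>Q\<bar> + 1"
    using tendsto_rabs[OF lim] by (rule order_tendstoD(2)) simp
  then have "\<forall>\<^sub>F \<epsilon> in at 0. norm \<bar>(\<Sum>n. \<epsilon> ^ n * U n) - v \<epsilon>\<bar> \<le> (\<bar>Q\<bar> + 1) * norm (\<epsilon>\<^sup>2)"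
    using near
  proof eventually_elim
    fix \<epsilon> :: real assume a: "\<bar>?f \<epsilon>\<bar> < \<bar>Q\<bar> + 1" and b: "\<epsilon> \<noteq> 0 \<and> \<bar>\<epsilon>\<bar> \<le> e1"
    have "\<bar>(\<Sum>n. \<epsilon> ^ n * U n) - v \<epsilon>\<bar> = \<bar>?f \<epsilon>\<bar> * \<epsilon>\<^sup>2" using b by (simp add: abs_divide abs_minus_commute)
    also have "\<dots> \<le> (\<bar>Q\<bar> + 1) * \<epsilon>\<^sup>2" using a by (intro mult_right_mono) auto
    finally show "norm \<bar>(\<Sum>n. \<epsilon> ^ n * U n) - v \<epsilon>\<bar> \<le> (\<bar>Q\<bar> + 1) * norm (\<epsilon>\<^sup>2)" by simp
  qed
  then show "(\<lambda>\<epsilon>. \<bar>(\<Sum>n. \<epsilon> ^ n * U n) - v \<epsilon>\<bar>) \<in> O[at 0](\<lambda>\<epsilon>. \<epsilon>\<^sup>2)" by (rule bigoI)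
qed

locale chaos_setting = heat_phi T C \<phi> P + brownian M W
  for T C :: real and \<phi> :: "real \<Rightarrow> real" and P :: real and M :: "'w measure" and W :: "'w \<Rightarrow> real \<Rightarrow> real" +
  fixes x :: real and U :: "nat \<Rightarrow> 'w \<Rightarrow> real"
  assumes x_in: "x \<in> {0..pi}" and comp: "\<And>n. chaos_component M W \<phi> T x n (U n)"
begin

definition Qlim :: real where "Qlim = integral {0..pi} (\<lambda>z. p3 T x z * \<phi> z)"

lemma U_sq_int: "sq_int M (U n)"
  using comp[of n] unfolding chaos_component_def sq_int_def by blast

lemma family: "orthonormal_family M {\<alpha>. multi_index \<alpha> \<and> mi_len \<alpha> = n} (xi_mi W)"
proof
  fix \<alpha> \<beta> assume "\<alpha> \<in> {\<alpha>. multi_index \<alpha> \<and> mi_len \<alpha> = n}" "\<beta> \<in> {\<alpha>. multi_index \<alpha> \<and> mi_len \<alpha> = n}"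
  then have m: "multi_index \<alpha>" "multi_index \<beta>" by auto
  show "integrable M (\<lambda>\<omega>. xi_mi W \<alpha> \<omega> * xi_mi W \<beta> \<omega>)"
    by (rule all_moments_integrable[OF all_moments_mult[OF xi_mi_all_moments[OF m(1)] xi_mi_all_moments[OF m(2)]]])
  show "(LINT \<omega>|M. xi_mi W \<alpha> \<omega> * xi_mi W \<beta> \<omega>) = (if \<alpha> = \<beta> then 1 else 0)" by (rule xi_mi_orthonormal[OF m])
next
  fix \<alpha> assume "\<alpha> \<in> {\<alpha>. multi_index \<alpha> \<and> mi_len \<alpha> = n}"
  then show "xi_mi W \<alpha> \<in> borel_measurable M" using xi_mi_all_moments[of \<alpha>] by (simp add: all_moments_def)
qed

lemma coef_bound:
  assumes "finite F" "F \<subseteq> {\<alpha>. multi_index \<alpha> \<and> mi_len \<alpha> = n}"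
  shows "(\<Sum>\<alpha>\<in>F. (u_alpha \<phi> 1 \<alpha> T x)\<^sup>2) \<le> chaos_const ^ Suc n * T powr (real n - 1/2)"
proof -
  have "(\<Sum>\<alpha>\<in>F. (u_alpha \<phi> 1 \<alpha> T x)\<^sup>2) = (\<Sum>\<alpha>\<in>F. (chaos_coef n \<phi> 1 \<alpha> T x)\<^sup>2)"
    by (rule sum.cong) (use assms in \<open>auto simp: u_alpha_def\<close>)
  then show ?thesis using chaos_sum_bound[OF assms _ x_in, of T] T_pos by simp
qed

lemma net: "((\<lambda>F. LINT \<omega>|M. (U n \<omega> - (\<Sum>\<alpha>\<in>F. u_alpha \<phi> 1 \<alpha> T x * xi_mi W \<alpha> \<omega>))\<^sup>2) \<longlongrightarrow> 0) (finite_subsets_at_top {\<alpha>. multi_index \<alpha> \<and> mi_len \<alpha> = n})"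
  using comp[of n] unfolding chaos_component_def by blast

lemma U_summable: "\<exists>r>0. AE \<omega> in M. summable (\<lambda>n. r ^ n * \<bar>U n \<omega>\<bar>)"
proof -
  let ?q = "T powr (-1/2)"
  \<comment> \<open>The factors 1 + T and 1 + T^(-1/2) absorb T^(n - 1/2) = T^n T^(-1/2) into a
    power with exponent n + 1.\<close>
  define E where "E = chaos_const * (1 + T) * (1 + ?q)"
  have cc: "chaos_const \<ge> 1" using B0_nonneg C_pos by (simp add: chaos_const_def)
  have E0: "E > 0" using cc T_pos by (auto simp: E_def intro!: mult_pos_pos add_pos_nonneg)
  have b: "(LINT \<omega>|M. (U n \<omega>)\<^sup>2) \<le> 2 + 2 * E ^ Suc n" for n
  proof -
    have "(LINT \<omega>|M. (U n \<omega>)\<^sup>2) \<le> 2 + 2 * (chaos_const ^ Suc n * T powr (real n - 1/2))"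
      by (rule orthonormal_family.second_moment_bound[OF family U_sq_int net coef_bound])
    also have "T powr (real n - 1/2) = T ^ n * ?q"
      using T_pos powr_add[of T "real n" "-1/2"] by (simp add: powr_realpow)
    also have "2 + 2 * (chaos_const ^ Suc n * (T ^ n * ?q)) \<le> 2 + 2 * (chaos_const ^ Suc n * ((1 + T) ^ Suc n * (1 + ?q) ^ Suc n))"
    proof -
      have "T ^ n \<le> (1 + T) ^ n" using T_pos by (intro power_mono) auto
      also have "\<dots> \<le> (1 + T) ^ Suc n" using T_pos by (intro power_increasing) auto
      finally have 1: "T ^ n \<le> (1 + T) ^ Suc n" .
      have "?q \<le> (1 + ?q) ^ 1" by simp
      also have "\<dots> \<le> (1 + ?q) ^ Suc n" by (intro power_increasing) auto
      finally have 2: "?q \<le> (1 + ?q) ^ Suc n" .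
      show ?thesis using T_pos cc by (intro add_left_mono mult_left_mono mult_mono 1 2) auto
    qed
    also have "\<dots> = 2 + 2 * E ^ Suc n" by (simp only: E_def power_mult_distrib mult.assoc)
    finally show ?thesis .
  qed
  show ?thesis by (rule AE_summable_geometric[OF U_sq_int E0 b])
qed

lemma U_subseq:
  "\<exists>\<rho> :: nat \<Rightarrow> nat. strict_mono \<rho> \<and> (AE \<omega> in M. (\<lambda>i. \<Sum>\<alpha>\<in>mi_box n (\<rho> i). mi_weight (\<rho> i) \<alpha> * chaos_coef n \<phi> 1 \<alpha> T x * xi_mi W \<alpha> \<omega>) \<longlonglongrightarrow> U n \<omega>)"
proof -
  have eq: "(\<Sum>\<alpha>\<in>mi_box n N. mi_weight N \<alpha> * u_alpha \<phi> 1 \<alpha> T x * xi_mi W \<alpha> \<omega>) = (\<Sum>\<alpha>\<in>mi_box n N. mi_weight N \<alpha> * chaos_coef n \<phi> 1 \<alpha> T x * xi_mi W \<alpha> \<omega>)" for N \<omega>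
    by (intro sum.cong refl) (auto simp: mi_box_def u_alpha_def)
  have "\<exists>\<rho> :: nat \<Rightarrow> nat. strict_mono \<rho> \<and> (AE \<omega> in M. (\<lambda>i. \<Sum>\<alpha>\<in>mi_box n (\<rho> i). mi_weight (\<rho> i) \<alpha> * u_alpha \<phi> 1 \<alpha> T x * xi_mi W \<alpha> \<omega>) \<longlonglongrightarrow> U n \<omega>)"
    by (rule orthonormal_family.weighted_sums_AE_subseq[OF family U_sq_int net coef_bound mi_weight_bounds mi_box_finite mi_box_subset mi_weight_outside])
      auto
  then show ?thesis unfolding eq .
qed

lemma path_noise_derivative:
  assumes "continuous_on {0..pi} w"
  shows "\<forall>y\<in>{0..pi}. (fmean N w has_real_derivative path_noise N w y) (at y within {0..pi})"
  unfolding fmean_def path_noise_def using cmean_has_derivative_sum[OF assms] by blast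

lemma Qlim_tendsto: "(\<lambda>n. \<Sum>k=1..Suc n. (fejw (Suc n) k)\<^sup>2 * Top (mk k) (Top (mk k) u0) T x) \<longlonglongrightarrow> Qlim"
  using fejer_trace_tendsto[OF heat_sol_cont_X x_in] unfolding diag_heat_sol_eq_p3[OF x_in] Qlim_def .

text \<open>For a fixed path the subsequence limits match orders 0 and 1 of the chaos with the
  Stratonovich expansion, and order 2 up to the limit of the traces. The threshold \<open>e0\<close>
  depends on the path through its bound \<open>K\<close>, which is allowed because the limit in
  \<epsilon> is taken path by path.\<close>

lemma pathwise_comparison:
  fixes v :: "real \<Rightarrow> real \<Rightarrow> real \<Rightarrow> real"
  assumes \<omega>: "\<omega> \<in> space M" and v: "\<And>\<epsilon>. strat_mild_solution \<epsilon> (W \<omega>) \<phi> (v \<epsilon>)"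
    and \<rho>: "\<And>n. strict_mono (\<rho> n :: nat \<Rightarrow> nat)"
    and lim: "\<And>n. (\<lambda>i. \<Sum>\<alpha>\<in>mi_box n (\<rho> n i). mi_weight (\<rho> n i) \<alpha> * chaos_coef n \<phi> 1 \<alpha> T x * xi_mi W \<alpha> \<omega>) \<longlonglongrightarrow> U n \<omega>"
    and r: "r > 0" "summable (\<lambda>n. r ^ n * \<bar>U n \<omega>\<bar>)"
  shows "(\<lambda>\<epsilon>. \<bar>wick_sol U \<epsilon> \<omega> - v \<epsilon> T x\<bar>) \<in> O[at 0](\<lambda>\<epsilon>. \<epsilon>\<^sup>2) \<and>
    ((\<lambda>\<epsilon>. (v \<epsilon> T x - wick_sol U \<epsilon> \<omega>) / \<epsilon>\<^sup>2) \<longlongrightarrow> Qlim) (at 0)"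
proof -
  let ?w = "W \<omega>"
  let ?pn = "\<lambda>N. path_noise N ?w"
  have TT: "T \<in> {0<..T}" using T_pos by simp
  obtain M0 where "\<forall>x\<in>{0..pi}. \<forall>y\<in>{0..pi}. \<bar>?w x - ?w y\<bar> \<le> M0 * \<bar>x - y\<bar> powr (3/8)"
    using W_hoelder[OF \<omega>, of "3/8"] by auto
  note M0 = this[rule_format]
  have M1: "\<bar>?w x - ?w y\<bar> \<le> max 0 M0 * \<bar>x - y\<bar> powr (3/8)" if "x \<in> {0..pi}" "y \<in> {0..pi}" for x y
    using M0[OF that] by (rule order_trans) (intro mult_right_mono, auto)
  obtain K \<eta> where K: "K > 0" "noise_bound K ?w" "\<eta> \<longlonglongrightarrow> (0::real)" "\<And>n. noise_bound K (fmean n ?w)"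
    "\<And>n. noise_bound (\<eta> n) (\<lambda>y. ?w y - fmean n ?w y)"
    by (rule fmean_noise_bounds[OF M1 max.cobounded1]) (assumption | rule that)+
  note wc = noise_boundD(1)[OF K(2)]
  note d = path_noise_derivative[OF wc]
  have \<eta>: "(\<lambda>i. \<eta> (\<rho> n i)) \<longlonglongrightarrow> 0" for n
    using LIMSEQ_subseq_LIMSEQ[OF K(3) \<rho>[of n]] by (simp add: o_def)
  have U0: "U 0 \<omega> = u0 T x"
  proof -
    have "(\<Sum>\<alpha>\<in>mi_box 0 N. mi_weight N \<alpha> * chaos_coef 0 \<phi> 1 \<alpha> T x * xi_mi W \<alpha> \<omega>) = u0 T x" for N
      unfolding mi_box_0 by (simp add: mi_weight_def xi_mi_def)
    then have "(\<lambda>i. u0 T x) \<longlonglongrightarrow> U 0 \<omega>" using lim[of 0] by simp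
    then show ?thesis by (rule LIMSEQ_unique) simp
  qed
  have U1: "U 1 \<omega> = Kop ?w u0 u0x T x"
  proof -
    have l: "(\<lambda>i. Top (?pn (\<rho> 1 i)) u0 T x) \<longlonglongrightarrow> U 1 \<omega>" using lim[of 1] unfolding first_chaos_sum[OF x_in] .
    have "(\<lambda>i. Kop ?w u0 u0x T x - Top (?pn (\<rho> 1 i)) u0 T x) \<longlonglongrightarrow> 0"
    proof (rule Lim_null_comparison)
      show "\<forall>\<^sub>F i in sequentially. norm (Kop ?w u0 u0x T x - Top (?pn (\<rho> 1 i)) u0 T x) \<le> KK * B0 * \<eta> (\<rho> 1 i)"
        unfolding real_norm_def
        by (intro always_eventually allI Kop_heat_sol_approx[OF K(2) TT x_in noise_boundD(1)[OF K(4)] d path_noise_continuous K(5)])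
      show "(\<lambda>i. KK * B0 * \<eta> (\<rho> 1 i)) \<longlonglongrightarrow> 0" by (rule tendsto_mult_right_zero[OF \<eta>])
    qed
    from tendsto_add[OF this l] have "(\<lambda>i::nat. Kop ?w u0 u0x T x) \<longlonglongrightarrow> U 1 \<omega>" by simp
    then show ?thesis by (rule LIMSEQ_unique) simp
  qed
  have U2: "(\<lambda>i. Top (?pn (\<rho> 2 i)) (Top (?pn (\<rho> 2 i)) u0) T x) \<longlonglongrightarrow> U 2 \<omega> + Qlim"
  proof -
    have "(\<lambda>i. \<Sum>k=1..Suc (\<rho> 2 i). (fejw (Suc (\<rho> 2 i)) k)\<^sup>2 * Top (mk k) (Top (mk k) u0) T x) \<longlonglongrightarrow> Qlim"
      using LIMSEQ_subseq_LIMSEQ[OF Qlim_tendsto \<rho>[of 2]] by (simp only: o_def)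
    from tendsto_add[OF lim[of 2, unfolded second_chaos_sum[OF x_in]] this] show ?thesis by (simp only: diff_add_cancel)
  qed
  define D where "D = second_order_error K 1 0"
  define e0 where "e0 = 1 / (2 * KK * K)"
  have e0: "e0 > 0" using KK_pos K(1) by (simp add: e0_def)
  have exp: "\<exists>R. v \<epsilon> T x = U 0 \<omega> + \<epsilon> * U 1 \<omega> + \<epsilon>\<^sup>2 * R \<and> \<bar>R - (U 2 \<omega> + Qlim)\<bar> \<le> D * \<bar>\<epsilon>\<bar>"
    if e: "\<epsilon> \<noteq> 0" "\<bar>\<epsilon>\<bar> \<le> e0" for \<epsilon>
  proof -
    have "\<bar>\<epsilon>\<bar> * KK * K \<le> e0 * KK * K" using e KK_pos K(1) by (intro mult_right_mono) auto
    also have "\<dots> = 1/2" using KK_pos K(1) by (simp add: e0_def)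
    finally have small: "\<bar>\<epsilon>\<bar> * KK * K \<le> 1/2" .
    from strat_second_order[OF v K(2) e(1) small x_in]
    obtain R where R: "v \<epsilon> T x = u0 T x + \<epsilon> * Kop ?w u0 u0x T x + \<epsilon>\<^sup>2 * R \<and>
      (\<forall>wN wN' \<eta>. (\<forall>y\<in>{0..pi}. (wN has_real_derivative wN' y) (at y within {0..pi})) \<longrightarrow> continuous_on {0..pi} wN' \<longrightarrow>
       noise_bound K wN \<longrightarrow> noise_bound \<eta> (\<lambda>y. ?w y - wN y) \<longrightarrow>
       \<bar>R - Top wN' (Top wN' u0) T x\<bar> \<le> second_order_error K \<bar>\<epsilon>\<bar> \<eta>)" ..
    have R2: "\<bar>R - Top (?pn N) (Top (?pn N) u0) T x\<bar> \<le> second_order_error K \<bar>\<epsilon>\<bar> (\<eta> N)" for N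
      using conjunct2[OF R, rule_format, OF d[rule_format] path_noise_continuous K(4) K(5)] .
    have l: "(\<lambda>i. \<bar>R - Top (?pn (\<rho> 2 i)) (Top (?pn (\<rho> 2 i)) u0) T x\<bar>) \<longlonglongrightarrow> \<bar>R - (U 2 \<omega> + Qlim)\<bar>"
      by (intro tendsto_rabs tendsto_diff tendsto_const U2)
    have "(\<lambda>i. second_order_error K \<bar>\<epsilon>\<bar> (\<eta> (\<rho> 2 i))) \<longlonglongrightarrow> second_order_error K \<bar>\<epsilon>\<bar> 0"
      unfolding second_order_error_def by (intro tendsto_intros \<eta>)
    \<comment> \<open>For fixed \<epsilon> the approximation of the path is removed first; only the
      part of the error proportional to |\<epsilon>| stays.\<close>
    from LIMSEQ_le[OF l this] R2 have "\<bar>R - (U 2 \<omega> + Qlim)\<bar> \<le> second_order_error K \<bar>\<epsilon>\<bar> 0" by blast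
    also have "\<dots> = D * \<bar>\<epsilon>\<bar>" by (simp add: D_def second_order_error_def mult_ac)
    finally have "\<bar>R - (U 2 \<omega> + Qlim)\<bar> \<le> D * \<bar>\<epsilon>\<bar>" .
    moreover have "v \<epsilon> T x = U 0 \<omega> + \<epsilon> * U 1 \<omega> + \<epsilon>\<^sup>2 * R" unfolding U0 U1 using conjunct1[OF R] .
    ultimately show ?thesis by blast
  qed
  show ?thesis
    unfolding wick_sol_def using second_order_comparison[where U = "\<lambda>n. U n \<omega>" and v = "\<lambda>\<epsilon>. v \<epsilon> T x", OF r e0 exp] by blast
qed

text \<open>The subsequences for all orders and the radius are chosen before the path and before
  \<epsilon>, so a countable union of null sets is discarded once and for all.\<close>

lemma AE_comparison:
  fixes v :: "real \<Rightarrow> 'w \<Rightarrow> real \<Rightarrow> real \<Rightarrow> real"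
  assumes v: "\<And>\<epsilon> \<omega>. \<omega> \<in> space M \<Longrightarrow> strat_mild_solution \<epsilon> (W \<omega>) \<phi> (v \<epsilon> \<omega>)"
  shows "AE \<omega> in M. (\<lambda>\<epsilon>. \<bar>wick_sol U \<epsilon> \<omega> - v \<epsilon> \<omega> T x\<bar>) \<in> O[at 0](\<lambda>\<epsilon>. \<epsilon>\<^sup>2) \<and>
    ((\<lambda>\<epsilon>. (v \<epsilon> \<omega> T x - wick_sol U \<epsilon> \<omega>) / \<epsilon>\<^sup>2) \<longlongrightarrow> Qlim) (at 0)"
proof -
  obtain \<rho> where \<rho>: "\<forall>n. strict_mono (\<rho> n :: nat \<Rightarrow> nat) \<and> (AE \<omega> in M. (\<lambda>i. \<Sum>\<alpha>\<in>mi_box n (\<rho> n i). mi_weight (\<rho> n i) \<alpha> * chaos_coef n \<phi> 1 \<alpha> T x * xi_mi W \<alpha> \<omega>) \<longlonglongrightarrow> U n \<omega>)"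
    using choice[OF allI[OF U_subseq]] ..
  obtain r where r: "r > 0" "AE \<omega> in M. summable (\<lambda>n. r ^ n * \<bar>U n \<omega>\<bar>)" using U_summable by auto
  have "AE \<omega> in M. \<forall>n. (\<lambda>i. \<Sum>\<alpha>\<in>mi_box n (\<rho> n i). mi_weight (\<rho> n i) \<alpha> * chaos_coef n \<phi> 1 \<alpha> T x * xi_mi W \<alpha> \<omega>) \<longlonglongrightarrow> U n \<omega>"
    unfolding AE_all_countable using \<rho> by blast
  then show ?thesis
    using r(2) AE_space
  proof eventually_elim
    fix \<omega>
    assume l: "\<forall>n. (\<lambda>i. \<Sum>\<alpha>\<in>mi_box n (\<rho> n i). mi_weight (\<rho> n i) \<alpha> * chaos_coef n \<phi> 1 \<alpha> T x * xi_mi W \<alpha> \<omega>) \<longlonglongrightarrow> U n \<omega>"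
      and s: "summable (\<lambda>n. r ^ n * \<bar>U n \<omega>\<bar>)" and \<omega>: "\<omega> \<in> space M"
    have \<rho>': "strict_mono (\<rho> n)" for n using \<rho> by blast
    show "(\<lambda>\<epsilon>. \<bar>wick_sol U \<epsilon> \<omega> - v \<epsilon> \<omega> T x\<bar>) \<in> O[at 0](\<lambda>\<epsilon>. \<epsilon>\<^sup>2) \<and>
      ((\<lambda>\<epsilon>. (v \<epsilon> \<omega> T x - wick_sol U \<epsilon> \<omega>) / \<epsilon>\<^sup>2) \<longlongrightarrow> Qlim) (at 0)"
      by (rule pathwise_comparison[OF \<omega> v[OF \<omega>] \<rho>' l[rule_format] r(1) s])
  qed
qed

end

theorem theorem2p1:
  fixes M :: "'w measure" and W :: "'w \<Rightarrow> real \<Rightarrow> real" and \<phi> :: "real \<Rightarrow> real"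
    and t x :: real
    and U :: "nat \<Rightarrow> 'w \<Rightarrow> real"
    and u_strat :: "real \<Rightarrow> 'w \<Rightarrow> real \<Rightarrow> real \<Rightarrow> real"
  assumes BM: "std_brownian_motion M W"
    and phi_cont: "continuous_on {0..pi} \<phi>"
    and t_pos: "t > 0" and x_in: "x \<in> {0..pi}"
    and wick: "\<And>n. chaos_component M W \<phi> t x n (U n)"
    and strat: "\<And>\<epsilon> \<omega>. \<omega> \<in> space M \<Longrightarrow> strat_mild_solution \<epsilon> (W \<omega>) \<phi> (u_strat \<epsilon> \<omega>)"
  shows "AE \<omega> in M.
           (\<lambda>\<epsilon>. \<bar>wick_sol U \<epsilon> \<omega> - u_strat \<epsilon> \<omega> t x\<bar>) \<in> O[at 0](\<lambda>\<epsilon>. \<epsilon>\<^sup>2) \<and>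
           ((\<lambda>\<epsilon>. (u_strat \<epsilon> \<omega> t x - wick_sol U \<epsilon> \<omega>) / \<epsilon>\<^sup>2)
              \<longlongrightarrow> integral {0..pi} (\<lambda>z. p3 t x z * \<phi> z)) (at 0)"
proof -
  \<comment> \<open>The horizon of all estimates is the time t of the statement itself, so every
    bound on (0,t] is available at the final time.\<close>
  obtain C where "heat_bounds t C" using heat_bounds_exist[OF t_pos] ..
  then interpret heat_bounds t C .
  have "bounded (\<phi> ` {0..pi})" using phi_cont by (intro compact_imp_bounded compact_continuous_image) auto
  then obtain P where "\<forall>z\<in>\<phi> ` {0..pi}. norm z \<le> P" unfolding bounded_iff by blast
  then have P: "\<And>y. y \<in> {0..pi} \<Longrightarrow> \<bar>\<phi> y\<bar> \<le> P" by auto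
  have "prob_space M" using BM by (simp add: std_brownian_motion_def)
  then interpret prob_space M .
  interpret chaos_setting t C \<phi> P M W x U
    by unfold_locales (fact phi_cont P BM x_in wick)+
  show ?thesis using AE_comparison[OF strat] unfolding Qlim_def .
qed

end
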